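(* Let $k$ be a field, let $G\le\mathcal{S}_n$ act on $S=k[x_1,\ldots,x_n]$ by permutations, and let $c$ be the number of transpositions in $G$. The ring $S^G$ is quasi-Gorenstein if and only if $a(S^G)=-(c+n)$. More precisely: (1) if $\operatorname{char}(k)=2$, then $S^G$ is quasi-Gorenstein; (2) if $\operatorname{char}(k)\neq2$, then $S^G$ is quasi-Gorenstein if and only if $\deg\operatorname{Hilb}(S^G)=-(c+n)$. In particular, if $G$ contains no transpositions, then $S^G$ is quasi-Gorenstein if and only if $G$ is contained in the alternating group $\mathcal{A}_n$.
   Context: The action is by $k$-algebra automorphisms with $\sigma\cdot x_i=x_{\sigma(i)}$; $S$ has the standard grading and $\mathfrak n$ is the homogeneous maximal ideal of $S^G$. The canonical module is $\omega_{S^G}:=H^n_{\mathfrak n}(S^G)^*$, where the graded dual $M^*$ has $[M^*]_d=\operatorname{Hom}_k([M]_{-d},k)$. $S^G$ is quasi-Gorenstein if $\omega_{S^G}\cong S^G(a)$ as graded $S^G$-modules for some $a\in\mathbb{Z}$, where $[M(a)]_d:=[M]_{a+d}$. The $a$-invariant $a(S^G)$ is the largest integer $a$ with $[H^n_{\mathfrak n}(S^G)]_a\ne0$. $\operatorname{Hilb}(S^G,t)=\sum_{d\ge0}\operatorname{rank}_k([S^G]_d)t^d$, a rational function, and $\deg(f/g):=\deg f-\deg g$ for polynomials $f,g$. The "in particular" sentence belongs to case (2), i.e. it assumes $\operatorname{char}(k)\ne2$. *)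

theory Defs
  imports
    "HOL-Library.Poly_Mapping"
    "HOL-Library.FuncSet"
    "HOL-Computational_Algebra.Computational_Algebra"
    "HOL-Algebra.Sym_Groups"
begin

section \<open>Polynomials and the permutation action\<close>

text \<open>Polynomials in the variables \<open>x\<^sub>0, x\<^sub>1, \<dots>\<close>; the ring \<open>k[x\<^sub>1,\<dots>,x\<^sub>n]\<close> is the subset
  \<open>poly_ring n\<close>.\<close>

type_synonym 'k mpol = "(nat \<Rightarrow>\<^sub>0 nat) \<Rightarrow>\<^sub>0 'k"

definition var :: "nat \<Rightarrow> 'k::field mpol" where
  "var i = Poly_Mapping.single (Poly_Mapping.single i 1) 1"

definition const :: "'k \<Rightarrow> 'k::field mpol" where
  "const c = Poly_Mapping.single 0 c"

definition poly_ring :: "nat \<Rightarrow> 'k::field mpol set" where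
  "poly_ring n = {p. \<forall>m \<in> Poly_Mapping.keys p. Poly_Mapping.keys m \<subseteq> {1..n}}"

definition mon_deg :: "(nat \<Rightarrow>\<^sub>0 nat) \<Rightarrow> nat" where
  "mon_deg m = (\<Sum>i \<in> Poly_Mapping.keys m. Poly_Mapping.lookup m i)"

text \<open>The zero polynomial is homogeneous of every degree; for negative \<open>d\<close> it is the only
  homogeneous polynomial.\<close>

definition homogeneous :: "int \<Rightarrow> 'k::field mpol \<Rightarrow> bool" where
  "homogeneous d p \<longleftrightarrow> (\<forall>m \<in> Poly_Mapping.keys p. int (mon_deg m) = d)"

definition graded_part :: "'k::field mpol set \<Rightarrow> int \<Rightarrow> 'k mpol set" where
  "graded_part R d = {p \<in> R. homogeneous d p}"

text \<open>The \<open>k\<close>-algebra endomorphism \<open>x\<^sub>i \<mapsto> x\<^bsub>\<sigma>(i)\<^esub>\<close>.\<close>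

definition perm_act :: "(nat \<Rightarrow> nat) \<Rightarrow> 'k::field mpol \<Rightarrow> 'k mpol" where
  "perm_act \<sigma> p = (\<Sum>m \<in> Poly_Mapping.keys p.
     const (Poly_Mapping.lookup p m) *
       (\<Prod>i \<in> Poly_Mapping.keys m. var (\<sigma> i) ^ Poly_Mapping.lookup m i))"

definition invariant_ring :: "nat \<Rightarrow> (nat \<Rightarrow> nat) set \<Rightarrow> 'k::field mpol set" where
  "invariant_ring n G = {p \<in> poly_ring n. \<forall>\<sigma> \<in> G. perm_act \<sigma> p = p}"

definition num_transpositions :: "(nat \<Rightarrow> nat) set \<Rightarrow> nat" where
  "num_transpositions G = card {\<sigma> \<in> G. \<exists>i j. i \<noteq> j \<and> \<sigma> = Transposition.transpose i j}"

section \<open>Graded modules\<close>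

text \<open>A \<open>\<int>\<close>-graded module over a graded subring \<open>R\<close> of the polynomial ring is given by the family
  of its homogeneous components: \<open>comp M d\<close> is \<open>[M]\<^sub>d\<close>, with addition \<open>plus_of M d\<close> and zero
  \<open>zero_of M d\<close>, and \<open>act M e d\<close> is the multiplication \<open>[R]\<^sub>e \<times> [M]\<^sub>d \<rightarrow> [M]\<^bsub>d+e\<^esub>\<close>.\<close>

record ('r, 'm) graded_module =
  comp :: "int \<Rightarrow> 'm set"
  plus_of :: "int \<Rightarrow> 'm \<Rightarrow> 'm \<Rightarrow> 'm"
  zero_of :: "int \<Rightarrow> 'm"
  act :: "int \<Rightarrow> int \<Rightarrow> 'r \<Rightarrow> 'm \<Rightarrow> 'm"

definition regular_module :: "'k::field mpol set \<Rightarrow> ('k mpol, 'k mpol) graded_module" where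
  "regular_module R = \<lparr>comp = graded_part R, plus_of = (\<lambda>_. (+)), zero_of = (\<lambda>_. 0),
     act = (\<lambda>_ _. (*))\<rparr>"

text \<open>\<open>M(a)\<close>, where \<open>[M(a)]\<^sub>d = [M]\<^bsub>a+d\<^esub>\<close>.\<close>

definition shift :: "('r, 'm) graded_module \<Rightarrow> int \<Rightarrow> ('r, 'm) graded_module" where
  "shift M a = \<lparr>comp = (\<lambda>d. comp M (a + d)), plus_of = (\<lambda>d. plus_of M (a + d)),
     zero_of = (\<lambda>d. zero_of M (a + d)), act = (\<lambda>e d. act M e (a + d))\<rparr>"

text \<open>The graded dual: \<open>[M\<^sup>*]\<^sub>d = Hom\<^sub>k([M]\<^bsub>-d\<^esub>, k)\<close>, and \<open>(r\<phi>)(x) = \<phi>(rx)\<close>. Linear maps are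
  represented by functions that are \<^const>\<open>undefined\<close> outside \<open>[M]\<^bsub>-d\<^esub>\<close>; the \<open>k\<close>-structure of
  \<open>[M]\<^bsub>-d\<^esub>\<close> is the action of the constants.\<close>

definition graded_dual ::
    "('k::field mpol, 'm) graded_module \<Rightarrow> ('k mpol, 'm \<Rightarrow> 'k) graded_module" where
  "graded_dual M = \<lparr>
     comp = (\<lambda>d. {\<phi> \<in> extensional (comp M (- d)).
        (\<forall>x \<in> comp M (- d). \<forall>y \<in> comp M (- d). \<phi> (plus_of M (- d) x y) = \<phi> x + \<phi> y) \<and>
        (\<forall>c. \<forall>x \<in> comp M (- d). \<phi> (act M 0 (- d) (const c) x) = c * \<phi> x)}),
     plus_of = (\<lambda>d \<phi> \<psi>. \<lambda>x \<in> comp M (- d). \<phi> x + \<psi> x),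
     zero_of = (\<lambda>d. \<lambda>x \<in> comp M (- d). 0),
     act = (\<lambda>e d r \<phi>. \<lambda>x \<in> comp M (- (d + e)). \<phi> (act M e (- (d + e)) r x))\<rparr>"

text \<open>Isomorphism of graded \<open>R\<close>-modules (homogeneous of degree 0).\<close>

definition graded_iso ::
    "'k::field mpol set \<Rightarrow> ('k mpol, 'm) graded_module \<Rightarrow> ('k mpol, 'l) graded_module \<Rightarrow> bool" where
  "graded_iso R M N \<longleftrightarrow> (\<exists>f.
     (\<forall>d. bij_betw (f d) (comp M d) (comp N d)) \<and>
     (\<forall>d. \<forall>x \<in> comp M d. \<forall>y \<in> comp M d. f d (plus_of M d x y) = plus_of N d (f d x) (f d y)) \<and>
     (\<forall>e d. \<forall>r \<in> graded_part R e. \<forall>x \<in> comp M d.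
        f (d + e) (act M e d r x) = act N e d r (f d x)))"

section \<open>Top local cohomology\<close>

text \<open>The homogeneous maximal ideal: the elements with zero constant term.\<close>

definition hom_max_ideal :: "'k::field mpol set \<Rightarrow> 'k mpol set" where
  "hom_max_ideal R = {p \<in> R. Poly_Mapping.lookup p 0 = 0}"

definition generated_ideal :: "'k::field mpol set \<Rightarrow> nat \<Rightarrow> (nat \<Rightarrow> 'k mpol) \<Rightarrow> 'k mpol set" where
  "generated_ideal R n y = {(\<Sum>i = 1..n. r i * y i) | r. \<forall>i \<in> {1..n}. r i \<in> R}"

text \<open>\<open>y\<^sub>1,\<dots>,y\<^sub>n\<close> is a homogeneous system of parameters of the \<open>n\<close>-dimensional ring \<open>R = S\<^sup>G\<close>:
  the \<open>y\<^sub>i\<close> are nonzero homogeneous elements of positive degree and the radical of \<open>(y\<^sub>1,\<dots>,y\<^sub>n)R\<close> is the homogeneous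
  maximal ideal. For every \<open>G\<close>, the elementary symmetric polynomials form such a system.\<close>

definition hom_sop :: "nat \<Rightarrow> 'k::field mpol set \<Rightarrow> (nat \<Rightarrow> 'k mpol) \<Rightarrow> bool" where
  "hom_sop n R y \<longleftrightarrow>
     (\<forall>i \<in> {1..n}. y i \<in> R \<and> y i \<noteq> 0 \<and> (\<exists>d > 0. homogeneous d (y i))) \<and>
     {f \<in> R. \<exists>t. f ^ t \<in> generated_ideal R n y} = hom_max_ideal R"

text \<open>As \<open>R\<close> is a domain, the localization \<open>R\<^sub>f\<close> is taken inside the field of fractions. It is
  graded by \<open>deg (a / f\<^sup>t) = deg a - t deg f\<close> for homogeneous \<open>f\<close>.\<close>

definition localization :: "'k::field mpol set \<Rightarrow> 'k mpol \<Rightarrow> 'k mpol fract set" where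
  "localization R f = {Fract a (f ^ t) | a t. a \<in> R}"

definition localization_part ::
    "'k::field mpol set \<Rightarrow> 'k mpol \<Rightarrow> int \<Rightarrow> 'k mpol fract set" where
  "localization_part R f d =
     {Fract a (f ^ t) | a t. a \<in> R \<and> (\<exists>e. homogeneous e f \<and> homogeneous (d + int t * e) a)}"

text \<open>The module \<open>H\<^sup>n(R)\<close> supported at the homogeneous maximal ideal, for \<open>R = S\<^sup>G\<close>, as the \<open>n\<close>-th
  cohomology of the Cech complex on a homogeneous system of parameters \<open>y\<^sub>1,\<dots>,y\<^sub>n\<close>. This is the last
  spot of the complex, so the cohomology is the cokernel of
  \<open>\<Oplus>\<^sub>i R\<^bsub>y\<^sub>1\<cdots>y\<^sub>i\<^sub>-\<^sub>1y\<^sub>i\<^sub>+\<^sub>1\<cdots>y\<^sub>n\<^esub> \<rightarrow> R\<^bsub>y\<^sub>1\<cdots>y\<^sub>n\<^esub>\<close>; the signs in the differential do not affect its image. The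
  elements are the cosets of that image.\<close>

definition cech_boundaries ::
    "nat \<Rightarrow> (nat \<Rightarrow> 'k::field mpol) \<Rightarrow> 'k mpol set \<Rightarrow> 'k mpol fract set" where
  "cech_boundaries n y R =
     {(\<Sum>i = 1..n. u i) | u. \<forall>i \<in> {1..n}. u i \<in> localization R (\<Prod>j \<in> {1..n} - {i}. y j)}"

definition top_local_cohomology ::
    "nat \<Rightarrow> (nat \<Rightarrow> 'k::field mpol) \<Rightarrow> 'k mpol set \<Rightarrow> ('k mpol, 'k mpol fract set) graded_module"
where
  "top_local_cohomology n y R = (let B = cech_boundaries n y R in \<lparr>
     comp = (\<lambda>d. (\<lambda>x. {x + b | b. b \<in> B}) ` localization_part R (\<Prod>i = 1..n. y i) d),
     plus_of = (\<lambda>_ X Y. {x + x' | x x'. x \<in> X \<and> x' \<in> Y}),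
     zero_of = (\<lambda>_. B),
     act = (\<lambda>_ _ r X. {Fract r 1 * x + b | x b. x \<in> X \<and> b \<in> B})\<rparr>)"

definition canonical_module ::
    "nat \<Rightarrow> (nat \<Rightarrow> 'k::field mpol) \<Rightarrow> 'k mpol set \<Rightarrow> ('k mpol, 'k mpol fract set \<Rightarrow> 'k) graded_module"
where
  "canonical_module n y R = graded_dual (top_local_cohomology n y R)"

definition quasi_gorenstein :: "nat \<Rightarrow> (nat \<Rightarrow> 'k::field mpol) \<Rightarrow> 'k mpol set \<Rightarrow> bool" where
  "quasi_gorenstein n y R \<longleftrightarrow>
     (\<exists>a. graded_iso R (canonical_module n y R) (shift (regular_module R) a))"

definition a_invariant :: "nat \<Rightarrow> (nat \<Rightarrow> 'k::field mpol) \<Rightarrow> 'k mpol set \<Rightarrow> int" where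
  "a_invariant n y R = (GREATEST a.
     comp (top_local_cohomology n y R) a \<noteq> {zero_of (top_local_cohomology n y R) a})"

section \<open>Hilbert series\<close>

definition hilbert_series :: "'k::field mpol set \<Rightarrow> rat fps" where
  "hilbert_series R =
     Abs_fps (\<lambda>d. of_nat (vector_space.dim (\<lambda>c p. const c * p) (graded_part R (int d))))"

text \<open>\<open>deg (p/q) = deg p - deg q\<close> for a power series representing a nonzero rational function.\<close>

definition rational_degree :: "rat fps \<Rightarrow> int" where
  "rational_degree F = (THE D. \<exists>p q. p \<noteq> 0 \<and> q \<noteq> 0 \<and> F * fps_of_poly q = fps_of_poly p \<and>
     D = int (degree p) - int (degree q))"

end

theory Submission
  imports Defs
begin

text \<open>
  Write \<open>S = k[x\<^sub>1, \<dots>, x\<^sub>n]\<close> and \<open>R = S\<^sup>G\<close>. The proof describes the canonical module of \<open>R\<close> explicitly. Let \<open>F\<close> (the set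
  \<open>can_ideal n G\<close>) consist of the \<open>f \<in> S\<close> with \<open>\<sigma>(f) = sign(\<sigma>) f\<close> for all \<open>\<sigma> \<in> G\<close> that are divisible by
  \<open>x\<^sub>i - x\<^sub>j\<close> for every transposition \<open>(i j) \<in> G\<close>. Then \<open>\<omega>\<^sub>R \<cong> F(-n)\<close> in every characteristic
  (\<open>canonical_module_iso\<close>).

  For the parameters \<open>e\<^sub>1, \<dots>, e\<^sub>n\<close>, the elementary symmetric polynomials, an element of \<open>\<omega>\<^sub>R\<close> is a compatible system of
  functionals \<open>\<phi>\<^sub>t\<close> on \<open>R / (e\<^sub>1\<^sup>t, \<dots>, e\<^sub>n\<^sup>t)\<close>. For \<open>R = S\<close>, which is free over the symmetric polynomials, these are
  the residues of \<open>f p / (e\<^sub>1 \<cdots> e\<^sub>n)\<^sup>t\<close> with \<open>f \<in> S\<close> (\<open>polynomial_ring_duality\<close>). For general \<open>G\<close>, composing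
  with the trace \<open>S \<rightarrow> R\<close> reduces to this case and yields \<open>f \<in> F\<close> (\<open>invariant_ring_duality\<close>). Any other homogeneous
  system of parameters is reached by exchanging one element at a time, where two systems can always be given a common
  element (\<open>common_parameter\<close>, \<open>sop_duality_exists\<close>).

  Let \<open>\<Delta>\<close> be the product of the \<open>c\<close> differences \<open>x\<^sub>i - x\<^sub>j\<close> with \<open>(i j) \<in> G\<close>. By the above
  \<open>a(R) = -(n + m)\<close>, where \<open>m\<close> is the least degree of a nonzero element of \<open>F\<close>. As \<open>\<Delta>\<close> divides every element of
  \<open>F\<close>, one has \<open>m \<ge> c\<close>, and \<open>m = c\<close> iff \<open>\<Delta> \<in> F\<close>. If
  \<open>\<Delta> \<in> F\<close> then \<open>F = R \<Delta>\<close> and \<open>R\<close> is quasi-Gorenstein. In characteristic 2 this is always so, because \<open>G\<close> permutes the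
  differences up to sign. In other characteristics a generator of a free \<open>F\<close> must have degree \<open>c\<close> (\<open>generator_degree\<close>).
  The degree of the Hilbert series comes from Molien's formula: substituting \<open>1/t\<close> shows that it is \<open>-(n + m')\<close>, where \<open>m'\<close>
  is the least degree of a sign semi-invariant over the rationals, and \<open>m' = m\<close> if the characteristic is not 2. If there are
  no transpositions then \<open>\<Delta> = 1\<close>, which lies in \<open>F\<close> iff all signs are 1.
\<close>

abbreviation "lookup \<equiv> Poly_Mapping.lookup"
abbreviation "keys \<equiv> Poly_Mapping.keys"
abbreviation "swap \<equiv> Transposition.transpose"
abbreviation "single \<equiv> Poly_Mapping.single"

section \<open>Monomials, grading and linear maps on the polynomial ring\<close>

definition mon :: "(nat \<Rightarrow>\<^sub>0 nat) \<Rightarrow> 'k::field mpol" where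
  "mon m = single m 1"

lemma mon_zero [simp]: "mon 0 = 1" by (simp add: mon_def)

lemma mon_add: "mon (a + b) = mon a * mon b" by (simp add: mon_def mult_single)

lemma mon_sum: "finite I \<Longrightarrow> mon (\<Sum>i\<in>I. f i) = (\<Prod>i\<in>I. mon (f i))"
  by (induction I rule: finite_induct) (auto simp: mon_add)

lemma mon_neq_0 [simp]: "mon m \<noteq> (0 :: 'k::field mpol)"
  by (metis lookup_single_eq lookup_zero mon_def zero_neq_one)

lemma lookup_mon: "lookup (mon m) m' = (if m = m' then 1 else 0)" by (simp add: mon_def lookup_single when_def)

lemma keys_mon [simp]: "keys (mon m :: 'k::field mpol) = {m}" by (simp add: mon_def)

lemma mon_inj: "inj (mon :: _ \<Rightarrow> 'k::field mpol)" by (metis injI keys_mon singleton_inject)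

lemma var_eq_mon: "var i = mon (single i 1)" by (simp add: var_def mon_def)

lemma var_power: "var i ^ t = mon (single i t)"
proof (induction t)
  case (Suc t)
  have "single i (Suc t) = single i 1 + single i t" by (simp flip: single_add)
  with Suc show ?case by (simp only: mon_add power_Suc var_eq_mon)
qed simp

lemma exp_eq_sum: "m = (\<Sum>i\<in>keys m. single i (lookup m i))" for m :: "'a \<Rightarrow>\<^sub>0 nat"
proof (rule poly_mapping_eqI)
  fix j
  have "lookup (\<Sum>i\<in>keys m. single i (lookup m i)) j = (\<Sum>i\<in>keys m. if i = j then lookup m i else 0)"
    by (simp add: lookup_sum lookup_single when_def)
  also have "\<dots> = lookup m j" by (simp add: in_keys_iff)
  finally show "lookup m j = lookup (\<Sum>i\<in>keys m. single i (lookup m i)) j" ..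
qed

lemma mon_eq_prod_var: "mon m = (\<Prod>i\<in>keys m. var i ^ lookup m i)"
  by (subst exp_eq_sum[of m]) (simp add: mon_sum var_power)

lemma const_0 [simp]: "const 0 = 0" and const_1 [simp]: "const 1 = 1"
  and const_add: "const (a + b) = const a + const b"
  and const_mult: "const (a * b) = const a * const b"
  and const_uminus: "const (- a) = - const a"
  by (auto simp: const_def single_add mult_single single_uminus single_diff)

lemma const_eq_0_iff [simp]: "const c = 0 \<longleftrightarrow> c = 0" by (metis const_0 const_def lookup_single_eq lookup_zero)

lemma const_power: "const (a ^ t) = const a ^ t" by (induction t) (auto simp: const_mult)

lemma lookup_const_mult [simp]: "lookup (const c * p) m = c * lookup p m"
proof -
  have "const c * p = Poly_Mapping.map ((*) c) p" by (simp add: const_def mult_map_scale_conv_mult)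
  then show ?thesis by (simp add: Poly_Mapping.map.rep_eq when_def)
qed

lemma lookup_const: "lookup (const c) m = (if m = 0 then c else 0)"
  by (simp add: const_def lookup_single when_def)

interpretation mp: vector_space "\<lambda>c (p :: 'k::field mpol). const c * p"
  by standard (auto simp: algebra_simps const_add const_mult)

declare mp.scale_scale [simp del]

lemma poly_eq_sum_mon: "p = (\<Sum>m\<in>keys p. const (lookup p m) * mon m)"
proof (rule poly_mapping_eqI)
  fix m
  have "lookup (\<Sum>m\<in>keys p. const (lookup p m) * mon m) m
      = (\<Sum>m'\<in>keys p. if m' = m then lookup p m' else 0)"
    by (simp add: lookup_sum lookup_mon if_distrib cong: if_cong)
  also have "\<dots> = lookup p m" by (simp add: in_keys_iff)
  finally show "lookup p m = lookup (\<Sum>m\<in>keys p. const (lookup p m) * mon m) m" ..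
qed

lemma lookup_mon_mult: "lookup (mon m * p) (m + m') = lookup p m'"
proof -
  have "lookup (mon m * p) (m + m')
      = (\<Sum>a\<in>keys p. lookup p a * lookup (mon (m + a) :: 'a mpol) (m + m'))" by (subst poly_eq_sum_mon[of p])
      (simp add: sum_distrib_left lookup_sum mon_add mult.left_commute[of "mon m"])
  also have "\<dots> = (\<Sum>a\<in>keys p. if a = m' then lookup p a else 0)" by (intro sum.cong) (auto simp: lookup_mon)
  finally show ?thesis by (simp add: in_keys_iff)
qed

subsection \<open>Linear extension from monomials\<close>

definition lin_ext :: "((nat \<Rightarrow>\<^sub>0 nat) \<Rightarrow> 'k::field mpol) \<Rightarrow> 'k mpol \<Rightarrow> 'k mpol" where
  "lin_ext \<phi> p = (\<Sum>m\<in>keys p. const (lookup p m) * \<phi> m)"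

lemma lin_ext_superset:
  assumes "finite A" "keys p \<subseteq> A"
  shows "lin_ext \<phi> p = (\<Sum>m\<in>A. const (lookup p m) * \<phi> m)"
  unfolding lin_ext_def using assms by (intro sum.mono_neutral_left) (auto simp: in_keys_iff)

lemma lin_ext_add: "lin_ext \<phi> (p + q) = lin_ext \<phi> p + lin_ext \<phi> q" using keys_add[of p q]
  by (simp add: lin_ext_superset[of "keys p \<union> keys q"] lookup_add const_add algebra_simps sum.distrib)

lemma keys_const_mult: "keys (const c * p) \<subseteq> keys p" by (auto simp: in_keys_iff)

lemma lin_ext_const_mult: "lin_ext \<phi> (const c * p) = const c * lin_ext \<phi> p" using keys_const_mult[of c p]
  by (simp add: lin_ext_superset[of "keys p"] const_mult sum_distrib_left mult.assoc)

lemma lin_ext_mon [simp]: "lin_ext \<phi> (mon m) = \<phi> m" by (simp add: lin_ext_def lookup_mon)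

lemma lin_ext_0 [simp]: "lin_ext \<phi> 0 = 0" by (simp add: lin_ext_def)

lemma lin_ext_sum: "lin_ext \<phi> (\<Sum>i\<in>I. f i) = (\<Sum>i\<in>I. lin_ext \<phi> (f i))"
  by (induction I rule: infinite_finite_induct) (auto simp: lin_ext_add)

lemma lin_ext_mult:
  assumes "\<And>a b. \<phi> (a + b) = \<phi> a * \<phi> b"
  shows "lin_ext \<phi> (p * q) = lin_ext \<phi> p * lin_ext \<phi> q"
proof -
  have "p * q = (\<Sum>a\<in>keys p. \<Sum>b\<in>keys q. const (lookup p a) * (const (lookup q b) * mon (a + b)))"
    by (subst poly_eq_sum_mon[of p], subst poly_eq_sum_mon[of q])
      (simp add: sum_product mon_add algebra_simps)
  then have "lin_ext \<phi> (p * q)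
      = (\<Sum>a\<in>keys p. \<Sum>b\<in>keys q. const (lookup p a) * (const (lookup q b) * \<phi> (a + b)))"
    by (simp add: lin_ext_sum lin_ext_const_mult)
  then show ?thesis by (simp add: lin_ext_def sum_product assms algebra_simps)
qed

subsection \<open>Homogeneous components\<close>

lemma mon_deg_superset: "finite A \<Longrightarrow> keys m \<subseteq> A \<Longrightarrow> mon_deg m = (\<Sum>i\<in>A. lookup m i)"
  unfolding mon_deg_def by (intro sum.mono_neutral_left) (auto simp: in_keys_iff)

lemma mon_deg_add [simp]: "mon_deg (a + b) = mon_deg a + mon_deg b" using keys_add[of a b]
  by (simp add: mon_deg_superset[of "keys a \<union> keys b"] lookup_add sum.distrib)

lemma mon_deg_0 [simp]: "mon_deg 0 = 0" by (simp add: mon_deg_def)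

lemma mon_deg_single [simp]: "mon_deg (single i t) = t" by (cases "t = 0") (auto simp: mon_deg_def)

lemma mon_deg_eq_0_iff: "mon_deg m = 0 \<longleftrightarrow> m = 0"
  by (auto simp: mon_deg_def in_keys_iff) (metis poly_mapping_eqI lookup_zero)

lemma homogeneous_0 [simp]: "homogeneous d 0" by (simp add: homogeneous_def)

lemma homogeneous_add: "homogeneous d p \<Longrightarrow> homogeneous d q \<Longrightarrow> homogeneous d (p + q)"
  using keys_add[of p q] by (auto simp: homogeneous_def)

lemma homogeneous_sum: "(\<And>i. i \<in> I \<Longrightarrow> homogeneous d (f i)) \<Longrightarrow> homogeneous d (\<Sum>i\<in>I. f i)"
  by (induction I rule: infinite_finite_induct) (auto intro: homogeneous_add)

lemma homogeneous_const_mult: "homogeneous d p \<Longrightarrow> homogeneous d (const c * p)"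
  using keys_const_mult[of c p] by (auto simp: homogeneous_def)

lemma homogeneous_uminus [simp]: "homogeneous d (- p) \<longleftrightarrow> homogeneous d p"
  by (auto simp: homogeneous_def in_keys_iff)

lemma homogeneous_diff: "homogeneous d p \<Longrightarrow> homogeneous d q \<Longrightarrow> homogeneous d (p - q)"
  using homogeneous_add[of d p "- q"] by simp

lemma homogeneous_mult: "homogeneous d p \<Longrightarrow> homogeneous e q \<Longrightarrow> homogeneous (d + e) (p * q)"
  using keys_mult[of p q] by (auto simp: homogeneous_def)

lemma homogeneous_const [simp]: "homogeneous 0 (const c)" by (auto simp: homogeneous_def const_def)

lemma homogeneous_1 [simp]: "homogeneous 0 1" by (metis const_1 homogeneous_const)

lemma homogeneous_power: "homogeneous d p \<Longrightarrow> homogeneous (int t * d) (p ^ t)"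
  by (induction t) (auto simp: algebra_simps intro: homogeneous_mult)

lemma homogeneous_prod:
  "(\<And>i. i \<in> I \<Longrightarrow> homogeneous (d i) (f i)) \<Longrightarrow> homogeneous (\<Sum>i\<in>I. d i) (\<Prod>i\<in>I. f i)"
  by (induction I rule: infinite_finite_induct) (auto intro: homogeneous_mult)

lemma homogeneous_mon: "homogeneous (int (mon_deg m)) (mon m)" by (simp add: homogeneous_def)

lemma homogeneous_var: "homogeneous 1 (var i)" using homogeneous_mon[of "single i 1"] by (simp add: var_eq_mon)

lemma homogeneous_unique: "homogeneous d p \<Longrightarrow> homogeneous e p \<Longrightarrow> p \<noteq> 0 \<Longrightarrow> d = e" by (force simp: homogeneous_def)

lemma homogeneous_nonneg: "homogeneous d p \<Longrightarrow> p \<noteq> 0 \<Longrightarrow> d \<ge> 0"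
  unfolding homogeneous_def by (metis all_not_in_conv keys_eq_empty of_nat_0_le_iff)

definition hcomp :: "int \<Rightarrow> 'k::field mpol \<Rightarrow> 'k mpol" where
  "hcomp d p = Poly_Mapping.mapp (\<lambda>m c. c when int (mon_deg m) = d) p"

lemma lookup_hcomp: "lookup (hcomp d p) m = (if int (mon_deg m) = d then lookup p m else 0)"
  by (auto simp: hcomp_def lookup_mapp when_def in_keys_iff)

lemma keys_hcomp: "keys (hcomp d p) \<subseteq> keys p" by (auto simp: in_keys_iff lookup_hcomp split: if_splits)

lemma homogeneous_hcomp [simp]: "homogeneous d (hcomp d p)"
  by (auto simp: homogeneous_def in_keys_iff lookup_hcomp split: if_splits)

lemma hcomp_add: "hcomp d (p + q) = hcomp d p + hcomp d q"
  by (rule poly_mapping_eqI) (simp add: lookup_hcomp lookup_add)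

lemma hcomp_const_mult: "hcomp d (const c * p) = const c * hcomp d p"
  by (rule poly_mapping_eqI) (simp add: lookup_hcomp)

lemma hcomp_0 [simp]: "hcomp d 0 = 0" by (rule poly_mapping_eqI) (simp add: lookup_hcomp)

lemma hcomp_sum: "hcomp d (\<Sum>i\<in>I. f i) = (\<Sum>i\<in>I. hcomp d (f i))"
  by (induction I rule: infinite_finite_induct) (auto simp: hcomp_add)

lemma hcomp_homogeneous: "homogeneous e p \<Longrightarrow> hcomp d p = (if d = e then p else 0)"
  by (rule poly_mapping_eqI) (auto simp: lookup_hcomp homogeneous_def in_keys_iff)

lemma poly_eq_sum_hcomp: "p = (\<Sum>d\<in>(int \<circ> mon_deg) ` keys p. hcomp d p)"
  by (rule poly_mapping_eqI) (auto simp: lookup_sum lookup_hcomp in_keys_iff)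

lemma hcomp_mult_homogeneous:
  assumes "homogeneous e q"
  shows "hcomp (d + e) (p * q) = hcomp d p * q"
proof -
  let ?D = "(int \<circ> mon_deg) ` keys p"
  have "p * q = (\<Sum>a\<in>?D. hcomp a p * q)" by (subst poly_eq_sum_hcomp[of p]) (simp add: sum_distrib_right)
  then have "hcomp (d + e) (p * q) = (\<Sum>a\<in>?D. hcomp (d + e) (hcomp a p * q))" by (simp add: hcomp_sum)
  also have "\<dots> = (\<Sum>a\<in>?D. if a = d then hcomp a p * q else 0)" using homogeneous_mult[OF homogeneous_hcomp assms]
    by (intro sum.cong) (auto simp: hcomp_homogeneous[OF homogeneous_mult[OF homogeneous_hcomp assms]])
  also have "\<dots> = hcomp d p * q"
  proof (cases "d \<in> ?D")
    case False
    then have "hcomp d p = 0" by (intro poly_mapping_eqI) (auto simp: lookup_hcomp in_keys_iff)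
    with False show ?thesis by auto
  qed simp
  finally show ?thesis .
qed

lemma hcomp_homogeneous_mult:
  "homogeneous e q \<Longrightarrow> hcomp (d + e) (q * p) = q * hcomp d p"
  using hcomp_mult_homogeneous[of e q d p] by (simp add: mult.commute)

subsection \<open>Graded subalgebras\<close>

definition graded_subalgebra :: "'k::field mpol set \<Rightarrow> bool" where
  "graded_subalgebra R \<longleftrightarrow> (\<forall>c. const c \<in> R) \<and> (\<forall>p\<in>R. \<forall>q\<in>R. p + q \<in> R \<and> p * q \<in> R) \<and>
     (\<forall>p\<in>R. \<forall>d. hcomp d p \<in> R)"

context
  fixes R :: "'k::field mpol set"
  assumes R: "graded_subalgebra R"
begin

lemma subalg_const [simp]: "const c \<in> R" using R by (simp add: graded_subalgebra_def)
lemma subalg_0 [simp]: "0 \<in> R" using subalg_const[of 0] by simp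
lemma subalg_1 [simp]: "1 \<in> R" using subalg_const[of 1] by simp
lemma subalg_add: "p \<in> R \<Longrightarrow> q \<in> R \<Longrightarrow> p + q \<in> R" using R by (simp add: graded_subalgebra_def)
lemma subalg_mult: "p \<in> R \<Longrightarrow> q \<in> R \<Longrightarrow> p * q \<in> R" using R by (simp add: graded_subalgebra_def)
lemma subalg_hcomp: "p \<in> R \<Longrightarrow> hcomp d p \<in> R" using R by (simp add: graded_subalgebra_def)
lemma subalg_uminus: "p \<in> R \<Longrightarrow> - p \<in> R"
  using subalg_mult[OF subalg_const[of "-1"], of p] by (simp add: const_uminus)
lemma subalg_diff: "p \<in> R \<Longrightarrow> q \<in> R \<Longrightarrow> p - q \<in> R" using subalg_add[of p "- q"] subalg_uminus by simp
lemma subalg_power: "p \<in> R \<Longrightarrow> p ^ t \<in> R" by (induction t) (auto intro: subalg_mult)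
lemma subalg_sum: "(\<And>i. i \<in> I \<Longrightarrow> f i \<in> R) \<Longrightarrow> (\<Sum>i\<in>I. f i) \<in> R"
  by (induction I rule: infinite_finite_induct) (auto intro: subalg_add)
lemma subalg_prod: "(\<And>i. i \<in> I \<Longrightarrow> f i \<in> R) \<Longrightarrow> (\<Prod>i\<in>I. f i) \<in> R"
  by (induction I rule: infinite_finite_induct) (auto intro: subalg_mult)

end

lemma poly_ring_subalgebra: "graded_subalgebra (poly_ring n)"
  unfolding graded_subalgebra_def
proof (intro conjI ballI allI)
  fix p q :: "'a mpol" assume "p \<in> poly_ring n" "q \<in> poly_ring n"
  then have pq: "\<And>m. m \<in> keys p \<Longrightarrow> keys m \<subseteq> {1..n}" "\<And>m. m \<in> keys q \<Longrightarrow> keys m \<subseteq> {1..n}"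
    by (auto simp: poly_ring_def)
  then show "p + q \<in> poly_ring n" using keys_add[of p q] unfolding poly_ring_def by blast
  have "keys m \<subseteq> {1..n}" if m: "m \<in> keys (p * q)" for m
  proof -
    obtain a b where "m = a + b" "a \<in> keys p" "b \<in> keys q" using subsetD[OF keys_mult m] by blast
    then show ?thesis using keys_add[of a b] pq by blast
  qed
  then show "p * q \<in> poly_ring n" by (auto simp: poly_ring_def)
next
  fix p :: "'a mpol" and d assume "p \<in> poly_ring n"
  then show "hcomp d p \<in> poly_ring n" using keys_hcomp[of d p] by (auto simp: poly_ring_def)
qed (auto simp: poly_ring_def const_def)

lemmas poly_ring_0 = subalg_0[OF poly_ring_subalgebra]
  and poly_ring_1 = subalg_1[OF poly_ring_subalgebra]
  and poly_ring_add = subalg_add[OF poly_ring_subalgebra]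
  and poly_ring_const = subalg_const[OF poly_ring_subalgebra]
  and poly_ring_diff = subalg_diff[OF poly_ring_subalgebra]
  and poly_ring_hcomp = subalg_hcomp[OF poly_ring_subalgebra]
  and poly_ring_mult = subalg_mult[OF poly_ring_subalgebra]
  and poly_ring_power = subalg_power[OF poly_ring_subalgebra]
  and poly_ring_prod = subalg_prod[OF poly_ring_subalgebra]
  and poly_ring_sum = subalg_sum[OF poly_ring_subalgebra]
  and poly_ring_uminus = subalg_uminus[OF poly_ring_subalgebra]

lemma mon_in_poly_ring [simp]: "mon m \<in> poly_ring n \<longleftrightarrow> keys m \<subseteq> {1..n}" by (simp add: poly_ring_def)

lemma var_in_poly_ring: "i \<in> {1..n} \<Longrightarrow> var i \<in> poly_ring n" by (simp add: var_eq_mon)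

definition exps :: "nat \<Rightarrow> int \<Rightarrow> (nat \<Rightarrow>\<^sub>0 nat) set" where
  "exps n d = {m. keys m \<subseteq> {1..n} \<and> int (mon_deg m) = d}"

lemma finite_exps: "finite (exps n d)"
proof -
  let ?F = "{f. \<forall>i. (i \<in> {1..n} \<longrightarrow> f i \<in> {0..nat d}) \<and> (i \<notin> {1..n} \<longrightarrow> f i = (0::nat))}"
  have "lookup m \<in> ?F" if m: "m \<in> exps n d" for m
  proof -
    have "lookup m i \<le> nat d" for i
    proof (cases "i \<in> keys m")
      case True
      then have "lookup m i \<le> mon_deg m"
        unfolding mon_deg_def by (intro member_le_sum) auto
      then show ?thesis using m by (auto simp: exps_def)
    qed (simp add: in_keys_iff)
    then show ?thesis using m by (auto simp: exps_def in_keys_iff subset_iff)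
  qed
  then have "lookup ` exps n d \<subseteq> ?F" by (rule image_subsetI)
  moreover have "finite ?F" by (rule finite_set_of_finite_funs) auto
  ultimately have "finite (lookup ` exps n d)" by (rule finite_subset)
  moreover have "inj_on lookup (exps n d)" by (rule inj_onI) (metis poly_mapping_eq_iff)
  ultimately show ?thesis by (rule finite_imageD)
qed

lemma graded_part_poly_ring: "p \<in> graded_part (poly_ring n) d \<longleftrightarrow> keys p \<subseteq> exps n d"
  by (auto simp: graded_part_def poly_ring_def homogeneous_def exps_def)

lemma sum_scaled_mon_inj:
  assumes "finite A" "(\<Sum>m\<in>A. const (u m) * mon m) = 0" "m \<in> A"
  shows "u m = 0"
proof -
  have "lookup (\<Sum>m\<in>A. const (u m) * mon m) m = (\<Sum>m'\<in>A. if m' = m then u m' else 0)"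
    by (simp add: lookup_sum lookup_mon if_distrib cong: if_cong)
  with assms show ?thesis by simp
qed

lemma mon_independent: "mp.independent ((mon :: _ \<Rightarrow> 'k::field mpol) ` A)"
  unfolding mp.independent_explicit_finite_subsets
proof (intro allI impI ballI)
  fix S and u :: "'k mpol \<Rightarrow> 'k" and v
  assume S: "S \<subseteq> mon ` A" "finite S" "(\<Sum>v\<in>S. const (u v) * v) = 0" "v \<in> S"
  obtain B where B: "finite B" "S = mon ` B" by (meson S finite_subset_image)
  then have "(\<Sum>m\<in>B. const (u (mon m)) * mon m) = 0"
    using S(3) by (simp add: sum.reindex inj_on_subset[OF mon_inj])
  with B S(4) show "u v = 0" using sum_scaled_mon_inj[of B "\<lambda>m. u (mon m)"] by auto
qed

lemma span_mon: "mp.span ((mon :: _ \<Rightarrow> 'k::field mpol) ` A) = {p. keys p \<subseteq> A}"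
proof (rule Set.set_eqI, rule iffI)
  fix p :: "'k mpol" assume "p \<in> {p. keys p \<subseteq> A}"
  then have "(\<Sum>m\<in>keys p. const (lookup p m) * mon m) \<in> mp.span (mon ` A)"
    by (intro mp.span_sum mp.span_scale mp.span_base) auto
  then show "p \<in> mp.span (mon ` A)" by (simp flip: poly_eq_sum_mon)
next
  fix p :: "'k mpol" assume "p \<in> mp.span (mon ` A)"
  moreover have "mp.subspace {p :: 'k mpol. keys p \<subseteq> A}"
  proof (rule mp.subspaceI)
    fix p q :: "'k mpol" and c
    assume "p \<in> {p. keys p \<subseteq> A}" "q \<in> {p. keys p \<subseteq> A}"
    then show "p + q \<in> {p. keys p \<subseteq> A}" "const c * p \<in> {p. keys p \<subseteq> A}"
      using keys_add[of p q] keys_const_mult[of c p] by auto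
  qed auto
  moreover have "(mon ` A :: 'k mpol set) \<subseteq> {p. keys p \<subseteq> A}" by auto
  ultimately show "p \<in> {p. keys p \<subseteq> A}" using mp.span_minimal by blast
qed

lemma card_mon_image: "card ((mon :: _ \<Rightarrow> 'k::field mpol) ` A) = card A"
  by (intro card_image inj_on_subset[OF mon_inj]) simp

text \<open>On the finite-dimensional space spanned by finitely many monomials, a linear endomorphism is injective
  iff it is surjective.\<close>

lemma lin_ext_surj_imp_inj:
  fixes \<phi> :: "(nat \<Rightarrow>\<^sub>0 nat) \<Rightarrow> 'k::field mpol"
  assumes A: "finite A"
    and surj: "\<And>m. m \<in> A \<Longrightarrow> mon m \<in> mp.span (\<phi> ` A)"
    and p: "keys p \<subseteq> A" "lin_ext \<phi> p = 0"
  shows "p = 0"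
proof -
  have "mp.span (mon ` A) \<subseteq> mp.span (\<phi> ` A)" using surj by (intro mp.span_minimal) auto
  then obtain B where B: "B \<subseteq> \<phi> ` A" "mp.independent B" "\<phi> ` A \<subseteq> mp.span B"
    using mp.maximal_independent_subset[of "\<phi> ` A"] by auto
  have finB: "finite B" using B A finite_subset by blast
  have "(mon ` A :: 'k mpol set) \<subseteq> mp.span B" using surj B(3) mp.span_minimal[OF B(3) mp.subspace_span] by auto
  then have "card A \<le> card B" using mp.independent_span_bound[OF finB mon_independent] card_mon_image by metis
  moreover have "card B \<le> card (\<phi> ` A)" "card (\<phi> ` A) \<le> card A"
    using B A by (auto intro: card_mono card_image_le)
  ultimately have eq: "card (\<phi> ` A) = card A" "card B = card (\<phi> ` A)" by auto
  then have "B = \<phi> ` A" using B A by (intro card_subset_eq) auto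
  with B have ind: "mp.independent (\<phi> ` A)" by simp
  have inj: "inj_on \<phi> A" using A eq by (intro eq_card_imp_inj_on) auto
  have "(\<Sum>v\<in>\<phi> ` A. const (lookup p (the_inv_into A \<phi> v)) * v) = lin_ext \<phi> p"
    by (simp add: sum.reindex inj the_inv_into_f_f lin_ext_superset[OF A p(1)])
  with p(2) have "lookup p (the_inv_into A \<phi> v) = 0" if "v \<in> \<phi> ` A" for v
    by (intro mp.independentD[OF ind _ subset_refl, of "\<lambda>v. lookup p (the_inv_into A \<phi> v)"])
      (use A that in auto)
  then have "lookup p m = 0" if "m \<in> A" for m using that inj by (metis imageI the_inv_into_f_f)
  with p(1) show ?thesis by (intro poly_mapping_eqI) (metis in_keys_iff lookup_zero subsetD)
qed

lemma lin_ext_inj_imp_surj: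
  fixes \<phi> :: "(nat \<Rightarrow>\<^sub>0 nat) \<Rightarrow> 'k::field mpol"
  assumes A: "finite A" and \<phi>: "\<And>m. m \<in> A \<Longrightarrow> keys (\<phi> m) \<subseteq> A"
    and inj: "\<And>p. keys p \<subseteq> A \<Longrightarrow> lin_ext \<phi> p = 0 \<Longrightarrow> p = 0"
    and q: "keys q \<subseteq> A"
  shows "\<exists>p. keys p \<subseteq> A \<and> lin_ext \<phi> p = q"
proof -
  have keys_comb: "keys (\<Sum>m\<in>A. const (u m) * mon m :: 'k mpol) \<subseteq> A" for u
    using keys_sum[of "\<lambda>m. const (u m) * mon m" A] keys_const_mult by fastforce
  have ext_comb: "lin_ext \<phi> (\<Sum>m\<in>A. const (u m) * mon m) = (\<Sum>m\<in>A. const (u m) * \<phi> m)" for u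
    by (simp add: lin_ext_sum lin_ext_const_mult)
  have inj\<phi>: "inj_on \<phi> A"
  proof (rule inj_onI)
    fix a b assume ab: "a \<in> A" "b \<in> A" "\<phi> a = \<phi> b"
    let ?p = "mon a + const (-1) * mon b :: 'k mpol"
    have "keys ?p \<subseteq> A"
      using keys_add[of "mon a" "const (-1) * mon b :: 'k mpol"] keys_const_mult[of "-1" "mon b :: 'k mpol"] ab by auto
    moreover have "lin_ext \<phi> ?p = 0"
      using ab by (simp only: lin_ext_add lin_ext_const_mult lin_ext_mon) (simp add: const_uminus)
    ultimately have "?p = 0" by (rule inj)
    then have "(mon a :: 'k mpol) = mon b" by (simp add: const_uminus)
    then show "a = b" using mon_inj by (auto dest: injD)
  qed
  have ind: "mp.independent (\<phi> ` A)"
  proof (rule mp.independent_if_scalars_zero)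
    fix f x assume f: "(\<Sum>x\<in>\<phi> ` A. const (f x) * x) = 0" "x \<in> \<phi> ` A"
    have "lin_ext \<phi> (\<Sum>m\<in>A. const (f (\<phi> m)) * mon m) = 0" using f by (simp add: ext_comb sum.reindex inj\<phi>)
    then have "(\<Sum>m\<in>A. const (f (\<phi> m)) * mon m :: 'k mpol) = 0" by (rule inj[OF keys_comb])
    then show "f x = 0" using sum_scaled_mon_inj[OF A, of "f \<circ> \<phi>"] f(2) by auto
  qed (use A in simp)
  have sub: "\<phi> ` A \<subseteq> mp.span (mon ` A)" using \<phi> by (auto simp: span_mon)
  have "q \<in> mp.span (\<phi> ` A)"
  proof (rule ccontr)
    assume "q \<notin> mp.span (\<phi> ` A)"
    then have "mp.independent (insert q (\<phi> ` A))" "q \<notin> \<phi> ` A"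
      using ind mp.independent_insertI mp.span_base by blast+
    moreover have "insert q (\<phi> ` A) \<subseteq> mp.span (mon ` A)" using sub q by (auto simp: span_mon)
    ultimately have "card (insert q (\<phi> ` A)) \<le> card (mon ` A :: 'k mpol set)"
      using mp.independent_span_bound[of "mon ` A"] A by blast
    then show False using A \<open>q \<notin> \<phi> ` A\<close> card_image[OF inj\<phi>]
        card_mon_image[of A, where ?'k = 'k] by simp
  qed
  then obtain u where u: "q = (\<Sum>v\<in>\<phi> ` A. const (u v) * v)"
    unfolding mp.span_finite[OF finite_imageI[OF A]] by blast
  have "q = lin_ext \<phi> (\<Sum>m\<in>A. const (u (\<phi> m)) * mon m)"
    unfolding u by (simp add: ext_comb sum.reindex inj\<phi>)
  with keys_comb show ?thesis by metis
qed

declare One_nat_def [simp del]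

section \<open>Substitution of variables and the permutation action\<close>

definition push :: "(nat \<Rightarrow> nat) \<Rightarrow> (nat \<Rightarrow>\<^sub>0 nat) \<Rightarrow> (nat \<Rightarrow>\<^sub>0 nat)" where
  "push \<sigma> m = (\<Sum>i\<in>keys m. single (\<sigma> i) (lookup m i))"

lemma push_superset: "finite A \<Longrightarrow> keys m \<subseteq> A \<Longrightarrow> push \<sigma> m = (\<Sum>i\<in>A. single (\<sigma> i) (lookup m i))"
  unfolding push_def by (intro sum.mono_neutral_left) (auto simp: in_keys_iff)

lemma push_add: "push \<sigma> (a + b) = push \<sigma> a + push \<sigma> b" using keys_add[of a b]
  by (simp add: push_superset[of "keys a \<union> keys b"] lookup_add single_add sum.distrib)

lemma push_0 [simp]: "push \<sigma> 0 = 0" by (simp add: push_def)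

lemma push_single [simp]: "push \<sigma> (single i t) = single (\<sigma> i) t" by (cases "t = 0") (auto simp: push_def)

lemma push_sum: "push \<sigma> (\<Sum>i\<in>I. f i) = (\<Sum>i\<in>I. push \<sigma> (f i))"
  by (induction I rule: infinite_finite_induct) (auto simp: push_add)

lemma push_comp: "push \<sigma> (push \<tau> m) = push (\<sigma> \<circ> \<tau>) m"
  by (simp add: push_def[of \<tau>] push_def[of "\<sigma> \<circ> \<tau>"] push_sum)

lemma push_id [simp]: "push id m = m" by (simp add: push_def flip: exp_eq_sum)

lemma mon_deg_push [simp]: "mon_deg (push \<sigma> m) = mon_deg m"
proof -
  have *: "mon_deg (\<Sum>i\<in>I. f i) = (\<Sum>i\<in>I. mon_deg (f i))" if "finite I" for I and f :: "nat \<Rightarrow> nat \<Rightarrow>\<^sub>0 nat"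
    using that by (induction I rule: finite_induct) auto
  show ?thesis by (simp add: push_def *) (simp add: mon_deg_def)
qed

lemma lookup_push: "inj \<sigma> \<Longrightarrow> lookup (push \<sigma> m) (\<sigma> i) = lookup m i"
  by (simp add: push_def lookup_sum lookup_single when_def inj_eq in_keys_iff)

lemma keys_push: "keys (push \<sigma> m) \<subseteq> \<sigma> ` keys m" using keys_sum[of "\<lambda>i. single (\<sigma> i) (lookup m i)" "keys m"]
  by (auto simp: push_def)

lemma perm_act_eq_lin_ext: "perm_act \<sigma> = lin_ext (\<lambda>m. mon (push \<sigma> m))"
  by (rule ext) (simp add: perm_act_def lin_ext_def push_def mon_sum var_power)

lemma perm_act_add: "perm_act \<sigma> (p + q) = perm_act \<sigma> p + perm_act \<sigma> q"
  by (simp add: perm_act_eq_lin_ext lin_ext_add)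

lemma perm_act_const_mult: "perm_act \<sigma> (const c * p) = const c * perm_act \<sigma> p"
  by (simp add: perm_act_eq_lin_ext lin_ext_const_mult)

lemma perm_act_mult: "perm_act \<sigma> (p * q) = perm_act \<sigma> p * perm_act \<sigma> q"
  by (simp add: perm_act_eq_lin_ext lin_ext_mult push_add mon_add)

lemma perm_act_0 [simp]: "perm_act \<sigma> 0 = 0" by (simp add: perm_act_eq_lin_ext)

lemma perm_act_mon [simp]: "perm_act \<sigma> (mon m) = mon (push \<sigma> m)" by (simp add: perm_act_eq_lin_ext)

lemma perm_act_1 [simp]: "perm_act \<sigma> 1 = 1" using perm_act_mon[of \<sigma> 0] by (simp del: perm_act_mon)

lemma perm_act_const [simp]: "perm_act \<sigma> (const c) = const c" using perm_act_const_mult[of \<sigma> c 1] by simp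

lemma perm_act_var [simp]: "perm_act \<sigma> (var i) = var (\<sigma> i)" by (simp add: var_eq_mon)

lemma perm_act_uminus: "perm_act \<sigma> (- p) = - perm_act \<sigma> p"
  using perm_act_const_mult[of \<sigma> "-1" p] by (simp add: const_uminus)

lemma perm_act_diff: "perm_act \<sigma> (p - q) = perm_act \<sigma> p - perm_act \<sigma> q"
  using perm_act_add[of \<sigma> p "- q"] by (simp add: perm_act_uminus)

lemma perm_act_sum: "perm_act \<sigma> (\<Sum>i\<in>I. f i) = (\<Sum>i\<in>I. perm_act \<sigma> (f i))"
  by (induction I rule: infinite_finite_induct) (auto simp: perm_act_add)

lemma perm_act_prod: "perm_act \<sigma> (\<Prod>i\<in>I. f i) = (\<Prod>i\<in>I. perm_act \<sigma> (f i))"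
  by (induction I rule: infinite_finite_induct) (auto simp: perm_act_mult)

lemma perm_act_power: "perm_act \<sigma> (p ^ t) = perm_act \<sigma> p ^ t" by (induction t) (auto simp: perm_act_mult)

lemma perm_act_expand: "perm_act \<sigma> p = (\<Sum>m\<in>keys p. const (lookup p m) * mon (push \<sigma> m))"
  by (simp add: perm_act_eq_lin_ext lin_ext_def)

lemma perm_act_comp: "perm_act \<sigma> (perm_act \<tau> p) = perm_act (\<sigma> \<circ> \<tau>) p"
  by (simp add: perm_act_expand[of \<tau> p] perm_act_expand[of "\<sigma> \<circ> \<tau>" p] perm_act_sum
      perm_act_const_mult push_comp)

lemma perm_act_id [simp]: "perm_act id p = p" by (simp add: perm_act_expand flip: poly_eq_sum_mon)

lemma homogeneous_perm_act: "homogeneous d p \<Longrightarrow> homogeneous d (perm_act \<sigma> p)"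
  unfolding perm_act_expand by (intro homogeneous_sum homogeneous_const_mult) (auto simp: homogeneous_def)

lemma hcomp_perm_act: "hcomp d (perm_act \<sigma> p) = perm_act \<sigma> (hcomp d p)"
proof -
  let ?D = "(int \<circ> mon_deg) ` keys p"
  have "hcomp d (perm_act \<sigma> p) = (\<Sum>e\<in>?D. hcomp d (perm_act \<sigma> (hcomp e p)))"
    by (subst poly_eq_sum_hcomp[of p]) (simp add: perm_act_sum hcomp_sum)
  also have "\<dots> = (\<Sum>e\<in>?D. perm_act \<sigma> (hcomp d (hcomp e p)))" using homogeneous_perm_act[OF homogeneous_hcomp]
    by (intro sum.cong) (auto simp: hcomp_homogeneous[OF homogeneous_hcomp]
        hcomp_homogeneous[OF homogeneous_perm_act[OF homogeneous_hcomp]])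
  also have "\<dots> = perm_act \<sigma> (hcomp d (\<Sum>e\<in>?D. hcomp e p))" by (simp add: perm_act_sum hcomp_sum)
  also have "(\<Sum>e\<in>?D. hcomp e p) = p" by (rule poly_eq_sum_hcomp[symmetric])
  finally show ?thesis .
qed

lemma perm_act_in_poly_ring:
  assumes "p \<in> poly_ring n" "\<And>i. i \<in> {1..n} \<Longrightarrow> \<sigma> i \<in> {1..n}"
  shows "perm_act \<sigma> p \<in> poly_ring n"
  unfolding perm_act_expand
proof (intro poly_ring_sum poly_ring_mult)
  fix m assume "m \<in> keys p"
  then have "keys m \<subseteq> {1..n}" using assms(1) by (auto simp: poly_ring_def)
  then show "mon (push \<sigma> m) \<in> poly_ring n" using keys_push[of \<sigma> m] assms(2) by fastforce
qed (auto simp: poly_ring_const)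

lemma inj_push: "inj \<sigma> \<Longrightarrow> inj (push \<sigma>)"
proof (rule injI)
  fix a b assume "inj \<sigma>" "push \<sigma> a = push \<sigma> b"
  then show "a = b" by (intro poly_mapping_eqI) (metis lookup_push)
qed

lemma lookup_perm_act: "inj \<sigma> \<Longrightarrow> lookup (perm_act \<sigma> p) (push \<sigma> m) = lookup p m"
  by (simp add: perm_act_expand lookup_sum lookup_mon inj_eq[OF inj_push] if_distrib in_keys_iff cong: if_cong)

lemma push_inv: "bij \<sigma> \<Longrightarrow> push \<sigma> (push (inv' \<sigma>) m) = m" "bij \<sigma> \<Longrightarrow> push (inv' \<sigma>) (push \<sigma> m) = m"
  by (simp_all add: push_comp bij_is_surj surj_iff[THEN iffD1] bij_is_inj inv_o_cancel)

lemma perm_act_eq_0_iff: "inj \<sigma> \<Longrightarrow> perm_act \<sigma> p = 0 \<longleftrightarrow> p = 0"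
  by (metis lookup_perm_act perm_act_0 poly_mapping_eqI)

subsection \<open>Groups of permutations and their invariants\<close>

locale perm_group =
  fixes n :: nat and G :: "(nat \<Rightarrow> nat) set"
  assumes permutes: "\<sigma> \<in> G \<Longrightarrow> \<sigma> permutes {1..n}"
    and id_mem [simp]: "id \<in> G"
    and comp_mem: "\<sigma> \<in> G \<Longrightarrow> \<tau> \<in> G \<Longrightarrow> \<sigma> \<circ> \<tau> \<in> G"
    and inv_mem: "\<sigma> \<in> G \<Longrightarrow> inv' \<sigma> \<in> G"
begin

lemma finite_group [simp]: "finite G"
  by (rule finite_subset[OF _ finite_permutations[of "{1..n}"]]) (auto intro: permutes)

lemma bij_mem: "\<sigma> \<in> G \<Longrightarrow> bij \<sigma>" using permutes permutes_bij by blast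

lemma inj_mem: "\<sigma> \<in> G \<Longrightarrow> inj \<sigma>" using bij_mem bij_is_inj by blast

lemma permutation_mem: "\<sigma> \<in> G \<Longrightarrow> permutation \<sigma>" using permutes by (auto simp: permutation_permutes)

lemma inv_comp_mem: "\<sigma> \<in> G \<Longrightarrow> inv' \<sigma> \<circ> \<sigma> = id" "\<sigma> \<in> G \<Longrightarrow> \<sigma> \<circ> inv' \<sigma> = id"
  using permutes_inv_o[OF permutes] by auto

lemma perm_act_mem: "\<sigma> \<in> G \<Longrightarrow> p \<in> poly_ring n \<Longrightarrow> perm_act \<sigma> p \<in> poly_ring n"
  by (rule perm_act_in_poly_ring) (simp_all add: permutes_in_image[OF permutes] del: atLeastAtMost_iff)

lemma bij_comp_left: "\<sigma> \<in> G \<Longrightarrow> bij_betw ((\<circ>) \<sigma>) G G" by (rule bij_betw_byWitness[where f' = "(\<circ>) (inv' \<sigma>)"])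
    (auto simp: comp_mem inv_mem inv_comp_mem simp flip: comp_assoc)

lemma bij_comp_right: "\<sigma> \<in> G \<Longrightarrow> bij_betw (\<lambda>\<tau>. \<tau> \<circ> \<sigma>) G G"
  by (rule bij_betw_byWitness[where f' = "\<lambda>\<tau>. \<tau> \<circ> inv' \<sigma>"])
    (auto simp: comp_mem inv_mem inv_comp_mem comp_assoc)

lemma invariant_ring_subalgebra: "graded_subalgebra (invariant_ring n G :: 'k::field mpol set)"
  using poly_ring_subalgebra[of n, where ?'a = 'k]
  by (auto simp: graded_subalgebra_def invariant_ring_def perm_act_add perm_act_mult hcomp_perm_act
      simp flip: hcomp_perm_act)

lemma invariantD: "f \<in> invariant_ring n G \<Longrightarrow> \<sigma> \<in> G \<Longrightarrow> perm_act \<sigma> f = f"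
  "f \<in> invariant_ring n G \<Longrightarrow> f \<in> poly_ring n" by (auto simp: invariant_ring_def)

end

lemma perm_group_of_subgroup: "subgroup G (sym_group n) \<Longrightarrow> perm_group n G"
proof -
  assume G: "subgroup G (sym_group n)"
  interpret subgroup G "sym_group n" by (rule G)
  show ?thesis
  proof
    fix \<sigma> assume \<sigma>: "\<sigma> \<in> G"
    then show p: "\<sigma> permutes {1..n}" using mem_carrier sym_group_carrier by blast
    have "inv\<^bsub>sym_group n\<^esub> \<sigma> = inv' \<sigma>" using p by (intro group.inv_equality[OF sym_group_is_group])
        (auto simp: sym_group_def permutes_inv permutes_inv_o)
    then show "inv' \<sigma> \<in> G" using m_inv_closed[OF \<sigma>] by simp
  next
    show "id \<in> G" using one_closed by (simp add: sym_group_def)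
  next
    fix \<sigma> \<tau> assume "\<sigma> \<in> G" "\<tau> \<in> G"
    then show "\<sigma> \<circ> \<tau> \<in> G" using m_closed by (simp add: sym_group_def)
  qed
qed

definition full_sym :: "nat \<Rightarrow> (nat \<Rightarrow> nat) set" where
  "full_sym n = {\<sigma>. \<sigma> permutes {1..n}}"

abbreviation "sym_polys n \<equiv> invariant_ring n (full_sym n)"

lemma perm_group_full: "perm_group n (full_sym n)"
  by standard (auto simp: full_sym_def permutes_id permutes_compose permutes_inv)

lemma perm_group_trivial: "perm_group n {id}" by standard (auto simp: permutes_id)

lemma perm_group_transpose:
  "i \<in> {1..n} \<Longrightarrow> j \<in> {1..n} \<Longrightarrow> perm_group n {id, swap i j}" by standard (auto simp: permutes_id permutes_swap_id)

subsection \<open>Relative traces\<close>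

definition pm_char :: "((nat \<Rightarrow> nat) \<Rightarrow> 'k::field) \<Rightarrow> bool" where
  "pm_char \<chi> \<longleftrightarrow> (\<forall>\<sigma> \<tau>. permutation \<sigma> \<longrightarrow> permutation \<tau> \<longrightarrow> \<chi> (\<sigma> \<circ> \<tau>) = \<chi> \<sigma> * \<chi> \<tau>) \<and>
     (\<forall>\<sigma>. \<chi> \<sigma> * \<chi> \<sigma> = 1)"

definition sgn_char :: "(nat \<Rightarrow> nat) \<Rightarrow> 'k::field" where
  "sgn_char \<sigma> = of_int (sign \<sigma>)"

lemma pm_char_trivial: "pm_char (\<lambda>_. 1)" by (simp add: pm_char_def)

lemma pm_char_sgn: "pm_char (sgn_char :: _ \<Rightarrow> 'k::field)"
  by (auto simp: pm_char_def sgn_char_def sign_compose simp flip: of_int_mult)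

lemma sgn_char_transpose: "i \<noteq> j \<Longrightarrow> sgn_char (swap i j) = -1" by (simp add: sgn_char_def sign_swap_id)

lemma sgn_char_id [simp]: "sgn_char id = 1" by (simp add: sgn_char_def)

definition char_trace ::
    "((nat \<Rightarrow> nat) \<Rightarrow> 'k::field) \<Rightarrow> (nat \<Rightarrow> nat) set \<Rightarrow> 'k mpol \<Rightarrow> 'k mpol" where
  "char_trace \<chi> G s = (\<Sum>\<sigma>\<in>G. const (\<chi> \<sigma>) * perm_act \<sigma> s)"

abbreviation "orbit_trace \<equiv> char_trace (\<lambda>_. 1)"

definition semi_inv :: "((nat \<Rightarrow> nat) \<Rightarrow> 'k::field) \<Rightarrow> (nat \<Rightarrow> nat) set \<Rightarrow> 'k mpol \<Rightarrow> bool" where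
  "semi_inv \<chi> G f \<longleftrightarrow> (\<forall>\<sigma>\<in>G. perm_act \<sigma> f = const (\<chi> \<sigma>) * f)"

text \<open>For a semi-invariant of \<open>K\<close> the term \<open>\<chi>(t) t(v)\<close> only depends on the coset \<open>tK\<close>, so that the
  sum below does not depend on the chosen representatives.\<close>

definition coset_rep_sum ::
    "((nat \<Rightarrow> nat) \<Rightarrow> 'k::field) \<Rightarrow> (nat \<Rightarrow> nat) set \<Rightarrow> (nat \<Rightarrow> nat) set \<Rightarrow> 'k mpol \<Rightarrow> 'k mpol" where
  "coset_rep_sum \<chi> G K v =
     (\<Sum>C\<in>(\<lambda>t. (\<circ>) t ` K) ` G. const (\<chi> (SOME t. t \<in> C)) * perm_act (SOME t. t \<in> C) v)"

lemma coset_rep_sum_add: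
  "coset_rep_sum \<chi> G K (u + v) = coset_rep_sum \<chi> G K u + coset_rep_sum \<chi> G K v"
  by (simp add: coset_rep_sum_def perm_act_add algebra_simps sum.distrib)

lemma char_trace_add: "char_trace \<chi> G (u + v) = char_trace \<chi> G u + char_trace \<chi> G v"
  by (simp add: char_trace_def perm_act_add algebra_simps sum.distrib)

lemma char_trace_mult:
  "(\<And>\<sigma>. \<sigma> \<in> G \<Longrightarrow> perm_act \<sigma> a = a) \<Longrightarrow> char_trace \<chi> G (a * u) = a * char_trace \<chi> G u"
  by (simp add: char_trace_def perm_act_mult sum_distrib_left mult.left_commute)

lemma char_trace_homogeneous: "homogeneous d u \<Longrightarrow> homogeneous d (char_trace \<chi> G u)"
  unfolding char_trace_def by (intro homogeneous_sum homogeneous_const_mult homogeneous_perm_act)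

lemma coset_rep_sum_homogeneous: "homogeneous d u \<Longrightarrow> homogeneous d (coset_rep_sum \<chi> G K u)"
  unfolding coset_rep_sum_def by (intro homogeneous_sum homogeneous_const_mult homogeneous_perm_act)

lemma (in perm_group) char_trace_in_poly_ring: "u \<in> poly_ring n \<Longrightarrow> char_trace \<chi> G u \<in> poly_ring n"
  unfolding char_trace_def by (intro poly_ring_sum poly_ring_mult
      poly_ring_const perm_act_mem)

lemma semi_inv_add: "semi_inv \<chi> G u \<Longrightarrow> semi_inv \<chi> G v \<Longrightarrow> semi_inv \<chi> G (u + v)"
  by (simp add: semi_inv_def perm_act_add distrib_left)

lemma semi_inv_mult:
  "semi_inv \<chi> G u \<Longrightarrow> (\<And>\<sigma>. \<sigma> \<in> G \<Longrightarrow> perm_act \<sigma> a = a) \<Longrightarrow> semi_inv \<chi> G (a * u)"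
  by (simp add: semi_inv_def perm_act_mult mult.left_commute)

lemma semi_inv_mono: "semi_inv \<chi> G u \<Longrightarrow> K \<subseteq> G \<Longrightarrow> semi_inv \<chi> K u" by (auto simp: semi_inv_def)

context perm_group
begin

lemma char_trace_semi_inv: "pm_char \<chi> \<Longrightarrow> semi_inv \<chi> G (char_trace \<chi> G s)"
  unfolding semi_inv_def
proof
  fix \<sigma> assume \<chi>: "pm_char \<chi>" and \<sigma>: "\<sigma> \<in> G"
  have "const (\<chi> \<tau>) = const (\<chi> \<sigma>) * const (\<chi> (\<sigma> \<circ> \<tau>))" if "\<tau> \<in> G" for \<tau>
  proof -
    have "\<chi> (\<sigma> \<circ> \<tau>) = \<chi> \<sigma> * \<chi> \<tau>" "\<chi> \<sigma> * \<chi> \<sigma> = 1" using \<chi> \<sigma> that permutation_mem by (auto simp: pm_char_def)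
    then show ?thesis by (simp flip: const_mult mult.assoc)
  qed
  then have "perm_act \<sigma> (char_trace \<chi> G s)
      = (\<Sum>\<tau>\<in>G. const (\<chi> \<sigma>) * (const (\<chi> (\<sigma> \<circ> \<tau>)) * perm_act (\<sigma> \<circ> \<tau>) s))"
    by (auto simp: char_trace_def perm_act_sum perm_act_const_mult perm_act_comp mult.assoc intro!: sum.cong)
  also have "\<dots> = const (\<chi> \<sigma>) * char_trace \<chi> G s"
    unfolding char_trace_def sum_distrib_left[symmetric]
    by (subst sum.reindex_bij_betw[OF bij_comp_left[OF \<sigma>]]) simp
  finally show "perm_act \<sigma> (char_trace \<chi> G s) = const (\<chi> \<sigma>) * char_trace \<chi> G s" .
qed

lemma char_trace_perm_act:
  assumes \<chi>: "pm_char \<chi>" and \<sigma>: "\<sigma> \<in> G"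
  shows "char_trace \<chi> G (perm_act \<sigma> s) = const (\<chi> \<sigma>) * char_trace \<chi> G s"
proof -
  have "const (\<chi> \<tau>) = const (\<chi> \<sigma>) * const (\<chi> (\<tau> \<circ> \<sigma>))" if "\<tau> \<in> G" for \<tau>
  proof -
    have "\<chi> (\<tau> \<circ> \<sigma>) = \<chi> \<tau> * \<chi> \<sigma>" "\<chi> \<sigma> * \<chi> \<sigma> = 1" using \<chi> \<sigma> that permutation_mem by (auto simp: pm_char_def)
    then show ?thesis by (simp add: mult.left_commute[of "\<chi> \<sigma>"] flip: const_mult)
  qed
  then have "char_trace \<chi> G (perm_act \<sigma> s)
      = (\<Sum>\<tau>\<in>G. const (\<chi> \<sigma>) * (const (\<chi> (\<tau> \<circ> \<sigma>)) * perm_act (\<tau> \<circ> \<sigma>) s))"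
    by (auto simp: char_trace_def perm_act_comp mult.assoc intro!: sum.cong)
  also have "\<dots> = const (\<chi> \<sigma>) * char_trace \<chi> G s"
    unfolding char_trace_def sum_distrib_left[symmetric]
    by (subst sum.reindex_bij_betw[OF bij_comp_right[OF \<sigma>]]) simp
  finally show ?thesis .
qed

end

locale perm_group_pair = G: perm_group n G + K: perm_group n K for n G K +
  assumes sub: "K \<subseteq> G"
begin

abbreviation coset :: "(nat \<Rightarrow> nat) \<Rightarrow> (nat \<Rightarrow> nat) set" where
  "coset t \<equiv> (\<circ>) t ` K"

lemma coset_eqI: assumes "s \<in> coset t" "t \<in> G" shows "coset s = coset t"
proof -
  from assms obtain k where k: "k \<in> K" "s = t \<circ> k" by blast
  have "coset s = (\<circ>) t ` ((\<circ>) k ` K)" by (auto simp: k image_image comp_assoc)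
  also have "(\<circ>) k ` K = K" using K.bij_comp_left[OF k(1)] by (simp add: bij_betw_def)
  finally show ?thesis .
qed

lemma mem_coset: "t \<in> coset t" using image_eqI[of t "(\<circ>) t" id K] by simp

lemma coset_subset: "t \<in> G \<Longrightarrow> coset t \<subseteq> G" using sub G.comp_mem by auto

lemma coset_fibre: "t \<in> G \<Longrightarrow> {s \<in> G. coset s = coset t} = coset t"
proof (intro equalityI subsetI)
  fix s assume "s \<in> {s \<in> G. coset s = coset t}"
  then show "s \<in> coset t" using mem_coset[of s] by auto
next
  fix s assume "t \<in> G" "s \<in> coset t"
  then show "s \<in> {s \<in> G. coset s = coset t}" using coset_eqI[of s t] coset_subset[of t] by auto
qed

lemma comp_coset: "(\<circ>) s ` coset t = coset (s \<circ> t)" by (auto simp: image_image comp_assoc)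

lemma some_coset: "t \<in> G \<Longrightarrow> (SOME s. s \<in> coset t) \<in> coset t" by (rule someI[of _ t]) (rule mem_coset)

lemma bij_cosets: "\<sigma> \<in> G \<Longrightarrow> bij_betw (image ((\<circ>) \<sigma>)) (coset ` G) (coset ` G)"
proof (rule bij_betw_byWitness[where f' = "image ((\<circ>) (inv' \<sigma>))"])
  assume \<sigma>: "\<sigma> \<in> G"
  show "\<forall>C\<in>coset ` G. (\<circ>) (inv' \<sigma>) ` (\<circ>) \<sigma> ` C = C" "\<forall>C\<in>coset ` G. (\<circ>) \<sigma> ` (\<circ>) (inv' \<sigma>) ` C = C"
    by (auto simp: image_image comp_assoc[symmetric] G.inv_comp_mem[OF \<sigma>])
  show "image ((\<circ>) \<sigma>) ` coset ` G \<subseteq> coset ` G" "image ((\<circ>) (inv' \<sigma>)) ` coset ` G \<subseteq> coset ` G"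
    using \<sigma> G.comp_mem G.inv_mem by (auto simp: comp_coset)
qed

context
  fixes \<chi> :: "(nat \<Rightarrow> nat) \<Rightarrow> 'k::field"
  assumes \<chi>: "pm_char \<chi>"
begin

lemma coset_term:
  assumes v: "semi_inv \<chi> K v" and t: "t \<in> G"
  shows "const (\<chi> (SOME s. s \<in> coset t)) * perm_act (SOME s. s \<in> coset t) v = const (\<chi> t) * perm_act t v"
proof -
  obtain k where k: "k \<in> K" "(SOME s. s \<in> coset t) = t \<circ> k" using some_coset[OF t] by auto
  have "\<chi> (t \<circ> k) = \<chi> t * \<chi> k" using \<chi> k t sub G.permutation_mem by (auto simp: pm_char_def)
  moreover have "perm_act (t \<circ> k) v = const (\<chi> k) * perm_act t v"
    using v k by (simp add: semi_inv_def perm_act_const_mult flip: perm_act_comp)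
  moreover have sq: "\<chi> k * \<chi> k = 1" using \<chi> by (simp add: pm_char_def)
  moreover have "const (\<chi> k) * (const (\<chi> k) * X) = X" for X by (simp add: sq flip: const_mult mult.assoc)
  ultimately show ?thesis
    unfolding k by (simp add: const_mult mult.assoc)
qed

lemma coset_rep_sum_semi_inv:
  assumes v: "semi_inv \<chi> K v"
  shows "semi_inv \<chi> G (coset_rep_sum \<chi> G K v)"
  unfolding semi_inv_def
proof
  fix \<sigma> assume \<sigma>: "\<sigma> \<in> G"
  define F where "F C = const (\<chi> (SOME t. t \<in> C)) * perm_act (SOME t. t \<in> C) v" for C
  have F: "F (coset t) = const (\<chi> t) * perm_act t v" if "t \<in> G" for t
    unfolding F_def by (rule coset_term[OF v that])
  have "perm_act \<sigma> (F C) = const (\<chi> \<sigma>) * F ((\<circ>) \<sigma> ` C)" if C: "C \<in> coset ` G" for C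
  proof -
    from C obtain t where t: "t \<in> G" "C = coset t" by blast
    have "\<chi> (\<sigma> \<circ> t) = \<chi> \<sigma> * \<chi> t" "\<chi> \<sigma> * \<chi> \<sigma> = 1" using \<chi> \<sigma> t G.permutation_mem by (auto simp: pm_char_def)
    then have "const (\<chi> t) = const (\<chi> \<sigma>) * const (\<chi> (\<sigma> \<circ> t))" by (simp flip: const_mult mult.assoc)
    then show ?thesis
      using \<sigma> t by (simp add: comp_coset F G.comp_mem perm_act_const_mult perm_act_comp mult.assoc)
  qed
  then have "perm_act \<sigma> (\<Sum>C\<in>coset ` G. F C) = (\<Sum>C\<in>coset ` G. const (\<chi> \<sigma>) * F ((\<circ>) \<sigma> ` C))"
    by (simp add: perm_act_sum)
  also have "\<dots> = const (\<chi> \<sigma>) * (\<Sum>C\<in>coset ` G. F C)"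
    by (simp only: sum_distrib_left[symmetric] sum.reindex_bij_betw[OF bij_cosets[OF \<sigma>]])
  finally show "perm_act \<sigma> (coset_rep_sum \<chi> G K v) = const (\<chi> \<sigma>) * coset_rep_sum \<chi> G K v"
    by (simp add: coset_rep_sum_def F_def)
qed

lemma coset_rep_sum_trace: "coset_rep_sum \<chi> G K (char_trace \<chi> K s) = char_trace \<chi> G s"
proof -
  have "char_trace \<chi> G s = (\<Sum>C\<in>coset ` G. \<Sum>t\<in>{t \<in> G. coset t = C}. const (\<chi> t) * perm_act t s)"
    unfolding char_trace_def by (rule sum.image_gen) simp
  also have "\<dots> = coset_rep_sum \<chi> G K (char_trace \<chi> K s)"
    unfolding coset_rep_sum_def
  proof (rule sum.cong)
    fix C assume "C \<in> coset ` G"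
    then obtain t where t: "t \<in> G" "C = coset t" by blast
    have inj: "inj_on ((\<circ>) t) K"
      using G.bij_comp_left[OF t(1)] sub by (auto simp: bij_betw_def intro: inj_on_subset)
    have "(\<Sum>t\<in>{t \<in> G. coset t = C}. const (\<chi> t) * perm_act t s)
        = (\<Sum>k\<in>K. const (\<chi> (t \<circ> k)) * perm_act (t \<circ> k) s)"
      unfolding t(2) coset_fibre[OF t(1)] sum.reindex[OF inj] by (simp add: o_def)
    also have "\<dots> = (\<Sum>k\<in>K. const (\<chi> t) * (const (\<chi> k) * perm_act t (perm_act k s)))"
    proof (rule sum.cong)
      fix k assume "k \<in> K"
      then have "\<chi> (t \<circ> k) = \<chi> t * \<chi> k" using \<chi> t sub G.permutation_mem by (auto simp: pm_char_def)
      then show "const (\<chi> (t \<circ> k)) * perm_act (t \<circ> k) s = const (\<chi> t) * (const (\<chi> k) * perm_act t (perm_act k s))"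
        by (simp add: const_mult perm_act_comp mult.assoc)
    qed simp
    also have "\<dots> = const (\<chi> t) * perm_act t (char_trace \<chi> K s)"
      by (simp add: char_trace_def perm_act_sum perm_act_const_mult sum_distrib_left)
    also have "\<dots> = const (\<chi> (SOME t. t \<in> C)) * perm_act (SOME t. t \<in> C) (char_trace \<chi> K s)"
      unfolding t(2) by (rule coset_term[OF K.char_trace_semi_inv[OF \<chi>] t(1), symmetric])
    finally show "(\<Sum>t\<in>{t \<in> G. coset t = C}. const (\<chi> t) * perm_act t s)
      = const (\<chi> (SOME t. t \<in> C)) * perm_act (SOME t. t \<in> C) (char_trace \<chi> K s)" .
  qed simp
  finally show ?thesis by simp
qed

end

lemma some_coset_mem: "C \<in> coset ` G \<Longrightarrow> (SOME t. t \<in> C) \<in> G" using some_coset coset_subset by fastforce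

lemma coset_rep_sum_mult:
  assumes a: "\<And>\<sigma>. \<sigma> \<in> G \<Longrightarrow> perm_act \<sigma> a = a"
  shows "coset_rep_sum \<chi> G K (a * v) = a * coset_rep_sum \<chi> G K v"
  unfolding coset_rep_sum_def sum_distrib_left
  by (intro sum.cong) (simp_all add: perm_act_mult a[OF some_coset_mem] mult.left_commute)

lemma coset_rep_sum_in_poly_ring: "v \<in> poly_ring n \<Longrightarrow> coset_rep_sum \<chi> G K v \<in> poly_ring n"
  unfolding coset_rep_sum_def by (intro poly_ring_sum poly_ring_mult
      poly_ring_const G.perm_act_mem some_coset_mem)

end

section \<open>Differences of variables as primes\<close>

definition collapse :: "nat \<Rightarrow> nat \<Rightarrow> nat \<Rightarrow> nat" where
  "collapse i j k = (if k = i then j else k)"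

lemma collapse_simps [simp]: "collapse i j i = j" "collapse i j j = j" "k \<noteq> i \<Longrightarrow> collapse i j k = k"
  by (auto simp: collapse_def)

lemma diff_var_dvd_collapse: "(var i - var j) dvd (f - perm_act (collapse i j) f)"
proof -
  let ?\<pi> = "perm_act (collapse i j) :: 'a mpol \<Rightarrow> 'a mpol" and ?p = "var i - var j :: 'a mpol"
  have mult: "?p dvd f * g - ?\<pi> (f * g)" if "?p dvd f - ?\<pi> f" "?p dvd g - ?\<pi> g" for f g
  proof -
    have "f * g - ?\<pi> (f * g) = f * (g - ?\<pi> g) + ?\<pi> g * (f - ?\<pi> f)" by (simp add: perm_act_mult algebra_simps)
    then show ?thesis using that by (metis dvd_add dvd_mult)
  qed
  have var: "?p dvd var k - ?\<pi> (var k)" for k by (cases "k = i") auto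
  have pow: "?p dvd var k ^ t - ?\<pi> (var k ^ t)" for k t
    by (induction t) (auto simp del: perm_act_var intro!: mult[OF var])
  have prod: "?p dvd (\<Prod>k\<in>A. var k ^ t k) - ?\<pi> (\<Prod>k\<in>A. var k ^ t k)" for A t
    by (induction A rule: infinite_finite_induct) (auto intro: mult pow)
  have "?p dvd (\<Sum>m\<in>A. const (c m) * mon m) - ?\<pi> (\<Sum>m\<in>A. const (c m) * mon m)" for A c
  proof (induction A rule: infinite_finite_induct)
    case (insert m A)
    have "?p dvd mon m - ?\<pi> (mon m)"
      unfolding mon_eq_prod_var[of m] by (rule prod)
    then have "?p dvd const (c m) * mon m - ?\<pi> (const (c m) * mon m)" by (intro mult) auto
    from dvd_add[OF this insert.IH] show ?case
      using insert.hyps by (simp add: perm_act_add add_diff_add[symmetric] del: perm_act_mon)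
  qed auto
  from this[of "lookup f" "keys f"] show ?thesis by (simp flip: poly_eq_sum_mon)
qed

lemma var_inject: "var i = (var j :: 'k::field mpol) \<longleftrightarrow> i = j"
proof
  assume "var i = (var j :: 'k mpol)"
  then have "single i (1::nat) = single j 1" using mon_inj[where ?'k = 'k] by (simp add: var_eq_mon inj_eq)
  then have "lookup (single i (1::nat)) i = lookup (single j 1) i" by simp
  then show "i = j" by (simp add: lookup_single when_def split: if_splits)
qed simp

text \<open>Setting \<open>x\<^sub>i\<close> to \<open>x\<^sub>j\<close> is an endomorphism with kernel \<open>(x\<^sub>i - x\<^sub>j)\<close>; as its image is a domain, \<open>x\<^sub>i - x\<^sub>j\<close>
  is prime.\<close>

lemma diff_var_dvd_iff: "(var i - var j) dvd f \<longleftrightarrow> perm_act (collapse i j) f = 0"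
proof
  assume "(var i - var j) dvd f"
  then obtain g where "f = (var i - var j) * g" by (rule dvdE)
  then show "perm_act (collapse i j) f = 0" by (simp add: perm_act_mult perm_act_diff)
qed (use diff_var_dvd_collapse[of i j f] in simp)

lemma prime_diff_var: "i \<noteq> j \<Longrightarrow> prime_elem (var i - var j :: 'k::field mpol)"
  unfolding prime_elem_def by (auto simp: diff_var_dvd_iff perm_act_mult var_inject)

lemma diff_var_not_dvd:
  assumes "i \<noteq> j" "k \<noteq> l" "{k, l} \<noteq> {i, j}"
  shows "\<not> (var i - var j) dvd (var k - var l :: 'k::field mpol)"
  using assms by (auto simp: diff_var_dvd_iff perm_act_diff var_inject collapse_def split: if_splits)

lemma prime_elem_dvd_prodD:
  "finite A \<Longrightarrow> prime_elem q \<Longrightarrow> q dvd (\<Prod>a\<in>A. p a) \<Longrightarrow> \<exists>a\<in>A. q dvd p a"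
  by (induction A rule: finite_induct) (auto simp: prime_elem_dvd_mult_iff prime_elem_not_unit)

lemma prod_dvd_of_primes:
  fixes f :: "'a::comm_semiring_1_cancel"
  assumes "finite A" "\<And>a. a \<in> A \<Longrightarrow> prime_elem (p a) \<and> p a dvd f"
    and "\<And>a b. a \<in> A \<Longrightarrow> b \<in> A \<Longrightarrow> a \<noteq> b \<Longrightarrow> \<not> p a dvd p b"
  shows "(\<Prod>a\<in>A. p a) dvd f" using assms
proof (induction A rule: finite_induct)
  case (insert a A)
  then obtain g where g: "f = (\<Prod>a\<in>A. p a) * g" by (auto elim: dvdE)
  have "\<not> p a dvd (\<Prod>b\<in>A. p b)" using insert by (auto dest!: prime_elem_dvd_prodD)
  then have "p a dvd g" using insert.prems(1)[of a] by (auto simp: g prime_elem_dvd_mult_iff)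
  with insert.hyps show ?case
    unfolding g by (simp add: mult.commute mult_dvd_mono)
qed simp

lemma dvd_prod_primes_unit:
  fixes h :: "'a::idom"
  assumes "finite A" "\<And>a. a \<in> A \<Longrightarrow> prime_elem (p a) \<and> \<not> p a dvd h" "h dvd (\<Prod>a\<in>A. p a)"
  shows "h dvd 1" using assms
proof (induction A rule: finite_induct)
  case (insert a A)
  then obtain w where w: "p a * (\<Prod>b\<in>A. p b) = h * w" by (auto simp: dvd_def)
  then have "p a dvd h * w" by (metis dvd_triv_left)
  then obtain w' where w': "w = p a * w'"
    using insert.prems(1)[of a] by (auto simp: prime_elem_dvd_mult_iff elim: dvdE)
  have "p a \<noteq> 0" using insert.prems(1)[of a] by (simp add: prime_elem_not_zeroI)
  moreover from w w' have "p a * (\<Prod>b\<in>A. p b) = p a * (h * w')" by (simp add: mult.left_commute)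
  ultimately have "(\<Prod>b\<in>A. p b) = h * w'" by simp
  then show ?case using insert by auto
qed simp

lemma poly_ring_quotient:
  fixes f p q :: "'k::field mpol"
  assumes "f = p * q" "p \<noteq> 0" "f \<in> poly_ring n" "p \<in> poly_ring n"
  shows "q \<in> poly_ring n"
proof -
  let ?\<phi> = "\<lambda>m. if keys m \<subseteq> {1..n} then mon m else (0 :: 'k mpol)"
  let ?r = "lin_ext ?\<phi>"
  have keys_sum_nat: "keys (a + b) = keys a \<union> keys b" for a b :: "nat \<Rightarrow>\<^sub>0 nat"
    by (auto simp: in_keys_iff lookup_add)
  have mult: "?r (a * b) = ?r a * ?r b" for a b by (rule lin_ext_mult) (auto simp: keys_sum_nat mon_add)
  have keep: "?r a = a" if "a \<in> poly_ring n" for a using that unfolding lin_ext_def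
    by (subst (3) poly_eq_sum_mon[of a]) (auto simp: poly_ring_def intro!: sum.cong)
  have "p * ?r q = p * q" using assms mult[of p q] by (simp add: keep)
  then have "?r q = q" using assms(2) by simp
  moreover have "?r q \<in> poly_ring n"
    unfolding lin_ext_def using poly_ring_subalgebra
    by (intro subalg_sum subalg_mult) (auto simp: subalg_const subalg_0)
  ultimately show ?thesis by simp
qed

lemma homogeneous_quotient:
  assumes "homogeneous d (p * q)" "homogeneous e p" "p \<noteq> 0"
  shows "homogeneous (d - e) q"
proof -
  have "p * q = p * hcomp (d - e) q"
    using hcomp_homogeneous[OF assms(1), of d] hcomp_homogeneous_mult[OF assms(2), of "d - e" q] by simp
  with assms(3) have "q = hcomp (d - e) q" by simp
  then show ?thesis by (metis homogeneous_hcomp)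
qed

lemma homogeneous_0_const: "homogeneous 0 p \<Longrightarrow> p = const (lookup p 0)"
  by (rule poly_mapping_eqI) (auto simp: lookup_const homogeneous_def in_keys_iff mon_deg_eq_0_iff)

lemma homogeneous_unit: "homogeneous d p \<Longrightarrow> p dvd 1 \<Longrightarrow> d = 0"
proof -
  assume p: "homogeneous d p" "p dvd 1"
  then obtain q where q: "1 = p * q" by (metis dvdE)
  then have nz: "p \<noteq> 0" "q \<noteq> 0" by auto
  then have "homogeneous (0 - d) q" using p q by (intro homogeneous_quotient[of _ p]) simp_all
  with p nz show "d = 0" by (auto dest!: homogeneous_nonneg)
qed

text \<open>In characteristic 2, opposite terms may be equal; so the fixed points need a hypothesis of their own.\<close>

lemma sum_involution_zero:
  fixes a :: "'b \<Rightarrow> 'a::ab_group_add"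
  assumes "finite A" "\<And>x. x \<in> A \<Longrightarrow> \<iota> x \<in> A \<and> \<iota> (\<iota> x) = x" "\<And>x. x \<in> A \<Longrightarrow> a (\<iota> x) = - a x"
    and "\<And>x. x \<in> A \<Longrightarrow> \<iota> x = x \<Longrightarrow> a x = 0"
  shows "sum a A = 0" using assms
proof (induction A rule: finite_psubset_induct)
  case (psubset A)
  show ?case
  proof (cases "A = {}")
    case False
    then obtain x where x: "x \<in> A" by blast
    let ?B = "A - {x, \<iota> x}"
    have \<iota>: "\<iota> y \<in> A" "\<iota> (\<iota> y) = y" if "y \<in> A" for y using psubset.prems(1) that by auto
    have "sum a ?B = 0"
    proof (rule psubset.IH)
      show "?B \<subset> A" using x by auto
      fix y assume y: "y \<in> ?B"
      then have "\<iota> y \<noteq> x" "\<iota> y \<noteq> \<iota> x" using \<iota>(2)[of y] \<iota>(2)[of x] x by auto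
      with y \<iota> show "\<iota> y \<in> ?B \<and> \<iota> (\<iota> y) = y" by auto
      show "a (\<iota> y) = - a y" using y psubset.prems(2) by simp
      show "\<iota> y = y \<Longrightarrow> a y = 0" using y psubset.prems(3) by simp
    qed
    moreover have "sum a A = sum a ?B + sum a {x, \<iota> x}"
      using x \<iota>(1)[OF x] psubset.hyps by (intro sum.subset_diff) auto
    moreover have "sum a {x, \<iota> x} = 0" using psubset.prems(2,3)[OF x] by (cases "\<iota> x = x") auto
    ultimately show ?thesis by simp
  qed simp
qed

section \<open>Sign semi-invariants and the Vandermonde product\<close>

definition pairs :: "nat \<Rightarrow> (nat \<times> nat) set" where
  "pairs n = {(i, j). 1 \<le> i \<and> i < j \<and> j \<le> n}"

lemma finite_pairs [simp]: "finite (pairs n)"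
  by (rule finite_subset[of _ "{1..n} \<times> {1..n}"]) (auto simp: pairs_def)

lemma card_pairs: "(\<Sum>i=1..n. i - 1) = card (pairs n)"
proof -
  have "card (pairs n) = card (SIGMA j:{1..n}. {1..<j})"
    by (rule bij_betw_same_card[of prod.swap]) (auto simp: bij_betw_def pairs_def inj_on_def image_iff)
  then show ?thesis by simp
qed

abbreviation diff_pair :: "nat \<times> nat \<Rightarrow> 'k::field mpol" where
  "diff_pair \<equiv> \<lambda>(i, j). var i - var j"

lemma prod_pairs_dvd:
  assumes "A \<subseteq> pairs n" "\<And>i j. (i, j) \<in> A \<Longrightarrow> (var i - var j) dvd (f :: 'k::field mpol)"
  shows "(\<Prod>a\<in>A. diff_pair a) dvd f"
proof (rule prod_dvd_of_primes)
  show "finite A" using assms(1) finite_pairs by (rule finite_subset)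
  fix a assume "a \<in> A"
  then show "prime_elem (diff_pair a) \<and> diff_pair a dvd f"
    using assms by (auto simp: pairs_def intro!: prime_diff_var)
  fix b assume "b \<in> A" "a \<noteq> b"
  moreover obtain i j k l where "a = (i, j)" "b = (k, l)" by fastforce
  moreover have "a \<in> pairs n" "b \<in> pairs n" using assms(1) \<open>a \<in> A\<close> \<open>b \<in> A\<close> by auto
  ultimately show "\<not> diff_pair a dvd (diff_pair b :: 'k mpol)"
    using diff_var_not_dvd[of i j k l, where ?'k = 'k] by (auto simp: pairs_def doubleton_eq_iff)
qed

lemma homogeneous_diff_var: "homogeneous 1 (var i - var j)" by (intro homogeneous_diff homogeneous_var)

lemma prod_pairs_props:
  assumes "A \<subseteq> pairs n"
  shows "(\<Prod>a\<in>A. diff_pair a) \<noteq> (0 :: 'k::field mpol)"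
    "homogeneous (int (card A)) (\<Prod>a\<in>A. diff_pair a :: 'k mpol)"
    "(\<Prod>a\<in>A. diff_pair a) \<in> (poly_ring n :: 'k mpol set)"
proof -
  have fin: "finite A" using assms finite_pairs by (rule finite_subset)
  show "(\<Prod>a\<in>A. diff_pair a) \<noteq> (0 :: 'k mpol)" using assms fin by (auto simp: pairs_def var_inject)
  have "homogeneous (\<Sum>a\<in>A. 1) (\<Prod>a\<in>A. diff_pair a :: 'k mpol)"
    by (rule homogeneous_prod) (auto intro: homogeneous_diff_var)
  then show "homogeneous (int (card A)) (\<Prod>a\<in>A. diff_pair a :: 'k mpol)" by simp
  show "(\<Prod>a\<in>A. diff_pair a) \<in> (poly_ring n :: 'k mpol set)" using assms by (intro poly_ring_prod)
      (auto simp: pairs_def intro!: poly_ring_diff var_in_poly_ring)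
qed

definition vand :: "nat \<Rightarrow> 'k::field mpol" where
  "vand n = (\<Prod>a\<in>pairs n. diff_pair a)"

text \<open>In characteristic 2 the divisibility by \<open>x\<^sub>i - x\<^sub>j\<close> for the transpositions \<open>(i j)\<close> of the group does not follow
  from the semi-invariance; this is how the module below describes the canonical module of the ring of invariants in
  every characteristic.\<close>

definition can_ideal :: "nat \<Rightarrow> (nat \<Rightarrow> nat) set \<Rightarrow> 'k::field mpol set" where
  "can_ideal n G = {f \<in> poly_ring n. semi_inv sgn_char G f \<and>
     (\<forall>i j. i \<noteq> j \<longrightarrow> swap i j \<in> G \<longrightarrow> (var i - var j) dvd f)}"

lemma can_ideal_add: "f \<in> can_ideal n G \<Longrightarrow> g \<in> can_ideal n G \<Longrightarrow> f + g \<in> can_ideal n G"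
  by (auto simp: can_ideal_def intro: semi_inv_add poly_ring_add)

lemma (in perm_group) can_ideal_mult:
  "f \<in> can_ideal n G \<Longrightarrow> r \<in> invariant_ring n G \<Longrightarrow> r * f \<in> can_ideal n G"
  by (auto simp: can_ideal_def invariant_ring_def intro: semi_inv_mult poly_ring_mult)

lemma can_ideal_trivial: "can_ideal n {id} = poly_ring n"
  by (auto simp: can_ideal_def semi_inv_def transpose_eq_id_iff)

lemma (in perm_group) transpose_mem_range:
  assumes "swap i j \<in> G" "i \<noteq> j"
  shows "i \<in> {1..n} \<and> j \<in> {1..n}"
proof -
  have "swap i j permutes {1..n}" by (rule permutes) fact
  then show ?thesis using assms(2) by (metis permutes_def transpose_apply_first transpose_apply_second)
qed

lemma perm_act_transpose_collapse:
  "perm_act (collapse i j) (perm_act (swap i j) f) = perm_act (collapse i j) f"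
proof -
  have "collapse i j \<circ> swap i j = collapse i j"
    by (rule ext) (auto simp: collapse_def Transposition.transpose_def)
  then show ?thesis by (simp add: perm_act_comp)
qed

context perm_group
begin

interpretation pp: perm_group_pair n "full_sym n" G
  by (unfold_locales) (auto simp: full_sym_def permutes_id permutes_compose permutes_inv permutes)

text \<open>Modulo \<open>x\<^sub>i - x\<^sub>j\<close> the cosets \<open>C\<close> and \<open>(i j)C\<close> contribute opposite terms; if they coincide, a conjugate of \<open>(i j)\<close>
  lies in \<open>G\<close> and the term itself is divisible.\<close>

lemma vand_dvd_coset_rep_sum:
  assumes f: "f \<in> can_ideal n G"
  shows "vand n dvd coset_rep_sum sgn_char (full_sym n) G f"
  unfolding vand_def
proof (rule prod_pairs_dvd[OF order_refl])
  fix i j assume ij: "(i, j) \<in> pairs n"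
  let ?\<tau> = "swap i j"
  have \<tau>: "?\<tau> \<in> full_sym n" using ij by (auto simp: full_sym_def pairs_def intro!: permutes_swap_id)
  have si: "semi_inv sgn_char G f" using f by (simp add: can_ideal_def)
  define F where "F C = const (sgn_char (SOME t. t \<in> C)) * perm_act (SOME t. t \<in> C) f" for C
  have F: "F (pp.coset t) = const (sgn_char t) * perm_act t f" if "t \<in> full_sym n" for t
    unfolding F_def by (rule pp.coset_term[OF pm_char_sgn si that])
  have "(\<Sum>C\<in>pp.coset ` full_sym n. perm_act (collapse i j) (F C)) = 0"
  proof (rule sum_involution_zero[where \<iota> = "image ((\<circ>) ?\<tau>)"])
    show "finite (pp.coset ` full_sym n)" by simp
  next
    fix C assume "C \<in> pp.coset ` full_sym n"
    then obtain t where t: "t \<in> full_sym n" "C = pp.coset t" by blast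
    have \<tau>t: "?\<tau> \<circ> t \<in> full_sym n" using \<tau> t pp.G.comp_mem by blast
    show "(\<circ>) ?\<tau> ` C \<in> pp.coset ` full_sym n \<and> (\<circ>) ?\<tau> ` (\<circ>) ?\<tau> ` C = C"
      using \<tau>t by (auto simp: t(2) pp.comp_coset simp flip: comp_assoc)
    have sg: "sgn_char (?\<tau> \<circ> t) = - (sgn_char t :: 'a)"
      using pm_char_sgn[where ?'k = 'a] pp.G.permutation_mem[OF \<tau>] pp.G.permutation_mem[OF t(1)] ij
      by (auto simp: pm_char_def sgn_char_transpose pairs_def)
    show "perm_act (collapse i j) (F ((\<circ>) ?\<tau> ` C)) = - perm_act (collapse i j) (F C)"
      unfolding t(2) pp.comp_coset F[OF \<tau>t] F[OF t(1)] sg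
      by (simp add: perm_act_const_mult const_uminus perm_act_uminus perm_act_transpose_collapse flip: perm_act_comp)
    assume "(\<circ>) ?\<tau> ` C = C"
    then have "?\<tau> \<circ> t \<in> pp.coset t"
      unfolding t(2) pp.comp_coset using pp.mem_coset[of "?\<tau> \<circ> t"] by simp
    then obtain g where g: "g \<in> G" "?\<tau> \<circ> t = t \<circ> g" by auto
    have t_bij: "bij t" using pp.G.bij_mem t(1) by blast
    have "g = inv' t \<circ> (?\<tau> \<circ> t)"
      unfolding g(2) using pp.G.inv_comp_mem(1)[OF t(1)] by (simp flip: comp_assoc)
    also have "\<dots> = swap (inv' t i) (inv' t j)"
      using t_bij by (auto simp: fun_eq_iff Transposition.transpose_def bij_inv_eq_iff inv_f_f[OF bij_is_inj])
    finally have "swap (inv' t i) (inv' t j) \<in> G" using g(1) by simp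
    moreover have "inv' t i \<noteq> inv' t j"
      using bij_imp_bij_inv[OF t_bij] ij by (auto simp: pairs_def bij_def inj_eq)
    ultimately have "(var (inv' t i) - var (inv' t j)) dvd f" using f by (simp add: can_ideal_def)
    then obtain g where "f = (var (inv' t i) - var (inv' t j)) * g" by (rule dvdE)
    then have "perm_act t f = (var i - var j) * perm_act t g"
      using t_bij by (simp add: perm_act_mult perm_act_diff bij_is_surj surj_f_inv_f)
    then show "perm_act (collapse i j) (F C) = 0"
      unfolding t(2) F[OF t(1)] by (simp add: perm_act_mult perm_act_diff)
  qed
  then show "(var i - var j) dvd coset_rep_sum sgn_char (full_sym n) G f"
    unfolding diff_var_dvd_iff coset_rep_sum_def perm_act_sum F_def .
qed

end

definition stair :: "nat \<Rightarrow> (nat \<Rightarrow>\<^sub>0 nat)" where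
  "stair n = (\<Sum>i=1..n. single i (i - 1))"

lemma lookup_stair: "lookup (stair n) i = (if i \<in> {1..n} then i - 1 else 0)"
  by (simp add: stair_def lookup_sum lookup_single when_def cong: if_cong)

lemma keys_stair: "keys (stair n) \<subseteq> {1..n}" by (auto simp: in_keys_iff lookup_stair split: if_splits)

lemma mon_deg_stair: "mon_deg (stair n) = card (pairs n)"
  by (simp add: mon_deg_superset[OF _ keys_stair] lookup_stair flip: card_pairs)

lemma push_stair: "\<sigma> permutes {1..n} \<Longrightarrow> push \<sigma> (stair n) = stair n \<longleftrightarrow> \<sigma> = id"
proof
  assume \<sigma>: "\<sigma> permutes {1..n}" "push \<sigma> (stair n) = stair n"
  show "\<sigma> = id"
  proof
    fix i
    show "\<sigma> i = id i"
    proof (cases "i \<in> {1..n}")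
      case True
      then have "\<sigma> i \<in> {1..n}" using \<sigma>(1) by (simp only: permutes_in_image)
      moreover have "lookup (stair n) (\<sigma> i) = lookup (stair n) i"
        using lookup_push[of \<sigma> "stair n" i] \<sigma> by (simp add: permutes_inj)
      ultimately show ?thesis using True by (auto simp: lookup_stair)
    qed (use \<sigma>(1) in \<open>simp add: permutes_not_in\<close>)
  qed
qed simp

text \<open>The sign trace of a monomial with distinct exponents is a sum of distinct signed monomials.\<close>

lemma (in perm_group) char_trace_stair:
  "lookup (char_trace \<chi> G (mon (stair n))) (stair n) = \<chi> id"
proof -
  have "lookup (char_trace \<chi> G (mon (stair n))) (stair n) = (\<Sum>\<sigma>\<in>G. if \<sigma> = id then \<chi> \<sigma> else 0)"
    unfolding char_trace_def lookup_sum by (intro sum.cong) (auto simp: lookup_mon push_stair[OF permutes])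
  then show ?thesis by simp
qed

lemma coset_rep_sum_trivial:
  assumes "perm_group n G" "pm_char \<chi>"
  shows "coset_rep_sum \<chi> G {id} s = char_trace \<chi> G s"
proof -
  interpret perm_group n G by fact
  interpret perm_group_pair n G "{id}"
    by (intro perm_group_pair.intro perm_group_trivial assms(1)) (auto simp: perm_group_pair_axioms_def)
  have "\<chi> id * \<chi> id = \<chi> id" "\<chi> id * \<chi> id = 1"
    using assms(2) permutation_id unfolding pm_char_def by (metis comp_id)+
  then have "char_trace \<chi> {id} s = s" by (simp add: char_trace_def)
  then show ?thesis using coset_rep_sum_trace[OF assms(2), of s] by simp
qed

lemma vand_props: "vand n \<noteq> (0 :: 'k::field mpol)" "homogeneous (int (card (pairs n))) (vand n :: 'k mpol)"
  "vand n \<in> (poly_ring n :: 'k mpol set)"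
  unfolding vand_def by (rule prod_pairs_props[OF order_refl])+

lemma vand_semi_inv: "semi_inv sgn_char (full_sym n) (vand n :: 'k::field mpol)"
proof -
  interpret T: perm_group n "{id}" by (rule perm_group_trivial)
  interpret S: perm_group n "full_sym n" by (rule perm_group_full)
  let ?N = "char_trace sgn_char (full_sym n) (mon (stair n)) :: 'k mpol"
  have "vand n dvd ?N" using T.vand_dvd_coset_rep_sum[of "mon (stair n) :: 'k mpol"] keys_stair[of n]
    by (simp add: can_ideal_trivial coset_rep_sum_trivial[OF perm_group_full pm_char_sgn])
  then obtain q where q: "?N = vand n * q" by (rule dvdE)
  have "homogeneous (int (card (pairs n))) ?N"
    using homogeneous_mon[of "stair n"] by (intro char_trace_homogeneous) (simp add: mon_deg_stair)
  then have "homogeneous 0 q"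
    using homogeneous_quotient[of _ "vand n" q] vand_props(1,2)[of n, where ?'k = 'k] unfolding q by fastforce
  then obtain c where c: "q = const c" using homogeneous_0_const by blast
  have "lookup ?N (stair n) \<noteq> 0" by (simp add: S.char_trace_stair)
  then have "c \<noteq> 0" unfolding q c by auto
  then have "vand n = const (inverse c) * ?N" by (simp add: q c mult.left_commute flip: const_mult mult.assoc)
  then show ?thesis using S.char_trace_semi_inv[OF pm_char_sgn, of "mon (stair n) :: 'k mpol"]
    by (simp add: semi_inv_def perm_act_const_mult mult.left_commute)
qed

subsection \<open>The relative antisymmetrization divided by the Vandermonde product\<close>

text \<open>For \<open>G = 1\<close> this is the Jacobi symmetrizer, which sends \<open>f\<close> to \<open>\<Sum> sign(\<sigma>) \<sigma>(f)\<close> divided by the Vandermonde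
  product and generates the maps to the symmetric polynomials that are linear over them.\<close>

definition rho :: "nat \<Rightarrow> (nat \<Rightarrow> nat) set \<Rightarrow> 'k::field mpol \<Rightarrow> 'k mpol" where
  "rho n G f = (SOME q. coset_rep_sum sgn_char (full_sym n) G f = vand n * q)"

context perm_group
begin

interpretation S: perm_group n "full_sym n" by (rule perm_group_full)

interpretation pp: perm_group_pair n "full_sym n" G by (unfold_locales) (auto simp: full_sym_def permutes)

lemma vand_mult_rho:
  "f \<in> can_ideal n G \<Longrightarrow> vand n * rho n G f = coset_rep_sum sgn_char (full_sym n) G f"
proof -
  assume "f \<in> can_ideal n G"
  then obtain q where "coset_rep_sum sgn_char (full_sym n) G f = vand n * q"
    using vand_dvd_coset_rep_sum by (auto elim: dvdE)
  then show ?thesis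
    unfolding rho_def by (metis (mono_tags, lifting) someI_ex)
qed

lemma rho_eqI:
  assumes "f \<in> can_ideal n G" "vand n * q = coset_rep_sum sgn_char (full_sym n) G f"
  shows "rho n G f = q"
proof -
  have "vand n * rho n G f = vand n * q" using vand_mult_rho assms by simp
  then show ?thesis by (simp add: vand_props(1))
qed

lemma rho_add:
  assumes "f \<in> can_ideal n G" "g \<in> can_ideal n G"
  shows "rho n G (f + g) = rho n G f + rho n G g"
  using assms by (intro rho_eqI can_ideal_add) (auto simp: distrib_left vand_mult_rho coset_rep_sum_add)

lemma full_invariant_ring_subset: "sym_polys n \<subseteq> invariant_ring n G"
  using permutes by (auto simp: invariant_ring_def full_sym_def)

lemma rho_mult:
  assumes f: "f \<in> can_ideal n G" and a: "a \<in> sym_polys n"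
  shows "rho n G (a * f) = a * rho n G f"
proof (rule rho_eqI)
  show "a * f \<in> can_ideal n G" using f a full_invariant_ring_subset by (intro can_ideal_mult) auto
  show "vand n * (a * rho n G f) = coset_rep_sum sgn_char (full_sym n) G (a * f)"
    using vand_mult_rho[OF f] S.invariantD(1)[OF a] by (simp add: pp.coset_rep_sum_mult mult.left_commute)
qed

lemma rho_homogeneous:
  assumes f: "f \<in> can_ideal n G" "homogeneous d f"
  shows "homogeneous (d - int (card (pairs n))) (rho n G f)"
  using homogeneous_quotient[of d "vand n" "rho n G f"] vand_props(1,2)
  by (metis assms coset_rep_sum_homogeneous vand_mult_rho)

lemma rho_invariant:
  assumes f: "f \<in> can_ideal n G"
  shows "rho n G f \<in> sym_polys n"
proof -
  have "rho n G f \<in> poly_ring n"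
    using pp.coset_rep_sum_in_poly_ring[of f sgn_char] f vand_props(3) vand_props(1)
    by (intro poly_ring_quotient[OF vand_mult_rho[OF f, symmetric]]) (auto simp: can_ideal_def)
  moreover have "perm_act \<sigma> (rho n G f) = rho n G f" if \<sigma>: "\<sigma> \<in> full_sym n" for \<sigma>
  proof -
    have sq: "const (sgn_char \<sigma>) * (const (sgn_char \<sigma>) * p) = p" for p :: "'a mpol"
      using pm_char_sgn[where ?'k = 'a] by (simp add: pm_char_def flip: const_mult mult.assoc)
    have "semi_inv sgn_char G f" using f by (simp add: can_ideal_def)
    then have "semi_inv sgn_char (full_sym n) (coset_rep_sum sgn_char (full_sym n) G f)"
      by (rule pp.coset_rep_sum_semi_inv[OF pm_char_sgn])
    then have "perm_act \<sigma> (vand n * rho n G f) = const (sgn_char \<sigma>) * (vand n * rho n G f)"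
      using \<sigma> by (simp add: vand_mult_rho f semi_inv_def)
    moreover have "perm_act \<sigma> (vand n) = const (sgn_char \<sigma>) * (vand n :: 'a mpol)"
      using vand_semi_inv \<sigma> by (auto simp: semi_inv_def)
    ultimately have "const (sgn_char \<sigma>) * (const (sgn_char \<sigma>) * (vand n * perm_act \<sigma> (rho n G f)))
        = const (sgn_char \<sigma>) * (const (sgn_char \<sigma>) * (vand n * rho n G f))"
      by (simp add: perm_act_mult mult.assoc)
    then show ?thesis by (simp add: sq vand_props(1))
  qed
  ultimately show ?thesis by (simp add: invariant_ring_def)
qed

text \<open>The trace of \<open>G\<close> followed by the relative antisymmetrization is the antisymmetrization over the whole
  symmetric group.\<close>

lemma rho_mult_trace:
  assumes f: "f \<in> can_ideal n G" and s: "s \<in> poly_ring n"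
  shows "rho n G (f * orbit_trace G s) = rho n {id} (f * s)"
proof -
  have fS: "f \<in> poly_ring n" and si: "semi_inv sgn_char G f" using f by (auto simp: can_ideal_def)
  have "f * perm_act \<sigma> s = const (sgn_char \<sigma>) * perm_act \<sigma> (f * s)" if "\<sigma> \<in> G" for \<sigma>
  proof -
    have "const (sgn_char \<sigma>) * (const (sgn_char \<sigma>) * p) = p" for p :: "'a mpol"
      using pm_char_sgn[where ?'k = 'a] by (simp add: pm_char_def flip: const_mult mult.assoc)
    then show ?thesis using si that by (simp add: semi_inv_def perm_act_mult mult.assoc)
  qed
  then have eq: "f * orbit_trace G s = char_trace sgn_char G (f * s)"
    by (simp add: char_trace_def sum_distrib_left)
  have inv: "orbit_trace G s \<in> invariant_ring n G"
    using char_trace_semi_inv[OF pm_char_trivial, of s] char_trace_in_poly_ring[OF s, of "\<lambda>_. 1"]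
    by (auto simp: invariant_ring_def semi_inv_def)
  interpret T: perm_group n "{id}" by (rule perm_group_trivial)
  have fs: "f * s \<in> can_ideal n {id}"
    unfolding can_ideal_trivial by (intro poly_ring_mult fS s)
  show ?thesis
  proof (rule rho_eqI)
    show "f * orbit_trace G s \<in> can_ideal n G" using can_ideal_mult[OF f inv] by (simp add: mult.commute)
    show "vand n * rho n {id} (f * s) = coset_rep_sum sgn_char (full_sym n) G (f * orbit_trace G s)"
      unfolding eq pp.coset_rep_sum_trace[OF pm_char_sgn] T.vand_mult_rho[OF fs]
      by (rule coset_rep_sum_trivial[OF perm_group_full pm_char_sgn])
  qed
qed

end

lemma rho_perm_act:
  assumes s: "s \<in> poly_ring n" and \<sigma>: "\<sigma> \<in> full_sym n"
  shows "rho n {id} (perm_act \<sigma> s) = const (sgn_char \<sigma>) * rho n {id} s"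
proof -
  interpret T: perm_group n "{id}" by (rule perm_group_trivial)
  interpret S: perm_group n "full_sym n" by (rule perm_group_full)
  have [simp]: "coset_rep_sum sgn_char (full_sym n) {id} = char_trace sgn_char (full_sym n)"
    by (rule ext) (rule coset_rep_sum_trivial[OF perm_group_full pm_char_sgn])
  show ?thesis using s S.perm_act_mem[OF \<sigma> s] T.vand_mult_rho[of s]
    by (intro T.rho_eqI) (auto simp: can_ideal_trivial S.char_trace_perm_act[OF pm_char_sgn \<sigma>] mult.left_commute)
qed

lemma rho_stair_neq_0: "rho n {id} (mon (stair n)) \<noteq> (0 :: 'k::field mpol)"
proof
  interpret T: perm_group n "{id}" by (rule perm_group_trivial)
  interpret S: perm_group n "full_sym n" by (rule perm_group_full)
  assume "rho n {id} (mon (stair n)) = (0 :: 'k mpol)"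
  then have "char_trace sgn_char (full_sym n) (mon (stair n)) = (0 :: 'k mpol)"
    using T.vand_mult_rho[of "mon (stair n) :: 'k mpol"] keys_stair[of n]
    by (simp add: can_ideal_trivial coset_rep_sum_trivial[OF perm_group_full pm_char_sgn])
  then show False using S.char_trace_stair[where \<chi> = "sgn_char :: _ \<Rightarrow> 'k"] by simp
qed

section \<open>Elementary symmetric polynomials\<close>

definition esym :: "nat \<Rightarrow> nat \<Rightarrow> 'k::field mpol" where
  "esym i k = (\<Sum>A | A \<subseteq> {1..i} \<and> card A = k. \<Prod>j\<in>A. var j)"

lemma esym_0 [simp]: "esym i 0 = 1"
proof -
  have "{A. A \<subseteq> {1..i} \<and> card A = 0} = {{}}" using finite_subset[of _ "{1..i}"] by auto
  then show ?thesis by (simp add: esym_def)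
qed

lemma esym_beyond: "k > i \<Longrightarrow> esym i k = 0"
proof -
  assume "k > i"
  have "\<not> (A \<subseteq> {1..i} \<and> card A = k)" for A using card_mono[OF finite_atLeastAtMost, of A 1 i] \<open>k > i\<close> by auto
  then have "{A. A \<subseteq> {1..i} \<and> card A = k} = {}" by (simp only: empty_Collect_eq) simp
  then show ?thesis unfolding esym_def by (simp only: sum.empty)
qed

lemma esym_Suc: "esym (Suc i) (Suc k) = esym i (Suc k) + var (Suc i) * esym i k"
proof -
  let ?S = "\<lambda>i k. {A. A \<subseteq> {1..i} \<and> card A = k}"
  have fin: "finite (?S i k)" for i k :: nat by (rule finite_subset[of _ "Pow {1..i}"]) auto
  have fin': "finite A" if "A \<in> ?S i k" for A :: "nat set" and i k
    using that finite_subset[OF _ finite_atLeastAtMost, of A 1 i] by simp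
  have "?S (Suc i) (Suc k) = ?S i (Suc k) \<union> insert (Suc i) ` ?S i k" (is "_ = ?R")
  proof (intro equalityI subsetI)
    fix A assume A: "A \<in> ?S (Suc i) (Suc k)"
    show "A \<in> ?R"
    proof (cases "Suc i \<in> A")
      case True
      have "A - {Suc i} \<in> ?S i k" "A = insert (Suc i) (A - {Suc i})"
        using A True fin'[OF A] by (auto simp: le_Suc_eq)
      then show ?thesis by blast
    next
      case False
      then have "A \<subseteq> {1..i}" using A by (force simp: le_Suc_eq)
      then show ?thesis using A by auto
    qed
  next
    fix A assume "A \<in> ?R"
    then show "A \<in> ?S (Suc i) (Suc k)"
    proof
      assume "A \<in> insert (Suc i) ` ?S i k"
      then obtain B where B: "B \<in> ?S i k" "A = insert (Suc i) B" by blast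
      then have "Suc i \<notin> B" by auto
      with B fin'[OF B(1)] show ?thesis by auto
    qed auto
  qed
  moreover have "?S i (Suc k) \<inter> insert (Suc i) ` ?S i k = {}" by auto
  ultimately have "esym (Suc i) (Suc k) = esym i (Suc k) + (\<Sum>A\<in>insert (Suc i) ` ?S i k. \<Prod>j\<in>A. var j)"
    unfolding esym_def using fin by (simp add: sum.union_disjoint)
  also have "(\<Sum>A\<in>insert (Suc i) ` ?S i k. \<Prod>j\<in>A. var j) = (\<Sum>A\<in>?S i k. \<Prod>j\<in>insert (Suc i) A. var j)"
  proof (subst sum.reindex)
    show "inj_on (insert (Suc i)) (?S i k)"
    proof (rule inj_onI)
      fix A B assume "A \<in> ?S i k" "B \<in> ?S i k" "insert (Suc i) A = insert (Suc i) B"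
      moreover from this have "Suc i \<notin> A" "Suc i \<notin> B" by auto
      ultimately show "A = B" by (simp add: insert_ident)
    qed
  qed simp
  also have "\<dots> = (\<Sum>A\<in>?S i k. var (Suc i) * (\<Prod>j\<in>A. var j))" using fin' by (intro sum.cong refl prod.insert) auto
  finally show ?thesis by (simp add: esym_def sum_distrib_left)
qed

lemma esym_homogeneous: "homogeneous (int k) (esym i k)"
  unfolding esym_def
proof (rule homogeneous_sum)
  fix A assume "A \<in> {A. A \<subseteq> {1..i} \<and> card A = k}"
  then show "homogeneous (int k) (\<Prod>j\<in>A. var j)" using homogeneous_prod[of A "\<lambda>_. 1" var] homogeneous_var by auto
qed

lemma esym_in_poly_ring: "esym n k \<in> poly_ring n"
  unfolding esym_def by (intro poly_ring_sum poly_ring_prod var_in_poly_ring) auto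

lemma perm_act_esym: "\<sigma> permutes {1..n} \<Longrightarrow> perm_act \<sigma> (esym n k) = esym n k"
proof -
  assume \<sigma>: "\<sigma> permutes {1..n}"
  let ?S = "{A. A \<subseteq> {1..n} \<and> card A = k}"
  have "bij_betw (image \<sigma>) ?S ?S"
  proof (rule bij_betw_byWitness[where f' = "image (inv' \<sigma>)"])
    have card: "card (f ` A) = card A" if "f permutes {1..n}" for f A
      using that by (intro card_image) (auto intro: inj_on_subset[OF permutes_inj])
    have sub: "f ` A \<subseteq> {1..n}" if "f permutes {1..n}" "A \<subseteq> {1..n}" for f A using that permutes_image by blast
    have "f ` A \<in> ?S" if "f permutes {1..n}" "A \<in> ?S" for f A
      using card[OF that(1)] sub[OF that(1)] that(2) by simp
    then show "image \<sigma> ` ?S \<subseteq> ?S" "image (inv' \<sigma>) ` ?S \<subseteq> ?S" using \<sigma> permutes_inv[OF \<sigma>] by blast+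
  qed (auto simp: image_image permutes_inverses[OF \<sigma>])
  then have "(\<Sum>A\<in>?S. \<Prod>j\<in>\<sigma> ` A. var j) = (\<Sum>A\<in>?S. \<Prod>j\<in>A. var j :: 'a mpol)" by (rule sum.reindex_bij_betw)
  moreover have "(\<Prod>j\<in>\<sigma> ` A. var j) = (\<Prod>j\<in>A. var (\<sigma> j) :: 'a mpol)" for A
    using permutes_inj[OF \<sigma>] by (subst prod.reindex) (auto intro: inj_on_subset)
  ultimately show ?thesis by (simp add: esym_def perm_act_sum perm_act_prod)
qed

lemma esym_invariant: "esym n k \<in> sym_polys n"
  by (simp add: invariant_ring_def full_sym_def esym_in_poly_ring perm_act_esym)

lemma prod_minus_var: "(\<Prod>j=1..i. t - var j) = (\<Sum>k\<le>i. (-1) ^ k * esym i k * t ^ (i - k))"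
proof (induction i)
  case (Suc i)
  let ?a = "\<lambda>k. (-1) ^ k * esym i k * t ^ (i - k)"
  have "(\<Prod>j\<in>{1..Suc i}. t - var j) = t * (\<Sum>k\<le>i. ?a k) - var (Suc i) * (\<Sum>k\<le>i. ?a k)"
    using Suc by (simp add: algebra_simps)
  moreover have "t * (\<Sum>k\<le>i. ?a k) = t ^ Suc i + (\<Sum>k\<le>i. (-1) ^ Suc k * esym i (Suc k) * t ^ (i - k))"
  proof -
    have "t * (\<Sum>k\<le>i. ?a k) = (\<Sum>k\<le>i. (-1) ^ k * esym i k * t ^ (Suc i - k))"
      by (simp add: sum_distrib_left Suc_diff_le mult_ac)
    also have "\<dots> = (\<Sum>k\<le>Suc i. (-1) ^ k * esym i k * t ^ (Suc i - k))" by (simp add: esym_beyond)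
    also have "\<dots> = t ^ Suc i + (\<Sum>k\<le>i. (-1) ^ Suc k * esym i (Suc k) * t ^ (i - k))"
      by (subst sum.atMost_Suc_shift) simp
    finally show ?thesis .
  qed
  moreover have "var (Suc i) * (\<Sum>k\<le>i. ?a k) = - (\<Sum>k\<le>i. (-1) ^ Suc k * (var (Suc i) * esym i k) * t ^ (i - k))"
    by (simp add: sum_distrib_left sum_negf mult_ac)
  ultimately have "(\<Prod>j\<in>{1..Suc i}. t - var j)
      = t ^ Suc i + (\<Sum>k\<le>i. (-1) ^ Suc k * esym (Suc i) (Suc k) * t ^ (i - k))"
    by (simp only: esym_Suc distrib_left distrib_right sum.distrib) simp
  also have "\<dots> = (\<Sum>k\<le>Suc i. (-1) ^ k * esym (Suc i) k * t ^ (Suc i - k))" by (subst sum.atMost_Suc_shift) simp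
  finally show ?case .
qed simp

lemma var_power_reduce:
  assumes "1 \<le> m"
  shows "var m ^ m = - (\<Sum>k=1..m. (-1) ^ k * esym m k * var m ^ (m - k))"
proof -
  have "(\<Prod>j=1..m. var m - var j) = 0" using assms by (intro prod_zero) auto
  then have "(\<Sum>k\<le>m. (-1) ^ k * esym m k * var m ^ (m - k)) = 0" by (simp add: prod_minus_var)
  moreover have "{..m} = insert 0 {1..m}" by auto
  ultimately show ?thesis by (simp add: eq_neg_iff_add_eq_0)
qed

section \<open>The polynomial ring as a free module over the symmetric polynomials\<close>

text \<open>The variable \<open>x\<^sub>i\<close> satisfies a monic equation of degree \<open>i\<close> over the ring generated by the symmetric polynomials and
  \<open>x\<^bsub>i+1\<^esub>, \<dots>, x\<^sub>n\<close>. Writing each exponent as \<open>c\<^sub>i = i q + r\<close> with \<open>r < i\<close> and replacing \<open>(x\<^sub>i\<^sup>i)\<^sup>q\<close> by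
  \<open>e\<^sub>i\<^sup>q\<close> gives a basis of the polynomial ring with as many elements in each degree as there are monomials.\<close>

definition bas :: "nat \<Rightarrow> (nat \<Rightarrow>\<^sub>0 nat) \<Rightarrow> 'k::field mpol" where
  "bas n c = (\<Prod>i\<in>keys c. var i ^ (lookup c i mod i) * esym n i ^ (lookup c i div i))"

lemma bas_superset:
  "finite A \<Longrightarrow> keys c \<subseteq> A \<Longrightarrow> bas n c = (\<Prod>i\<in>A. var i ^ (lookup c i mod i) * esym n i ^ (lookup c i div i))"
  unfolding bas_def by (intro prod.mono_neutral_left) (auto simp: in_keys_iff)

lemma bas_add:
  assumes "\<And>i. i dvd lookup c' i"
  shows "bas n (c + c') = bas n c * bas n c'"
proof -
  have "(x + y) mod i = x mod i" "(x + y) div i = x div i + y div i" if "i dvd y" for x y i :: nat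
    using that by (auto simp: div_plus_div_distrib_dvd_right mod_add_eq dvd_def)
  from this[OF assms] show ?thesis using keys_add[of c c']
    by (simp add: bas_superset[of "keys c \<union> keys c'"] lookup_add power_add dvd_imp_mod_0[OF assms]
        mult.assoc flip: prod.distrib)
qed

lemma bas_0 [simp]: "bas n 0 = 1" by (simp add: bas_def)

lemma bas_esym: "k \<ge> 1 \<Longrightarrow> bas n (single k (k * t)) = esym n k ^ t" by (cases "t = 0") (auto simp: bas_def)

lemma bas_homogeneous: "homogeneous (int (mon_deg c)) (bas n c)"
proof -
  have "homogeneous (\<Sum>i\<in>keys c. int (lookup c i mod i) + int (lookup c i div i * i)) (bas n c)"
    unfolding bas_def
  proof (rule homogeneous_prod)
    fix i
    show "homogeneous (int (lookup c i mod i) + int (lookup c i div i * i))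
        (var i ^ (lookup c i mod i) * esym n i ^ (lookup c i div i))"
      using homogeneous_power[OF homogeneous_var, of "lookup c i mod i" i]
        homogeneous_power[OF esym_homogeneous, of "lookup c i div i" i n] by (intro homogeneous_mult) simp_all
  qed
  moreover have "(\<Sum>i\<in>keys c. int (lookup c i mod i) + int (lookup c i div i * i)) = int (mon_deg c)"
    unfolding mon_deg_def of_nat_sum by (intro sum.cong) (simp_all flip: of_nat_add of_nat_mult)
  ultimately show ?thesis by simp
qed

lemma bas_in_poly_ring: "keys c \<subseteq> {1..n} \<Longrightarrow> bas n c \<in> poly_ring n"
  unfolding bas_def by (intro poly_ring_prod poly_ring_mult
      poly_ring_power var_in_poly_ring esym_in_poly_ring) auto

definition tower_exps :: "nat \<Rightarrow> nat \<Rightarrow> (nat \<Rightarrow>\<^sub>0 nat) set" where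
  "tower_exps n i = {c. keys c \<subseteq> {1..n} \<and> (\<forall>j<i. j dvd lookup c j)}"

text \<open>The \<open>k\<close>-span of these elements turns out to be the subring generated by the elementary symmetric
  polynomials and the variables \<open>x\<^sub>i, \<dots>, x\<^sub>n\<close>.\<close>

definition tower :: "nat \<Rightarrow> nat \<Rightarrow> 'k::field mpol set" where
  "tower n i = mp.span (bas n ` tower_exps n i)"

lemma span_mult_closed:
  assumes "\<And>b. b \<in> B \<Longrightarrow> a * b \<in> V" "mp.subspace V" "v \<in> mp.span B"
  shows "a * v \<in> V"
proof -
  have "mp.subspace {v. a * v \<in> V}"
    using assms(2) by (auto simp: mp.subspace_def distrib_left mult.left_commute[of a])
  then have "mp.span B \<subseteq> {v. a * v \<in> V}" using assms(1) by (intro mp.span_minimal) auto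
  with assms(3) show ?thesis by auto
qed

lemma tower_mono: "tower n (Suc i) \<subseteq> tower n i"
  unfolding tower_def by (intro mp.span_mono image_mono) (auto simp: tower_exps_def)

lemma tower_subspace: "mp.subspace (tower n i)"
  unfolding tower_def by (rule mp.subspace_span)

lemma tower_bas: "c \<in> tower_exps n i \<Longrightarrow> bas n c \<in> tower n i"
  unfolding tower_def by (intro mp.span_base) auto

lemma tower_1: "1 \<in> tower n i" using tower_bas[of 0 n i] by (simp add: tower_exps_def)

text \<open>One step of the tower: \<open>tower n m\<close> consists of the polynomials of degree less than \<open>m\<close> in \<open>x\<^sub>m\<close> with
  coefficients in \<open>tower n (m + 1)\<close>.\<close>

lemma tower_var_mult:
  assumes "a < m" "m \<in> {1..n}" "b \<in> tower n (Suc m)"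
  shows "var m ^ a * b \<in> tower n m"
proof (rule span_mult_closed[OF _ tower_subspace])
  show "b \<in> mp.span (bas n ` tower_exps n (Suc m))" using assms by (simp add: tower_def)
  fix b' :: "'a mpol" assume "b' \<in> bas n ` tower_exps n (Suc m)"
  then obtain c where c: "c \<in> tower_exps n (Suc m)" "b' = bas n c" by blast
  have "var m ^ a * b' = bas n (single m a + c)"
  proof -
    have mm: "m dvd lookup c m" using c by (auto simp: tower_exps_def)
    let ?A = "insert m (keys c)"
    have k: "keys (single m a + c) \<subseteq> ?A" using keys_add[of "single m a" c] by (auto split: if_splits)
    have "(bas n (single m a + c) :: 'a mpol) = (\<Prod>i\<in>?A. var i ^ (lookup (single m a + c) i mod i) * esym n i ^ (lookup (single m a + c) i div i))"
      using k by (intro bas_superset) auto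
    also have "\<dots> = (\<Prod>i\<in>?A. (if i = m then var m ^ a else 1) * (var i ^ (lookup c i mod i) * esym n i ^ (lookup c i div i)))"
      using mm assms(1) by (intro prod.cong) (auto simp: lookup_add lookup_single dvd_def)
    also have "\<dots> = var m ^ a * bas n c" by (subst prod.distrib, subst bas_superset[of ?A c]) auto
    finally show ?thesis by (simp add: c)
  qed
  moreover have "single m a + c \<in> tower_exps n m" using c assms keys_add[of "single m a" c]
    by (auto simp: tower_exps_def lookup_add lookup_single split: if_splits)
  ultimately show "var m ^ a * b' \<in> tower n m" by (simp add: tower_bas)
qed

lemma tower_decompose:
  assumes "m \<in> {1..n}" "p \<in> tower n m"
  shows "\<exists>q. (\<forall>a. q a \<in> tower n (Suc m)) \<and> p = (\<Sum>a<m. var m ^ a * q a)"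
proof -
  let ?V = "{p :: 'a mpol. \<exists>q. (\<forall>a. q a \<in> tower n (Suc m)) \<and> p = (\<Sum>a<m. var m ^ a * q a)}"
  have "mp.subspace ?V"
  proof (rule mp.subspaceI)
    show "0 \<in> ?V" by (auto intro!: exI[of _ "\<lambda>_. 0"] mp.subspace_0[OF tower_subspace])
  next
    fix p q :: "'a mpol"
    assume "p \<in> ?V" "q \<in> ?V"
    then obtain p' q' where p': "\<forall>a. p' a \<in> tower n (Suc m)" "p = (\<Sum>a<m. var m ^ a * p' a)"
      and q': "\<forall>a. q' a \<in> tower n (Suc m)" "q = (\<Sum>a<m. var m ^ a * q' a)" by auto
    have "p + q = (\<Sum>a<m. var m ^ a * (p' a + q' a))" by (simp add: p' q' distrib_left sum.distrib)
    moreover have "\<forall>a. p' a + q' a \<in> tower n (Suc m)"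
      using p' q' by (auto intro: mp.subspace_add[OF tower_subspace])
    ultimately show "p + q \<in> ?V" by (intro CollectI exI[of _ "\<lambda>a. p' a + q' a"]) simp
  next
    fix p :: "'a mpol" and c
    assume "p \<in> ?V"
    then obtain p' where p': "\<forall>a. p' a \<in> tower n (Suc m)" "p = (\<Sum>a<m. var m ^ a * p' a)" by auto
    have "const c * p = (\<Sum>a<m. var m ^ a * (const c * p' a))"
      by (simp add: p' sum_distrib_left mult.left_commute)
    moreover have "\<forall>a. const c * p' a \<in> tower n (Suc m)"
      using p' by (auto intro: mp.subspace_scale[OF tower_subspace])
    ultimately show "const c * p \<in> ?V" by (intro CollectI exI[of _ "\<lambda>a. const c * p' a"]) simp
  qed
  moreover have "bas n ` tower_exps n m \<subseteq> ?V"
  proof (intro image_subsetI)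
    fix c assume c: "c \<in> tower_exps n m"
    define a0 where "a0 = lookup c m mod m"
    define c' where "c' = c - single m a0"
    have m: "m \<ge> 1" using assms by simp
    have look: "lookup c' i = (if i = m then lookup c m - a0 else lookup c i)" for i
      by (simp add: c'_def lookup_minus lookup_single when_def)
    have "keys c' \<subseteq> keys c" by (auto simp: in_keys_iff look split: if_splits)
    moreover have "m dvd lookup c m - a0" by (simp add: a0_def minus_mod_eq_mult_div)
    ultimately have c': "c' \<in> tower_exps n (Suc m)" using c by (auto simp: tower_exps_def look less_Suc_eq)
    have "bas n c' = (\<Prod>i\<in>keys c. var i ^ (lookup c' i mod i) * esym n i ^ (lookup c' i div i))"
      using \<open>keys c' \<subseteq> keys c\<close> by (intro bas_superset) auto
    have eq: "bas n c = var m ^ a0 * bas n c'"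
    proof -
      let ?A = "insert m (keys c)"
      have "lookup c i mod i = (if i = m then a0 else lookup c' i mod i)" "lookup c i div i = lookup c' i div i"
        "lookup c' m mod m = 0" for i
        using \<open>m dvd lookup c m - a0\<close> m by (auto simp: look a0_def minus_mod_eq_mult_div)
      then have "bas n c = (\<Prod>i\<in>?A. (if i = m then var m ^ a0 else 1) * (var i ^ (lookup c' i mod i) * esym n i ^ (lookup c' i div i)))"
        by (subst bas_superset[of ?A]) (auto intro!: prod.cong)
      also have "\<dots> = var m ^ a0 * bas n c'"
        using \<open>keys c' \<subseteq> keys c\<close> by (subst prod.distrib, subst bas_superset[of ?A c']) auto
      finally show ?thesis .
    qed
    have "a0 < m" using m by (simp add: a0_def)
    then have "bas n c = (\<Sum>a<m. var m ^ a * (if a = a0 then bas n c' else 0))"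
      by (simp add: eq if_distrib[of "(*) _"] cong: if_cong)
    moreover have "\<forall>a. (if a = a0 then bas n c' else 0) \<in> tower n (Suc m)"
      using tower_bas[OF c'] mp.subspace_0[OF tower_subspace] by auto
    ultimately show "bas n c \<in> ?V" by (intro CollectI exI[of _ "\<lambda>a. if a = a0 then bas n c' else 0"]) simp
  qed
  ultimately have "tower n m \<subseteq> ?V" unfolding tower_def by (intro mp.span_minimal)
  with assms(2) show ?thesis by auto
qed

text \<open>Going down from \<open>i = n\<close>: the monic equation of \<open>x\<^sub>i\<close> makes the next step of the tower closed under products, and
  \<open>e\<^sub>k(x\<^sub>1, \<dots>, x\<^bsub>i-1\<^esub>)\<close> is obtained recursively from \<open>e\<^sub>k(x\<^sub>1, \<dots>, x\<^sub>i)\<close>.\<close>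

lemma tower_ring:
  assumes "i \<le> n"
  shows "(\<forall>p\<in>tower n (Suc i). \<forall>q\<in>tower n (Suc i). p * q \<in> (tower n (Suc i) :: 'k::field mpol set)) \<and>
    (\<forall>j\<in>{i<..n}. var j \<in> (tower n (Suc i) :: 'k mpol set)) \<and> (\<forall>k. esym i k \<in> (tower n (Suc i) :: 'k mpol set))"
  using assms
proof (induction i rule: inc_induct)
  case base
  have *: "p * q \<in> tower n (Suc n)" if p: "p \<in> tower n (Suc n)" and q: "q \<in> tower n (Suc n)" for p q :: "'k mpol"
  proof (rule span_mult_closed[OF _ tower_subspace])
    show "q \<in> mp.span (bas n ` tower_exps n (Suc n))" using q by (simp add: tower_def)
    fix b :: "'k mpol" assume "b \<in> bas n ` tower_exps n (Suc n)"
    then obtain c where c: "c \<in> tower_exps n (Suc n)" "b = bas n c" by blast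
    have "b * p \<in> tower n (Suc n)"
    proof (rule span_mult_closed[OF _ tower_subspace])
      show "p \<in> mp.span (bas n ` tower_exps n (Suc n))" using p by (simp add: tower_def)
      fix b' :: "'k mpol" assume "b' \<in> bas n ` tower_exps n (Suc n)"
      then obtain c' where c': "c' \<in> tower_exps n (Suc n)" "b' = bas n c'" by blast
      have dv: "i dvd lookup c' i" for i
      proof (cases "i \<le> n")
        case False
        then have "i \<notin> keys c'" using c' by (auto simp: tower_exps_def)
        then show ?thesis by (simp add: in_keys_iff)
      qed (use c' in \<open>auto simp: tower_exps_def\<close>)
      have "b * b' = bas n (c + c')" by (simp add: c c' bas_add dv)
      moreover have "c + c' \<in> tower_exps n (Suc n)"
        using c c' keys_add[of c c'] by (auto simp: tower_exps_def lookup_add)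
      ultimately show "b * b' \<in> tower n (Suc n)" by (simp add: tower_bas)
    qed
    then show "p * b \<in> tower n (Suc n)" by (simp add: mult.commute)
  qed
  have "esym n k \<in> (tower n (Suc n) :: 'k mpol set)" for k
  proof -
    consider "k = 0" | "k > n" | "1 \<le> k" "k \<le> n" by linarith
    then show ?thesis
    proof cases
      case 3
      have "single k k \<in> tower_exps n (Suc n)" using 3 by (auto simp: tower_exps_def lookup_single when_def)
      then show ?thesis using tower_bas[of "single k k" n "Suc n", where ?'a = 'k] bas_esym[of k n 1, where ?'a = 'k] 3 by simp
    qed (auto simp: tower_1 esym_beyond mp.subspace_0[OF tower_subspace])
  qed
  with * show ?case by auto
next
  case (step i)
  define m where "m = Suc i"
  have m: "m \<in> {1..n}" using step.hyps by (simp add: m_def)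
  let ?A = "tower n (Suc m) :: 'k mpol set" and ?W = "tower n m :: 'k mpol set"
  have A_mult: "p * q \<in> ?A" if "p \<in> ?A" "q \<in> ?A" for p q using step.IH that by (simp add: m_def)
  have A_esym: "esym m k \<in> ?A" for k using step.IH by (simp add: m_def)
  have W_sum: "(\<Sum>a\<in>I. f a) \<in> ?W" if "\<And>a. a \<in> I \<Longrightarrow> f a \<in> ?W" for f and I :: "nat set"
    using that by (rule mp.subspace_sum[OF tower_subspace])
  have A_neg1: "(-1) ^ k * q \<in> ?A" if "q \<in> ?A" for k q
    using mp.subspace_scale[OF tower_subspace that, of "(-1) ^ k"] by (simp add: const_power const_uminus)
  have xW: "var m * p \<in> ?W" if p: "p \<in> ?W" for p
  proof -
    obtain q where q: "\<And>a. q a \<in> ?A" "p = (\<Sum>a<m. var m ^ a * q a)" using tower_decompose[OF m p] by auto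
    have "var m ^ Suc a * q a \<in> ?W" if "a < m" for a
    proof (cases "Suc a < m")
      case False
      then have "Suc a = m" using that by simp
      then have "var m ^ Suc a * q a = - (\<Sum>k=1..m. var m ^ (m - k) * ((-1) ^ k * (esym m k * q a)))"
        using m var_power_reduce[of m, where ?'a = 'k] by (simp add: sum_distrib_right sum_distrib_left mult_ac)
      also have "\<dots> \<in> ?W"
        using m by (intro mp.subspace_neg[OF tower_subspace] W_sum tower_var_mult A_neg1 A_mult A_esym q) auto
      finally show ?thesis .
    qed (use tower_var_mult[OF _ m q(1)] in blast)
    moreover have "var m * p = (\<Sum>a<m. var m ^ Suc a * q a)" by (simp add: q(2) sum_distrib_left mult.assoc)
    ultimately show ?thesis by (simp only:) (intro W_sum, simp)
  qed
  have xpW: "var m ^ a * p \<in> ?W" if "p \<in> ?W" for p a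
    using that by (induction a) (auto simp: mult.assoc intro: xW)
  have AW: "b * p \<in> ?W" if b: "b \<in> ?A" and p: "p \<in> ?W" for b p
  proof -
    obtain q where q: "\<And>a. q a \<in> ?A" "p = (\<Sum>a<m. var m ^ a * q a)" using tower_decompose[OF m p] by auto
    have "b * p = (\<Sum>a<m. var m ^ a * (b * q a))" by (simp add: q(2) sum_distrib_left mult.left_commute)
    also have "\<dots> \<in> ?W" using m by (intro W_sum tower_var_mult A_mult b q) auto
    finally show ?thesis .
  qed
  have W_mult: "p * p' \<in> ?W" if p: "p \<in> ?W" and p': "p' \<in> ?W" for p p'
  proof -
    obtain q where q: "\<And>a. q a \<in> ?A" "p = (\<Sum>a<m. var m ^ a * q a)" using tower_decompose[OF m p] by auto
    have "p * p' = (\<Sum>a<m. var m ^ a * (q a * p'))" by (simp add: q(2) sum_distrib_right mult.assoc)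
    also have "\<dots> \<in> ?W" by (intro W_sum xpW AW q p')
    finally show ?thesis .
  qed
  have W_var: "var j \<in> ?W" if "j \<in> {i<..n}" for j
  proof (cases "j = m")
    case True
    then show ?thesis using xW[OF tower_1] by simp
  next
    case False
    then have "var j \<in> ?A" using step.IH that by (auto simp: m_def)
    then show ?thesis using tower_mono by auto
  qed
  have "esym i k \<in> ?W" for k
  proof (induction k)
    case (Suc k)
    have [simp]: "esym i (Suc k) = esym m (Suc k) - var m * (esym i k :: 'k mpol)" by (simp add: m_def esym_Suc)
    have "esym m (Suc k) \<in> ?W" using A_esym tower_mono by auto
    with xW[OF Suc] show ?case by (simp add: mp.subspace_diff[OF tower_subspace])
  qed (simp add: tower_1)
  then show ?case using W_mult W_var by (auto simp: m_def)
qed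

lemma mon_in_tower: "keys c \<subseteq> {1..n} \<Longrightarrow> mon c \<in> (tower n 1 :: 'k::field mpol set)"
proof -
  assume c: "keys c \<subseteq> {1..n}"
  have mult: "p * q \<in> tower n 1" if "p \<in> tower n 1" "q \<in> tower n 1" for p q :: "'k mpol"
    using tower_ring[of 0 n, where ?'k = 'k] that by (simp add: One_nat_def)
  have var: "var j \<in> (tower n 1 :: 'k mpol set)" if "j \<in> {1..n}" for j
    using tower_ring[of 0 n, where ?'k = 'k] that by (simp add: One_nat_def)
  have pow: "p ^ t \<in> tower n 1" if "p \<in> tower n 1" for p :: "'k mpol" and t
    by (induction t) (auto intro: mult that tower_1)
  have "(\<Prod>i\<in>B. var i ^ lookup c i) \<in> (tower n 1 :: 'k mpol set)" if "B \<subseteq> {1..n}" for B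
    using finite_subset[OF that finite_atLeastAtMost] that
    by (induction B rule: finite_induct) (auto intro!: mult pow var simp: tower_1)
  with c show ?thesis by (simp add: mon_eq_prod_var)
qed

lemma mon_in_span_bas:
  assumes "c \<in> exps n d"
  shows "mon c \<in> (mp.span (bas n ` exps n d) :: 'k::field mpol set)"
proof -
  have "mon c \<in> (tower n 1 :: 'k mpol set)" using assms by (intro mon_in_tower) (auto simp: exps_def)
  moreover have "tower n 1 \<subseteq> {p :: 'k mpol. hcomp d p \<in> mp.span (bas n ` exps n d)}"
    unfolding tower_def
  proof (rule mp.span_minimal)
    show "mp.subspace {p :: 'k mpol. hcomp d p \<in> mp.span (bas n ` exps n d)}"
      by (rule mp.subspaceI) (auto simp: hcomp_add hcomp_const_mult mp.span_zero intro: mp.span_add mp.span_scale)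
    show "bas n ` tower_exps n 1 \<subseteq> {p :: 'k mpol. hcomp d p \<in> mp.span (bas n ` exps n d)}"
    proof (intro image_subsetI CollectI)
      fix c' assume "c' \<in> tower_exps n 1"
      then show "hcomp d (bas n c') \<in> (mp.span (bas n ` exps n d) :: 'k mpol set)"
        by (auto simp: hcomp_homogeneous[OF bas_homogeneous] mp.span_zero tower_exps_def exps_def intro!: mp.span_base)
    qed
  qed
  ultimately have "hcomp d (mon c) \<in> (mp.span (bas n ` exps n d) :: 'k mpol set)" by auto
  then show ?thesis using assms by (simp add: exps_def hcomp_homogeneous[OF homogeneous_mon])
qed

abbreviation bas_map :: "nat \<Rightarrow> 'k::field mpol \<Rightarrow> 'k mpol" where
  "bas_map n \<equiv> lin_ext (bas n)"

lemma bas_map_in_poly_ring: "q \<in> poly_ring n \<Longrightarrow> bas_map n q \<in> poly_ring n"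
  unfolding lin_ext_def by (intro poly_ring_sum poly_ring_mult
      poly_ring_const bas_in_poly_ring) (auto simp: poly_ring_def simp del: atLeastAtMost_iff)

lemma hcomp_bas_map: "hcomp d (bas_map n q) = bas_map n (hcomp d q)"
proof -
  have "bas_map n (hcomp d q) = (\<Sum>m\<in>keys q. const (lookup (hcomp d q) m) * bas n m)"
    by (intro lin_ext_superset keys_hcomp) simp
  then show ?thesis
    by (auto simp: lin_ext_def hcomp_sum hcomp_const_mult hcomp_homogeneous[OF bas_homogeneous] lookup_hcomp
        intro!: sum.cong)
qed

text \<open>Since the \<open>bas n c\<close> span and are as numerous as the monomials in each degree, they are independent.\<close>

lemma bas_map_inj:
  assumes q: "q \<in> poly_ring n" "bas_map n q = 0"
  shows "q = 0"
proof -
  have "hcomp d q = 0" for d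
  proof (rule lin_ext_surj_imp_inj[OF finite_exps[of n d]])
    show "mon m \<in> mp.span (bas n ` exps n d)" if "m \<in> exps n d" for m using that by (rule mon_in_span_bas)
    show "keys (hcomp d q) \<subseteq> exps n d"
      using subalg_hcomp[OF poly_ring_subalgebra q(1), of d] by (simp add: graded_part_def flip: graded_part_poly_ring)
    show "bas_map n (hcomp d q) = 0" by (simp add: q flip: hcomp_bas_map)
  qed
  then show ?thesis by (subst poly_eq_sum_hcomp[of q]) simp
qed

lemma bas_map_surj:
  fixes p :: "'k::field mpol"
  assumes "p \<in> poly_ring n"
  shows "\<exists>q\<in>poly_ring n. bas_map n q = p"
proof -
  let ?V = "bas_map n ` (poly_ring n :: 'k mpol set)"
  have sub: "mp.subspace ?V"
  proof (rule mp.subspaceI)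
    show "0 \<in> ?V" using poly_ring_0 by (intro image_eqI[of _ _ 0]) auto
  next
    fix x y assume "x \<in> ?V" "y \<in> ?V"
    then show "x + y \<in> ?V" by (auto simp: lin_ext_add[symmetric] intro!: imageI poly_ring_add)
  next
    fix c x assume "x \<in> ?V"
    then show "const c * x \<in> ?V" by (auto simp: lin_ext_const_mult[symmetric] intro!: imageI poly_ring_mult
          poly_ring_const)
  qed
  have "bas n m \<in> ?V" if "keys m \<subseteq> {1..n}" for m using that by (intro image_eqI[of _ _ "mon m"]) auto
  then have sp: "mp.span (bas n ` exps n d) \<subseteq> ?V" for d
    using sub by (intro mp.span_minimal) (auto simp: exps_def)
  have "mon m \<in> ?V" if "keys m \<subseteq> {1..n}" for m
    using that by (intro subsetD[OF sp mon_in_span_bas[of m n "int (mon_deg m)"]]) (simp add: exps_def)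
  then have "mp.span (mon ` {m. keys m \<subseteq> {1..n}}) \<subseteq> ?V" using sub by (intro mp.span_minimal) auto
  moreover have "p \<in> mp.span (mon ` {m. keys m \<subseteq> {1..n}})" using assms by (auto simp: span_mon poly_ring_def)
  ultimately show ?thesis by auto
qed

definition coords :: "nat \<Rightarrow> 'k::field mpol \<Rightarrow> 'k mpol" where
  "coords n p = (SOME q. q \<in> poly_ring n \<and> bas_map n q = p)"

lemma coords_props:
  assumes "p \<in> poly_ring n"
  shows "coords n p \<in> poly_ring n" "bas_map n (coords n p) = p"
proof -
  have "\<exists>q. q \<in> poly_ring n \<and> bas_map n q = p" using bas_map_surj[OF assms] by blast
  then have "coords n p \<in> poly_ring n \<and> bas_map n (coords n p) = p"
    unfolding coords_def by (rule someI_ex)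
  then show "coords n p \<in> poly_ring n" "bas_map n (coords n p) = p" by auto
qed

lemma coords_eqI:
  assumes "q \<in> poly_ring n" "bas_map n q = p"
  shows "coords n p = q"
proof -
  have p: "p \<in> poly_ring n" using assms bas_map_in_poly_ring by blast
  have "bas_map n (coords n p + const (-1) * q) = 0"
    by (simp only: lin_ext_add lin_ext_const_mult coords_props[OF p] assms(2)) (simp add: const_uminus)
  moreover have "coords n p + const (-1) * q \<in> poly_ring n" by (intro poly_ring_add poly_ring_mult
        poly_ring_const coords_props p assms)
  ultimately have "coords n p + const (-1) * q = 0" by (rule bas_map_inj[rotated])
  then show ?thesis by (simp add: const_uminus)
qed

lemma coords_add:
  "p \<in> poly_ring n \<Longrightarrow> q \<in> poly_ring n \<Longrightarrow> coords n (p + q) = coords n p + coords n q"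
  by (intro coords_eqI poly_ring_add) (simp_all add: lin_ext_add coords_props)

lemma coords_const_mult: "p \<in> poly_ring n \<Longrightarrow> coords n (const c * p) = const c * coords n p"
  by (intro coords_eqI poly_ring_mult poly_ring_const)
    (simp_all add: lin_ext_const_mult coords_props)

lemma coords_eq_0: "p \<in> poly_ring n \<Longrightarrow> coords n p = 0 \<Longrightarrow> p = 0" using coords_props(2)[of p n] by simp

lemma coords_homogeneous: "p \<in> poly_ring n \<Longrightarrow> homogeneous d p \<Longrightarrow> homogeneous d (coords n p)"
proof -
  assume p: "p \<in> poly_ring n" "homogeneous d p"
  have "coords n p = hcomp d (coords n p)" using p by (intro coords_eqI poly_ring_hcomp coords_props)
      (simp_all add: coords_props hcomp_homogeneous flip: hcomp_bas_map)
  then show ?thesis by (metis homogeneous_hcomp)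
qed

lemma bas_map_mult:
  assumes "\<And>i. i dvd lookup c i"
  shows "bas_map n (mon c * q) = bas n c * bas_map n q"
proof -
  have "mon c * q = (\<Sum>m\<in>keys q. const (lookup q m) * mon (m + c))"
    by (subst poly_eq_sum_mon[of q]) (simp add: sum_distrib_left mon_add mult_ac)
  then have "bas_map n (mon c * q) = (\<Sum>m\<in>keys q. const (lookup q m) * (bas n m * bas n c))"
    by (simp add: lin_ext_sum lin_ext_const_mult bas_add[OF assms])
  then show ?thesis by (simp add: lin_ext_def[of _ q] sum_distrib_left mult_ac)
qed

lemma coords_bas_mult:
  assumes "p \<in> poly_ring n" "keys c \<subseteq> {1..n}" "\<And>i. i dvd lookup c i"
  shows "coords n (bas n c * p) = mon c * coords n p" using assms by (intro coords_eqI poly_ring_mult)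
    (auto simp: bas_map_mult coords_props)

subsection \<open>Symmetric polynomials\<close>

lemma tower_perm_act:
  assumes "p \<in> tower n i" "\<sigma> permutes {1..n}" "\<And>j. j \<ge> i \<Longrightarrow> \<sigma> j = j"
  shows "perm_act \<sigma> p = p"
proof -
  have "mp.subspace {p :: 'a mpol. perm_act \<sigma> p = p}"
    by (rule mp.subspaceI) (auto simp: perm_act_add perm_act_const_mult)
  moreover have "perm_act \<sigma> (bas n c) = (bas n c :: 'a mpol)" if c: "c \<in> tower_exps n i" for c
  proof -
    have "perm_act \<sigma> (var j ^ (lookup c j mod j) * esym n j ^ (lookup c j div j))
        = (var j ^ (lookup c j mod j) * esym n j ^ (lookup c j div j) :: 'a mpol)" for j
    proof (cases "j < i")
      case True
      then have "lookup c j mod j = 0" using c by (auto simp: tower_exps_def)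
      then show ?thesis by (simp add: perm_act_power perm_act_esym[OF assms(2)])
    next
      case False
      then show ?thesis by (simp add: perm_act_mult perm_act_power perm_act_esym[OF assms(2)] assms(3))
    qed
    then show ?thesis by (simp add: bas_def perm_act_prod)
  qed
  ultimately have "tower n i \<subseteq> {p :: 'a mpol. perm_act \<sigma> p = p}"
    unfolding tower_def by (intro mp.span_minimal) auto
  with assms(1) show ?thesis by auto
qed

text \<open>A symmetric polynomial of \<open>tower n i\<close> has degree less than \<open>i\<close> in \<open>x\<^sub>i\<close>. Exchanging \<open>x\<^sub>i\<close> with the
  earlier variables shows that it takes the same value at \<open>i\<close> different places, hence it is constant in \<open>x\<^sub>i\<close>.\<close>

lemma symmetric_tower_step:
  fixes P :: "'k::field mpol"
  assumes P: "P \<in> sym_polys n" "P \<in> tower n i" and i: "i \<in> {1..n}"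
  shows "P \<in> tower n (Suc i)"
proof -
  obtain q where q: "\<And>a. q a \<in> tower n (Suc i)" "P = (\<Sum>a<i. var i ^ a * q a)"
    using tower_decompose[OF i P(2)] by auto
  define f :: "'k mpol poly" where "f = (\<Sum>a<i. monom (q a) a) - [:P:]"
  have coeff: "poly.coeff f a = (if a < i then q a else 0) - (if a = 0 then P else 0)" for a
  proof -
    have "poly.coeff (\<Sum>a<i. monom (q a) a) a = (if a < i then q a else 0)"
      by (simp add: coeff_sum if_distrib cong: if_cong)
    then show ?thesis by (simp add: f_def coeff_pCons split: nat.split)
  qed
  have "poly f (var j) = 0" if j: "j \<in> {1..i}" for j
  proof -
    let ?\<tau> = "swap i j"
    have \<tau>: "?\<tau> permutes {1..n}" using i j by (intro permutes_swap_id) auto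
    have "P = perm_act ?\<tau> P" using P(1) \<tau> by (simp add: invariant_ring_def full_sym_def)
    also have "\<dots> = (\<Sum>a<i. var j ^ a * q a)"
      using j by (subst q(2)) (simp add: perm_act_sum perm_act_mult perm_act_power
          tower_perm_act[OF q(1) \<tau>])
    finally show ?thesis by (simp add: f_def poly_sum poly_monom mult.commute)
  qed
  then have roots: "var ` {1..i} \<subseteq> {x. poly f x = 0}" by auto
  have "f = 0"
  proof (rule ccontr)
    assume f: "f \<noteq> 0"
    have "card (var ` {1..i} :: 'k mpol set) = i" by (subst card_image) (auto simp: inj_on_def var_inject)
    then have "i \<le> card {x. poly f x = 0}" using card_mono[OF poly_roots_finite[OF f] roots] by simp
    also have "\<dots> \<le> degree f" using card_poly_roots_bound[OF f] .
    also have "degree f < i" using i by (intro degree_lessI) (auto simp: f coeff)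
    finally show False by simp
  qed
  then have "q 0 = P" using coeff[of 0] i by simp
  then show ?thesis using q(1)[of 0] by simp
qed

lemma symmetric_in_tower:
  fixes P :: "'k::field mpol"
  assumes P: "P \<in> sym_polys n"
  shows "P \<in> tower n (Suc n)"
proof -
  have "P \<in> tower n (Suc i)" if "i \<le> n" for i using that
  proof (induction i)
    case 0
    have "mp.span (mon ` {m. keys m \<subseteq> {1..n}}) \<subseteq> (tower n 1 :: 'k mpol set)"
      using mon_in_tower by (intro mp.span_minimal tower_subspace) auto
    moreover have "P \<in> mp.span (mon ` {m. keys m \<subseteq> {1..n}})"
      using P by (auto simp: span_mon poly_ring_def invariant_ring_def)
    ultimately show ?case by (auto simp: One_nat_def)
  qed (use symmetric_tower_step[OF P] in auto)
  then show ?thesis by simp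
qed

lemma tower_exps_top_dvd: "c \<in> tower_exps n (Suc n) \<Longrightarrow> i dvd lookup c i"
proof (cases "i \<le> n")
  case False
  moreover assume "c \<in> tower_exps n (Suc n)"
  ultimately have "i \<notin> keys c" by (auto simp: tower_exps_def)
  then show ?thesis by (simp add: in_keys_iff)
qed (auto simp: tower_exps_def)

lemma keys_coords_symmetric:
  fixes P :: "'k::field mpol"
  assumes "P \<in> sym_polys n"
  shows "keys (coords n P) \<subseteq> tower_exps n (Suc n)"
proof -
  let ?V = "{p :: 'k mpol. p \<in> poly_ring n \<and> keys (coords n p) \<subseteq> tower_exps n (Suc n)}"
  have "mp.subspace ?V"
  proof (rule mp.subspaceI)
    show "0 \<in> ?V" using coords_eqI[of 0 n "0 :: 'k mpol"] by (simp add: poly_ring_0)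
  next
    fix x y assume "x \<in> ?V" "y \<in> ?V"
    then show "x + y \<in> ?V" using keys_add[of "coords n x" "coords n y"]
      by (auto simp: coords_add intro: poly_ring_add)
  next
    fix c x assume "x \<in> ?V"
    then show "const c * x \<in> ?V" using keys_const_mult[of c "coords n x"]
      by (auto simp: coords_const_mult intro: poly_ring_mult poly_ring_const)
  qed
  moreover have "bas n c \<in> ?V" if c: "c \<in> tower_exps n (Suc n)" for c
  proof -
    have "keys c \<subseteq> {1..n}" using c by (simp add: tower_exps_def)
    moreover from this have "coords n (bas n c) = (mon c :: 'k mpol)" by (intro coords_eqI) auto
    ultimately show ?thesis using c by (simp add: bas_in_poly_ring)
  qed
  ultimately have "tower n (Suc n) \<subseteq> ?V"
    unfolding tower_def by (intro mp.span_minimal) auto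
  then show ?thesis using symmetric_in_tower[OF assms] by auto
qed

section \<open>The residue pairing\<close>

definition esym_prod :: "nat \<Rightarrow> 'k::field mpol" where
  "esym_prod n = (\<Prod>i=1..n. esym n i)"

definition estep :: "nat \<Rightarrow> nat \<Rightarrow> (nat \<Rightarrow>\<^sub>0 nat)" where
  "estep n t = (\<Sum>i=1..n. single i (i * t))"

lemma lookup_estep: "lookup (estep n t) i = (if i \<in> {1..n} then i * t else 0)"
  by (simp add: estep_def lookup_sum lookup_single when_def cong: if_cong)

lemma keys_estep: "keys (estep n t) \<subseteq> {1..n}" by (auto simp: in_keys_iff lookup_estep split: if_splits)

lemma estep_dvd: "i dvd lookup (estep n t) i" by (simp add: lookup_estep)

lemma estep_add: "estep n (s + t) = estep n s + estep n t"
  by (rule poly_mapping_eqI) (simp add: lookup_estep lookup_add distrib_left)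

lemma bas_estep: "bas n (estep n t) = esym_prod n ^ t"
  by (simp add: bas_superset[OF _ keys_estep] lookup_estep esym_prod_def prod_power_distrib)

definition esym_deg :: "nat \<Rightarrow> int" where
  "esym_deg n = (\<Sum>i=1..n. int i)"

lemma mon_deg_estep: "int (mon_deg (estep n t)) = int t * esym_deg n"
  by (simp add: mon_deg_superset[OF _ keys_estep] lookup_estep esym_deg_def sum_distrib_left mult.commute)

lemma esym_deg_eq: "esym_deg n = int n + int (card (pairs n))"
proof -
  have "esym_deg n = (\<Sum>i=1..n. int (i - 1) + 1)"
    unfolding esym_deg_def by (intro sum.cong) auto
  also have "\<dots> = int n + int (\<Sum>i=1..n. i - 1)" by (simp only: sum.distrib of_nat_sum) simp
  finally show ?thesis by (simp add: card_pairs)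
qed

lemma lookup_mon_mult_zero: "lookup c i < lookup m i \<Longrightarrow> lookup (mon m * p) c = 0"
proof (rule ccontr)
  assume "lookup c i < lookup m i" "lookup (mon m * p) c \<noteq> 0"
  then have "c \<in> keys (mon m * p)" by (simp add: in_keys_iff)
  then obtain b where "c = m + b" using subsetD[OF keys_mult] by fastforce
  with \<open>lookup c i < lookup m i\<close> show False by (simp add: lookup_add)
qed

text \<open>Elements \<open>\<phi>\<close> of degree \<open>d\<close> of the dual of the top local cohomology of \<open>R\<close>, computed with the elementary symmetric
  polynomials: \<open>\<phi> t p\<close> is the value at the class of \<open>p / (e\<^sub>1 \<cdots> e\<^sub>n)\<^sup>t\<close>, and the value is zero unless this class has
  degree \<open>-d\<close>.\<close>

definition dual_system :: "nat \<Rightarrow> 'k::field mpol set \<Rightarrow> int \<Rightarrow> (nat \<Rightarrow> 'k mpol \<Rightarrow> 'k) \<Rightarrow> bool" where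
  "dual_system n R d \<phi> \<longleftrightarrow> (\<forall>t\<ge>1.
     (\<forall>p\<in>R. \<forall>q\<in>R. \<phi> t (p + q) = \<phi> t p + \<phi> t q) \<and>
     (\<forall>c. \<forall>p\<in>R. \<phi> t (const c * p) = c * \<phi> t p) \<and>
     (\<forall>i\<in>{1..n}. \<forall>p\<in>R. \<phi> t (esym n i ^ t * p) = 0) \<and>
     (\<forall>p\<in>R. \<phi> (Suc t) (esym_prod n * p) = \<phi> t p) \<and>
     (\<forall>p\<in>R. \<forall>e. homogeneous e p \<longrightarrow> e \<noteq> int t * esym_deg n - d \<longrightarrow> \<phi> t p = 0))"

lemma dual_systemD:
  assumes "dual_system n R d \<phi>" "t \<ge> 1"
  shows "p \<in> R \<Longrightarrow> q \<in> R \<Longrightarrow> \<phi> t (p + q) = \<phi> t p + \<phi> t q"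
    "p \<in> R \<Longrightarrow> \<phi> t (const c * p) = c * \<phi> t p"
    "i \<in> {1..n} \<Longrightarrow> p \<in> R \<Longrightarrow> \<phi> t (esym n i ^ t * p) = 0"
    "p \<in> R \<Longrightarrow> \<phi> (Suc t) (esym_prod n * p) = \<phi> t p"
    "p \<in> R \<Longrightarrow> homogeneous e p \<Longrightarrow> e \<noteq> int t * esym_deg n - d \<Longrightarrow> \<phi> t p = 0"
  using assms unfolding dual_system_def by blast+

lemma dual_system_diff:
  "dual_system n R d \<phi> \<Longrightarrow> dual_system n R d \<psi> \<Longrightarrow> dual_system n R d (\<lambda>t p. \<phi> t p - \<psi> t p)"
  unfolding dual_system_def by (auto simp: algebra_simps)

lemma dual_system_shift:
  assumes "dual_system n R d \<phi>" "graded_subalgebra R" "esym_prod n \<in> R" "t \<ge> 1" "p \<in> R"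
  shows "\<phi> (t + k) (esym_prod n ^ k * p) = \<phi> t p"
proof (induction k)
  case (Suc k)
  have "esym_prod n ^ k * p \<in> R" using assms by (intro subalg_mult subalg_power)
  then have "\<phi> (Suc (t + k)) (esym_prod n * (esym_prod n ^ k * p)) = \<phi> (t + k) (esym_prod n ^ k * p)"
    using assms(4) by (intro dual_systemD(4)[OF assms(1)]) simp_all
  with Suc show ?case by (simp add: mult.assoc)
qed simp

lemma dual_system_sum:
  assumes "dual_system n R d \<phi>" "graded_subalgebra R" "t \<ge> 1" "\<And>i. i \<in> I \<Longrightarrow> f i \<in> R"
  shows "\<phi> t (\<Sum>i\<in>I. const (c i) * f i) = (\<Sum>i\<in>I. c i * \<phi> t (f i))"
proof -
  have zero: "\<phi> t 0 = 0" using dual_systemD(2)[OF assms(1,3), of 0 0] subalg_0[OF assms(2)] by simp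
  show ?thesis using assms(4) by (induction I rule: infinite_finite_induct)
      (auto simp: zero dual_systemD(1,2)[OF assms(1,3)] subalg_mult[OF assms(2)] subalg_const[OF assms(2)]
        subalg_sum[OF assms(2)])
qed

lemma esym_prod_invariant: "esym_prod n \<in> sym_polys n"
  unfolding esym_prod_def
  by (intro subalg_prod[OF perm_group.invariant_ring_subalgebra[OF perm_group_full]] esym_invariant)

text \<open>On symmetric polynomials the residue is the coefficient of \<open>(e\<^sub>1 \<cdots> e\<^sub>n)\<^bsup>t-1\<^esup>\<close>, and \<open>rho\<close> reduces to them: this is
  the residue of \<open>f p / (e\<^sub>1 \<cdots> e\<^sub>n)\<^sup>t\<close>.\<close>

definition theta :: "nat \<Rightarrow> (nat \<Rightarrow> nat) set \<Rightarrow> 'k::field mpol \<Rightarrow> nat \<Rightarrow> 'k mpol \<Rightarrow> 'k" where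
  "theta n G f t p = lookup (coords n (rho n G (f * p))) (estep n (t - 1))"

context perm_group
begin

lemma rho_in_poly_ring: "f \<in> can_ideal n G \<Longrightarrow> rho n G f \<in> poly_ring n"
  using rho_invariant[of f] by (simp add: invariant_ring_def)

lemma full_invariant_const: "const c \<in> sym_polys n"
  by (intro subalg_const perm_group.invariant_ring_subalgebra perm_group_full)

lemma theta_dual_system:
  assumes f: "f \<in> can_ideal n G" "homogeneous (d - int n) f"
  shows "dual_system n (invariant_ring n G) d (theta n G f)"
proof -
  have fp: "f * p \<in> can_ideal n G" if "p \<in> invariant_ring n G" for p
    using can_ideal_mult[OF f(1) that] by (simp add: mult.commute)
  have mult: "rho n G (f * (a * p)) = a * rho n G (f * p)"
    if "p \<in> invariant_ring n G" "a \<in> sym_polys n" for a p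
    using rho_mult[OF fp[OF that(1)] that(2)] by (simp add: mult.left_commute)
  have power: "a ^ t \<in> sym_polys n" if "a \<in> sym_polys n" for t and a :: "'a mpol"
    using that by (intro subalg_power perm_group.invariant_ring_subalgebra perm_group_full)
  show ?thesis
    unfolding dual_system_def theta_def
  proof (intro allI impI conjI ballI)
    fix t :: nat and p q :: "'a mpol" assume t: "t \<ge> 1" and p: "p \<in> invariant_ring n G"
    show "lookup (coords n (rho n G (f * (p + q)))) (estep n (t - 1)) =
        lookup (coords n (rho n G (f * p))) (estep n (t - 1)) + lookup (coords n (rho n G (f * q))) (estep n (t - 1))"
      if "q \<in> invariant_ring n G"
      using fp[OF p] fp[OF that] by (simp add: distrib_left rho_add coords_add rho_in_poly_ring lookup_add)
    show "lookup (coords n (rho n G (f * (const c * p)))) (estep n (t - 1)) =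
        c * lookup (coords n (rho n G (f * p))) (estep n (t - 1))" for c
      using fp[OF p] by (simp add: mult p full_invariant_const coords_const_mult rho_in_poly_ring)
    show "lookup (coords n (rho n G (f * (esym n i ^ t * p)))) (estep n (t - 1)) = 0" if i: "i \<in> {1..n}" for i
    proof -
      have "coords n (bas n (single i (i * t)) * rho n G (f * p)) = mon (single i (i * t)) * coords n (rho n G (f * p))"
        using i by (intro coords_bas_mult rho_in_poly_ring fp p) (auto simp: lookup_single when_def)
      then have "coords n (rho n G (f * (esym n i ^ t * p))) = mon (single i (i * t)) * coords n (rho n G (f * p))"
        using i by (simp add: mult p power esym_invariant bas_esym)
      moreover have "lookup (estep n (t - 1)) i < lookup (single i (i * t)) i"
        using i t by (simp add: lookup_estep)
      ultimately show ?thesis by (simp only: lookup_mon_mult_zero)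
    qed
    show "lookup (coords n (rho n G (f * (esym_prod n * p)))) (estep n (Suc t - 1)) =
        lookup (coords n (rho n G (f * p))) (estep n (t - 1))"
    proof -
      have "coords n (bas n (estep n 1) * rho n G (f * p)) = mon (estep n 1) * coords n (rho n G (f * p))"
        by (intro coords_bas_mult rho_in_poly_ring fp p keys_estep estep_dvd)
      then have "coords n (rho n G (f * (esym_prod n * p))) = mon (estep n 1) * coords n (rho n G (f * p))"
        by (simp add: mult p esym_prod_invariant bas_estep)
      moreover have "estep n (Suc t - 1) = estep n 1 + estep n (t - 1)" using t by (simp flip: estep_add)
      ultimately show ?thesis by (simp only: lookup_mon_mult)
    qed
    show "lookup (coords n (rho n G (f * p))) (estep n (t - 1)) = 0"
      if e: "homogeneous e p" "e \<noteq> int t * esym_deg n - d" for e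
    proof (rule ccontr)
      assume nz: "lookup (coords n (rho n G (f * p))) (estep n (t - 1)) \<noteq> 0"
      have "homogeneous (d - int n + e - int (card (pairs n))) (coords n (rho n G (f * p)))"
        by (intro coords_homogeneous rho_in_poly_ring rho_homogeneous fp p homogeneous_mult f e)
      with nz have "int (mon_deg (estep n (t - 1))) = d - int n + e - int (card (pairs n))"
        by (simp add: homogeneous_def in_keys_iff)
      then show False using e(2) t by (simp add: mon_deg_estep esym_deg_eq algebra_simps of_nat_diff)
    qed
  qed
qed

end

definition orbit_prod :: "nat \<Rightarrow> 'k::field mpol \<Rightarrow> 'k mpol" where
  "orbit_prod n p = (\<Prod>\<sigma>\<in>full_sym n. perm_act \<sigma> p)"

lemma orbit_prod_invariant:
  assumes p: "p \<in> poly_ring n"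
  shows "orbit_prod n p \<in> sym_polys n"
proof -
  interpret S: perm_group n "full_sym n" by (rule perm_group_full)
  have "perm_act \<tau> (orbit_prod n p) = orbit_prod n p" if \<tau>: "\<tau> \<in> full_sym n" for \<tau>
  proof -
    have "perm_act \<tau> (orbit_prod n p) = (\<Prod>\<sigma>\<in>full_sym n. perm_act (\<tau> \<circ> \<sigma>) p)"
      by (simp add: orbit_prod_def perm_act_prod perm_act_comp)
    also have "\<dots> = orbit_prod n p"
      unfolding orbit_prod_def by (rule prod.reindex_bij_betw[OF S.bij_comp_left[OF \<tau>]])
    finally show ?thesis .
  qed
  moreover have "orbit_prod n p \<in> poly_ring n"
    unfolding orbit_prod_def by (intro poly_ring_prod S.perm_act_mem p)
  ultimately show ?thesis by (simp add: invariant_ring_def)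
qed

lemma orbit_prod_factor:
  assumes p: "p \<in> poly_ring n"
  obtains q where "q \<in> poly_ring n" "orbit_prod n p = p * q"
proof
  interpret S: perm_group n "full_sym n" by (rule perm_group_full)
  show "orbit_prod n p = p * (\<Prod>\<sigma>\<in>full_sym n - {id}. perm_act \<sigma> p)"
    unfolding orbit_prod_def by (subst prod.remove[of _ id]) auto
  show "(\<Prod>\<sigma>\<in>full_sym n - {id}. perm_act \<sigma> p) \<in> poly_ring n" by (intro poly_ring_prod S.perm_act_mem p) auto
qed

lemma orbit_prod_nonzero: "p \<noteq> 0 \<Longrightarrow> orbit_prod n p \<noteq> 0"
proof -
  interpret S: perm_group n "full_sym n" by (rule perm_group_full)
  show "p \<noteq> 0 \<Longrightarrow> orbit_prod n p \<noteq> 0" using S.inj_mem by (auto simp: orbit_prod_def perm_act_eq_0_iff)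
qed

lemma invariant_ring_trivial: "invariant_ring n {id} = poly_ring n" by (auto simp: invariant_ring_def)

subsection \<open>Nondegeneracy\<close>

text \<open>Take a term \<open>e\<^sup>b\<close> of \<open>P\<close> and multiply by the complementary power product in the \<open>e\<^sub>i\<close>.\<close>

lemma symmetric_residue_nonzero:
  fixes P :: "'k::field mpol"
  assumes P: "P \<in> sym_polys n" "P \<noteq> 0"
  shows "\<exists>t\<ge>1. \<exists>c. keys c \<subseteq> {1..n} \<and> (\<forall>i. i dvd lookup c i) \<and>
    lookup (coords n (bas n c * P)) (estep n (t - 1)) \<noteq> 0"
proof -
  have PS: "P \<in> poly_ring n" using P by (simp add: invariant_ring_def)
  then obtain b where b: "b \<in> keys (coords n P)" using coords_eq_0 P(2) by (metis all_not_in_conv keys_eq_empty)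
  then have bt: "b \<in> tower_exps n (Suc n)" using keys_coords_symmetric[OF P(1)] by auto
  have dv: "i dvd lookup b i" for i by (rule tower_exps_top_dvd[OF bt])
  have kb: "keys b \<subseteq> {1..n}" using bt by (simp add: tower_exps_def)
  define t where "t = Suc (mon_deg b)"
  define c where "c = estep n (t - 1) - b"
  have le: "lookup b i \<le> lookup (estep n (t - 1)) i" for i
  proof (cases "i \<in> keys b")
    case True
    then have "lookup b i \<le> mon_deg b" unfolding mon_deg_def by (intro member_le_sum) auto
    also have "\<dots> \<le> i * mon_deg b" using True kb by auto
    finally show ?thesis using True kb by (auto simp: lookup_estep t_def)
  qed (simp add: in_keys_iff)
  have cb: "estep n (t - 1) = c + b" by (rule poly_mapping_eqI) (simp add: c_def lookup_add lookup_minus le)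
  have "keys c \<subseteq> {1..n}" "i dvd lookup c i" for i
    using dv[of i] by (auto simp: c_def lookup_minus in_keys_iff lookup_estep split: if_splits intro: dvd_diff_nat)
  moreover from this have "lookup (coords n (bas n c * P)) (estep n (t - 1)) = lookup (coords n P) b"
    unfolding cb by (subst coords_bas_mult[OF PS]) (auto simp: lookup_mon_mult)
  ultimately show ?thesis using b by (intro exI[of _ t]) (auto simp: t_def in_keys_iff intro!: exI[of _ c])
qed

lemma rho_mult_trivial:
  "f \<in> poly_ring n \<Longrightarrow> a \<in> sym_polys n \<Longrightarrow> rho n {id} (a * f) = a * rho n {id} f"
  using perm_group.rho_mult[OF perm_group_trivial, of f n a] by (simp add: can_ideal_trivial)

text \<open>The product of the conjugates of \<open>f\<close> is a symmetric multiple of \<open>f\<close>, hence is paired nontrivially with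
  the staircase monomial times a symmetric polynomial.\<close>

lemma theta_nondegenerate:
  fixes f :: "'k::field mpol"
  assumes f: "f \<in> poly_ring n" and zero: "\<And>t p. t \<ge> 1 \<Longrightarrow> p \<in> poly_ring n \<Longrightarrow> theta n {id} f t p = 0"
  shows "f = 0"
proof (rule ccontr)
  assume nz: "f \<noteq> 0"
  obtain q where q: "q \<in> poly_ring n" "orbit_prod n f = f * q" using orbit_prod_factor[OF f] .
  let ?s = "mon (stair n) :: 'k mpol"
  have s: "?s \<in> poly_ring n" using keys_stair by simp
  have inv: "orbit_prod n f \<in> sym_polys n" by (rule orbit_prod_invariant[OF f])
  define P where "P = orbit_prod n f * rho n {id} ?s"
  have r: "rho n {id} ?s \<in> sym_polys n"
    using perm_group.rho_invariant[OF perm_group_trivial, of ?s n] s by (simp add: can_ideal_trivial)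
  have P: "P \<in> sym_polys n" "P \<noteq> 0"
    unfolding P_def using subalg_mult[OF perm_group.invariant_ring_subalgebra[OF perm_group_full] inv r]
      orbit_prod_nonzero[OF nz, of n] rho_stair_neq_0[of n, where ?'k = 'k] by auto
  obtain t c where tc: "t \<ge> 1" "keys c \<subseteq> {1..n}" "\<And>i. i dvd lookup c i"
    "lookup (coords n (bas n c * P)) (estep n (t - 1)) \<noteq> 0" using symmetric_residue_nonzero[OF P] by auto
  have b: "bas n c \<in> (sym_polys n :: 'k mpol set)"
  proof -
    have eq: "bas n c = (\<Prod>i\<in>keys c. esym n i ^ (lookup c i div i) :: 'k mpol)"
      unfolding bas_def using tc(3) by (intro prod.cong) (simp_all add: dvd_imp_mod_0)
    note S = perm_group.invariant_ring_subalgebra[OF perm_group_full]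
    show ?thesis
      unfolding eq by (intro subalg_prod[OF S] subalg_power[OF S] esym_invariant)
  qed
  have "bas n c * P = rho n {id} (bas n c * (orbit_prod n f * ?s))"
    using s b inv subalg_mult[OF poly_ring_subalgebra, of "orbit_prod n f" n ?s]
    by (simp add: P_def rho_mult_trivial invariant_ring_def[of n "full_sym n"])
  also have "\<dots> = rho n {id} (f * (bas n c * (q * ?s)))" by (simp add: q(2) mult_ac)
  finally have "theta n {id} f t (bas n c * (q * ?s)) \<noteq> 0" using tc by (simp add: theta_def)
  moreover have "bas n c * (q * ?s) \<in> poly_ring n"
    using b q s by (intro poly_ring_mult) (auto simp: invariant_ring_def)
  ultimately show False using zero[OF tc(1)] by simp
qed

lemma theta_add:
  "f \<in> poly_ring n \<Longrightarrow> g \<in> poly_ring n \<Longrightarrow> p \<in> poly_ring n \<Longrightarrow>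
    theta n {id} (f + g) t p = theta n {id} f t p + theta n {id} g t p"
  using perm_group.rho_add[OF perm_group_trivial, of "f * p" n "g * p"]
    perm_group.rho_in_poly_ring[OF perm_group_trivial, of "f * p" n]
    perm_group.rho_in_poly_ring[OF perm_group_trivial, of "g * p" n]
  by (simp add: theta_def can_ideal_trivial poly_ring_mult distrib_right coords_add lookup_add)

lemma theta_const_mult:
  "f \<in> poly_ring n \<Longrightarrow> p \<in> poly_ring n \<Longrightarrow> theta n {id} (const c * f) t p = c * theta n {id} f t p"
  using perm_group.rho_in_poly_ring[OF perm_group_trivial, of "f * p" n]
  by (simp add: theta_def mult.assoc rho_mult_trivial can_ideal_trivial poly_ring_mult
      perm_group.full_invariant_const[OF perm_group_trivial] coords_const_mult)

lemma theta_sum: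
  assumes "\<And>i. i \<in> I \<Longrightarrow> f i \<in> poly_ring n" "p \<in> poly_ring n"
  shows "theta n {id} (\<Sum>i\<in>I. const (c i) * f i) t p = (\<Sum>i\<in>I. c i * theta n {id} (f i) t p)"
proof -
  have "theta n {id} 0 t p = 0" using theta_const_mult[OF poly_ring_0 assms(2), of 0 t] by simp
  then show ?thesis using assms(1) by (induction I rule: infinite_finite_induct)
      (auto simp: theta_add theta_const_mult assms(2) poly_ring_mult
        poly_ring_const poly_ring_sum)
qed

lemma theta_dual_system_trivial:
  "f \<in> poly_ring n \<Longrightarrow> homogeneous (d - int n) f \<Longrightarrow> dual_system n (poly_ring n) d (theta n {id} f)"
  using perm_group.theta_dual_system[OF perm_group_trivial, of f n d]
  by (simp add: can_ideal_trivial invariant_ring_trivial)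

subsection \<open>Duality for the polynomial ring\<close>

definition compl_exp :: "nat \<Rightarrow> nat \<Rightarrow> (nat \<Rightarrow>\<^sub>0 nat) \<Rightarrow> (nat \<Rightarrow>\<^sub>0 nat)" where
  "compl_exp n t c = (\<Sum>i=1..n. single i (i * t - 1 - lookup c i))"

lemma lookup_compl_exp: "lookup (compl_exp n t c) i = (if i \<in> {1..n} then i * t - 1 - lookup c i else 0)"
  by (simp add: compl_exp_def lookup_sum lookup_single when_def cong: if_cong)

lemma keys_compl_exp: "keys (compl_exp n t c) \<subseteq> {1..n}"
  by (auto simp: in_keys_iff lookup_compl_exp split: if_splits)

lemma dual_system_bas_zero:
  assumes \<phi>: "dual_system n (poly_ring n) d \<phi>" "t \<ge> 1" and c: "keys c \<subseteq> {1..n}" "i \<in> {1..n}" "lookup c i \<ge> i * t"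
  shows "\<phi> t (bas n c) = 0"
proof -
  define c' where "c' = c - single i (i * t)"
  have look: "lookup c' j = (if j = i then lookup c i - i * t else lookup c j)" for j
    by (auto simp: c'_def lookup_minus lookup_single when_def)
  have "c = c' + single i (i * t)"
    by (rule poly_mapping_eqI) (use c in \<open>auto simp: look lookup_add lookup_single when_def\<close>)
  then have "bas n c = bas n c' * (bas n (single i (i * t)) :: 'a mpol)"
    by (simp only:) (intro bas_add, auto simp: lookup_single when_def)
  moreover have "bas n (single i (i * t)) = (esym n i ^ t :: 'a mpol)" using c by (intro bas_esym) auto
  ultimately have "bas n c = esym n i ^ t * (bas n c' :: 'a mpol)" by (simp add: mult.commute)
  moreover have "keys c' \<subseteq> {1..n}" using c by (auto simp: in_keys_iff look subset_iff split: if_splits)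
  ultimately show ?thesis using dual_systemD(3)[OF \<phi> c(2) bas_in_poly_ring] by simp
qed

text \<open>The classes of \<open>bas n c / (e\<^sub>1 \<cdots> e\<^sub>n)\<^sup>t\<close> with \<open>c\<^sub>i < i t\<close> span the top local cohomology of the polynomial ring;
  those of degree \<open>-d\<close> are counted by the monomials of degree \<open>d - n\<close>. For \<open>t\<^sub>0 > d - n\<close> the complementary
  exponents \<open>i t\<^sub>0 - 1 - c\<^sub>i\<close> are not truncated.\<close>

lemma dual_system_determined:
  fixes \<phi> :: "nat \<Rightarrow> 'k::field mpol \<Rightarrow> 'k"
  assumes \<phi>: "dual_system n (poly_ring n) d \<phi>"
    and t0: "t0 \<ge> 1" "int t0 > d - int n"
    and zero: "\<And>c. c \<in> exps n (d - int n) \<Longrightarrow> \<phi> t0 (bas n (compl_exp n t0 c)) = 0"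
    and t: "t \<ge> 1" and p: "p \<in> poly_ring n"
  shows "\<phi> t p = 0"
proof -
  have E: "esym_prod n \<in> (poly_ring n :: 'k mpol set)"
    using esym_prod_invariant[of n, where ?'a = 'k] by (simp add: invariant_ring_def)
  have shift: "\<phi> (s + k) (bas n (c + estep n k)) = \<phi> s (bas n c)"
    if "s \<ge> 1" "keys c \<subseteq> {1..n}" for s k c
    using dual_system_shift[OF \<phi> poly_ring_subalgebra E that(1) bas_in_poly_ring[OF that(2)], of k]
    by (simp add: bas_add[OF estep_dvd] bas_estep mult.commute)
  have bas_zero: "\<phi> t (bas n c') = 0" if c': "keys c' \<subseteq> {1..n}" for c'
  proof (cases "int (mon_deg c') = int t * esym_deg n - d")
    case False
    then show ?thesis by (intro dual_systemD(5)[OF \<phi> t bas_in_poly_ring[OF c'] bas_homogeneous])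
  next
    case True
    show ?thesis
    proof (cases "\<exists>i\<in>{1..n}. lookup c' i \<ge> i * t")
      case True
      then show ?thesis using dual_system_bas_zero[OF \<phi> t c'] by blast
    next
      case False
      then have less: "lookup c' i < i * t" if "i \<in> {1..n}" for i using that by force
      define c where "c = compl_exp n t c'"
      have look_c: "lookup c i + lookup c' i + 1 = i * t" if "i \<in> {1..n}" for i
        using less[OF that] that by (simp add: c_def lookup_compl_exp)
      have "int (mon_deg c) + int (mon_deg c') + int n = (\<Sum>i=1..n. int (lookup c i + lookup c' i + 1))"
        unfolding c_def mon_deg_superset[OF finite_atLeastAtMost keys_compl_exp]
          mon_deg_superset[OF finite_atLeastAtMost c'] by (simp add: sum.distrib)
      also have "\<dots> = (\<Sum>i=1..n. int t * int i)"
        using look_c by (intro sum.cong refl) (simp add: mult.commute flip: of_nat_mult)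
      finally have deg: "int (mon_deg c) = d - int n" using True by (simp add: esym_deg_def sum_distrib_left)
      then have cD: "c \<in> exps n (d - int n)"
        unfolding exps_def c_def using keys_compl_exp by blast
      have small: "lookup c i < t0" for i
      proof (cases "i \<in> keys c")
        case True
        then have "lookup c i \<le> mon_deg c" unfolding mon_deg_def by (intro member_le_sum) auto
        then show ?thesis using deg t0 by linarith
      qed (use t0 in \<open>simp add: in_keys_iff\<close>)
      have look0: "lookup (compl_exp n t0 c) i + lookup c i + 1 = i * t0" if "i \<in> {1..n}" for i
      proof -
        have "t0 \<le> i * t0" using that by simp
        with small[of i] have "lookup c i + 1 \<le> i * t0" by linarith
        then show ?thesis using that by (simp add: lookup_compl_exp)
      qed
      show ?thesis
      proof (cases "t \<le> t0")
        case True
        have "compl_exp n t0 c = c' + estep n (t0 - t)"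
        proof (rule poly_mapping_eqI)
          fix i
          show "lookup (compl_exp n t0 c) i = lookup (c' + estep n (t0 - t)) i"
          proof (cases "i \<in> {1..n}")
            case i: True
            have "i * (t0 - t) + i * t = i * t0" using True by (simp flip: distrib_left)
            then show ?thesis using look0[OF i] look_c[OF i] i by (simp add: lookup_add lookup_estep)
          next
            case i: False
            then have "i \<notin> keys c'" using c' by auto
            with i show ?thesis
              by (simp add: lookup_compl_exp lookup_add lookup_estep in_keys_iff del: atLeastAtMost_iff)
          qed
        qed
        then show ?thesis using shift[OF t c', of "t0 - t"] zero[OF cD] True by simp
      next
        case False
        have "c' = compl_exp n t0 c + estep n (t - t0)"
        proof (rule poly_mapping_eqI)
          fix i
          show "lookup c' i = lookup (compl_exp n t0 c + estep n (t - t0)) i"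
          proof (cases "i \<in> {1..n}")
            case i: True
            have "i * (t - t0) + i * t0 = i * t" using False by (simp flip: distrib_left)
            then show ?thesis using look0[OF i] look_c[OF i] i by (simp add: lookup_add lookup_estep)
          next
            case i: False
            then have "i \<notin> keys c'" using c' by auto
            with i show ?thesis
              by (simp add: lookup_compl_exp lookup_add lookup_estep in_keys_iff del: atLeastAtMost_iff)
          qed
        qed
        then show ?thesis using shift[OF t0(1) keys_compl_exp, of "t - t0" t0 c] zero[OF cD] False by simp
      qed
    qed
  qed
  have "p = (\<Sum>m\<in>keys (coords n p). const (lookup (coords n p) m) * bas n m)"
    using coords_props(2)[OF p] by (simp add: lin_ext_def)
  moreover have "keys m \<subseteq> {1..n}" if "m \<in> keys (coords n p)" for m
    using coords_props(1)[OF p] that by (auto simp: poly_ring_def simp del: atLeastAtMost_iff)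
  ultimately show ?thesis
    using dual_system_sum[OF \<phi> poly_ring_subalgebra t, of "keys (coords n p)" "bas n" "lookup (coords n p)"]
    by (simp add: bas_in_poly_ring bas_zero)
qed

text \<open>The systems of degree \<open>d\<close> form a vector space of dimension at most that of the degree \<open>d - n\<close> part of the
  polynomial ring, and \<open>f \<mapsto> theta n {id} f\<close> is injective; so it is surjective.\<close>

theorem polynomial_ring_duality:
  fixes \<phi> :: "nat \<Rightarrow> 'k::field mpol \<Rightarrow> 'k"
  assumes \<phi>: "dual_system n (poly_ring n) d \<phi>"
  obtains f where "f \<in> poly_ring n" "homogeneous (d - int n) f"
    "\<And>t p. t \<ge> 1 \<Longrightarrow> p \<in> poly_ring n \<Longrightarrow> \<phi> t p = theta n {id} f t p"
proof -
  define D where "D = exps n (d - int n)"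
  define t0 where "t0 = nat (d - int n) + 1"
  have t0: "t0 \<ge> 1" "int t0 > d - int n" by (auto simp: t0_def)
  define u :: "_ \<Rightarrow> 'k mpol" where "u c = bas n (compl_exp n t0 c)" for c
  have u: "u c \<in> poly_ring n" for c
    unfolding u_def by (intro bas_in_poly_ring keys_compl_exp)
  have fin: "finite D" by (simp add: D_def finite_exps)
  define \<psi> :: "_ \<Rightarrow> 'k mpol" where "\<psi> m = (\<Sum>c\<in>D. const (theta n {id} (mon m) t0 (u c)) * mon c)" for m
  have look: "lookup (\<Sum>c\<in>D. const (v c) * mon c) c = v c" if "c \<in> D" for v :: "_ \<Rightarrow> 'k" and c
    using that fin by (simp add: lookup_sum lookup_mon if_distrib cong: if_cong)
  have DS: "keys f \<subseteq> D \<Longrightarrow> f \<in> poly_ring n \<and> homogeneous (d - int n) f" for f :: "'k mpol"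
    using graded_part_poly_ring[of f n "d - int n"] by (simp add: D_def graded_part_def)
  have ext: "lin_ext \<psi> f = (\<Sum>c\<in>D. const (theta n {id} f t0 (u c)) * mon c)" if f: "keys f \<subseteq> D" for f
  proof -
    have "theta n {id} f t0 (u c) = (\<Sum>m\<in>keys f. lookup f m * theta n {id} (mon m) t0 (u c))" for c
      using f u by (subst poly_eq_sum_mon[of f], intro theta_sum) (auto simp: D_def exps_def)
    then have "(\<Sum>c\<in>D. const (theta n {id} f t0 (u c)) * mon c)
        = (\<Sum>c\<in>D. \<Sum>m\<in>keys f. const (lookup f m) * (const (theta n {id} (mon m) t0 (u c)) * mon c))"
      by (simp add: const_mult mult.assoc flip: mp.scale_sum_left) (simp add: mp.scale_sum_left const_mult mult.assoc)
    then show ?thesis by (simp add: lin_ext_def \<psi>_def sum_distrib_left) (rule sum.swap)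
  qed
  have inj: "f = 0" if f: "keys f \<subseteq> D" "lin_ext \<psi> f = 0" for f
  proof (rule theta_nondegenerate)
    show "f \<in> poly_ring n" using DS[OF f(1)] by simp
    fix t :: nat and p :: "'k mpol" assume t: "t \<ge> 1" and p: "p \<in> poly_ring n"
    show "theta n {id} f t p = 0"
    proof (rule dual_system_determined[OF _ t0 _ t p])
      show "dual_system n (poly_ring n) d (theta n {id} f)"
        using DS[OF f(1)] by (intro theta_dual_system_trivial) auto
      fix c assume "c \<in> exps n (d - int n)"
      then show "theta n {id} f t0 (bas n (compl_exp n t0 c)) = 0"
        using f look[of c "\<lambda>c. theta n {id} f t0 (u c)"] by (simp add: ext D_def u_def)
    qed
  qed
  have comb: "keys (\<Sum>c\<in>D. const (v c) * mon c :: 'k mpol) \<subseteq> D" for v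
    using keys_sum[of "\<lambda>c. const (v c) * mon c :: 'k mpol" D] keys_const_mult by fastforce
  have "\<exists>f. keys f \<subseteq> D \<and> lin_ext \<psi> f = (\<Sum>c\<in>D. const (\<phi> t0 (u c)) * mon c)"
  proof (rule lin_ext_inj_imp_surj[OF fin _ inj comb])
    show "keys (\<psi> m) \<subseteq> D" for m unfolding \<psi>_def by (rule comb)
  qed
  then obtain f where f: "keys f \<subseteq> D" "lin_ext \<psi> f = (\<Sum>c\<in>D. const (\<phi> t0 (u c)) * mon c)" by blast
  have "\<phi> t p - theta n {id} f t p = 0" if t: "t \<ge> 1" and p: "p \<in> poly_ring n" for t p
  proof (rule dual_system_determined[OF _ t0 _ t p])
    show "dual_system n (poly_ring n) d (\<lambda>t p. \<phi> t p - theta n {id} f t p)"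
      using DS[OF f(1)] by (intro dual_system_diff \<phi> theta_dual_system_trivial) auto
    fix c assume c: "c \<in> exps n (d - int n)"
    have "theta n {id} f t0 (u c) = \<phi> t0 (u c)"
      using c look[of c "\<lambda>c. theta n {id} f t0 (u c)"] look[of c "\<lambda>c. \<phi> t0 (u c)"] f by (simp add: ext D_def)
    then show "\<phi> t0 (bas n (compl_exp n t0 c)) - theta n {id} f t0 (bas n (compl_exp n t0 c)) = 0"
      by (simp add: u_def)
  qed
  then show ?thesis using that DS[OF f(1)] by auto
qed

section \<open>Duality for the ring of invariants\<close>

text \<open>Suitable weights turn the lexicographic order on a finite set of exponents into a comparison of numbers.\<close>

lemma weight_minimum:
  fixes X :: "(nat \<Rightarrow>\<^sub>0 nat) set"
  assumes "finite X" "X \<noteq> {}" "\<And>b b'. b \<in> X \<Longrightarrow> b' \<in> X \<Longrightarrow> (\<forall>i\<in>{1..k}. lookup b i = lookup b' i) \<Longrightarrow> b = b'"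
  shows "\<exists>w. \<exists>b0\<in>X. \<forall>b\<in>X - {b0}. (\<Sum>i=1..k. w i * lookup b0 i) < (\<Sum>i=1..k. w i * lookup b i :: nat)" using assms
proof (induction k arbitrary: X)
  case 0
  then obtain b0 where "b0 \<in> X" by blast
  then have "X = {b0}" using 0(3) by auto
  then show ?case by auto
next
  case (Suc k)
  obtain b1 where b1: "b1 \<in> X" "\<And>b. b \<in> X \<Longrightarrow> lookup b1 (Suc k) \<le> lookup b (Suc k)"
    using arg_min_if_finite[OF Suc.prems(1,2), of "\<lambda>b. lookup b (Suc k)"] by (metis not_less)
  define X' where "X' = {b \<in> X. lookup b (Suc k) = lookup b1 (Suc k)}"
  have "finite X'" "X' \<noteq> {}" using Suc.prems b1 by (auto simp: X'_def)
  moreover have "b = b'" if "b \<in> X'" "b' \<in> X'" "\<forall>i\<in>{1..k}. lookup b i = lookup b' i" for b b'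
    using that by (intro Suc.prems(3)) (auto simp: X'_def le_Suc_eq)
  ultimately obtain w b0 where w: "b0 \<in> X'"
    "\<And>b. b \<in> X' - {b0} \<Longrightarrow> (\<Sum>i=1..k. w i * lookup b0 i) < (\<Sum>i=1..k. w i * lookup b i)"
    using Suc.IH[of X'] by blast
  define K where "K = Suc (\<Sum>i=1..k. w i * lookup b0 i)"
  define w' where "w' = w(Suc k := K)"
  have sum': "(\<Sum>i\<in>{1..Suc k}. w' i * lookup b i) = (\<Sum>i=1..k. w i * lookup b i) + K * lookup b (Suc k)" for b
    by (simp add: w'_def)
  have "(\<Sum>i\<in>{1..Suc k}. w' i * lookup b0 i) < (\<Sum>i\<in>{1..Suc k}. w' i * lookup b i)" if b: "b \<in> X - {b0}" for b
  proof (cases "b \<in> X'")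
    case True
    then show ?thesis using w(1) w(2)[of b] b unfolding sum' by (auto simp: X'_def)
  next
    case False
    then have "Suc (lookup b0 (Suc k)) \<le> lookup b (Suc k)" using b b1(2)[of b] w(1) by (auto simp: X'_def)
    then have "K * Suc (lookup b0 (Suc k)) \<le> K * lookup b (Suc k)" by (rule mult_le_mono2)
    then show ?thesis unfolding sum' by (simp add: K_def)
  qed
  moreover have "b0 \<in> X" using w(1) by (simp add: X'_def)
  ultimately show ?case by blast
qed

context perm_group
begin

interpretation S: perm_group n "full_sym n" by (rule perm_group_full)

lemma bas_symmetric: "(\<And>i. i dvd lookup c i) \<Longrightarrow> bas n c \<in> sym_polys n"
proof -
  assume dv: "\<And>i. i dvd lookup c i"
  have eq: "bas n c = (\<Prod>i\<in>keys c. esym n i ^ (lookup c i div i) :: 'a mpol)"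
    unfolding bas_def using dv by (intro prod.cong) (simp_all add: dvd_imp_mod_0)
  show "bas n c \<in> (sym_polys n :: 'a mpol set)"
    unfolding eq by (intro subalg_prod[OF S.invariant_ring_subalgebra] subalg_power[OF S.invariant_ring_subalgebra]
        esym_invariant)
qed

text \<open>Multiplication by a nonzero symmetric polynomial \<open>P\<close> is surjective on the top local cohomology, because in terms of
  inverse monomials in the \<open>e\<^sub>i\<close> it is triangular for a suitable weight. Dually, it is injective.\<close>

lemma dual_system_torsion_free:
  fixes \<phi> :: "nat \<Rightarrow> 'k::field mpol \<Rightarrow> 'k"
  assumes \<phi>: "dual_system n (invariant_ring n G) d \<phi>"
    and P: "P \<in> sym_polys n" "P \<noteq> 0"
    and zero: "\<And>t r. t \<ge> 1 \<Longrightarrow> r \<in> invariant_ring n G \<Longrightarrow> \<phi> t (P * r) = 0"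
    and t: "t \<ge> 1" and r: "r \<in> invariant_ring n G"
  shows "\<phi> t r = 0"
proof -
  note R = invariant_ring_subalgebra[where ?'k = 'k]
  define X where "X = keys (coords n P)"
  have PS: "P \<in> poly_ring n" using P by (simp add: invariant_ring_def)
  have X: "X \<subseteq> tower_exps n (Suc n)" using keys_coords_symmetric[OF P(1)] by (simp add: X_def)
  then have Xdv: "i dvd lookup b i" if "b \<in> X" for b i using that by (intro tower_exps_top_dvd) auto
  have Xk: "keys b \<subseteq> {1..n}" if "b \<in> X" for b
    using X that by (auto simp: tower_exps_def simp del: atLeastAtMost_iff)
  have "X \<noteq> {}" using coords_eq_0[OF PS] P(2) by (auto simp: X_def)
  moreover have "b = b'" if "b \<in> X" "b' \<in> X" "\<forall>i\<in>{1..n}. lookup b i = lookup b' i" for b b'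
  proof (rule poly_mapping_eqI)
    fix i
    show "lookup b i = lookup b' i"
    proof (cases "i \<in> {1..n}")
      case False
      then have "i \<notin> keys b" "i \<notin> keys b'" using Xk[OF that(1)] Xk[OF that(2)] by auto
      then show ?thesis by (simp add: in_keys_iff)
    qed (use that in auto)
  qed
  ultimately have "\<exists>w. \<exists>b0\<in>X. \<forall>b\<in>X - {b0}. (\<Sum>i=1..n. w i * lookup b0 i) < (\<Sum>i=1..n. w i * lookup b i :: nat)"
    by (intro weight_minimum) (simp_all add: X_def)
  then obtain w b0 where b0: "b0 \<in> X"
    and w: "\<And>b. b \<in> X \<Longrightarrow> b \<noteq> b0 \<Longrightarrow> (\<Sum>i=1..n. w i * lookup b0 i) < (\<Sum>i=1..n. w i * lookup b i)" by blast
  define W where "W c = (\<Sum>i=1..n. w i * lookup c i)" for c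
  have W_add: "W (a + b) = W a + W b" for a b by (simp add: W_def lookup_add distrib_left sum.distrib)
  have P_eq: "P = (\<Sum>b\<in>X. const (lookup (coords n P) b) * bas n b)"
    using coords_props(2)[OF PS] by (simp add: lin_ext_def X_def)
  have inv: "bas n c * r \<in> invariant_ring n G" if "\<And>i. i dvd lookup c i" for c
    using bas_symmetric[OF that] full_invariant_ring_subset r by (intro subalg_mult[OF R]) auto
  have EG: "esym_prod n \<in> (invariant_ring n G :: 'k mpol set)"
    using esym_prod_invariant full_invariant_ring_subset by auto
  have main: "\<phi> t (bas n e * r) = 0"
    if "t \<ge> 1" "c + e = estep n t" "\<And>i. i dvd lookup c i" "\<And>i. i dvd lookup e i" for c e t using that
  proof (induction "W c" arbitrary: c e t rule: less_induct)
    case less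
    define s where "s = mon_deg b0"
    define e0 where "e0 = estep n s - b0"
    have "lookup b0 i \<le> lookup (estep n s) i" for i
    proof (cases "i \<in> keys b0")
      case True
      then have "lookup b0 i \<le> s" unfolding s_def mon_deg_def by (intro member_le_sum) auto
      also have "s \<le> i * s" using True Xk[OF b0] by auto
      finally show ?thesis using True Xk[OF b0] by (auto simp: lookup_estep)
    qed (simp add: in_keys_iff)
    then have e0: "b0 + e0 = estep n s" by (intro poly_mapping_eqI) (simp add: e0_def lookup_add lookup_minus)
    have e0dv: "i dvd lookup e0 i" for i
      using Xdv[OF b0, of i] estep_dvd[of i n s] by (auto simp: e0_def lookup_minus intro: dvd_diff_nat)
    have dv: "i dvd lookup (e + e0) i" for i using e0dv less.prems(4) by (simp add: lookup_add)
    have bdv: "i dvd lookup (e + e0 + b) i" if "b \<in> X" for b i using dv Xdv[OF that] by (simp add: lookup_add)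
    have ts: "t + s \<ge> 1" using less.prems(1) by simp
    have term_zero: "\<phi> (t + s) (bas n (e + e0 + b) * r) = 0" if b: "b \<in> X" "b \<noteq> b0" for b
    proof (cases "\<exists>i\<in>{1..n}. lookup (e + e0 + b) i \<ge> i * (t + s)")
      case True
      then obtain i where i: "i \<in> {1..n}" "lookup (e + e0 + b) i \<ge> i * (t + s)" by blast
      define e' where "e' = e + e0 + b - single i (i * (t + s))"
      have e': "e + e0 + b = e' + single i (i * (t + s))"
        using i(2) by (intro poly_mapping_eqI) (auto simp: e'_def lookup_add lookup_minus lookup_single when_def)
      have dv': "j dvd lookup e' j" for j
        using bdv[OF b(1), of j] unfolding e'_def lookup_minus[of "e + e0 + b"]
        by (intro dvd_diff_nat) (auto simp: lookup_single when_def)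
      have "bas n (e + e0 + b) = bas n e' * (bas n (single i (i * (t + s))) :: 'k mpol)"
        unfolding e' by (intro bas_add) (auto simp: lookup_single when_def)
      then have eq: "bas n (e + e0 + b) * r = esym n i ^ (t + s) * (bas n e' * r)"
        using i by (simp add: bas_esym mult_ac)
      show ?thesis
        unfolding eq by (rule dual_systemD(3)[OF \<phi> ts i(1) inv[OF dv']])
    next
      case False
      define c' where "c' = estep n (t + s) - (e + e0 + b)"
      have "lookup (e + e0 + b) i \<le> lookup (estep n (t + s)) i" for i
      proof (cases "i \<in> {1..n}")
        case True
        then show ?thesis using False by (force simp: lookup_estep)
      next
        case i: False
        then have "i \<notin> keys b" "i \<notin> keys b0" using Xk[OF b(1)] Xk[OF b0] by auto
        moreover have "lookup e i = 0"
          using i arg_cong[OF less.prems(2), of "\<lambda>m. lookup m i"] by (simp add: lookup_add lookup_estep del: atLeastAtMost_iff)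
        ultimately show ?thesis using i by (simp add: lookup_add lookup_estep e0_def lookup_minus in_keys_iff del: atLeastAtMost_iff)
      qed
      then have c': "c' + (e + e0 + b) = estep n (t + s)"
        by (intro poly_mapping_eqI) (simp add: c'_def lookup_add lookup_minus)
      have c'dv: "i dvd lookup c' i" for i
        using bdv[OF b(1), of i] estep_dvd[of i n "t + s"] unfolding c'_def lookup_minus by (rule dvd_diff_nat[rotated])
      have "c' + (e + e0 + b) = c + e + (b0 + e0)"
        unfolding c' e0 less.prems(2) by (simp add: estep_add)
      then have "c' + b + (e + e0) = c + b0 + (e + e0)" by (simp add: ac_simps)
      then have "c' + b = c + b0" by (rule add_right_imp_eq)
      then have "W c' + W b = W c + W b0" by (simp flip: W_add)
      then have "W c' < W c" using w[OF b] by (simp add: W_def)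
      then show ?thesis by (rule less.hyps[OF _ ts c' c'dv bdv[OF b(1)]])
    qed
    have "P * (bas n (e + e0) * r) = (\<Sum>b\<in>X. const (lookup (coords n P) b) * (bas n (e + e0 + b) * r))"
      by (subst P_eq) (simp add: sum_distrib_right sum_distrib_left bas_add[OF Xdv] mult_ac cong: sum.cong)
    then have "0 = \<phi> (t + s) (\<Sum>b\<in>X. const (lookup (coords n P) b) * (bas n (e + e0 + b) * r))"
      using zero[OF ts inv[OF dv]] by simp
    also have "\<dots> = (\<Sum>b\<in>X. lookup (coords n P) b * \<phi> (t + s) (bas n (e + e0 + b) * r))"
      by (intro dual_system_sum[OF \<phi> R ts] inv bdv)
    also have "\<dots> = lookup (coords n P) b0 * \<phi> (t + s) (bas n (e + e0 + b0) * r)"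
      using b0 by (subst sum.remove[of X b0]) (auto simp: X_def term_zero)
    finally have "\<phi> (t + s) (bas n (e + e0 + b0) * r) = 0" using b0 by (auto simp: X_def in_keys_iff)
    moreover have "e + e0 + b0 = e + estep n s" by (simp add: e0[symmetric] ac_simps)
    then have "bas n (e + e0 + b0) * r = esym_prod n ^ s * (bas n e * r)"
      by (simp add: bas_add[OF estep_dvd] bas_estep mult_ac)
    ultimately show ?case using dual_system_shift[OF \<phi> R EG less.prems(1) inv[OF less.prems(4)], of s] by simp
  qed
  show ?thesis using main[OF t, of "estep n t" 0] estep_dvd by simp
qed

lemma trace_invariant:
  "s \<in> poly_ring n \<Longrightarrow> orbit_trace G s \<in> invariant_ring n G"
  using char_trace_semi_inv[OF pm_char_trivial, of s] char_trace_in_poly_ring[of s "\<lambda>_. 1"]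
  by (auto simp: invariant_ring_def semi_inv_def)

lemma full_invariant_perm_act: "a \<in> sym_polys n \<Longrightarrow> \<sigma> \<in> G \<Longrightarrow> perm_act \<sigma> a = a"
  using full_invariant_ring_subset invariantD(1) by blast

lemma theta_nondegenerate_group:
  fixes f :: "'k::field mpol"
  assumes f: "f \<in> can_ideal n G" and zero: "\<And>t r. t \<ge> 1 \<Longrightarrow> r \<in> invariant_ring n G \<Longrightarrow> theta n G f t r = 0"
  shows "f = 0"
proof (rule theta_nondegenerate)
  show "f \<in> poly_ring n" using f by (simp add: can_ideal_def)
  fix t :: nat and s :: "'k mpol" assume "t \<ge> 1" "s \<in> poly_ring n"
  then show "theta n {id} f t s = 0"
    using zero[of t "orbit_trace G s"] trace_invariant[of s] rho_mult_trace[OF f, of s] by (simp add: theta_def)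
qed

end

lemma theta_diff:
  assumes "f \<in> poly_ring n" "g \<in> poly_ring n" "p \<in> poly_ring n"
  shows "theta n {id} (f - g) t p = theta n {id} f t p - theta n {id} g t p"
proof -
  have "const (-1) * g \<in> poly_ring n" by (intro poly_ring_mult poly_ring_const assms)
  then have "theta n {id} (f + const (-1) * g) t p = theta n {id} f t p + (-1) * theta n {id} g t p"
    using assms by (simp only: theta_add theta_const_mult)
  then show ?thesis by (simp add: const_uminus)
qed

text \<open>The divided difference of \<open>s\<close> with respect to \<open>x\<^sub>i\<close> and \<open>x\<^sub>j\<close>.\<close>

definition demazure :: "nat \<Rightarrow> nat \<Rightarrow> 'k::field mpol \<Rightarrow> 'k mpol" where
  "demazure i j s = (SOME q. s - perm_act (swap i j) s = (var i - var j) * q)"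

lemma demazure_eq: "(var i - var j) * demazure i j s = s - perm_act (swap i j) s"
proof -
  have "(var i - var j) dvd s - perm_act (swap i j) s"
    by (simp add: diff_var_dvd_iff perm_act_diff perm_act_transpose_collapse)
  then obtain q where "s - perm_act (swap i j) s = (var i - var j) * q" by (rule dvdE)
  then show ?thesis
    unfolding demazure_def by (metis (mono_tags, lifting) someI_ex)
qed

lemma demazure_eqI:
  assumes "i \<noteq> j" "(var i - var j) * q = s - perm_act (swap i j) s"
  shows "demazure i j s = q"
proof -
  have "(var i - var j) * demazure i j s = (var i - var j) * q" by (simp add: demazure_eq assms(2))
  then show ?thesis using assms(1) by (simp add: var_inject)
qed

lemma demazure_add: "i \<noteq> j \<Longrightarrow> demazure i j (s + s') = demazure i j s + demazure i j s'"
  by (rule demazure_eqI) (simp_all add: distrib_left demazure_eq perm_act_add)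

lemma demazure_mult:
  "i \<noteq> j \<Longrightarrow> perm_act (swap i j) a = a \<Longrightarrow> demazure i j (a * s) = a * demazure i j s"
  by (rule demazure_eqI) (simp_all add: mult.left_commute[of _ a] demazure_eq perm_act_mult right_diff_distrib)

lemma demazure_invariant:
  assumes "i \<noteq> j"
  shows "perm_act (swap i j) (demazure i j s) = demazure i j s"
proof (rule demazure_eqI[OF assms, symmetric])
  let ?\<tau> = "swap i j"
  have "perm_act ?\<tau> ((var i - var j) * demazure i j s) = perm_act ?\<tau> s - s"
    unfolding demazure_eq by (simp add: perm_act_diff perm_act_comp)
  then show "(var i - var j) * perm_act ?\<tau> (demazure i j s) = s - perm_act ?\<tau> s"
    by (simp add: perm_act_mult perm_act_diff algebra_simps)
qed

lemma demazure_diff_var_mult: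
  "i \<noteq> j \<Longrightarrow> demazure i j ((var i - var j) * s) = s + perm_act (swap i j) s"
  by (rule demazure_eqI) (simp_all add: perm_act_mult perm_act_diff algebra_simps)

lemma demazure_homogeneous:
  assumes "i \<noteq> j" "homogeneous e s"
  shows "homogeneous (e - 1) (demazure i j s)"
proof (rule homogeneous_quotient[OF _ homogeneous_diff_var])
  show "homogeneous e ((var i - var j) * demazure i j s)"
    unfolding demazure_eq by (intro homogeneous_diff homogeneous_perm_act assms)
  show "var i - var j \<noteq> 0" using assms by (simp add: var_inject)
qed

lemma demazure_in_poly_ring:
  assumes "i \<noteq> j" "i \<in> {1..n}" "j \<in> {1..n}" "s \<in> poly_ring n"
  shows "demazure i j s \<in> poly_ring n"
proof (rule poly_ring_quotient[OF demazure_eq[symmetric]])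
  interpret \<tau>: perm_group n "{id, swap i j}" using assms by (intro perm_group_transpose)
  show "var i - var j \<noteq> 0" using assms by (simp add: var_inject)
  show "s - perm_act (swap i j) s \<in> poly_ring n" using assms by (intro poly_ring_diff \<tau>.perm_act_mem) auto
  show "var i - var j \<in> poly_ring n" using assms by (intro poly_ring_diff var_in_poly_ring)
qed

context perm_group
begin

interpretation S: perm_group n "full_sym n" by (rule perm_group_full)

lemma trace_dual_system:
  assumes \<phi>: "dual_system n (invariant_ring n G) d \<phi>"
  shows "dual_system n (poly_ring n) d (\<lambda>t s. \<phi> t (orbit_trace G s))"
proof -
  have mult: "orbit_trace G (a * s) = a * orbit_trace G s"
    if "a \<in> sym_polys n" for a s :: "'a mpol" by (rule char_trace_mult) (rule full_invariant_perm_act[OF that])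
  show ?thesis
    unfolding dual_system_def
  proof (intro allI impI conjI ballI)
    fix t :: nat and s :: "'a mpol" assume t: "t \<ge> 1" and s: "s \<in> poly_ring n"
    note D = dual_systemD[OF \<phi> t] and Ts = trace_invariant[OF s]
    show "\<phi> t (orbit_trace G (s + s')) = \<phi> t (orbit_trace G s) + \<phi> t (orbit_trace G s')"
      if "s' \<in> poly_ring n" for s' by (simp add: char_trace_add D(1) Ts trace_invariant that)
    show "\<phi> t (orbit_trace G (const c * s)) = c * \<phi> t (orbit_trace G s)" for c
      by (simp add: mult full_invariant_const D(2) Ts)
    show "\<phi> t (orbit_trace G (esym n l ^ t * s)) = 0" if "l \<in> {1..n}" for l
      using that by (simp add: mult subalg_power[OF S.invariant_ring_subalgebra] esym_invariant D(3) Ts)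
    show "\<phi> (Suc t) (orbit_trace G (esym_prod n * s)) = \<phi> t (orbit_trace G s)"
      by (simp add: mult esym_prod_invariant D(4) Ts)
    show "\<phi> t (orbit_trace G s) = 0" if "homogeneous e s" "e \<noteq> int t * esym_deg n - d" for e
      by (rule D(5)[OF Ts char_trace_homogeneous[OF that(1)] that(2)])
  qed
qed

text \<open>The trace over \<open>{1, (i j)}\<close> of \<open>s\<close> is the divided difference of \<open>(x\<^sub>i - x\<^sub>j) s\<close>, so that
  \<open>\<phi>\<close> composed with the trace of \<open>G\<close> is \<open>x\<^sub>i - x\<^sub>j\<close> times another functional on the polynomial ring.\<close>

lemma trace_dual_system_dvd:
  fixes \<phi> :: "nat \<Rightarrow> 'k::field mpol \<Rightarrow> 'k"
  assumes \<phi>: "dual_system n (invariant_ring n G) d \<phi>"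
    and f: "f \<in> poly_ring n" "\<And>t s. t \<ge> 1 \<Longrightarrow> s \<in> poly_ring n \<Longrightarrow> \<phi> t (orbit_trace G s) = theta n {id} f t s"
    and ij: "i \<noteq> j" "swap i j \<in> G"
  shows "(var i - var j) dvd f"
proof -
  let ?\<tau> = "swap i j" and ?p = "var i - var j :: 'k mpol"
  have ij': "i \<in> {1..n}" "j \<in> {1..n}" using transpose_mem_range[OF ij(2,1)] by auto
  define K where "K = {id, ?\<tau>}"
  interpret K: perm_group n K unfolding K_def by (rule perm_group_transpose[OF ij'])
  interpret GK: perm_group_pair n G K by unfold_locales (use ij in \<open>auto simp: K_def\<close>)
  have idt: "id \<noteq> ?\<tau>" using ij(1) transpose_eq_id_iff[of i j] by metis
  define T :: "'k mpol \<Rightarrow> 'k mpol" where "T = coset_rep_sum (\<lambda>_. 1) G K"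
  define \<chi> where "\<chi> t s = \<phi> t (T (demazure i j s))" for t s
  have p_in: "?p \<in> poly_ring n" by (intro poly_ring_diff var_in_poly_ring ij')
  have semi: "semi_inv (\<lambda>_. 1) K (demazure i j s)" for s :: "'k mpol"
    using demazure_invariant[OF ij(1), of s] by (simp add: semi_inv_def K_def)
  have T_inv: "T (demazure i j s) \<in> invariant_ring n G" if "s \<in> poly_ring n" for s
    using GK.coset_rep_sum_semi_inv[OF pm_char_trivial semi, of s]
      GK.coset_rep_sum_in_poly_ring[OF demazure_in_poly_ring[OF ij(1) ij' that], of "\<lambda>_. 1"]
    by (simp add: T_def invariant_ring_def semi_inv_def)
  have add: "T (demazure i j (s + s')) = T (demazure i j s) + T (demazure i j s')" for s s'
    by (simp add: T_def demazure_add ij coset_rep_sum_add)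
  have mult: "T (demazure i j (a * s)) = a * T (demazure i j s)"
    if "a \<in> sym_polys n" for a s
    using full_invariant_perm_act[OF that] ij by (simp add: T_def demazure_mult GK.coset_rep_sum_mult)
  have \<chi>: "dual_system n (poly_ring n) (d - 1) \<chi>"
    unfolding dual_system_def \<chi>_def
  proof (intro allI impI conjI ballI)
    fix t :: nat and s :: "'k mpol" assume t: "t \<ge> 1" and s: "s \<in> poly_ring n"
    note D = dual_systemD[OF \<phi> t]
    show "\<phi> t (T (demazure i j (s + s'))) = \<phi> t (T (demazure i j s)) + \<phi> t (T (demazure i j s'))"
      if "s' \<in> poly_ring n" for s' by (simp add: add D(1) T_inv s that)
    show "\<phi> t (T (demazure i j (const c * s))) = c * \<phi> t (T (demazure i j s))" for c
      by (simp add: mult full_invariant_const D(2) T_inv s)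
    show "\<phi> t (T (demazure i j (esym n l ^ t * s))) = 0" if "l \<in> {1..n}" for l
      using that by (simp add: mult subalg_power[OF S.invariant_ring_subalgebra] esym_invariant D(3) T_inv s)
    show "\<phi> (Suc t) (T (demazure i j (esym_prod n * s))) = \<phi> t (T (demazure i j s))"
      by (simp add: mult esym_prod_invariant D(4) T_inv s)
    show "\<phi> t (T (demazure i j s)) = 0" if "homogeneous e s" "e \<noteq> int t * esym_deg n - (d - 1)" for e
    proof (rule D(5)[OF T_inv[OF s]])
      show "homogeneous (e - 1) (T (demazure i j s))"
        unfolding T_def by (intro coset_rep_sum_homogeneous demazure_homogeneous ij that)
    qed (use that in auto)
  qed
  obtain f' where f': "f' \<in> poly_ring n"
    "\<And>t s. t \<ge> 1 \<Longrightarrow> s \<in> poly_ring n \<Longrightarrow> \<chi> t s = theta n {id} f' t s" using polynomial_ring_duality[OF \<chi>] by metis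
  have "theta n {id} (f - ?p * f') t s = 0" if t: "t \<ge> 1" and s: "s \<in> poly_ring n" for t s
  proof -
    have "orbit_trace K s = demazure i j (?p * s)"
      using idt by (simp add: char_trace_def K_def demazure_diff_var_mult ij)
    then have "orbit_trace G s = T (demazure i j (?p * s))"
      using GK.coset_rep_sum_trace[OF pm_char_trivial, of s] by (simp add: T_def)
    then have "theta n {id} f t s = theta n {id} f' t (?p * s)"
      using f(2)[OF t s] f'(2)[OF t subalg_mult[OF poly_ring_subalgebra p_in s]] by (simp add: \<chi>_def)
    also have "\<dots> = theta n {id} (?p * f') t s" by (simp add: theta_def mult_ac)
    finally show ?thesis using f(1) f'(1) p_in s by (simp add: theta_diff poly_ring_mult)
  qed
  moreover have "f - ?p * f' \<in> poly_ring n" by (intro poly_ring_diff poly_ring_mult f f' p_in)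
  ultimately have "f - ?p * f' = 0" by (rule theta_nondegenerate[rotated])
  then have "f = ?p * f'" by simp
  then show ?thesis by simp
qed

text \<open>Composed with the trace, \<open>\<phi>\<close> becomes a functional on the polynomial ring, represented by some \<open>f\<close>. Invariance
  of the trace makes \<open>f\<close> a sign semi-invariant. Now \<open>\<phi>\<close> and \<open>theta n G f\<close> agree on traces. Some nonzero symmetric polynomial
  multiplies all invariants into the traces, so they agree by torsion-freeness.\<close>

theorem invariant_ring_duality:
  fixes \<phi> :: "nat \<Rightarrow> 'k::field mpol \<Rightarrow> 'k"
  assumes \<phi>: "dual_system n (invariant_ring n G) d \<phi>"
  obtains f where "f \<in> can_ideal n G" "homogeneous (d - int n) f"
    "\<And>t r. t \<ge> 1 \<Longrightarrow> r \<in> invariant_ring n G \<Longrightarrow> \<phi> t r = theta n G f t r"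
proof -
  note SS = poly_ring_subalgebra[where ?'a = 'k]
  obtain f where f: "f \<in> poly_ring n" "homogeneous (d - int n) f"
    "\<And>t s. t \<ge> 1 \<Longrightarrow> s \<in> poly_ring n \<Longrightarrow> \<phi> t (orbit_trace G s) = theta n {id} f t s"
    using polynomial_ring_duality[OF trace_dual_system[OF \<phi>]] by metis
  have "perm_act g f = const (sgn_char g) * f" if g: "g \<in> G" for g
  proof -
    have g': "g \<in> full_sym n" using g permutes by (simp add: full_sym_def)
    define h where "h = perm_act (inv' g) f"
    have h: "h \<in> poly_ring n" unfolding h_def by (intro perm_act_mem inv_mem g f)
    have gh: "perm_act g h = f" by (simp add: h_def perm_act_comp inv_comp_mem[OF g])
    have "theta n {id} (const (sgn_char g) * h - f) t s = 0" if t: "t \<ge> 1" and s: "s \<in> poly_ring n" for t s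
    proof -
      have hs: "h * s \<in> poly_ring n" by (intro subalg_mult[OF SS] h s)
      have "f * perm_act g s = perm_act g (h * s)" by (simp add: perm_act_mult gh)
      then have "theta n {id} f t (perm_act g s) = theta n {id} (const (sgn_char g) * h) t s"
        using rho_perm_act[OF hs g'] perm_group.rho_in_poly_ring[OF perm_group_trivial, of "h * s" n] hs
        by (simp add: theta_def mult.assoc rho_mult_trivial full_invariant_const)
      moreover have "theta n {id} f t (perm_act g s) = theta n {id} f t s"
        using f(3)[OF t perm_act_mem[OF g s]] f(3)[OF t s] char_trace_perm_act[OF pm_char_trivial g, of s] by simp
      ultimately show ?thesis
        using f(1) h s by (simp add: theta_diff theta_const_mult subalg_mult[OF SS] subalg_const[OF SS])
    qed
    moreover have "const (sgn_char g) * h - f \<in> poly_ring n"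
      by (intro subalg_diff[OF SS] subalg_mult[OF SS] subalg_const[OF SS] f h)
    ultimately have "const (sgn_char g) * h - f = 0" by (rule theta_nondegenerate[rotated])
    then have "perm_act g (const (sgn_char g) * h) = perm_act g f" by simp
    then show ?thesis by (simp add: perm_act_const_mult gh)
  qed
  then have fF: "f \<in> can_ideal n G"
    using trace_dual_system_dvd[OF \<phi> f(1,3)] f(1) by (auto simp: can_ideal_def semi_inv_def)
  define r0 where "r0 = orbit_trace G (mon (stair n) :: 'k mpol)"
  have stair: "mon (stair n) \<in> (poly_ring n :: 'k mpol set)" using keys_stair by simp
  have r0: "r0 \<in> invariant_ring n G" unfolding r0_def by (rule trace_invariant[OF stair])
  then have r0S: "r0 \<in> poly_ring n" by (rule invariantD(2))
  have nz: "r0 \<noteq> 0" using char_trace_stair[where \<chi> = "\<lambda>_. 1 :: 'k"] by (auto simp: r0_def)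
  obtain q where q: "q \<in> poly_ring n" "orbit_prod n r0 = r0 * q" using orbit_prod_factor[OF r0S] .
  have P: "orbit_prod n r0 \<in> sym_polys n" "orbit_prod n r0 \<noteq> 0"
    using orbit_prod_invariant[OF r0S] orbit_prod_nonzero[OF nz] by auto
  have "perm_act g q = q" if g: "g \<in> G" for g
  proof -
    have "r0 * perm_act g q = r0 * q"
      using full_invariant_perm_act[OF P(1) g] invariantD(1)[OF r0 g] by (simp add: q(2) perm_act_mult)
    with nz show ?thesis by simp
  qed
  then have qR: "q \<in> invariant_ring n G" using q(1) by (simp add: invariant_ring_def)
  have "\<phi> t r - theta n G f t r = 0" if t: "t \<ge> 1" and r: "r \<in> invariant_ring n G" for t r
  proof (rule dual_system_torsion_free[OF _ P _ t r])
    show "dual_system n (invariant_ring n G) d (\<lambda>t r. \<phi> t r - theta n G f t r)"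
      by (intro dual_system_diff \<phi> theta_dual_system fF f)
    fix t :: nat and r :: "'k mpol" assume t: "t \<ge> 1" and r: "r \<in> invariant_ring n G"
    have qr: "q * r \<in> invariant_ring n G" by (intro subalg_mult[OF invariant_ring_subalgebra] qR r)
    define s where "s = q * r * mon (stair n)"
    have s: "s \<in> poly_ring n"
      unfolding s_def by (rule subalg_mult[OF SS invariantD(2)[OF qr] stair])
    have "orbit_trace G s = q * r * r0"
      unfolding s_def r0_def by (rule char_trace_mult) (rule invariantD(1)[OF qr])
    then have "orbit_prod n r0 * r = orbit_trace G s" by (simp add: q(2) mult_ac)
    moreover have "\<phi> t (orbit_trace G s) = theta n G f t (orbit_trace G s)"
      using f(3)[OF t s] rho_mult_trace[OF fF s] by (simp add: theta_def)
    ultimately show "\<phi> t (orbit_prod n r0 * r) - theta n G f t (orbit_prod n r0 * r) = 0" by simp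
  qed
  then show ?thesis using that[OF fF f(2)] by simp
qed

end

section \<open>When the canonical module is free\<close>

definition transp_pairs :: "nat \<Rightarrow> (nat \<Rightarrow> nat) set \<Rightarrow> (nat \<times> nat) set" where
  "transp_pairs n G = {(i, j) \<in> pairs n. swap i j \<in> G}"

definition transp_prod :: "nat \<Rightarrow> (nat \<Rightarrow> nat) set \<Rightarrow> 'k::field mpol" where
  "transp_prod n G = (\<Prod>a\<in>transp_pairs n G. diff_pair a)"

lemma transp_pairs_subset: "transp_pairs n G \<subseteq> pairs n" by (auto simp: transp_pairs_def)

lemma transp_prod_props:
  "transp_prod n G \<noteq> (0 :: 'k::field mpol)"
  "homogeneous (int (card (transp_pairs n G))) (transp_prod n G :: 'k mpol)"
  "transp_prod n G \<in> (poly_ring n :: 'k mpol set)"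
  unfolding transp_prod_def by (rule prod_pairs_props[OF transp_pairs_subset])+

lemma transp_prod_dvd:
  assumes "f \<in> can_ideal n G"
  shows "transp_prod n G dvd f"
  unfolding transp_prod_def
proof (rule prod_pairs_dvd[OF transp_pairs_subset])
  fix i j assume "(i, j) \<in> transp_pairs n G"
  then show "(var i - var j) dvd f" using assms by (auto simp: transp_pairs_def pairs_def can_ideal_def)
qed

lemma transpose_inject:
  fixes i j k l :: nat
  assumes "i < j" "k < l" "swap i j = swap k l"
  shows "i = k \<and> j = l"
proof -
  have "swap k l i = j" "swap k l j = i"
    using assms(3) by (metis transpose_apply_first, metis transpose_apply_second)
  then show ?thesis using assms(1,2) by (auto simp: Transposition.transpose_def split: if_splits)
qed

context perm_group
begin

lemma card_transp_pairs: "card (transp_pairs n G) = num_transpositions G"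
  unfolding num_transpositions_def
proof (rule bij_betw_same_card)
  show "bij_betw (\<lambda>(i, j). swap i j) (transp_pairs n G)
      {\<sigma> \<in> G. \<exists>i j. i \<noteq> j \<and> \<sigma> = swap i j}"
    unfolding bij_betw_def
  proof (intro conjI equalityI subsetI)
    show "inj_on (\<lambda>(i, j). swap i j) (transp_pairs n G)"
      using transpose_inject by (auto simp: inj_on_def transp_pairs_def pairs_def)
    fix \<sigma> assume "\<sigma> \<in> {\<sigma> \<in> G. \<exists>i j. i \<noteq> j \<and> \<sigma> = swap i j}"
    then obtain i j where ij: "i \<noteq> j" "\<sigma> = swap i j" "\<sigma> \<in> G" by blast
    then have "i \<in> {1..n}" "j \<in> {1..n}" using transpose_mem_range by blast+
    then have "(min i j, max i j) \<in> transp_pairs n G"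
      using ij by (auto simp: transp_pairs_def pairs_def min_def max_def transpose_commute)
    moreover have "swap (min i j) (max i j) = \<sigma>" using ij by (auto simp: min_def max_def transpose_commute)
    ultimately show "\<sigma> \<in> (\<lambda>(i, j). swap i j) ` transp_pairs n G" by (auto intro: rev_image_eqI)
  next
    fix \<sigma> assume "\<sigma> \<in> (\<lambda>(i, j). swap i j) ` transp_pairs n G"
    then obtain i j where "i < j" "\<sigma> = swap i j" "\<sigma> \<in> G" by (auto simp: transp_pairs_def pairs_def)
    then show "\<sigma> \<in> {\<sigma> \<in> G. \<exists>i j. i \<noteq> j \<and> \<sigma> = swap i j}" using less_imp_neq by blast
  qed
qed

lemma can_ideal_min_degree:
  assumes "f \<in> can_ideal n G" "f \<noteq> 0" "homogeneous d f"
  shows "d \<ge> int (card (transp_pairs n G))"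
proof -
  obtain q where q: "f = transp_prod n G * q" using transp_prod_dvd[OF assms(1)] by (rule dvdE)
  then have "homogeneous (d - int (card (transp_pairs n G))) q"
    using homogeneous_quotient[OF _ transp_prod_props(2,1)] assms by simp
  then show ?thesis using homogeneous_nonneg[of _ q] assms(2) q by fastforce
qed

lemma transp_prod_mem_of_min_degree:
  fixes f :: "'k::field mpol"
  assumes f: "f \<in> can_ideal n G" "f \<noteq> 0" "homogeneous (int (card (transp_pairs n G))) f"
  shows "(transp_prod n G :: 'k mpol) \<in> can_ideal n G"
proof -
  obtain q where q: "f = transp_prod n G * q" using transp_prod_dvd[OF f(1)] by (rule dvdE)
  then have "homogeneous (int (card (transp_pairs n G)) - int (card (transp_pairs n G))) q"
    by (intro homogeneous_quotient[OF _ transp_prod_props(2,1)]) (use f(3) in simp)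
  then obtain c where c: "q = const c" using homogeneous_0_const by auto
  have "c \<noteq> 0" using f(2) q c by auto
  then have "transp_prod n G = const (inverse c) * f"
    by (simp add: q c mult.left_commute flip: const_mult mult.assoc)
  then show ?thesis
    using can_ideal_mult[OF f(1) subalg_const[OF invariant_ring_subalgebra], of "inverse c"] by simp
qed

lemma can_ideal_generated:
  fixes f :: "'k::field mpol"
  assumes D: "(transp_prod n G :: 'k mpol) \<in> can_ideal n G" and f: "f \<in> can_ideal n G"
  shows "\<exists>r\<in>invariant_ring n G. f = r * transp_prod n G"
proof -
  obtain q where q: "f = transp_prod n G * q" using transp_prod_dvd[OF f] by (rule dvdE)
  have "q \<in> poly_ring n"
    using f by (intro poly_ring_quotient[OF q transp_prod_props(1) _ transp_prod_props(3)]) (simp add: can_ideal_def)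
  moreover have "perm_act \<sigma> q = q" if \<sigma>: "\<sigma> \<in> G" for \<sigma>
  proof -
    have sq: "const (sgn_char \<sigma>) * (const (sgn_char \<sigma>) * p) = p" for p :: "'k mpol"
      using pm_char_sgn[where ?'k = 'k] by (simp add: pm_char_def flip: const_mult mult.assoc)
    have "perm_act \<sigma> f = const (sgn_char \<sigma>) * f" "perm_act \<sigma> (transp_prod n G) = const (sgn_char \<sigma>) * (transp_prod n G :: 'k mpol)"
      using D f \<sigma> by (auto simp: can_ideal_def semi_inv_def)
    then have "const (sgn_char \<sigma>) * (transp_prod n G * perm_act \<sigma> q) = const (sgn_char \<sigma>) * (transp_prod n G * q)"
      unfolding q by (simp add: perm_act_mult mult.assoc)
    then have "transp_prod n G * perm_act \<sigma> q = transp_prod n G * q" by (metis sq)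
    then show ?thesis by (simp add: transp_prod_props(1))
  qed
  ultimately show ?thesis using q by (intro bexI[of _ q]) (auto simp: invariant_ring_def mult.commute)
qed

lemma conj_transpose:
  assumes "\<sigma> \<in> G" "swap i j \<in> G"
  shows "swap (\<sigma> i) (\<sigma> j) \<in> G"
proof -
  have "\<sigma> \<circ> swap i j \<circ> inv' \<sigma> = swap (\<sigma> i) (\<sigma> j)" using bij_mem[OF assms(1)]
    by (auto simp: fun_eq_iff Transposition.transpose_def bij_inv_eq_iff surj_f_inv_f[OF bij_is_surj] bij_is_inj inv_f_f)
  then show ?thesis using assms comp_mem inv_mem by metis
qed

text \<open>In characteristic 2 signs are invisible, so \<open>G\<close> permutes the factors of the product.\<close>

lemma transp_prod_mem_char_2:
  assumes "(1::'k::field) + 1 = 0"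
  shows "(transp_prod n G :: 'k mpol) \<in> can_ideal n G"
proof -
  have neg: "- (p :: 'k mpol) = p" for p
  proof -
    have "p + p = const (1 + 1) * p" by (simp only: const_add const_1 distrib_right mult_1)
    also have "\<dots> = 0" by (simp only: assms const_0 mult_zero_left)
    finally show ?thesis by (rule minus_unique)
  qed
  have swap: "var a - var b = (var b - var a :: 'k mpol)" for a b
    using neg[of "var a - var b"] by (metis minus_diff_eq)
  have neg1: "(-1::'k) = 1" using assms by (rule minus_unique)
  have sgn: "sgn_char \<sigma> = (1 :: 'k)" for \<sigma> by (cases \<sigma> rule: sign_cases) (simp_all add: sgn_char_def neg1)
  have "perm_act \<sigma> (transp_prod n G) = (transp_prod n G :: 'k mpol)" if \<sigma>: "\<sigma> \<in> G" for \<sigma>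
  proof -
    let ?f = "\<lambda>(i, j). (min (\<sigma> i) (\<sigma> j), max (\<sigma> i) (\<sigma> j))"
    have inj: "inj_on ?f (transp_pairs n G)"
    proof (rule inj_onI)
      fix a b assume ab: "a \<in> transp_pairs n G" "b \<in> transp_pairs n G" "?f a = ?f b"
      obtain i j k l where "a = (i, j)" "b = (k, l)" by fastforce
      with ab inj_mem[OF \<sigma>] show "a = b"
        by (auto simp: transp_pairs_def pairs_def min_def max_def inj_eq split: if_splits)
    qed
    have sub: "?f ` transp_pairs n G \<subseteq> transp_pairs n G"
    proof (rule image_subsetI)
      fix a assume a: "a \<in> transp_pairs n G"
      obtain i j where ij: "a = (i, j)" by fastforce
      have t: "swap (\<sigma> i) (\<sigma> j) \<in> G" using a ij by (intro conj_transpose[OF \<sigma>]) (simp add: transp_pairs_def)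
      have ne: "\<sigma> i \<noteq> \<sigma> j" using a ij inj_mem[OF \<sigma>] by (auto simp: transp_pairs_def pairs_def inj_eq)
      then show "?f a \<in> transp_pairs n G" using t transpose_mem_range[OF t ne]
        by (auto simp: ij transp_pairs_def pairs_def min_def max_def transpose_commute)
    qed
    have fin: "finite (transp_pairs n G)" by (rule finite_subset[OF transp_pairs_subset finite_pairs])
    have bij: "bij_betw ?f (transp_pairs n G) (transp_pairs n G)"
      using inj sub fin by (simp add: bij_betw_def endo_inj_surj)
    have "perm_act \<sigma> (transp_prod n G) = (\<Prod>a\<in>transp_pairs n G. diff_pair (?f a) :: 'k mpol)"
      unfolding transp_prod_def perm_act_prod
      by (intro prod.cong) (auto simp: perm_act_diff min_def max_def swap)
    also have "\<dots> = transp_prod n G"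
      unfolding transp_prod_def by (rule prod.reindex_bij_betw[OF bij])
    finally show ?thesis .
  qed
  moreover have "(var i - var j) dvd (transp_prod n G :: 'k mpol)"
    if ij: "i \<noteq> j" "swap i j \<in> G" for i j
  proof -
    have r: "i \<in> {1..n}" "j \<in> {1..n}" using transpose_mem_range ij by blast+
    have fin: "finite (transp_pairs n G)" by (rule finite_subset[OF transp_pairs_subset finite_pairs])
    have "(min i j, max i j) \<in> transp_pairs n G"
      using ij r by (auto simp: transp_pairs_def pairs_def min_def max_def transpose_commute)
    then have "diff_pair (min i j, max i j) dvd (transp_prod n G :: 'k mpol)"
      unfolding transp_prod_def by (intro dvd_prodI fin)
    then show ?thesis using ij(1) by (cases "i < j") (simp_all add: min_def max_def swap[of i j])
  qed
  ultimately show ?thesis by (simp add: can_ideal_def semi_inv_def sgn transp_prod_props)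
qed

subsection \<open>Characteristic different from 2\<close>

context
  assumes char: "(1::'k::field) + 1 \<noteq> 0"
begin

lemma can_ideal_semi_inv:
  fixes f :: "'k mpol"
  assumes "f \<in> poly_ring n" "semi_inv sgn_char G f"
  shows "f \<in> can_ideal n G"
proof -
  have "(var i - var j) dvd f" if ij: "i \<noteq> j" "swap i j \<in> G" for i j
  proof -
    have "perm_act (swap i j) f = - f"
      using assms(2) ij by (auto simp: semi_inv_def sgn_char_transpose const_uminus)
    then have "perm_act (collapse i j) f = - perm_act (collapse i j) f"
      using perm_act_transpose_collapse[of i j f] by (simp add: perm_act_uminus)
    then have "const (1 + 1) * perm_act (collapse i j) f = 0"
      by (simp only: const_add distrib_right const_1 mult_1 eq_neg_iff_add_eq_0)
    then have "perm_act (collapse i j) f = 0" using char by (simp only: mp.scale_eq_0_iff simp_thms)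
    then show ?thesis by (simp add: diff_var_dvd_iff)
  qed
  then show ?thesis using assms by (simp add: can_ideal_def)
qed

text \<open>Dedekind's independence argument: replacing \<open>u\<close> by \<open>v u\<close> and subtracting \<open>\<tau>(v)\<close> times the original sum removes the
  term of \<open>\<tau>\<close> at the cost of a factor \<open>v - \<tau>(v)\<close> in front of \<open>u\<close>.\<close>

lemma dedekind_elimination:
  fixes h :: "'k mpol"
  assumes "finite Y" "id \<notin> Y"
    and "\<And>u. u \<in> poly_ring n \<Longrightarrow> h dvd (\<Sum>g\<in>insert id Y. c g * perm_act g u)"
    and "\<And>g. g \<in> Y \<Longrightarrow> v g \<in> poly_ring n"
  shows "h dvd c id * (\<Prod>g\<in>Y. v g - perm_act g (v g))" using assms
proof (induction Y arbitrary: c rule: finite_induct)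
  case empty
  from empty.prems(2)[of 1] show ?case by (simp add: poly_ring_1)
next
  case (insert \<tau> Y)
  define c' where "c' g = c g * (perm_act g (v \<tau>) - perm_act \<tau> (v \<tau>))" for g
  have step: "h dvd (\<Sum>g\<in>insert id Y. c' g * perm_act g u)" if u: "u \<in> poly_ring n" for u
  proof -
    let ?s = "\<lambda>u. \<Sum>g\<in>insert id (insert \<tau> Y). c g * perm_act g u"
    have "v \<tau> * u \<in> poly_ring n" using insert.prems(3) u by (intro poly_ring_mult) auto
    then have "h dvd ?s (v \<tau> * u) - perm_act \<tau> (v \<tau>) * ?s u"
      using u by (intro dvd_diff dvd_mult insert.prems(2))
    also have "?s (v \<tau> * u) - perm_act \<tau> (v \<tau>) * ?s u = (\<Sum>g\<in>insert id (insert \<tau> Y). c' g * perm_act g u)"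
      unfolding sum_distrib_left sum_subtractf[symmetric]
      by (intro sum.cong refl) (simp add: c'_def perm_act_mult algebra_simps)
    also have "\<dots> = (\<Sum>g\<in>insert id Y. c' g * perm_act g u)"
    proof -
      have "\<tau> \<notin> insert id Y" using insert.hyps insert.prems(1) by blast
      then have "(\<Sum>g\<in>insert \<tau> (insert id Y). c' g * perm_act g u) = c' \<tau> * perm_act \<tau> u + (\<Sum>g\<in>insert id Y. c' g * perm_act g u)"
        using insert.hyps(1) by (intro sum.insert) auto
      moreover have "c' \<tau> = 0" by (simp add: c'_def)
      ultimately show ?thesis by (simp only: insert_commute[of id \<tau>] mult_zero_left add_0_left)
    qed
    finally show ?thesis .
  qed
  have "h dvd c' id * (\<Prod>g\<in>Y. v g - perm_act g (v g))"
  proof (rule insert.IH[OF _ step])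
    show "id \<notin> Y" using insert.prems(1) by blast
    show "v g \<in> poly_ring n" if "g \<in> Y" for g using insert.prems(3) that by blast
  qed
  then show ?case
    unfolding prod.insert[OF insert.hyps] c'_def perm_act_id mult.assoc .
qed

lemma moved_point_avoiding:
  assumes g: "g \<in> G" "g \<noteq> id" "a \<noteq> b" "g \<noteq> swap a b"
  shows "\<exists>k\<in>{1..n}. g k \<noteq> k \<and> {k, g k} \<noteq> {a, b}"
proof (rule ccontr)
  assume "\<not> ?thesis"
  then have all: "{k, g k} = {a, b}" if "g k \<noteq> k" for k
    using that permutes[OF g(1)] unfolding permutes_def by metis
  obtain k where k: "g k \<noteq> k" using g(2) by fastforce
  then have "g (g k) \<noteq> g k" using inj_mem[OF g(1)] by (simp add: inj_eq)
  from all[OF k] all[OF this] k \<open>g (g k) \<noteq> g k\<close> have gk: "g a = b" "g b = a" by (auto simp: doubleton_eq_iff)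
  have "g = swap a b"
  proof
    fix x show "g x = swap a b x" using all[of x] gk by (cases "x = a \<or> x = b") (auto simp: doubleton_eq_iff)
  qed
  with g(4) show False by simp
qed

text \<open>A generator \<open>h\<close> divides every sign trace, since for \<open>2 \<noteq> 0\<close> all sign semi-invariants lie in the module. Eliminating all
  group elements but the identity shows that \<open>h\<close> divides \<open>\<Prod>\<^bsub>g\<noteq>1\<^esub> (x\<^bsub>k(g)\<^esub> - x\<^bsub>g(k(g))\<^esub>)\<close> for every choice of
  \<open>k(g)\<close>. Unless \<open>g = (a b)\<close>, one can choose \<open>k(g)\<close> such that the factor of \<open>g\<close> is not associated to \<open>x\<^sub>a - x\<^sub>b\<close>; so
  only the differences belonging to transpositions of \<open>G\<close> occur in \<open>h\<close>, each once.\<close>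

lemma generator_degree:
  fixes h :: "'k mpol"
  assumes h: "h \<in> can_ideal n G" "h \<noteq> 0" "homogeneous d h"
    and gen: "\<And>e f. f \<in> can_ideal n G \<Longrightarrow> homogeneous e f \<Longrightarrow> h dvd f"
  shows "d = int (card (transp_pairs n G))"
proof -
  have trace: "h dvd char_trace sgn_char G u" if u: "u \<in> poly_ring n" for u
  proof -
    have "h dvd hcomp e (char_trace sgn_char G u)" for e
    proof (rule gen[OF _ homogeneous_hcomp])
      have "semi_inv sgn_char G (char_trace sgn_char G u)" by (rule char_trace_semi_inv[OF pm_char_sgn])
      then have "semi_inv sgn_char G (hcomp e (char_trace sgn_char G u))"
        unfolding semi_inv_def by (metis hcomp_const_mult hcomp_perm_act)
      then show "hcomp e (char_trace sgn_char G u) \<in> can_ideal n G"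
        using u by (intro can_ideal_semi_inv poly_ring_hcomp char_trace_in_poly_ring)
    qed
    then show ?thesis by (subst poly_eq_sum_hcomp) (rule dvd_sum)
  qed
  have prod: "h dvd (\<Prod>g\<in>G - {id}. var (k g) - var (g (k g)))" if k: "\<And>g. g \<in> G - {id} \<Longrightarrow> k g \<in> {1..n}" for k
  proof -
    have "h dvd const (sgn_char id) * (\<Prod>g\<in>G - {id}. var (k g) - perm_act g (var (k g)))"
    proof (rule dedekind_elimination)
      show "h dvd (\<Sum>g\<in>insert id (G - {id}). const (sgn_char g) * perm_act g u)" if "u \<in> poly_ring n" for u
        using trace[OF that] by (simp add: char_trace_def insert_absorb)
    qed (use k in \<open>auto intro!: var_in_poly_ring simp del: atLeastAtMost_iff\<close>)
    then show ?thesis by simp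
  qed
  obtain h' where h': "h = transp_prod n G * h'" using transp_prod_dvd[OF h(1)] by (rule dvdE)
  have "h' dvd 1"
  proof (rule ccontr)
    assume nonunit: "\<not> h' dvd 1"
    have "\<exists>k\<in>{1..n}. g k \<noteq> k" if "g \<in> G - {id}" for g
    proof -
      have "\<exists>k. g k \<noteq> k" using that by (auto simp: fun_eq_iff)
      then show ?thesis using permutes[of g] that unfolding permutes_def by blast
    qed
    then obtain k where k: "\<And>g. g \<in> G - {id} \<Longrightarrow> k g \<in> {1..n} \<and> g (k g) \<noteq> k g" by metis
    have "h dvd (\<Prod>g\<in>G - {id}. var (k g) - var (g (k g)))" by (rule prod) (simp only: k)
    then have h'_dvd: "h' dvd (\<Prod>g\<in>G - {id}. var (k g) - var (g (k g)))"
      unfolding h' by (rule dvd_mult_right)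
    have "\<exists>g0\<in>G - {id}. (var (k g0) - var (g0 (k g0))) dvd h'"
    proof (rule ccontr)
      assume none: "\<not> ?thesis"
      have "h' dvd 1"
      proof (rule dvd_prod_primes_unit[OF _ _ h'_dvd])
        fix g assume g: "g \<in> G - {id}"
        then have "k g \<noteq> g (k g)" using k[OF g] by simp
        then show "prime_elem (var (k g) - var (g (k g)) :: 'k mpol) \<and> \<not> (var (k g) - var (g (k g))) dvd h'"
          using none g prime_diff_var by blast
      qed simp
      with nonunit show False by simp
    qed
    then obtain g0 where g0: "g0 \<in> G - {id}" "(var (k g0) - var (g0 (k g0))) dvd h'" by blast
    define a where "a = k g0"
    define b where "b = g0 (k g0)"
    have ab: "a \<noteq> b" "a \<in> {1..n}" using k[OF g0(1)] by (auto simp: a_def b_def)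
    let ?p = "var a - var b :: 'k mpol" and ?\<tau> = "swap a b"
    have p: "prime_elem ?p" "?p dvd h'" using prime_diff_var[OF ab(1)] g0(2) by (auto simp: a_def b_def)
    have "\<exists>k\<in>{1..n}. g k \<noteq> k \<and> {k, g k} \<noteq> {a, b}" if "g \<in> G - {id, ?\<tau>}" for g
      using that ab by (intro moved_point_avoiding) auto
    then obtain k0 where k0: "\<And>g. g \<in> G - {id, ?\<tau>} \<Longrightarrow> k0 g \<in> {1..n} \<and> g (k0 g) \<noteq> k0 g \<and> {k0 g, g (k0 g)} \<noteq> {a, b}"
      by metis
    define l where "l g = (if g = ?\<tau> then a else k0 g)" for g
    have hl: "h dvd (\<Prod>g\<in>G - {id}. var (l g) - var (g (l g)))" using k0 ab by (intro prod) (auto simp: l_def)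
    let ?Q = "\<Prod>g\<in>G - {id, ?\<tau>}. var (l g) - var (g (l g)) :: 'k mpol"
    have "?p dvd ?Q"
    proof (cases "?\<tau> \<in> G")
      case True
      have "?\<tau> \<noteq> id" using ab by (simp add: transpose_eq_id_iff)
      then have split: "G - {id} = insert ?\<tau> (G - {id, ?\<tau>})" using True by auto
      have "(\<Prod>g\<in>insert ?\<tau> (G - {id, ?\<tau>}). var (l g) - var (g (l g))) = (var (l ?\<tau>) - var (?\<tau> (l ?\<tau>))) * ?Q"
        by (rule prod.insert) auto
      moreover have "l ?\<tau> = a" "?\<tau> a = b" by (simp_all add: l_def)
      ultimately have peq: "(\<Prod>g\<in>G - {id}. var (l g) - var (g (l g))) = ?p * ?Q" by (simp only: split)
      have "?p dvd transp_prod n G"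
      proof -
        have r: "a \<in> {1..n}" "b \<in> {1..n}" using transpose_mem_range True ab by blast+
        have fin: "finite (transp_pairs n G)" by (rule finite_subset[OF transp_pairs_subset finite_pairs])
        have "(min a b, max a b) \<in> transp_pairs n G"
          using True ab r by (auto simp: transp_pairs_def pairs_def min_def max_def transpose_commute)
        then have "diff_pair (min a b, max a b) dvd (transp_prod n G :: 'k mpol)"
          unfolding transp_prod_def by (intro dvd_prodI fin)
        moreover have "diff_pair (min a b, max a b) = ?p \<or> diff_pair (min a b, max a b) = - ?p"
          by (simp add: min_def max_def)
        then have "?p dvd diff_pair (min a b, max a b)" by (metis dvd_minus_iff dvd_refl)
        ultimately show ?thesis by (rule dvd_trans[rotated])
      qed
      then have "?p * ?p dvd h" using p(2) unfolding h' by (rule mult_dvd_mono)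
      then have "?p * ?p dvd ?p * ?Q" using hl unfolding peq by (rule dvd_trans)
      then show ?thesis using ab by (simp add: var_inject)
    next
      case False
      then have "G - {id} = G - {id, ?\<tau>}" by auto
      then have "h dvd ?Q" using hl by simp
      moreover have "?p dvd h" unfolding h' using p(2) by simp
      ultimately show ?thesis by (rule dvd_trans[rotated])
    qed
    then have "\<exists>g\<in>G - {id, ?\<tau>}. ?p dvd var (l g) - var (g (l g))"
      by (rule prime_elem_dvd_prodD[OF _ p(1), rotated]) simp
    then obtain g where g: "g \<in> G - {id, ?\<tau>}" "?p dvd var (l g) - var (g (l g))" by blast
    then show False
      using k0[OF g(1)] diff_var_not_dvd[OF ab(1), of "k0 g" "g (k0 g)", where ?'k = 'k] by (simp add: l_def)
  qed
  moreover have "homogeneous (d - int (card (transp_pairs n G))) h'"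
    using homogeneous_quotient[OF _ transp_prod_props(2,1), of d n G h'] h(3) h' by simp
  ultimately show ?thesis using homogeneous_unit by fastforce
qed

end

end

section \<open>The degree of the Hilbert series\<close>

definition fixed_exps :: "nat set \<Rightarrow> (nat \<Rightarrow> nat) \<Rightarrow> nat \<Rightarrow> (nat \<Rightarrow>\<^sub>0 nat) set" where
  "fixed_exps I \<sigma> d = {m. keys m \<subseteq> I \<and> (\<forall>i. lookup m (\<sigma> i) = lookup m i) \<and> mon_deg m = d}"

lemma push_eq_iff:
  assumes "bij \<sigma>"
  shows "push \<sigma> m = m \<longleftrightarrow> (\<forall>i. lookup m (\<sigma> i) = lookup m i)"
proof
  assume "push \<sigma> m = m"
  then show "\<forall>i. lookup m (\<sigma> i) = lookup m i" using lookup_push[of \<sigma> m] assms by (simp add: bij_is_inj)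
next
  assume *: "\<forall>i. lookup m (\<sigma> i) = lookup m i"
  show "push \<sigma> m = m"
  proof (rule poly_mapping_eqI)
    fix j
    obtain i where "j = \<sigma> i" using assms by (metis bij_is_surj surjD)
    then show "lookup (push \<sigma> m) j = lookup m j" using * assms by (simp add: lookup_push bij_is_inj)
  qed
qed

lemma cycle_decomp_permutes: "cycle_decomp I p \<Longrightarrow> p permutes I \<and> finite I"
proof (induction rule: cycle_decomp.induct)
  case (comp I p cs)
  have "cycle_of_list cs permutes (set cs \<union> I)" by (rule permutes_subset[OF cycle_permutes]) auto
  moreover have "p permutes (set cs \<union> I)" using comp.IH by (auto intro: permutes_subset)
  ultimately show ?case using comp.IH permutes_compose[of p "set cs \<union> I" "cycle_of_list cs"] by blast
qed (auto simp: permutes_id)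

lemma cycle_constant:
  assumes "distinct cs" "\<And>a. a \<in> set cs \<Longrightarrow> f (cycle_of_list cs a) = f a" "a \<in> set cs"
  shows "f a = f (hd cs)"
proof -
  have rot: "cycle_of_list cs (cs ! i) = cs ! (Suc i mod length cs)" if "i < length cs" for i
  proof -
    have "cycle_of_list cs (cs ! i) = map (cycle_of_list cs) cs ! i" using that by simp
    also have "\<dots> = rotate1 cs ! i" using cyclic_rotation[OF assms(1), of 1] by (simp add: One_nat_def)
    finally show ?thesis using that by (simp add: nth_rotate1)
  qed
  have "f (cs ! i) = f (cs ! 0)" if "i < length cs" for i using that
  proof (induction i)
    case (Suc i)
    then have "f (cs ! Suc i) = f (cycle_of_list cs (cs ! i))" by (simp add: rot)
    also have "\<dots> = f (cs ! i)" using Suc.prems by (intro assms(2)) simp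
    finally show ?case using Suc by simp
  qed simp
  then show ?thesis using assms(3) by (metis hd_conv_nth in_set_conv_nth list.set_cases neq_Nil_conv)
qed

lemma sign_cycle: "distinct cs \<Longrightarrow> cs \<noteq> [] \<Longrightarrow> sign (cycle_of_list cs) = (-1) ^ (length cs - 1)"
proof (induction cs rule: cycle_of_list.induct)
  case (1 i j cs)
  have comp: "sign (swap i j \<circ> cycle_of_list (j # cs))
      = sign (swap i j) * sign (cycle_of_list (j # cs))"
    by (intro sign_compose permutation_swap_id permutation_of_cycle)
  have IH: "sign (cycle_of_list (j # cs)) = (-1) ^ length cs" using 1 by simp
  have swap: "sign (swap i j) = -1" using 1 by (simp add: sign_swap_id)
  show ?case unfolding cycle_of_list.simps(1) comp IH swap by simp
qed (simp_all add: sign_id[unfolded id_def] id_def)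

definition fixed_series :: "nat set \<Rightarrow> (nat \<Rightarrow> nat) \<Rightarrow> rat fps" where
  "fixed_series I \<sigma> = Abs_fps (\<lambda>d. of_nat (card (fixed_exps I \<sigma> d)))"

text \<open>Fixed exponent vectors are constant on each cycle. Splitting off one cycle of length \<open>l\<close> multiplies the generating
  function by \<open>1 / (1 - X\<^sup>l)\<close>.\<close>

lemma card_fixed_exps_cycle:
  assumes p: "p permutes I" "finite I" and cs: "distinct cs" "cs \<noteq> []" "set cs \<inter> I = {}" and I: "set cs \<union> I \<subseteq> {1..n}"
  shows "card (fixed_exps (set cs \<union> I) (cycle_of_list cs \<circ> p) d)
    = card (fixed_exps I p d)
      + (if length cs \<le> d then card (fixed_exps (set cs \<union> I) (cycle_of_list cs \<circ> p) (d - length cs)) else 0)"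
proof -
  define \<sigma> where "\<sigma> = cycle_of_list cs \<circ> p"
  define c where "c = (\<Sum>a\<in>set cs. single a (1::nat))"
  let ?J = "set cs \<union> I" and ?a = "hd cs" and ?l = "length cs"
  have look_c: "lookup c i = (if i \<in> set cs then 1 else 0)" for i
    by (simp add: c_def lookup_sum lookup_single when_def)
  have deg_c: "mon_deg c = ?l"
  proof -
    have "keys c \<subseteq> set cs" by (auto simp: in_keys_iff look_c split: if_splits)
    then show ?thesis using cs(1) by (simp add: mon_deg_superset[of "set cs"] look_c distinct_card)
  qed
  have \<sigma>_cs: "\<sigma> a = cycle_of_list cs a" if "a \<in> set cs" for a
  proof -
    have "a \<notin> I" using cs(3) that by blast
    then show ?thesis by (simp add: \<sigma>_def permutes_not_in[OF p(1)])
  qed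
  have \<sigma>_I: "\<sigma> i = p i" if "i \<in> I" for i
    using permutes_in_image[OF p(1), of i] that cs(3) id_outside_supp[of "p i" cs] by (auto simp: \<sigma>_def)
  have \<sigma>_out: "\<sigma> i = i" "p i = i" if "i \<notin> ?J" for i
    using permutes_not_in[OF p(1), of i] that id_outside_supp[of i cs] by (auto simp: \<sigma>_def)
  have cyc_in: "cycle_of_list cs a \<in> set cs" if "a \<in> set cs" for a
    using that permutes_in_image[OF cycle_permutes] by metis
  have const_cs: "lookup m a = lookup m ?a" if "\<forall>i. lookup m (\<sigma> i) = lookup m i" "a \<in> set cs" for m :: "nat \<Rightarrow>\<^sub>0 nat" and a
    using cycle_constant[OF cs(1), of "lookup m" a] that by (simp flip: \<sigma>_cs)
  have c_\<sigma>: "lookup c (\<sigma> i) = lookup c i" for i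
  proof -
    consider "i \<in> set cs" | "i \<in> I" | "i \<notin> ?J" by blast
    then show ?thesis
    proof cases
      case 2
      then have "p i \<in> I" using permutes_in_image[OF p(1)] by simp
      then show ?thesis using 2 cs(3) by (auto simp: \<sigma>_I look_c)
    qed (auto simp: \<sigma>_cs \<sigma>_out look_c cyc_in)
  qed
  have zero: "{m \<in> fixed_exps ?J \<sigma> d. lookup m ?a = 0} = fixed_exps I p d"
  proof (intro equalityI subsetI)
    fix m assume m: "m \<in> {m \<in> fixed_exps ?J \<sigma> d. lookup m ?a = 0}"
    then have "lookup m a = 0" if "a \<in> set cs" for a using const_cs[of m a] that by (auto simp: fixed_exps_def)
    then have "keys m \<subseteq> I" using m by (auto simp: fixed_exps_def in_keys_iff)
    moreover have "lookup m (p i) = lookup m i" for i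
    proof (cases "i \<in> I")
      case True
      then show ?thesis using m by (simp add: fixed_exps_def flip: \<sigma>_I)
    qed (simp add: permutes_not_in[OF p(1)])
    ultimately show "m \<in> fixed_exps I p d" using m by (simp add: fixed_exps_def)
  next
    fix m assume m: "m \<in> fixed_exps I p d"
    then have cs0: "lookup m a = 0" if "a \<in> set cs" for a
      using that cs(3) by (auto simp: fixed_exps_def in_keys_iff)
    have "lookup m (\<sigma> i) = lookup m i" for i
    proof -
      consider "i \<in> set cs" | "i \<in> I" | "i \<notin> ?J" by blast
      then show ?thesis by cases (use m in \<open>auto simp: \<sigma>_cs \<sigma>_I \<sigma>_out cs0 cyc_in fixed_exps_def\<close>)
    qed
    then show "m \<in> {m \<in> fixed_exps ?J \<sigma> d. lookup m ?a = 0}" using m cs0 cs(2) by (auto simp: fixed_exps_def)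
  qed
  have le: "lookup c i \<le> lookup m i" if "m \<in> fixed_exps ?J \<sigma> d" "lookup m ?a > 0" for m i
    using const_cs[of m i] that by (auto simp: look_c fixed_exps_def)
  have split: "m - c + c = m" if "m \<in> fixed_exps ?J \<sigma> d" "lookup m ?a > 0" for m
    by (rule poly_mapping_eqI) (use le[OF that] in \<open>simp add: lookup_add lookup_minus\<close>)
  have pos: "card {m \<in> fixed_exps ?J \<sigma> d. lookup m ?a > 0} = (if ?l \<le> d then card (fixed_exps ?J \<sigma> (d - ?l)) else 0)"
  proof (cases "?l \<le> d")
    case True
    have "bij_betw (\<lambda>m. m - c) {m \<in> fixed_exps ?J \<sigma> d. lookup m ?a > 0} (fixed_exps ?J \<sigma> (d - ?l))"
    proof (rule bij_betw_byWitness[where f' = "\<lambda>m. m + c"])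
      show "(\<lambda>m. m - c) ` {m \<in> fixed_exps ?J \<sigma> d. lookup m ?a > 0} \<subseteq> fixed_exps ?J \<sigma> (d - ?l)"
      proof (rule image_subsetI)
        fix m assume m: "m \<in> {m \<in> fixed_exps ?J \<sigma> d. lookup m ?a > 0}"
        have "mon_deg (m - c) + ?l = d"
          using arg_cong[OF split[of m], of mon_deg] m by (simp add: deg_c fixed_exps_def)
        moreover have "keys (m - c) \<subseteq> keys m" by (auto simp: in_keys_iff lookup_minus)
        ultimately show "m - c \<in> fixed_exps ?J \<sigma> (d - ?l)"
          using m by (auto simp: fixed_exps_def lookup_minus c_\<sigma>)
      qed
      show "(\<lambda>m. m + c) ` fixed_exps ?J \<sigma> (d - ?l) \<subseteq> {m \<in> fixed_exps ?J \<sigma> d. lookup m ?a > 0}"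
      proof (rule image_subsetI)
        fix m assume m: "m \<in> fixed_exps ?J \<sigma> (d - ?l)"
        have "keys (m + c) \<subseteq> ?J"
        proof -
          have "keys c \<subseteq> set cs" by (auto simp: in_keys_iff look_c split: if_splits)
          then show ?thesis using m keys_add[of m c] by (auto simp: fixed_exps_def)
        qed
        then show "m + c \<in> {m \<in> fixed_exps ?J \<sigma> d. lookup m ?a > 0}"
          using m True cs(2) by (simp add: fixed_exps_def lookup_add c_\<sigma> deg_c) (simp add: look_c)
      qed
    qed (use split in auto)
    then show ?thesis using True by (simp add: bij_betw_same_card)
  next
    case False
    have "m \<notin> fixed_exps ?J \<sigma> d \<or> \<not> lookup m ?a > 0" for m
      using arg_cong[OF split[of m], of mon_deg] False by (auto simp: deg_c fixed_exps_def)
    then have "{m \<in> fixed_exps ?J \<sigma> d. lookup m ?a > 0} = {}" by blast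
    then show ?thesis using False by (simp only: card.empty if_False)
  qed
  have fin: "finite (fixed_exps ?J \<sigma> d)"
    using I by (intro finite_subset[OF _ finite_exps[of n "int d"]]) (auto simp: fixed_exps_def exps_def simp del: atLeastAtMost_iff)
  have "fixed_exps ?J \<sigma> d = {m \<in> fixed_exps ?J \<sigma> d. lookup m ?a = 0} \<union> {m \<in> fixed_exps ?J \<sigma> d. lookup m ?a > 0}"
    by auto
  then have "card (fixed_exps ?J \<sigma> d)
      = card {m \<in> fixed_exps ?J \<sigma> d. lookup m ?a = 0} + card {m \<in> fixed_exps ?J \<sigma> d. lookup m ?a > 0}"
    using fin by (subst card_Un_disjoint[symmetric]) (auto intro: finite_subset[OF _ fin])
  then show ?thesis unfolding zero pos unfolding \<sigma>_def .
qed

text \<open>The denominator \<open>D\<close> is \<open>det (1 - t \<sigma>)\<close>; its coefficients read backwards are \<open>(-1)\<^sup>n sign \<sigma>\<close> times its coefficients.\<close>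

lemma fixed_series_denominator:
  assumes "cycle_decomp I \<sigma>" "I \<subseteq> {1..n}"
  shows "\<exists>D :: rat poly. degree D = card I \<and> coeff D 0 = 1 \<and>
    reflect_poly D = smult ((-1) ^ card I * of_int (sign \<sigma>)) D \<and> fixed_series I \<sigma> * fps_of_poly D = 1"
  using assms
proof (induction rule: cycle_decomp.induct)
  case empty
  have "fixed_exps {} id d = (if d = 0 then {0} else {})" for d by (auto simp: fixed_exps_def)
  then have "fixed_series {} id = 1" by (intro fps_ext) (simp add: fixed_series_def)
  then show ?case by (intro exI[of _ 1]) (simp add: id_def)
next
  case (comp I p cs)
  then obtain D :: "rat poly" where D: "degree D = card I" "coeff D 0 = 1"
    "reflect_poly D = smult ((-1) ^ card I * of_int (sign p)) D" "fixed_series I p * fps_of_poly D = 1" by auto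
  have p: "p permutes I" "finite I" using cycle_decomp_permutes[OF comp.hyps(1)] by auto
  show ?case
  proof (cases "cs = []")
    case True
    then show ?thesis using D by (auto simp: id_def o_def)
  next
    case False
    let ?l = "length cs" and ?\<sigma> = "cycle_of_list cs \<circ> p"
    have l: "?l \<ge> 1" using False by (cases cs) auto
    define C :: "rat poly" where "C = 1 - monom 1 ?l"
    have coeff_C: "coeff C i = (if i = 0 then 1 else 0) - (if i = ?l then 1 else 0)" for i
      by (simp add: C_def coeff_1)
    have deg_C: "degree C = ?l" using l by (intro antisym degree_le le_degree) (auto simp: coeff_C)
    have C0: "C \<noteq> 0" using l deg_C by auto
    have refl_C: "reflect_poly C = - C"
      using l by (intro poly_eqI) (auto simp: coeff_reflect_poly deg_C coeff_C)
    have D0: "D \<noteq> 0" using D(2) by auto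
    have card: "card (set cs \<union> I) = ?l + card I"
      using comp.hyps p by (subst card_Un_disjoint) (auto simp: distinct_card)
    have perm: "permutation p" using p by (auto simp: permutation_permutes)
    have "sign ?\<sigma> = (-1) ^ (?l - 1) * sign p"
      using sign_cycle[OF comp.hyps(2) False] by (simp add: sign_compose permutation_of_cycle perm)
    then have sg: "of_int (sign ?\<sigma>) = (-1) ^ (?l - 1) * (of_int (sign p) :: rat)" by simp
    have pw: "(-1::rat) ^ (?l + card I) = - ((-1) ^ (?l - 1) * (-1) ^ card I)"
      using l by (cases ?l) (auto simp: power_add)
    have sq: "(-1::rat) ^ (?l - 1) * (-1) ^ (?l - 1) = 1" by (simp flip: power_mult_distrib)
    then have "(-1::rat) ^ (?l - 1) * ((-1) ^ (?l - 1) * y) = y" for y by (simp flip: mult.assoc)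
    with sq have sgn: "(-1) ^ card (set cs \<union> I) * of_int (sign ?\<sigma>) = - ((-1) ^ card I * of_int (sign p) :: rat)"
      unfolding sg card pw by (simp add: mult_ac)
    have "fixed_series (set cs \<union> I) ?\<sigma> * fps_of_poly C = fixed_series I p"
    proof (rule fps_ext)
      fix d
      have eqC: "fps_of_poly C = 1 - fps_X ^ ?l" by (simp add: C_def fps_of_poly_diff fps_of_poly_monom)
      have "(fixed_series (set cs \<union> I) ?\<sigma> * fps_of_poly C) $ d
          = fixed_series (set cs \<union> I) ?\<sigma> $ d - (if d < ?l then 0 else fixed_series (set cs \<union> I) ?\<sigma> $ (d - ?l))"
        unfolding eqC by (simp add: right_diff_distrib fps_X_power_mult_right_nth)
      also have "\<dots> = fixed_series I p $ d"
        using card_fixed_exps_cycle[OF p comp.hyps(2) False comp.hyps(3) comp.prems, of d] by (simp add: fixed_series_def)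
      finally show "(fixed_series (set cs \<union> I) ?\<sigma> * fps_of_poly C) $ d = fixed_series I p $ d" .
    qed
    then have "fixed_series (set cs \<union> I) ?\<sigma> * fps_of_poly (C * D) = 1"
      using D(4) by (simp add: fps_of_poly_mult flip: mult.assoc)
    moreover have "reflect_poly (C * D) = smult ((-1) ^ card (set cs \<union> I) * of_int (sign ?\<sigma>)) (C * D)"
      unfolding sgn by (simp add: reflect_poly_mult refl_C D(3))
    moreover have "degree (C * D) = card (set cs \<union> I)" using C0 D0 by (simp add: degree_mult_eq deg_C D(1) card)
    moreover have "coeff (C * D) 0 = 1" using False by (simp add: coeff_mult coeff_C D(2))
    ultimately show ?thesis by blast
  qed
qed

context perm_group
begin

interpretation S: perm_group n "full_sym n" by (rule perm_group_full)

definition exp_orbit :: "(nat \<Rightarrow>\<^sub>0 nat) \<Rightarrow> (nat \<Rightarrow>\<^sub>0 nat) set" where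
  "exp_orbit m = (\<lambda>\<sigma>. push \<sigma> m) ` G"

definition exp_stab :: "(nat \<Rightarrow>\<^sub>0 nat) \<Rightarrow> (nat \<Rightarrow> nat) set" where
  "exp_stab m = {\<sigma> \<in> G. push \<sigma> m = m}"

lemma exp_orbit_self: "m \<in> exp_orbit m" by (auto simp: exp_orbit_def intro!: image_eqI[of _ _ id])

lemma exp_orbit_eqI: "m' \<in> exp_orbit m \<Longrightarrow> exp_orbit m' = exp_orbit m"
proof -
  assume "m' \<in> exp_orbit m"
  then obtain \<tau> where \<tau>: "\<tau> \<in> G" "m' = push \<tau> m" by (auto simp: exp_orbit_def)
  have "exp_orbit m' = (\<lambda>\<sigma>. push \<sigma> m) ` ((\<lambda>\<sigma>. \<sigma> \<circ> \<tau>) ` G)"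
    by (simp add: exp_orbit_def \<tau>(2) push_comp image_image)
  also have "(\<lambda>\<sigma>. \<sigma> \<circ> \<tau>) ` G = G" using bij_comp_right[OF \<tau>(1)] by (simp add: bij_betw_def)
  finally show ?thesis by (simp add: exp_orbit_def)
qed

lemma push_exps: "\<sigma> \<in> G \<Longrightarrow> m \<in> exps n d \<Longrightarrow> push \<sigma> m \<in> exps n d"
proof -
  assume "\<sigma> \<in> G" "m \<in> exps n d"
  moreover have "\<sigma> ` keys m \<subseteq> \<sigma> ` {1..n}" if "keys m \<subseteq> {1..n}" using that by (rule image_mono)
  ultimately show ?thesis
    using keys_push[of \<sigma> m] permutes_image[OF permutes[of \<sigma>]] by (auto simp: exps_def simp del: atLeastAtMost_iff)
qed

lemma exp_orbit_subset: "m \<in> exps n d \<Longrightarrow> exp_orbit m \<subseteq> exps n d" using push_exps by (auto simp: exp_orbit_def)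

lemma finite_exp_orbit [simp]: "finite (exp_orbit m)" by (simp add: exp_orbit_def)

text \<open>\<open>G\<close> is the disjoint union over \<open>m'\<close> of the sets \<open>{\<sigma>. \<sigma> m = m'}\<close>, which are cosets of stabilizers.\<close>

lemma sum_card_stab_orbit: "(\<Sum>m'\<in>exp_orbit m. card (exp_stab m')) = card G"
proof -
  have "card (exp_stab m') = card {\<sigma> \<in> G. push \<sigma> m = m'}" if "m' \<in> exp_orbit m" for m'
  proof -
    from that obtain \<tau> where \<tau>: "\<tau> \<in> G" "m' = push \<tau> m" by (auto simp: exp_orbit_def)
    have "bij_betw (\<lambda>\<sigma>. \<sigma> \<circ> \<tau>) (exp_stab m') {\<sigma> \<in> G. push \<sigma> m = m'}"
    proof (rule bij_betw_byWitness[where f' = "\<lambda>\<sigma>. \<sigma> \<circ> inv' \<tau>"])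
      show "\<forall>\<sigma>\<in>exp_stab m'. \<sigma> \<circ> \<tau> \<circ> inv' \<tau> = \<sigma>" "\<forall>\<sigma>\<in>{\<sigma> \<in> G. push \<sigma> m = m'}. \<sigma> \<circ> inv' \<tau> \<circ> \<tau> = \<sigma>"
        by (simp_all add: comp_assoc inv_comp_mem[OF \<tau>(1)])
      show "(\<lambda>\<sigma>. \<sigma> \<circ> \<tau>) ` exp_stab m' \<subseteq> {\<sigma> \<in> G. push \<sigma> m = m'}"
        using \<tau> by (auto simp: exp_stab_def comp_mem simp flip: push_comp)
      show "(\<lambda>\<sigma>. \<sigma> \<circ> inv' \<tau>) ` {\<sigma> \<in> G. push \<sigma> m = m'} \<subseteq> exp_stab m'"
      proof (rule image_subsetI)
        fix \<sigma> assume \<sigma>: "\<sigma> \<in> {\<sigma> \<in> G. push \<sigma> m = m'}"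
        have "push (\<sigma> \<circ> inv' \<tau>) m' = push \<sigma> (push (inv' \<tau>) (push \<tau> m))"
          by (simp only: push_comp[symmetric] \<tau>(2))
        also have "\<dots> = m'" using \<sigma> by (simp add: push_inv bij_mem[OF \<tau>(1)])
        finally show "\<sigma> \<circ> inv' \<tau> \<in> exp_stab m'" using \<sigma> \<tau>(1) by (simp add: exp_stab_def comp_mem inv_mem)
      qed
    qed
    then show ?thesis by (rule bij_betw_same_card)
  qed
  then have "(\<Sum>m'\<in>exp_orbit m. card (exp_stab m')) = (\<Sum>m'\<in>exp_orbit m. card {\<sigma> \<in> G. push \<sigma> m = m'})" by simp
  also have "\<dots> = card G"
    using sum.image_gen[OF finite_group, of "\<lambda>_. 1::nat" "\<lambda>\<sigma>. push \<sigma> m"] by (simp add: exp_orbit_def)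
  finally show ?thesis .
qed

lemma lookup_invariant:
  "f \<in> invariant_ring n G \<Longrightarrow> m' \<in> exp_orbit m \<Longrightarrow> lookup f m' = lookup f m"
proof -
  assume f: "f \<in> invariant_ring n G" and "m' \<in> exp_orbit m"
  then obtain \<sigma> where \<sigma>: "\<sigma> \<in> G" "m' = push \<sigma> m" by (auto simp: exp_orbit_def)
  show "lookup f m' = lookup f m"
    using lookup_perm_act[OF inj_mem[OF \<sigma>(1)], of f m] by (simp add: \<sigma>(2) invariantD(1)[OF f \<sigma>(1)])
qed

definition orbit_sum :: "(nat \<Rightarrow>\<^sub>0 nat) set \<Rightarrow> 'k::field mpol" where
  "orbit_sum B = (\<Sum>m\<in>B. mon m)"

lemma lookup_orbit_sum: "finite B \<Longrightarrow> lookup (orbit_sum B) m = (if m \<in> B then 1 else 0)"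
  by (simp add: orbit_sum_def lookup_sum lookup_mon if_distrib cong: if_cong)

lemma orbit_sum_invariant:
  assumes "m \<in> exps n d"
  shows "orbit_sum (exp_orbit m) \<in> graded_part (invariant_ring n G :: 'k::field mpol set) d"
proof -
  have "perm_act \<sigma> (orbit_sum (exp_orbit m)) = (orbit_sum (exp_orbit m) :: 'k mpol)" if \<sigma>: "\<sigma> \<in> G" for \<sigma>
  proof -
    have "push \<sigma> ` exp_orbit m = exp_orbit m"
    proof -
      have "push \<sigma> ` exp_orbit m = (\<lambda>\<tau>. push \<tau> m) ` ((\<circ>) \<sigma> ` G)"
        by (simp add: exp_orbit_def image_image push_comp)
      also have "(\<circ>) \<sigma> ` G = G" using bij_comp_left[OF \<sigma>] by (simp add: bij_betw_def)
      finally show ?thesis by (simp add: exp_orbit_def)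
    qed
    moreover have "inj_on (push \<sigma>) (exp_orbit m)" using inj_push[OF inj_mem[OF \<sigma>]] by (rule inj_on_subset) simp
    then have "(\<Sum>i\<in>exp_orbit m. mon (push \<sigma> i)) = (\<Sum>i\<in>push \<sigma> ` exp_orbit m. mon i :: 'k mpol)"
      by (simp add: sum.reindex)
    ultimately show ?thesis by (simp add: orbit_sum_def perm_act_sum)
  qed
  moreover have "mon m' \<in> poly_ring n \<and> homogeneous d (mon m' :: 'k mpol)" if "m' \<in> exp_orbit m" for m'
    using exp_orbit_subset[OF assms] that homogeneous_mon[of m'] by (auto simp: exps_def simp del: atLeastAtMost_iff)
  ultimately show ?thesis
    unfolding graded_part_def invariant_ring_def
    by (auto simp: orbit_sum_def intro!: homogeneous_sum poly_ring_sum)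
qed

lemma dim_invariant_ring:
  "mp.dim (graded_part (invariant_ring n G :: 'k::field mpol set) d) = card (exp_orbit ` exps n d)"
proof (rule mp.dim_unique)
  let ?V = "graded_part (invariant_ring n G :: 'k mpol set) d" and ?O = "exp_orbit ` exps n d"
  let ?B = "orbit_sum ` ?O :: 'k mpol set"
  have finO: "finite ?O" by (simp add: finite_exps)
  have disj: "m \<in> C \<longleftrightarrow> C = exp_orbit m" if "C \<in> ?O" for C m using that exp_orbit_eqI exp_orbit_self by auto
  have finC: "finite C" if "C \<in> ?O" for C using that by auto
  have look: "lookup (\<Sum>C\<in>?O. const (u C) * orbit_sum C) m = u (exp_orbit m)" if "m \<in> exps n d" for u :: "_ \<Rightarrow> 'k" and m
  proof -
    have "lookup (\<Sum>C\<in>?O. const (u C) * orbit_sum C) m = (\<Sum>C\<in>?O. if C = exp_orbit m then u C else 0)"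
      unfolding lookup_sum by (intro sum.cong) (auto simp: lookup_orbit_sum[OF finC] disj)
    then show ?thesis using finO that by simp
  qed
  show "?B \<subseteq> ?V" using orbit_sum_invariant by auto
  have inj: "inj_on (orbit_sum :: _ \<Rightarrow> 'k mpol) ?O"
  proof (rule inj_onI)
    fix C C' assume C: "C \<in> ?O" "C' \<in> ?O" "orbit_sum C = (orbit_sum C' :: 'k mpol)"
    then obtain m where m: "m \<in> C" using exp_orbit_self by auto
    have "lookup (orbit_sum C' :: 'k mpol) m = 1" using C m by (simp add: lookup_orbit_sum[OF finC] flip: C(3))
    then have "m \<in> C'" using C finC by (simp add: lookup_orbit_sum split: if_splits)
    then show "C = C'" using disj C m by metis
  qed
  show "?V \<subseteq> mp.span ?B"
  proof
    fix f assume f: "f \<in> ?V"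
    have keys: "keys f \<subseteq> exps n d"
      using f graded_part_poly_ring[of f n d] by (auto simp: graded_part_def invariant_ring_def)
    define u where "u C = lookup f (SOME m. m \<in> C)" for C
    have u: "u (exp_orbit m) = lookup f m" if "m \<in> exps n d" for m
    proof -
      have "(SOME m'. m' \<in> exp_orbit m) \<in> exp_orbit m" using exp_orbit_self by (rule someI[of "\<lambda>m'. m' \<in> exp_orbit m"])
      then show ?thesis using lookup_invariant f by (auto simp: u_def graded_part_def)
    qed
    have "f = (\<Sum>C\<in>?O. const (u C) * orbit_sum C)"
    proof (rule poly_mapping_eqI)
      fix m
      show "lookup f m = lookup (\<Sum>C\<in>?O. const (u C) * orbit_sum C) m"
      proof (cases "m \<in> exps n d")
        case True
        then show ?thesis by (simp add: look u)
      next
        case False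
        have "lookup (\<Sum>C\<in>?O. const (u C) * orbit_sum C) m = (\<Sum>C\<in>?O. 0)"
          unfolding lookup_sum
        proof (rule sum.cong)
          fix C assume C: "C \<in> ?O"
          then have "m \<notin> C" using exp_orbit_subset False by auto
          then show "lookup (const (u C) * orbit_sum C) m = 0" using finC[OF C] by (simp add: lookup_orbit_sum)
        qed simp
        then show ?thesis using False keys by (auto simp: in_keys_iff)
      qed
    qed
    also have "\<dots> \<in> mp.span ?B" by (intro mp.span_sum mp.span_scale mp.span_base) auto
    finally show "f \<in> mp.span ?B" .
  qed
  show "mp.independent ?B"
  proof (rule mp.independent_if_scalars_zero)
    show "finite ?B" using finO by simp
    fix u :: "'k mpol \<Rightarrow> 'k" and x assume u: "(\<Sum>x\<in>?B. const (u x) * x) = 0" "x \<in> ?B"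
    then obtain m where m: "m \<in> exps n d" "x = orbit_sum (exp_orbit m)" by auto
    have "(\<Sum>C\<in>?O. const (u (orbit_sum C)) * orbit_sum C) = 0" using u(1) by (simp add: sum.reindex[OF inj])
    then show "u x = 0" using look[OF m(1), of "\<lambda>C. u (orbit_sum C)"] m by simp
  qed
  show "card ?B = card ?O" by (rule card_image[OF inj])
qed

lemma card_group_mult_orbits: "card G * card (exp_orbit ` exps n d) = (\<Sum>m\<in>exps n d. card (exp_stab m))"
proof -
  have "(\<Sum>m\<in>exps n d. card (exp_stab m)) = (\<Sum>C\<in>exp_orbit ` exps n d. \<Sum>m\<in>{m \<in> exps n d. exp_orbit m = C}. card (exp_stab m))"
    by (rule sum.image_gen[OF finite_exps])
  also have "\<dots> = (\<Sum>C\<in>exp_orbit ` exps n d. card G)"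
  proof (rule sum.cong)
    fix C assume "C \<in> exp_orbit ` exps n d"
    then obtain m where m: "m \<in> exps n d" "C = exp_orbit m" by blast
    have "{m' \<in> exps n d. exp_orbit m' = C} = exp_orbit m"
      using exp_orbit_self exp_orbit_eqI exp_orbit_subset[OF m(1)] m(2) by blast
    then show "(\<Sum>m\<in>{m \<in> exps n d. exp_orbit m = C}. card (exp_stab m)) = card G"
      by (simp add: sum_card_stab_orbit)
  qed simp
  finally show ?thesis by (simp add: mult.commute)
qed

lemma fixed_exps_eq: "\<sigma> \<in> G \<Longrightarrow> fixed_exps {1..n} \<sigma> d = {m \<in> exps n (int d). push \<sigma> m = m}"
  by (auto simp: fixed_exps_def exps_def push_eq_iff[OF bij_mem] simp del: atLeastAtMost_iff)

lemma sum_weight_fixed: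
  fixes w :: "(nat \<Rightarrow> nat) \<Rightarrow> rat"
  shows "(\<Sum>\<sigma>\<in>G. w \<sigma> * of_nat (card (fixed_exps {1..n} \<sigma> d))) = (\<Sum>m\<in>exps n (int d). \<Sum>\<sigma>\<in>exp_stab m. w \<sigma>)"
proof -
  have "(\<Sum>\<sigma>\<in>G. w \<sigma> * of_nat (card (fixed_exps {1..n} \<sigma> d))) = (\<Sum>\<sigma>\<in>G. \<Sum>m\<in>exps n (int d). if push \<sigma> m = m then w \<sigma> else 0)"
  proof (rule sum.cong)
    fix \<sigma> assume "\<sigma> \<in> G"
    then show "w \<sigma> * of_nat (card (fixed_exps {1..n} \<sigma> d)) = (\<Sum>m\<in>exps n (int d). if push \<sigma> m = m then w \<sigma> else 0)"
      by (simp add: fixed_exps_eq sum.inter_filter[OF finite_exps, symmetric])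
  qed simp
  also have "\<dots> = (\<Sum>m\<in>exps n (int d). \<Sum>\<sigma>\<in>G. if push \<sigma> m = m then w \<sigma> else 0)" by (rule sum.swap)
  also have "\<dots> = (\<Sum>m\<in>exps n (int d). \<Sum>\<sigma>\<in>exp_stab m. w \<sigma>)" by (simp add: exp_stab_def sum.inter_filter)
  finally show ?thesis .
qed

lemma molien: "of_nat (card G) * hilbert_series (invariant_ring n G :: 'k::field mpol set) = (\<Sum>\<sigma>\<in>G. fixed_series {1..n} \<sigma>)"
proof (rule fps_ext)
  fix d
  have "(of_nat (card G) * hilbert_series (invariant_ring n G :: 'k mpol set)) $ d
      = rat_of_nat (card G * card (exp_orbit ` exps n (int d)))"
    by (simp add: hilbert_series_def dim_invariant_ring fps_mult_of_nat_nth)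
  also have "\<dots> = (\<Sum>m\<in>exps n (int d). \<Sum>\<sigma>\<in>exp_stab m. 1)"
    unfolding card_group_mult_orbits by simp
  also have "\<dots> = (\<Sum>\<sigma>\<in>G. fixed_series {1..n} \<sigma>) $ d"
    using sum_weight_fixed[of "\<lambda>_. 1" d] by (simp add: fps_sum_nth fixed_series_def)
  finally show "(of_nat (card G) * hilbert_series (invariant_ring n G :: 'k mpol set)) $ d
      = (\<Sum>\<sigma>\<in>G. fixed_series {1..n} \<sigma>) $ d" .
qed

definition even_stab :: "(nat \<Rightarrow>\<^sub>0 nat) \<Rightarrow> bool" where
  "even_stab m \<longleftrightarrow> (\<forall>\<sigma>\<in>exp_stab m. evenperm \<sigma>)"

definition sgn_degree :: nat where
  "sgn_degree = (LEAST d. \<exists>m\<in>exps n (int d). even_stab m)"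

lemma exp_stab_group: "perm_group n (exp_stab m)"
proof
  fix \<sigma> \<tau> assume "\<sigma> \<in> exp_stab m" "\<tau> \<in> exp_stab m"
  then show "\<sigma> \<circ> \<tau> \<in> exp_stab m" by (auto simp: exp_stab_def comp_mem simp flip: push_comp)
next
  fix \<sigma> assume \<sigma>: "\<sigma> \<in> exp_stab m"
  then have "bij \<sigma>" by (simp add: exp_stab_def bij_mem)
  then have "push (inv' \<sigma>) (push \<sigma> m) = m" by (rule push_inv(2))
  with \<sigma> show "inv' \<sigma> \<in> exp_stab m" by (simp add: exp_stab_def inv_mem)
qed (auto simp: exp_stab_def permutes)

lemma sum_sign_stab: "(\<Sum>\<sigma>\<in>exp_stab m. rat_of_int (sign \<sigma>)) = (if even_stab m then of_nat (card (exp_stab m)) else 0)"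
proof (cases "even_stab m")
  case True
  then show ?thesis by (simp add: even_stab_def sign_def)
next
  case False
  interpret St: perm_group n "exp_stab m" by (rule exp_stab_group)
  obtain \<tau> where \<tau>: "\<tau> \<in> exp_stab m" "\<not> evenperm \<tau>" using False by (auto simp: even_stab_def)
  have "(\<Sum>\<sigma>\<in>exp_stab m. rat_of_int (sign \<sigma>)) = (\<Sum>\<sigma>\<in>exp_stab m. rat_of_int (sign (\<tau> \<circ> \<sigma>)))"
    by (rule sum.reindex_bij_betw[OF St.bij_comp_left[OF \<tau>(1)], symmetric])
  also have "\<dots> = - (\<Sum>\<sigma>\<in>exp_stab m. rat_of_int (sign \<sigma>))"
    using St.permutation_mem \<tau> by (simp add: sign_compose sum_negf sign_def[of \<tau>] cong: sum.cong)
  finally show ?thesis using False by simp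
qed

lemma sgn_degree_props:
  "\<exists>m\<in>exps n (int sgn_degree). even_stab m" "m \<in> exps n (int d) \<Longrightarrow> even_stab m \<Longrightarrow> sgn_degree \<le> d"
proof -
  have "even_stab (stair n)" by (auto simp: even_stab_def exp_stab_def push_stair[OF permutes])
  moreover have "stair n \<in> exps n (int (mon_deg (stair n)))" using keys_stair by (simp add: exps_def)
  ultimately have "\<exists>d. \<exists>m\<in>exps n (int d). even_stab m" by blast
  then show "\<exists>m\<in>exps n (int sgn_degree). even_stab m"
    unfolding sgn_degree_def by (rule LeastI_ex)
  show "m \<in> exps n (int d) \<Longrightarrow> even_stab m \<Longrightarrow> sgn_degree \<le> d"
    unfolding sgn_degree_def by (rule Least_le) blast
qed

lemma sign_series_coeff:
  fixes d
  defines "F \<equiv> \<Sum>\<sigma>\<in>G. fps_const (rat_of_int (sign \<sigma>)) * fixed_series {1..n} \<sigma>"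
  shows "d < sgn_degree \<Longrightarrow> F $ d = 0" "F $ sgn_degree \<noteq> 0"
proof -
  have F: "F $ d = (\<Sum>m\<in>exps n (int d). if even_stab m then of_nat (card (exp_stab m)) else 0)" for d
    using sum_weight_fixed[of "\<lambda>\<sigma>. of_int (sign \<sigma>)" d] by (simp add: F_def fps_sum_nth fixed_series_def sum_sign_stab)
  show "d < sgn_degree \<Longrightarrow> F $ d = 0"
    unfolding F using sgn_degree_props(2) by (intro sum.neutral) (auto simp: not_less[symmetric])
  obtain m where m: "m \<in> exps n (int sgn_degree)" "even_stab m" using sgn_degree_props(1) by blast
  have "id \<in> exp_stab m" by (simp add: exp_stab_def)
  then have "card (exp_stab m) > 0" using perm_group.finite_group[OF exp_stab_group] by (auto simp: card_gt_0_iff)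
  then have "0 < (\<Sum>m\<in>exps n (int sgn_degree). if even_stab m then rat_of_nat (card (exp_stab m)) else 0)"
    using m by (intro sum_pos2[OF finite_exps m(1)]) auto
  then show "F $ sgn_degree \<noteq> 0" unfolding F by simp
qed

end

lemma rational_degree_eqI:
  assumes "p \<noteq> 0" "q \<noteq> 0" "F * fps_of_poly q = fps_of_poly p"
  shows "rational_degree F = int (degree p) - int (degree q)"
  unfolding rational_degree_def
proof (rule the_equality)
  show "\<exists>p' q'. p' \<noteq> 0 \<and> q' \<noteq> 0 \<and> F * fps_of_poly q' = fps_of_poly p' \<and>
      int (degree p) - int (degree q) = int (degree p') - int (degree q')" using assms by blast
  fix D assume "\<exists>p' q'. p' \<noteq> 0 \<and> q' \<noteq> 0 \<and> F * fps_of_poly q' = fps_of_poly p' \<and> D = int (degree p') - int (degree q')"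
  then obtain p' q' where pq: "p' \<noteq> 0" "q' \<noteq> 0" "F * fps_of_poly q' = fps_of_poly p'" "D = int (degree p') - int (degree q')" by blast
  have "fps_of_poly (p * q') = fps_of_poly (p' * q)"
    unfolding fps_of_poly_mult assms(3)[symmetric] pq(3)[symmetric] by (simp add: mult_ac)
  then have "p * q' = p' * q" by (simp add: fps_of_poly_eq_iff)
  then have "degree p + degree q' = degree p' + degree q" using assms pq by (metis degree_mult_eq)
  then show "D = int (degree p) - int (degree q)" using pq(4) by linarith
qed

text \<open>Substituting \<open>1/t\<close> in Molien's formula turns the Hilbert series into that of the sign semi-invariants, up to a sign
  and the factor \<open>t\<^sup>n\<close>. On the level of numerators this is a reversal of the coefficients.\<close>

theorem (in perm_group) rational_degree_hilbert_series:
  "rational_degree (hilbert_series (invariant_ring n G :: 'k::field mpol set)) = - int n - int sgn_degree"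
proof -
  have "\<exists>D :: rat poly. degree D = n \<and> coeff D 0 = 1 \<and>
      reflect_poly D = smult ((-1) ^ n * of_int (sign \<sigma>)) D \<and> fixed_series {1..n} \<sigma> * fps_of_poly D = 1" if "\<sigma> \<in> G" for \<sigma>
    using fixed_series_denominator[OF cycle_decomposition[OF permutes[OF that] finite_atLeastAtMost] order_refl] by simp
  then obtain D :: "_ \<Rightarrow> rat poly" where D: "\<And>\<sigma>. \<sigma> \<in> G \<Longrightarrow> degree (D \<sigma>) = n" "\<And>\<sigma>. \<sigma> \<in> G \<Longrightarrow> coeff (D \<sigma>) 0 = 1"
    "\<And>\<sigma>. \<sigma> \<in> G \<Longrightarrow> reflect_poly (D \<sigma>) = smult ((-1) ^ n * of_int (sign \<sigma>)) (D \<sigma>)"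
    "\<And>\<sigma>. \<sigma> \<in> G \<Longrightarrow> fixed_series {1..n} \<sigma> * fps_of_poly (D \<sigma>) = 1" by metis
  define E where "E \<sigma> = (\<Prod>\<tau>\<in>G - {\<sigma>}. D \<tau>)" for \<sigma>
  define Q where "Q = (\<Prod>\<tau>\<in>G. D \<tau>)"
  define N where "N = n * (card G - 1)"
  define u :: rat where "u = (\<Prod>\<tau>\<in>G. (-1) ^ n * of_int (sign \<tau>))"
  define P where "P = (\<Sum>\<sigma>\<in>G. E \<sigma>)"
  define P2 where "P2 = (\<Sum>\<sigma>\<in>G. smult (of_int (sign \<sigma>)) (E \<sigma>))"
  have D0: "D \<sigma> \<noteq> 0" if "\<sigma> \<in> G" for \<sigma> using D(2)[OF that] by auto
  have Q: "Q = D \<sigma> * E \<sigma>" if "\<sigma> \<in> G" for \<sigma>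
    unfolding Q_def E_def by (rule prod.remove) (use that in auto)
  have Q0: "Q \<noteq> 0" using D0 by (simp add: Q_def)
  have degQ: "degree Q = n * card G" using D(1) D0 by (simp add: Q_def degree_prod_eq_sum_degree)
  have "poly (D \<tau>) 0 = 1" if "\<tau> \<in> G" for \<tau> using D(2)[OF that] by (simp add: poly_0_coeff_0)
  then have "poly Q 0 = 1" by (simp add: Q_def poly_prod)
  then have Qcoeff: "coeff Q 0 = 1" by (simp add: poly_0_coeff_0)
  have degE: "degree (E \<sigma>) = N" if "\<sigma> \<in> G" for \<sigma>
    using D(1) D0 that by (simp add: E_def N_def degree_prod_eq_sum_degree)
  have u2: "u * u = 1" "u \<noteq> 0"
  proof -
    show "u * u = 1"
      unfolding u_def prod.distrib[symmetric] by (intro prod.neutral ballI) (simp add: mult_ac flip: power_mult_distrib of_int_mult)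
    then show "u \<noteq> 0" by auto
  qed
  have reflE: "reflect_poly (E \<sigma>) = smult ((-1) ^ n * u * of_int (sign \<sigma>)) (E \<sigma>)" if "\<sigma> \<in> G" for \<sigma>
  proof -
    have "reflect_poly (E \<sigma>) = (\<Prod>\<tau>\<in>G - {\<sigma>}. smult ((-1) ^ n * of_int (sign \<tau>)) (D \<tau>))"
      using D(3) by (simp add: E_def reflect_poly_prod)
    also have "\<dots> = smult (\<Prod>\<tau>\<in>G - {\<sigma>}. (-1) ^ n * of_int (sign \<tau>)) (E \<sigma>)"
      unfolding E_def by (rule prod_smult)
    also have "(\<Prod>\<tau>\<in>G - {\<sigma>}. (-1) ^ n * of_int (sign \<tau>)) = (-1) ^ n * u * rat_of_int (sign \<sigma>)"
    proof -
      have "u = (-1) ^ n * of_int (sign \<sigma>) * (\<Prod>\<tau>\<in>G - {\<sigma>}. (-1) ^ n * of_int (sign \<tau>))"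
        unfolding u_def by (rule prod.remove) (use that in auto)
      then show ?thesis by (simp add: mult_ac flip: power_mult_distrib of_int_mult mult.assoc)
    qed
    finally show ?thesis .
  qed
  have coeffP: "coeff P (N - k) = (-1) ^ n * u * coeff P2 k" if "k \<le> N" for k
  proof -
    have "coeff (E \<sigma>) (N - k) = (-1) ^ n * u * (of_int (sign \<sigma>) * coeff (E \<sigma>) k)" if "\<sigma> \<in> G" for \<sigma>
    proof -
      have "coeff (reflect_poly (E \<sigma>)) k = coeff (E \<sigma>) (N - k)"
        using \<open>k \<le> N\<close> degE[OF that] by (simp add: coeff_reflect_poly)
      then show ?thesis unfolding reflE[OF that] by (simp add: mult.assoc)
    qed
    then show ?thesis by (simp add: P_def P2_def coeff_sum sum_distrib_left)
  qed
  have P2: "fps_of_poly P2 = (\<Sum>\<sigma>\<in>G. fps_const (rat_of_int (sign \<sigma>)) * fixed_series {1..n} \<sigma>) * fps_of_poly Q"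
  proof -
    have "fixed_series {1..n} \<sigma> * fps_of_poly Q = fps_of_poly (E \<sigma>)" if "\<sigma> \<in> G" for \<sigma>
      using D(4)[OF that] by (simp add: Q[OF that] fps_of_poly_mult flip: mult.assoc)
    then show ?thesis by (simp add: P2_def fps_of_poly_sum fps_of_poly_smult sum_distrib_right mult.assoc)
  qed
  have P: "fps_of_poly P = (\<Sum>\<sigma>\<in>G. fixed_series {1..n} \<sigma>) * fps_of_poly Q"
  proof -
    have "fixed_series {1..n} \<sigma> * fps_of_poly Q = fps_of_poly (E \<sigma>)" if "\<sigma> \<in> G" for \<sigma>
      using D(4)[OF that] by (simp add: Q[OF that] fps_of_poly_mult flip: mult.assoc)
    then show ?thesis by (simp add: P_def fps_of_poly_sum sum_distrib_right)
  qed
  have "G \<noteq> {}" using id_mem by blast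
  then have cG: "card G > 0" by (simp add: card_gt_0_iff)
  have coeffP2: "coeff P2 k = 0" if "k < sgn_degree" for k
  proof -
    have "fps_of_poly P2 $ k = 0"
      unfolding P2 fps_mult_nth using sign_series_coeff(1) that by (intro sum.neutral) auto
    then show ?thesis by simp
  qed
  have coeffP2': "coeff P2 sgn_degree \<noteq> 0"
  proof -
    have "fps_of_poly P2 $ sgn_degree = (\<Sum>\<sigma>\<in>G. fps_const (rat_of_int (sign \<sigma>)) * fixed_series {1..n} \<sigma>) $ sgn_degree * coeff Q 0"
      unfolding P2 fps_mult_nth using sign_series_coeff(1)
      by (subst sum.remove[of _ sgn_degree]) (auto intro!: sum.neutral)
    then show ?thesis using sign_series_coeff(2) by (simp add: Qcoeff)
  qed
  have degP: "degree P \<le> N"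
    unfolding P_def using degE by (intro degree_sum_le) auto
  have degP2: "degree P2 \<le> N"
    unfolding P2_def using degE by (intro degree_sum_le) auto
  have le: "sgn_degree \<le> N" using coeffP2' degP2 le_degree le_trans by blast
  have "coeff P (N - sgn_degree) \<noteq> 0" using coeffP2' u2 by (simp add: coeffP[OF le])
  moreover have "degree P \<le> N - sgn_degree"
  proof (rule degree_le, intro allI impI)
    fix i assume i: "N - sgn_degree < i"
    show "coeff P i = 0"
    proof (cases "i \<le> N")
      case True
      then have "coeff P (N - (N - i)) = 0" using i le by (subst coeffP) (auto intro!: coeffP2)
      then show ?thesis using True by simp
    qed (use degP in \<open>auto intro: coeff_eq_0\<close>)
  qed
  ultimately have degP: "degree P = N - sgn_degree" by (intro antisym le_degree)
  have P0: "P \<noteq> 0" using \<open>coeff P (N - sgn_degree) \<noteq> 0\<close> by auto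
  have "hilbert_series (invariant_ring n G :: 'k mpol set) * fps_of_poly (smult (of_nat (card G)) Q) = fps_of_poly P"
    unfolding P molien[where ?'k = 'k, symmetric] by (simp add: fps_of_poly_smult mult_ac fps_of_nat)
  then have "rational_degree (hilbert_series (invariant_ring n G :: 'k mpol set))
      = int (degree P) - int (degree (smult (rat_of_nat (card G)) Q))"
    using P0 Q0 cG by (intro rational_degree_eqI) auto
  also have "\<dots> = int (N - sgn_degree) - int (n * card G)" using cG degP degQ by simp
  also have "\<dots> = - int n - int sgn_degree"
  proof -
    have "n * card G = N + n" using cG by (cases "card G") (simp_all add: N_def)
    then show ?thesis using le by (simp add: of_nat_diff)
  qed
  finally show ?thesis .
qed

context perm_group
begin

definition can_degree :: "'k::field itself \<Rightarrow> nat" where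
  "can_degree _ = (LEAST d. \<exists>f \<in> (can_ideal n G :: 'k mpol set). f \<noteq> 0 \<and> homogeneous (int d) f)"

lemma vand_mem_can_ideal: "vand n \<in> can_ideal n G"
proof -
  have "semi_inv sgn_char G (vand n)"
    by (rule semi_inv_mono[OF vand_semi_inv]) (auto simp: full_sym_def permutes)
  moreover have "(var i - var j) dvd (vand n :: 'a mpol)" if ij: "i \<noteq> j" "swap i j \<in> G" for i j
  proof -
    have r: "i \<in> {1..n}" "j \<in> {1..n}" using transpose_mem_range ij by blast+
    have "(min i j, max i j) \<in> pairs n" using ij r by (auto simp: pairs_def min_def max_def)
    then have "diff_pair (min i j, max i j) dvd (vand n :: 'a mpol)"
      unfolding vand_def by (intro dvd_prodI finite_pairs)
    moreover have "diff_pair (min i j, max i j) = (var i - var j :: 'a mpol) \<or>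
        diff_pair (min i j, max i j) = - (var i - var j :: 'a mpol)" by (simp add: min_def max_def)
    ultimately show ?thesis by (metis minus_dvd_iff)
  qed
  ultimately show ?thesis by (simp add: can_ideal_def vand_props)
qed

lemma can_degree_props:
  fixes f :: "'k::field mpol"
  shows "\<exists>f \<in> (can_ideal n G :: 'k mpol set). f \<noteq> 0 \<and> homogeneous (int (can_degree TYPE('k))) f"
    and "f \<in> can_ideal n G \<Longrightarrow> f \<noteq> 0 \<Longrightarrow> homogeneous d f \<Longrightarrow> int (can_degree TYPE('k)) \<le> d"
proof -
  have "\<exists>d. \<exists>f \<in> (can_ideal n G :: 'k mpol set). f \<noteq> 0 \<and> homogeneous (int d) f"
    using vand_mem_can_ideal vand_props(1,2) by blast
  then show "\<exists>f \<in> (can_ideal n G :: 'k mpol set). f \<noteq> 0 \<and> homogeneous (int (can_degree TYPE('k))) f"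
    unfolding can_degree_def by (rule LeastI_ex)
  assume f: "f \<in> can_ideal n G" "f \<noteq> 0" "homogeneous d f"
  then obtain d' where d': "d = int d'" using homogeneous_nonneg nonneg_int_cases by metis
  then have "can_degree TYPE('k) \<le> d'" unfolding can_degree_def using f by (intro Least_le) blast
  then show "int (can_degree TYPE('k)) \<le> d" using d' by simp
qed

lemma can_degree_eq_iff: "can_degree TYPE('k::field) = card (transp_pairs n G) \<longleftrightarrow> (transp_prod n G :: 'k mpol) \<in> can_ideal n G"
proof
  assume "can_degree TYPE('k) = card (transp_pairs n G)"
  then show "(transp_prod n G :: 'k mpol) \<in> can_ideal n G"
    using can_degree_props(1)[where ?'k = 'k] transp_prod_mem_of_min_degree by metis
next
  assume "(transp_prod n G :: 'k mpol) \<in> can_ideal n G"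
  then have "int (can_degree TYPE('k)) \<le> int (card (transp_pairs n G))"
    by (rule can_degree_props(2)) (rule transp_prod_props)+
  moreover have "int (card (transp_pairs n G)) \<le> int (can_degree TYPE('k))"
    using can_degree_props(1)[where ?'k = 'k] can_ideal_min_degree by blast
  ultimately show "can_degree TYPE('k) = card (transp_pairs n G)" by simp
qed

text \<open>In characteristic different from 2 a monomial occurs in some sign semi-invariant iff its stabilizer consists of even
  permutations; this does not depend on the characteristic.\<close>

lemma can_degree_eq_sgn_degree:
  assumes char: "(1::'k::field) + 1 \<noteq> 0"
  shows "can_degree TYPE('k) = sgn_degree"
proof (rule antisym)
  obtain f :: "'k mpol" where f: "f \<in> can_ideal n G" "f \<noteq> 0" "homogeneous (int (can_degree TYPE('k))) f"
    using can_degree_props(1) by blast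
  obtain m where m: "m \<in> keys f" using f(2) by (metis all_not_in_conv keys_eq_empty)
  have "f \<in> graded_part (poly_ring n) (int (can_degree TYPE('k)))"
    using f by (simp add: graded_part_def can_ideal_def)
  then have mD: "m \<in> exps n (int (can_degree TYPE('k)))" using m unfolding graded_part_poly_ring by blast
  have "even_stab m"
    unfolding even_stab_def
  proof
    fix \<sigma> assume \<sigma>: "\<sigma> \<in> exp_stab m"
    then have \<sigma>G: "\<sigma> \<in> G" and pm: "push \<sigma> m = m" by (auto simp: exp_stab_def)
    have "lookup f m = lookup (perm_act \<sigma> f) m" using lookup_perm_act[OF inj_mem[OF \<sigma>G], of f m] pm by simp
    also have "\<dots> = sgn_char \<sigma> * lookup f m" using f(1) \<sigma>G by (simp add: can_ideal_def semi_inv_def)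
    finally have "sgn_char \<sigma> = (1::'k)" using m by (simp add: in_keys_iff)
    moreover have "(-1::'k) \<noteq> 1"
    proof
      assume "(-1::'k) = 1"
      then have "(1::'k) + 1 = 1 + (-1)" by simp
      with char show False by simp
    qed
    ultimately show "evenperm \<sigma>" by (auto simp: sgn_char_def sign_def split: if_splits)
  qed
  then show "sgn_degree \<le> can_degree TYPE('k)" using sgn_degree_props(2)[OF mD] by simp
next
  obtain m where m: "m \<in> exps n (int sgn_degree)" "even_stab m" using sgn_degree_props(1) by blast
  interpret St: perm_group n "exp_stab m" by (rule exp_stab_group)
  interpret GS: perm_group_pair n G "exp_stab m" by unfold_locales (auto simp: exp_stab_def)
  have mS: "mon m \<in> (poly_ring n :: 'k mpol set)" using m by (simp add: exps_def)
  have semi: "semi_inv sgn_char (exp_stab m) (mon m :: 'k mpol)"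
    using m(2) by (auto simp: semi_inv_def even_stab_def exp_stab_def sgn_char_def sign_def)
  define f :: "'k mpol" where "f = coset_rep_sum sgn_char G (exp_stab m) (mon m)"
  have "f \<in> can_ideal n G"
    unfolding f_def by (intro can_ideal_semi_inv[OF char] GS.coset_rep_sum_in_poly_ring mS GS.coset_rep_sum_semi_inv[OF pm_char_sgn semi])
  moreover have "homogeneous (int sgn_degree) f"
    unfolding f_def using homogeneous_mon[of m] m(1) by (intro coset_rep_sum_homogeneous) (simp add: exps_def)
  moreover have "lookup f m = 1"
  proof -
    have "lookup f m = (\<Sum>C\<in>GS.coset ` G. if C = GS.coset id then 1 else 0)"
      unfolding f_def coset_rep_sum_def lookup_sum
    proof (rule sum.cong)
      fix C assume "C \<in> GS.coset ` G"
      then obtain t where t: "t \<in> G" "C = GS.coset t" by blast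
      have "lookup (const (sgn_char t) * perm_act t (mon m)) m = (if C = GS.coset id then 1 else 0 :: 'k)"
      proof (cases "push t m = m")
        case True
        then have tS: "t \<in> exp_stab m" using t by (simp add: exp_stab_def)
        then have "C = GS.coset id" using GS.coset_eqI[of t id] t by (simp add: image_iff)
        moreover have "sgn_char t = (1::'k)" using m(2) tS by (simp add: even_stab_def sgn_char_def sign_def)
        ultimately show ?thesis using True by (simp add: lookup_mon)
      next
        case False
        then have "t \<notin> exp_stab m" by (simp add: exp_stab_def)
        then have "C \<noteq> GS.coset id" using GS.mem_coset[of t] t(2) by auto
        then show ?thesis using False by (simp add: lookup_mon)
      qed
      then show "lookup (const (sgn_char (SOME t. t \<in> C)) * perm_act (SOME t. t \<in> C) (mon m)) m = (if C = GS.coset id then 1 else 0 :: 'k)"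
        using GS.coset_term[OF pm_char_sgn semi t(1)] t(2) by simp
    qed simp
    also have "\<dots> = 1"
    proof -
      have "GS.coset id \<in> GS.coset ` G" by (rule imageI[OF id_mem])
      then show ?thesis by (simp only: sum.delta' sum.delta finite_imageI finite_group if_True)
    qed
    finally show ?thesis .
  qed
  then have "f \<noteq> 0" by auto
  ultimately have "int (can_degree TYPE('k)) \<le> int sgn_degree" using can_degree_props(2)[of f] by blast
  then show "can_degree TYPE('k) \<le> sgn_degree" by simp
qed

end

section \<open>Exchanging an element of a system of parameters\<close>

definition ideal_of :: "'k::field mpol set \<Rightarrow> nat set \<Rightarrow> (nat \<Rightarrow> 'k mpol) \<Rightarrow> 'k mpol set" where
  "ideal_of R A y = {(\<Sum>i\<in>A. r i * y i) | r. \<forall>i\<in>A. r i \<in> R}"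

definition rad :: "'k::field mpol set \<Rightarrow> 'k mpol set \<Rightarrow> 'k mpol set" where
  "rad R J = {f \<in> R. \<exists>t. f ^ t \<in> J}"

text \<open>Radicals are compared through the radical ideals that contain given elements.\<close>

definition radical_ideal :: "'k::field mpol set \<Rightarrow> 'k mpol set \<Rightarrow> bool" where
  "radical_ideal R J \<longleftrightarrow> J \<subseteq> R \<and> 0 \<in> J \<and> (\<forall>a\<in>J. \<forall>b\<in>J. a + b \<in> J) \<and> (\<forall>r\<in>R. \<forall>a\<in>J. r * a \<in> J) \<and>
     (\<forall>a\<in>R. \<forall>t. a ^ t \<in> J \<longrightarrow> a \<in> J)"

lemma generated_ideal_eq: "generated_ideal R n y = ideal_of R {1..n} y"
  by (simp add: generated_ideal_def ideal_of_def)

context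
  fixes R :: "'k::field mpol set"
  assumes R: "graded_subalgebra R"
begin

lemma ideal_of_add: "a \<in> ideal_of R A y \<Longrightarrow> b \<in> ideal_of R A y \<Longrightarrow> a + b \<in> ideal_of R A y"
proof -
  assume "a \<in> ideal_of R A y" "b \<in> ideal_of R A y"
  then obtain r s where "\<forall>i\<in>A. r i \<in> R" "\<forall>i\<in>A. s i \<in> R" "a = (\<Sum>i\<in>A. r i * y i)" "b = (\<Sum>i\<in>A. s i * y i)"
    by (auto simp: ideal_of_def)
  then have "a + b = (\<Sum>i\<in>A. (r i + s i) * y i)" "\<forall>i\<in>A. r i + s i \<in> R"
    using subalg_add[OF R] by (auto simp: distrib_right sum.distrib)
  then show ?thesis unfolding ideal_of_def by (intro CollectI exI[of _ "\<lambda>i. r i + s i"]) simp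
qed

lemma ideal_of_mult: "a \<in> ideal_of R A y \<Longrightarrow> q \<in> R \<Longrightarrow> q * a \<in> ideal_of R A y"
proof -
  assume "a \<in> ideal_of R A y" and q: "q \<in> R"
  then obtain r where "\<forall>i\<in>A. r i \<in> R" "a = (\<Sum>i\<in>A. r i * y i)" by (auto simp: ideal_of_def)
  then have "q * a = (\<Sum>i\<in>A. (q * r i) * y i)" "\<forall>i\<in>A. q * r i \<in> R"
    using subalg_mult[OF R q] by (auto simp: sum_distrib_left mult.assoc)
  then show ?thesis unfolding ideal_of_def by (intro CollectI exI[of _ "\<lambda>i. q * r i"]) simp
qed

lemma ideal_of_0: "0 \<in> ideal_of R A y"
  unfolding ideal_of_def using subalg_0[OF R] by (intro CollectI exI[of _ "\<lambda>_. 0"]) simp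

lemma ideal_of_gen: "finite A \<Longrightarrow> i \<in> A \<Longrightarrow> y i \<in> ideal_of R A y"
  unfolding ideal_of_def using subalg_0[OF R] subalg_1[OF R]
  by (intro CollectI exI[of _ "\<lambda>j. if j = i then 1 else 0"]) (auto simp: if_distrib[of "\<lambda>x. x * _"] cong: if_cong)

lemma ideal_of_sum: "(\<And>i. i \<in> I \<Longrightarrow> f i \<in> ideal_of R A y) \<Longrightarrow> (\<Sum>i\<in>I. f i) \<in> ideal_of R A y"
  by (induction I rule: infinite_finite_induct) (auto intro: ideal_of_add ideal_of_0)

lemma radical_ideal_rad:
  fixes y :: "nat \<Rightarrow> 'k mpol"
  shows "radical_ideal R (rad R (ideal_of R A y))"
  unfolding radical_ideal_def
proof (intro conjI ballI allI impI)
  let ?J = "ideal_of R A y"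
  show "rad R ?J \<subseteq> R" by (auto simp: rad_def)
  show "0 \<in> rad R ?J" using subalg_0[OF R] ideal_of_0 by (auto simp: rad_def intro!: exI[of _ 1])
  fix a assume a: "a \<in> rad R ?J"
  then obtain s where s: "a \<in> R" "a ^ s \<in> ?J" by (auto simp: rad_def)
  show "r * a \<in> rad R ?J" if "r \<in> R" for r
  proof -
    have "(r * a) ^ s \<in> ?J"
      using ideal_of_mult[OF s(2) subalg_power[OF R that], of s] by (simp add: power_mult_distrib)
    then show ?thesis using s(1) that subalg_mult[OF R] by (auto simp: rad_def)
  qed
  fix b assume "b \<in> rad R ?J"
  then obtain t where t: "b \<in> R" "b ^ t \<in> ?J" by (auto simp: rad_def)
  have "(a + b) ^ (s + t) \<in> ?J"
    unfolding binomial_ring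
  proof (rule ideal_of_sum)
    fix k assume "k \<in> {..s + t}"
    have c: "of_nat (s + t choose k) \<in> R"
      using subalg_const[OF R, of "of_nat (s + t choose k)"] by (simp add: const_def single_of_nat)
    show "of_nat (s + t choose k) * a ^ k * b ^ (s + t - k) \<in> ?J"
    proof (cases "s \<le> k")
      case True
      then have "of_nat (s + t choose k) * a ^ k * b ^ (s + t - k)
          = (of_nat (s + t choose k) * a ^ (k - s) * b ^ (s + t - k)) * a ^ s"
        by (simp add: mult_ac flip: power_add)
      then show ?thesis using s t c by (simp only:) (intro ideal_of_mult subalg_mult[OF R] subalg_power[OF R])
    next
      case False
      then have "s + t - k = (s - k) + t" by simp
      then have "of_nat (s + t choose k) * a ^ k * b ^ (s + t - k)
          = (of_nat (s + t choose k) * a ^ k * b ^ (s - k)) * b ^ t" by (simp add: power_add mult_ac)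
      then show ?thesis using s t c by (simp only:) (intro ideal_of_mult subalg_mult[OF R] subalg_power[OF R])
    qed
  qed
  then show "a + b \<in> rad R ?J" using s t subalg_add[OF R] by (auto simp: rad_def)
next
  fix a t assume "a \<in> R" "a ^ t \<in> rad R (ideal_of R A y)"
  then show "a \<in> rad R (ideal_of R A y)" by (auto simp: rad_def simp flip: power_mult)
qed

lemma rad_gen: "finite A \<Longrightarrow> i \<in> A \<Longrightarrow> y i \<in> R \<Longrightarrow> y i \<in> rad R (ideal_of R A y)"
  using ideal_of_gen by (auto simp: rad_def intro!: exI[of _ 1])

lemma radical_ideal_sum:
  "radical_ideal R J \<Longrightarrow> (\<And>i. i \<in> I \<Longrightarrow> f i \<in> J) \<Longrightarrow> (\<Sum>i\<in>I. f i) \<in> J"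
  by (induction I rule: infinite_finite_induct) (auto simp: radical_ideal_def)

lemma rad_minimal:
  assumes "radical_ideal R J" "\<And>i. i \<in> A \<Longrightarrow> y i \<in> J"
  shows "rad R (ideal_of R A y) \<subseteq> J"
proof
  fix f assume "f \<in> rad R (ideal_of R A y)"
  then obtain t r where f: "f \<in> R" "f ^ t = (\<Sum>i\<in>A. r i * y i)" "\<forall>i\<in>A. r i \<in> R"
    by (auto simp: rad_def ideal_of_def)
  have "(\<Sum>i\<in>A. r i * y i) \<in> J" using assms f(3) by (intro radical_ideal_sum) (auto simp: radical_ideal_def)
  then have "f ^ t \<in> J" by (simp only: f(2))
  then show "f \<in> J" using f(1) assms(1) unfolding radical_ideal_def by blast
qed

end

lemma hom_sop_rad: "hom_sop n R y \<Longrightarrow> rad R (ideal_of R {1..n} y) = hom_max_ideal R"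
  by (simp add: hom_sop_def rad_def generated_ideal_eq)

lemma lookup_0_mult: "lookup (p * q) (0 :: nat \<Rightarrow>\<^sub>0 nat) = lookup p 0 * lookup q (0 :: nat \<Rightarrow>\<^sub>0 nat)"
  for p q :: "'k::field mpol"
proof -
  have hc: "const (lookup p 0) = hcomp 0 p" for p :: "'k mpol"
    by (rule poly_mapping_eqI) (auto simp: lookup_const lookup_hcomp mon_deg_eq_0_iff)
  let ?D = "(int \<circ> mon_deg) ` keys p"
  have "hcomp 0 (p * q) = (\<Sum>d\<in>?D. hcomp 0 (hcomp d p * q))"
    by (subst poly_eq_sum_hcomp[of p]) (simp add: sum_distrib_right hcomp_sum)
  also have "\<dots> = (\<Sum>d\<in>?D. hcomp d p * hcomp (0 - d) q)"
  proof (intro sum.cong refl)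
    fix d
    show "hcomp 0 (hcomp d p * q) = hcomp d p * hcomp (0 - d) q"
      using hcomp_homogeneous_mult[OF homogeneous_hcomp[of d p], of "0 - d" q] by simp
  qed
  also have "\<dots> = (\<Sum>d\<in>?D. if d = 0 then hcomp 0 p * hcomp 0 q else 0)"
  proof (rule sum.cong)
    fix d assume d: "d \<in> ?D"
    have "hcomp (0 - d) q = 0" if "d \<noteq> 0"
      using homogeneous_nonneg[OF homogeneous_hcomp[of "0 - d" q]] d that by fastforce
    then show "hcomp d p * hcomp (0 - d) q = (if d = 0 then hcomp 0 p * hcomp 0 q else 0)" by auto
  qed simp
  also have "\<dots> = hcomp 0 p * hcomp 0 q"
  proof (cases "0 \<in> ?D")
    case False
    then have "hcomp 0 p = 0" by (intro poly_mapping_eqI) (force simp: lookup_hcomp in_keys_iff)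
    with False show ?thesis by simp
  qed simp
  finally have "const (lookup (p * q) 0) = const (lookup p 0 * lookup q 0)" by (simp add: hc const_mult)
  then show ?thesis by (metis lookup_const)
qed

lemma lookup_0_power: "lookup (p ^ t) 0 = lookup p (0 :: nat \<Rightarrow>\<^sub>0 nat) ^ t" for p :: "'k::field mpol"
  by (induction t) (auto simp: lookup_0_mult)

lemma homogeneous_lookup_0: "homogeneous d p \<Longrightarrow> d > 0 \<Longrightarrow> lookup p 0 = 0"
  by (force simp: homogeneous_def in_keys_iff)

lemma hom_sopI:
  assumes R: "graded_subalgebra R" and n: "n \<ge> 1"
    and y: "\<And>i. i \<in> {1..n} \<Longrightarrow> y i \<in> R \<and> y i \<noteq> 0 \<and> (\<exists>d>0. homogeneous d (y i))"
    and rad: "hom_max_ideal R \<subseteq> rad R (ideal_of R {1..n} y)"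
  shows "hom_sop n R y"
proof -
  have "rad R (ideal_of R {1..n} y) \<subseteq> hom_max_ideal R"
  proof
    fix f assume "f \<in> rad R (ideal_of R {1..n} y)"
    then obtain t r where f: "f \<in> R" "f ^ t = (\<Sum>i=1..n. r i * y i)" by (auto simp: rad_def ideal_of_def)
    have "lookup (f ^ t) 0 = (\<Sum>i=1..n. lookup (r i) 0 * lookup (y i) 0)"
      unfolding f(2) by (simp add: lookup_sum lookup_0_mult)
    also have "\<dots> = 0" using y homogeneous_lookup_0 by (intro sum.neutral) fastforce
    finally show "f \<in> hom_max_ideal R" using f(1) by (auto simp: lookup_0_power hom_max_ideal_def)
  qed
  with rad y show ?thesis by (simp add: hom_sop_def rad_def generated_ideal_eq)
qed

text \<open>An invariant that lies in the extension of an ideal of \<open>S\<^sup>G\<close> to the polynomial ring has a power in the ideal itself: its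
  \<open>|G|\<close>-th power is the product of its conjugates, and the coefficients of each monomial in the generators add up to an
  invariant.\<close>

lemma (in perm_group) invariant_power_in_ideal:
  fixes f :: "'k::field mpol"
  assumes f: "f \<in> invariant_ring n G" "f \<in> ideal_of (poly_ring n) A y"
    and A: "finite A" "\<And>i. i \<in> A \<Longrightarrow> y i \<in> invariant_ring n G"
  shows "f ^ card G \<in> ideal_of (invariant_ring n G) A y"
proof -
  note R = invariant_ring_subalgebra[where ?'k = 'k]
  obtain s where s: "\<forall>i\<in>A. s i \<in> poly_ring n" "f = (\<Sum>i\<in>A. s i * y i)" using f(2) by (auto simp: ideal_of_def)
  define H where "H = PiE G (\<lambda>_. A)"
  define trm where "trm h = (\<Prod>\<sigma>\<in>G. perm_act \<sigma> (s (h \<sigma>)))" for h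
  define cnt where "cnt h i = card {\<sigma> \<in> G. h \<sigma> = i}" for h :: "(nat \<Rightarrow> nat) \<Rightarrow> nat" and i
  have "f ^ card G = (\<Prod>\<sigma>\<in>G. perm_act \<sigma> f)" using invariantD(1)[OF f(1)] by simp
  also have "\<dots> = (\<Prod>\<sigma>\<in>G. \<Sum>i\<in>A. perm_act \<sigma> (s i) * y i)"
    using invariantD(1)[OF A(2)] by (intro prod.cong refl) (simp add: s(2) perm_act_sum perm_act_mult)
  also have "\<dots> = (\<Sum>h\<in>H. \<Prod>\<sigma>\<in>G. perm_act \<sigma> (s (h \<sigma>)) * y (h \<sigma>))"
    unfolding H_def by (rule prod_sum_PiE) (use A in auto)
  also have "\<dots> = (\<Sum>h\<in>H. trm h * (\<Prod>i\<in>A. y i ^ cnt h i))"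
  proof (rule sum.cong)
    fix h assume h: "h \<in> H"
    have "(\<Prod>\<sigma>\<in>G. y (h \<sigma>)) = (\<Prod>i\<in>h ` G. \<Prod>\<sigma>\<in>{\<sigma> \<in> G. h \<sigma> = i}. y (h \<sigma>))" by (rule prod.image_gen) simp
    also have "\<dots> = (\<Prod>i\<in>h ` G. y i ^ cnt h i)"
      unfolding cnt_def by (intro prod.cong refl) simp
    also have "\<dots> = (\<Prod>i\<in>A. y i ^ cnt h i)"
    proof (rule prod.mono_neutral_left)
      show "h ` G \<subseteq> A" using h by (auto simp: H_def)
      show "\<forall>i\<in>A - h ` G. y i ^ cnt h i = 1"
      proof
        fix i assume "i \<in> A - h ` G"
        then have "{\<sigma> \<in> G. h \<sigma> = i} = {}" by auto
        then show "y i ^ cnt h i = 1" unfolding cnt_def by (simp only: card.empty power_0)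
      qed
    qed (rule A(1))
    finally show "(\<Prod>\<sigma>\<in>G. perm_act \<sigma> (s (h \<sigma>)) * y (h \<sigma>)) = trm h * (\<Prod>i\<in>A. y i ^ cnt h i)"
      by (simp add: prod.distrib trm_def)
  qed simp
  also have "\<dots> = (\<Sum>c\<in>cnt ` H. \<Sum>h\<in>{h \<in> H. cnt h = c}. trm h * (\<Prod>i\<in>A. y i ^ cnt h i))"
    using A(1) by (intro sum.image_gen) (simp add: H_def finite_PiE)
  also have "\<dots> = (\<Sum>c\<in>cnt ` H. (\<Sum>h\<in>{h \<in> H. cnt h = c}. trm h) * (\<Prod>i\<in>A. y i ^ c i))"
    by (intro sum.cong refl) (simp add: sum_distrib_right)
  also have "\<dots> \<in> ideal_of (invariant_ring n G) A y"
  proof (rule ideal_of_sum[OF R])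
    fix c assume "c \<in> cnt ` H"
    then obtain h0 where h0: "h0 \<in> H" "c = cnt h0" by blast
    define B where "B = {h \<in> H. cnt h = c}"
    define i where "i = h0 id"
    have i: "i \<in> A" unfolding i_def using h0(1)[unfolded H_def] id_mem by (rule PiE_mem)
    have "id \<in> {\<sigma> \<in> G. h0 \<sigma> = i}" unfolding i_def by (rule CollectI) (rule conjI[OF id_mem refl])
    then have ne: "{\<sigma> \<in> G. h0 \<sigma> = i} \<noteq> {}" by (metis empty_iff)
    have "finite {\<sigma> \<in> G. h0 \<sigma> = i}" using finite_group by simp
    with ne have "card {\<sigma> \<in> G. h0 \<sigma> = i} > 0" by (rule card_gt_0_iff[THEN iffD2, OF conjI])
    then have ci: "c i > 0" by (simp add: h0(2) cnt_def)
    have tS: "trm h \<in> poly_ring n" if "h \<in> H" for h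
      unfolding trm_def using s(1) that by (intro poly_ring_prod perm_act_mem) (auto simp: H_def)
    have "perm_act \<tau> (\<Sum>h\<in>B. trm h) = (\<Sum>h\<in>B. trm h)" if \<tau>: "\<tau> \<in> G" for \<tau>
    proof -
      let ?m = "\<lambda>\<tau> h. restrict (\<lambda>\<sigma>. h (inv' \<tau> \<circ> \<sigma>)) G"
      have mH: "?m \<tau> h \<in> B" if "\<tau> \<in> G" "h \<in> B" for \<tau> h
      proof -
        have "cnt (?m \<tau> h) j = cnt h j" for j
        proof -
          have "bij_betw ((\<circ>) \<tau>) {\<sigma> \<in> G. h \<sigma> = j} {\<sigma> \<in> G. ?m \<tau> h \<sigma> = j}"
            by (rule bij_betw_byWitness[where f' = "(\<circ>) (inv' \<tau>)"])
              (use that in \<open>auto simp: inv_comp_mem comp_mem inv_mem simp flip: comp_assoc\<close>)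
          then show ?thesis unfolding cnt_def by (simp add: bij_betw_same_card)
        qed
        moreover have "?m \<tau> h \<in> H" using that by (auto simp: B_def H_def comp_mem inv_mem PiE_mem)
        ultimately show ?thesis using that by (auto simp: B_def)
      qed
      have bij: "bij_betw (?m \<tau>) B B"
      proof (rule bij_betw_byWitness[where f' = "?m (inv' \<tau>)"])
        have *: "?m \<rho> (?m \<tau>' h) = h" if "h \<in> B" "\<rho> \<in> G" "\<tau>' \<in> G" "inv' \<tau>' \<circ> inv' \<rho> = id" for \<rho> \<tau>' h
        proof
          fix \<sigma>
          show "?m \<rho> (?m \<tau>' h) \<sigma> = h \<sigma>"
          proof (cases "\<sigma> \<in> G")
            case True
            then have "?m \<rho> (?m \<tau>' h) \<sigma> = h (inv' \<tau>' \<circ> (inv' \<rho> \<circ> \<sigma>))" using that by (simp add: comp_mem inv_mem)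
            also have "inv' \<tau>' \<circ> (inv' \<rho> \<circ> \<sigma>) = \<sigma>" using that(4) by (metis comp_assoc id_comp)
            finally show ?thesis .
          next
            case False
            then show ?thesis using that(1) by (auto simp: B_def H_def PiE_def extensional_def)
          qed
        qed
        have inv2: "inv' (inv' \<tau>) = \<tau>" using bij_mem[OF \<tau>] by (rule inv_inv_eq)
        show "\<forall>h\<in>B. ?m (inv' \<tau>) (?m \<tau> h) = h"
          using \<tau> by (intro ballI *) (simp_all add: inv_mem inv2 inv_comp_mem)
        show "\<forall>h\<in>B. ?m \<tau> (?m (inv' \<tau>) h) = h"
          using \<tau> by (intro ballI *) (simp_all add: inv_mem inv2 inv_comp_mem)
      qed (use mH \<tau> inv_mem in auto)
      have "perm_act \<tau> (trm h) = trm (?m \<tau> h)" for h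
      proof -
        have "trm (?m \<tau> h) = (\<Prod>\<sigma>\<in>G. perm_act (\<tau> \<circ> \<sigma>) (s (?m \<tau> h (\<tau> \<circ> \<sigma>))))"
          unfolding trm_def by (rule prod.reindex_bij_betw[OF bij_comp_left[OF \<tau>], symmetric])
        also have "\<dots> = (\<Prod>\<sigma>\<in>G. perm_act \<tau> (perm_act \<sigma> (s (h \<sigma>))))"
          by (intro prod.cong refl) (simp add: comp_mem \<tau> perm_act_comp inv_comp_mem[OF \<tau>] flip: comp_assoc)
        finally show ?thesis by (simp add: trm_def perm_act_prod)
      qed
      then have "perm_act \<tau> (\<Sum>h\<in>B. trm h) = (\<Sum>h\<in>B. trm (?m \<tau> h))" by (simp add: perm_act_sum)
      also have "\<dots> = (\<Sum>h\<in>B. trm h)" by (rule sum.reindex_bij_betw[OF bij])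
      finally show ?thesis .
    qed
    then have inv: "(\<Sum>h\<in>B. trm h) \<in> invariant_ring n G"
      using tS by (auto simp: invariant_ring_def B_def intro!: poly_ring_sum)
    have "(\<Prod>j\<in>A. y j ^ c j) = y i ^ c i * (\<Prod>j\<in>A - {i}. y j ^ c j)" using A(1) i by (rule prod.remove)
    then have "(\<Sum>h\<in>B. trm h) * (\<Prod>j\<in>A. y j ^ c j)
        = ((\<Sum>h\<in>B. trm h) * (y i ^ (c i - 1) * (\<Prod>j\<in>A - {i}. y j ^ c j))) * y i"
      using ci by (simp add: mult_ac power_eq_if)
    then show "(\<Sum>h\<in>{h \<in> H. cnt h = c}. trm h) * (\<Prod>i\<in>A. y i ^ c i) \<in> ideal_of (invariant_ring n G) A y"
      unfolding B_def[symmetric] using i A inv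
      by (simp only:) (intro ideal_of_mult[OF R] ideal_of_gen[OF R] subalg_mult[OF R] subalg_power[OF R] subalg_prod[OF R], auto)
  qed
  finally show ?thesis .
qed

context perm_group
begin

lemma esym_mem: "(esym n k :: 'k::field mpol) \<in> invariant_ring n G"
  using full_invariant_ring_subset esym_invariant by blast

lemma var_mem_rad_esym:
  fixes J :: "'k::field mpol set"
  assumes J: "radical_ideal (poly_ring n) J" and e: "\<And>k. k \<in> {1..n} \<Longrightarrow> esym n k \<in> J" and j: "j \<in> {1..n}"
  shows "var j \<in> J"
proof -
  let ?S = "poly_ring n :: 'k mpol set"
  have v: "var j \<in> ?S" using j by (rule var_in_poly_ring)
  have "(\<Prod>i=1..n. var j - var i) = (0 :: 'k mpol)" using j by (intro prod_zero) auto
  then have "(\<Sum>k\<le>n. (-1) ^ k * esym n k * var j ^ (n - k)) = (0 :: 'k mpol)" by (simp add: prod_minus_var)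
  moreover have "{..n} = insert 0 {1..n}" by auto
  ultimately have "var j ^ n = - (\<Sum>k=1..n. (-1) ^ k * esym n k * var j ^ (n - k) :: 'k mpol)"
    by (simp add: eq_neg_iff_add_eq_0)
  also have "\<dots> = (\<Sum>k=1..n. (- ((-1) ^ k) * var j ^ (n - k)) * esym n k)" by (simp add: sum_negf mult_ac)
  also have "\<dots> \<in> J"
  proof (rule radical_ideal_sum[OF poly_ring_subalgebra J])
    fix k assume "k \<in> {1..n}"
    moreover have "- ((-1) ^ k) * var j ^ (n - k) \<in> ?S" by (intro poly_ring_mult poly_ring_power
        poly_ring_uminus poly_ring_1 v)
    ultimately show "(- ((-1) ^ k) * var j ^ (n - k)) * esym n k \<in> J"
      using e J unfolding radical_ideal_def by blast
  qed
  finally show ?thesis using J v unfolding radical_ideal_def by blast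
qed

lemma var_mem_rad:
  fixes p :: "nat \<Rightarrow> 'k::field mpol"
  assumes p: "hom_sop n (invariant_ring n G) p" and j: "j \<in> {1..n}"
  shows "var j \<in> rad (poly_ring n) (ideal_of (poly_ring n) {1..n} p)"
proof (rule var_mem_rad_esym[OF radical_ideal_rad[OF poly_ring_subalgebra] _ j])
  let ?S = "poly_ring n :: 'k mpol set" and ?R = "invariant_ring n G :: 'k mpol set"
  have RS: "?R \<subseteq> ?S" by (auto simp: invariant_ring_def)
  fix k assume "k \<in> {1..n}"
  then have "lookup (esym n k :: 'k mpol) 0 = 0" by (intro homogeneous_lookup_0[OF esym_homogeneous]) auto
  then have "esym n k \<in> hom_max_ideal ?R" using esym_mem[of k] by (simp add: hom_max_ideal_def)
  then have "esym n k \<in> rad ?R (ideal_of ?R {1..n} p)" using hom_sop_rad[OF p] by simp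
  then show "esym n k \<in> rad ?S (ideal_of ?S {1..n} p)" using RS by (fastforce simp: rad_def ideal_of_def)
qed

lemma var_power_mem:
  fixes p :: "nat \<Rightarrow> 'k::field mpol"
  assumes p: "hom_sop n (invariant_ring n G) p"
  shows "\<exists>N. \<forall>j\<in>{1..n}. var j ^ N \<in> ideal_of (poly_ring n) {1..n} p"
proof -
  let ?I = "ideal_of (poly_ring n) {1..n} p"
  have "\<forall>j\<in>{1..n}. \<exists>t. var j ^ t \<in> ?I" using var_mem_rad[OF p] by (simp add: rad_def)
  then obtain t where t: "\<forall>j\<in>{1..n}. var j ^ t j \<in> ?I" by metis
  show ?thesis
  proof (intro exI[of _ "\<Sum>j=1..n. t j"] ballI)
    fix j assume j: "j \<in> {1..n}"
    then have "t j \<le> (\<Sum>j=1..n. t j)" by (intro member_le_sum) auto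
    then have "var j ^ (\<Sum>j=1..n. t j) = var j ^ ((\<Sum>j=1..n. t j) - t j) * (var j ^ t j :: 'k mpol)"
      by (simp flip: power_add)
    also have "\<dots> \<in> ?I"
      using t j by (intro ideal_of_mult[OF poly_ring_subalgebra] poly_ring_power var_in_poly_ring) auto
    finally show "var j ^ (\<Sum>j=1..n. t j) \<in> ?I" .
  qed
qed

definition box :: "nat \<Rightarrow> (nat \<Rightarrow>\<^sub>0 nat) set" where
  "box N = {a. keys a \<subseteq> {1..n} \<and> (\<forall>i. lookup a i < N)}"

lemma finite_box: "finite (box N)"
proof -
  have "box N \<subseteq> (\<Union>d\<in>{0..int (n * N)}. exps n d)"
  proof
    fix a assume a: "a \<in> box N"
    have "mon_deg a \<le> (\<Sum>i\<in>keys a. N)"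
      unfolding mon_deg_def using a by (intro sum_mono) (auto simp: box_def less_imp_le)
    also have "\<dots> \<le> n * N" using a card_mono[of "{1..n}" "keys a"] by (simp add: box_def)
    finally show "a \<in> (\<Union>d\<in>{0..int (n * N)}. exps n d)"
      using a by (auto simp: box_def exps_def simp del: of_nat_mult)
  qed
  then show ?thesis by (rule finite_subset) (simp add: finite_exps)
qed

definition box_gens :: "'k::field mpol \<Rightarrow> nat \<Rightarrow> nat \<Rightarrow> nat \<Rightarrow> 'k mpol set" where
  "box_gens P \<delta> N d = {P ^ j * mon a | j a. a \<in> box N \<and> j * \<delta> + mon_deg a = d}"

lemma box_gens_bound:
  assumes "\<delta> > 0"
  shows "finite (box_gens P \<delta> N d)" "card (box_gens P \<delta> N d) \<le> card (box N)"
proof -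
  have "box_gens P \<delta> N d \<subseteq> (\<lambda>a. P ^ ((d - mon_deg a) div \<delta>) * mon a) ` box N"
  proof
    fix x assume "x \<in> box_gens P \<delta> N d"
    then obtain j a where *: "x = P ^ j * mon a" "a \<in> box N" "j * \<delta> + mon_deg a = d"
      by (auto simp: box_gens_def)
    then have "j * \<delta> = d - mon_deg a" by simp
    then have "j = (d - mon_deg a) div \<delta>" using assms by (metis less_numeral_extra(3) nonzero_mult_div_cancel_right)
    then show "x \<in> (\<lambda>a. P ^ ((d - mon_deg a) div \<delta>) * mon a) ` box N" using * by blast
  qed
  then show "finite (box_gens P \<delta> N d)" "card (box_gens P \<delta> N d) \<le> card (box N)"
    using finite_box[of N] by (auto intro: finite_subset surj_card_le)
qed

text \<open>Modulo the other parameters, the polynomial ring is a module over \<open>k[p\<^sub>m]\<close> generated by the finitely many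
  monomials with exponents below \<open>N\<close>.\<close>

lemma poly_ring_mod_gens:
  fixes p :: "nat \<Rightarrow> 'k::field mpol" and f :: "'k mpol"
  assumes hp: "\<And>i. i \<in> {1..n} \<Longrightarrow> p i \<in> poly_ring n" "\<And>i. i \<in> {1..n} \<Longrightarrow> homogeneous (int (\<delta> i)) (p i)"
    and m: "m \<in> {1..n}" "\<delta> m > 0"
    and N: "\<And>j. j \<in> {1..n} \<Longrightarrow> var j ^ N \<in> ideal_of (poly_ring n) {1..n} p"
    and f: "f \<in> poly_ring n" "homogeneous (int d) f"
  shows "\<exists>w g. f = w + g \<and> w \<in> mp.span (box_gens (p m) (\<delta> m) N d) \<and> g \<in> ideal_of (poly_ring n) ({1..n} - {m}) p"
  using f
proof (induction d arbitrary: f rule: less_induct)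
  case (less d)
  let ?S = "poly_ring n :: 'k mpol set"
  let ?I = "ideal_of ?S ({1..n} - {m}) p"
  define U where "U = {f. \<exists>w g. f = w + g \<and> w \<in> mp.span (box_gens (p m) (\<delta> m) N d) \<and> g \<in> ?I}"
  note S = poly_ring_subalgebra[where ?'a = 'k]
  have U_add: "a + b \<in> U" if ab: "a \<in> U" "b \<in> U" for a b
  proof -
    obtain w g w' g' where "a = w + g" "b = w' + g'" "w \<in> mp.span (box_gens (p m) (\<delta> m) N d)"
      "w' \<in> mp.span (box_gens (p m) (\<delta> m) N d)" "g \<in> ?I" "g' \<in> ?I" using ab unfolding U_def by blast
    then have "a + b = (w + w') + (g + g')" "w + w' \<in> mp.span (box_gens (p m) (\<delta> m) N d)" "g + g' \<in> ?I"
      by (auto intro: mp.span_add ideal_of_add[OF S])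
    then show ?thesis unfolding U_def by blast
  qed
  have U_scale: "const c * a \<in> U" if a: "a \<in> U" for c a
  proof -
    obtain w g where "a = w + g" "w \<in> mp.span (box_gens (p m) (\<delta> m) N d)" "g \<in> ?I" using a unfolding U_def by blast
    then have "const c * a = const c * w + const c * g" "const c * w \<in> mp.span (box_gens (p m) (\<delta> m) N d)"
      "const c * g \<in> ?I"
      by (auto intro: mp.span_scale ideal_of_mult[OF S] subalg_const[OF S] simp: distrib_left)
    then show ?thesis unfolding U_def by blast
  qed
  have U_span: "w \<in> U" if "w \<in> mp.span (box_gens (p m) (\<delta> m) N d)" for w
  proof -
    have "w = w + 0" by simp
    then show ?thesis using that ideal_of_0[OF S] unfolding U_def by blast
  qed
  have U_I: "g \<in> U" if "g \<in> ?I" for g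
  proof -
    have "g = 0 + g" by simp
    then show ?thesis using that mp.span_zero unfolding U_def by blast
  qed
  have U_mon: "mon a \<in> U" if a: "keys a \<subseteq> {1..n}" "mon_deg a = d" for a
  proof (cases "\<forall>i. lookup a i < N")
    case True
    have "p m ^ 0 * mon a \<in> box_gens (p m) (\<delta> m) N d"
      unfolding box_gens_def using a True by (intro CollectI exI[of _ 0] exI[of _ a]) (auto simp: box_def)
    then show ?thesis using mp.span_base U_span by fastforce
  next
    case False
    then obtain i where i: "N \<le> lookup a i" by (auto simp: not_less)
    have monS: "mon b \<in> ?S" if "keys b \<subseteq> {1..n}" for b using that by (auto simp: poly_ring_def mon_def)
    have "mon a \<in> ideal_of ?S {1..n} p"
    proof (cases "i \<in> {1..n}")
      case True
      define b where "b = a - single i N"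
      have ab: "a = b + single i N"
        by (rule poly_mapping_eqI) (use i in \<open>auto simp: b_def lookup_add lookup_minus lookup_single when_def\<close>)
      have kb: "keys b \<subseteq> {1..n}" using a(1) by (auto simp: b_def in_keys_iff lookup_minus subset_iff)
      have "mon a = mon b * (var i ^ N :: 'k mpol)" by (simp add: ab mon_add var_power)
      then show ?thesis using ideal_of_mult[OF S N[OF True] monS[OF kb]] by simp
    next
      case False
      then have "lookup a i = 0" using a(1) by (auto simp: in_keys_iff)
      then have "N = 0" using i by simp
      then have "1 \<in> ideal_of ?S {1..n} p" using N[OF m(1)] by simp
      then show ?thesis using ideal_of_mult[OF S _ monS[OF a(1)]] by fastforce
    qed
    then obtain s where s: "\<forall>l\<in>{1..n}. s l \<in> ?S" "mon a = (\<Sum>l=1..n. s l * p l)" by (auto simp: ideal_of_def)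
    define s' where "s' l = hcomp (int d - int (\<delta> l)) (s l)" for l
    have s'S: "s' l \<in> ?S" if "l \<in> {1..n}" for l
      unfolding s'_def using s(1) that by (intro subalg_hcomp[OF S]) auto
    have "mon a = hcomp (int d) (mon a :: 'k mpol)"
      using homogeneous_mon[of a, where ?'a = 'k] a(2) by (simp add: hcomp_homogeneous)
    also have "\<dots> = (\<Sum>l=1..n. hcomp (int d) (s l * p l))" by (simp add: s(2) hcomp_sum)
    also have "\<dots> = (\<Sum>l=1..n. s' l * p l)"
    proof (rule sum.cong)
      fix l assume "l \<in> {1..n}"
      then show "hcomp (int d) (s l * p l) = s' l * p l"
        using hcomp_mult_homogeneous[OF hp(2), of l "int d - int (\<delta> l)" "s l"] by (simp add: s'_def)
    qed simp
    also have "\<dots> = s' m * p m + (\<Sum>l\<in>{1..n} - {m}. s' l * p l)" using m(1) by (simp add: sum.remove)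
    finally have eq: "mon a = s' m * p m + (\<Sum>l\<in>{1..n} - {m}. s' l * p l)" .
    have g: "(\<Sum>l\<in>{1..n} - {m}. s' l * p l) \<in> ?I"
      unfolding ideal_of_def using s'S by blast
    have "s' m * p m \<in> U"
    proof (cases "\<delta> m \<le> d")
      case False
      then have "s' m = 0"
        using homogeneous_nonneg[OF homogeneous_hcomp[of "int d - int (\<delta> m)" "s m"]] by (force simp: s'_def)
      then show ?thesis using U_I[OF ideal_of_0[OF S]] by simp
    next
      case True
      define d' where "d' = d - \<delta> m"
      have d': "d' < d" "d = d' + \<delta> m" using True m(2) by (auto simp: d'_def)
      have "homogeneous (int d') (s' m)"
        using homogeneous_hcomp[of "int d - int (\<delta> m)" "s m"] d'(2) by (simp add: s'_def)
      then obtain w h where wh: "s' m = w + h" "w \<in> mp.span (box_gens (p m) (\<delta> m) N d')" "h \<in> ?I"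
        using less.IH[OF d'(1) s'S[OF m(1)]] by blast
      have "w * p m \<in> mp.span (box_gens (p m) (\<delta> m) N d)" using wh(2)
      proof (induction rule: mp.span_induct_alt)
        case base
        then show ?case by (simp add: mp.span_zero)
      next
        case (step c x y)
        then obtain j b where jb: "x = p m ^ j * mon b" "b \<in> box N" "j * \<delta> m + mon_deg b = d'"
          by (auto simp: box_gens_def)
        have "p m ^ Suc j * mon b \<in> box_gens (p m) (\<delta> m) N d"
          unfolding box_gens_def using jb d'(2) by (intro CollectI exI[of _ "Suc j"] exI[of _ b]) auto
        then have "const c * (p m ^ Suc j * mon b) \<in> mp.span (box_gens (p m) (\<delta> m) N d)"
          by (intro mp.span_scale mp.span_base)
        moreover have "(const c * x + y) * p m = const c * (p m ^ Suc j * mon b) + y * p m"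
          by (simp add: jb(1) algebra_simps)
        ultimately show ?case using step by (simp add: mp.span_add)
      qed
      moreover have "p m * h \<in> ?I" by (rule ideal_of_mult[OF S wh(3) hp(1)[OF m(1)]])
      ultimately show ?thesis using U_add[OF U_span U_I] by (simp add: wh(1) distrib_left mult.commute)
    qed
    then show ?thesis using U_add U_I[OF g] eq by simp
  qed
  have "(\<Sum>a\<in>A. const (lookup f a) * mon a) \<in> U" if "finite A" "A \<subseteq> keys f" for A using that
  proof (induction A rule: finite_induct)
    case empty
    then show ?case using U_I[OF ideal_of_0[OF S]] by simp
  next
    case (insert a A)
    then have "keys a \<subseteq> {1..n}" "mon_deg a = d" using less.prems by (auto simp: poly_ring_def homogeneous_def)
    then show ?case using insert U_add U_scale U_mon by simp
  qed
  from this[OF finite_keys order_refl] have "f \<in> U" by (simp only: poly_eq_sum_mon[of f, symmetric])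
  then show ?case by (simp add: U_def)
qed

text \<open>The number of these generators, which bounds the dimension of every homogeneous component, does not depend on the degree.\<close>

lemma dependent_mod_ideal:
  fixes p :: "nat \<Rightarrow> 'k::field mpol"
  assumes p: "hom_sop n (invariant_ring n G) p" and m: "m \<in> {1..n}"
  shows "\<exists>C::nat. \<forall>d f. (\<forall>i\<le>C. f i \<in> poly_ring n \<and> homogeneous (int d) (f i)) \<longrightarrow>
    (\<exists>a. (\<exists>i\<le>C. a i \<noteq> 0) \<and> (\<Sum>i\<le>C. const (a i) * f i) \<in> ideal_of (poly_ring n) ({1..n} - {m}) p)"
proof -
  let ?S = "poly_ring n :: 'k mpol set"
  let ?I = "ideal_of ?S ({1..n} - {m}) p"
  note S = poly_ring_subalgebra[where ?'a = 'k]
  obtain N where N: "\<forall>j\<in>{1..n}. var j ^ N \<in> ideal_of ?S {1..n} p" using var_power_mem[OF p] by blast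
  have "\<forall>i\<in>{1..n}. \<exists>e>0. homogeneous (int e) (p i)"
    using p unfolding hom_sop_def by (metis pos_int_cases of_nat_0_less_iff)
  then obtain \<delta> where \<delta>: "\<forall>i\<in>{1..n}. \<delta> i > 0 \<and> homogeneous (int (\<delta> i)) (p i)" by metis
  have pS: "p i \<in> ?S" if "i \<in> {1..n}" for i using p that by (auto simp: hom_sop_def invariant_ring_def)
  show ?thesis
  proof (intro exI[of _ "card (box N)"] allI impI)
    fix d and f :: "nat \<Rightarrow> 'k mpol"
    let ?C = "card (box N)" and ?W = "box_gens (p m) (\<delta> m) N d"
    assume f: "\<forall>i\<le>?C. f i \<in> ?S \<and> homogeneous (int d) (f i)"
    have "\<forall>i\<in>{..?C}. \<exists>w g. f i = w + g \<and> w \<in> mp.span ?W \<and> g \<in> ?I"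
      using poly_ring_mod_gens[of p \<delta> m N _ d] pS \<delta> m N f by simp
    then obtain w g where wg: "\<And>i. i \<le> ?C \<Longrightarrow> f i = w i + g i \<and> w i \<in> mp.span ?W \<and> g i \<in> ?I" by (metis atMost_iff)
    have "\<exists>a. (\<exists>i\<le>?C. a i \<noteq> 0) \<and> (\<Sum>i\<le>?C. const (a i) * w i) = 0"
    proof (cases "inj_on w {..?C}")
      case False
      then obtain i j where ij: "i \<le> ?C" "j \<le> ?C" "i \<noteq> j" "w i = w j" by (auto simp: inj_on_def)
      define a where "a l = (if l = i then 1 else if l = j then - 1 else (0::'k))" for l
      have "(\<Sum>l\<le>?C. const (a l) * w l) = (\<Sum>l\<in>{i, j}. const (a l) * w l)"
        using ij by (intro sum.mono_neutral_right) (auto simp: a_def)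
      also have "\<dots> = 0" using ij by (simp add: a_def const_uminus)
      finally show ?thesis using ij(1) by (intro exI[of _ a]) (auto simp: a_def)
    next
      case True
      have "mp.dependent (w ` {..?C})"
      proof (rule ccontr)
        assume "\<not> mp.dependent (w ` {..?C})"
        moreover have "w ` {..?C} \<subseteq> mp.span ?W" using wg by auto
        ultimately have "card (w ` {..?C}) \<le> card ?W"
          using mp.independent_span_bound[OF box_gens_bound(1)] \<delta> m by metis
        then show False using card_image[OF True] box_gens_bound(2)[of "\<delta> m" "p m" N d] \<delta> m by simp
      qed
      then obtain u where u: "(\<Sum>v\<in>w ` {..?C}. const (u v) * v) = 0" "\<exists>v\<in>w ` {..?C}. u v \<noteq> 0"
        by (subst (asm) mp.dependent_finite) auto
      then show ?thesis using True by (intro exI[of _ "u \<circ> w"]) (auto simp: sum.reindex)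
    qed
    then obtain a where a: "\<exists>i\<le>?C. a i \<noteq> 0" "(\<Sum>i\<le>?C. const (a i) * w i) = 0" by blast
    have "(\<Sum>i\<le>?C. const (a i) * f i) = (\<Sum>i\<le>?C. const (a i) * w i) + (\<Sum>i\<le>?C. const (a i) * g i)"
      using wg by (simp add: distrib_left flip: sum.distrib)
    also have "\<dots> = (\<Sum>i\<le>?C. const (a i) * g i)" by (simp add: a(2))
    also have "\<dots> \<in> ?I" using wg by (intro ideal_of_sum[OF S] ideal_of_mult[OF S] subalg_const[OF S]) auto
    finally show "\<exists>a. (\<exists>i\<le>?C. a i \<noteq> 0) \<and> (\<Sum>i\<le>?C. const (a i) * f i) \<in> ?I" using a(1) by blast
  qed
qed

end

definition bform :: "'k::field mpol \<Rightarrow> 'k mpol \<Rightarrow> nat \<Rightarrow> 'k poly \<Rightarrow> 'k mpol" where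
  "bform u v M a = (\<Sum>i\<le>M. const (coeff a i) * (u ^ (M - i) * v ^ i))"

lemma const_sum: "const (\<Sum>i\<in>A. f i) = (\<Sum>i\<in>A. const (f i))"
  by (induction A rule: infinite_finite_induct) (auto simp: const_add)

lemma bform_mult:
  assumes "degree a \<le> M" "degree b \<le> N"
  shows "bform u v (M + N) (a * b) = bform u v M a * bform u v N b"
proof -
  have "bform u v M a * bform u v N b = (\<Sum>(i, j)\<in>{..M} \<times> {..N}. const (coeff a i * coeff b j) * (u ^ (M + N - (i + j)) * v ^ (i + j)))"
    unfolding bform_def sum_product sum.cartesian_product
  proof (rule sum.cong[OF refl])
    fix x assume "x \<in> {..M} \<times> {..N}"
    then obtain i j where x: "x = (i, j)" "i \<le> M" "j \<le> N" by auto
    then have "M + N - (i + j) = (M - i) + (N - j)" by simp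
    then have "u ^ (M - i) * u ^ (N - j) = u ^ (M + N - (i + j))" by (simp add: power_add)
    then show "(case x of (i, j) \<Rightarrow> const (coeff a i) * (u ^ (M - i) * v ^ i) * (const (coeff b j) * (u ^ (N - j) * v ^ j)))
        = (case x of (i, j) \<Rightarrow> const (coeff a i * coeff b j) * (u ^ (M + N - (i + j)) * v ^ (i + j)))"
      by (simp add: x power_add[of v] const_mult mult_ac)
  qed
  also have "\<dots> = (\<Sum>k\<le>M + N. \<Sum>(i, j)\<in>{(i, j). (i, j) \<in> {..M} \<times> {..N} \<and> i + j = k}.
      const (coeff a i * coeff b j) * (u ^ (M + N - (i + j)) * v ^ (i + j)))"
    by (subst sum.group[symmetric, where g = "\<lambda>(i, j). i + j" and T = "{..M + N}"])
      (auto intro!: sum.cong)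
  also have "\<dots> = (\<Sum>k\<le>M + N. const (coeff (a * b) k) * (u ^ (M + N - k) * v ^ k))"
  proof (rule sum.cong)
    fix k assume "k \<in> {..M + N}"
    have "coeff (a * b) k = (\<Sum>i\<le>k. coeff a i * coeff b (k - i))" by (rule coeff_mult)
    also have "\<dots> = (\<Sum>(i, j)\<in>(\<lambda>i. (i, k - i)) ` {..k}. coeff a i * coeff b j)"
      by (subst sum.reindex) (auto simp: inj_on_def)
    also have "\<dots> = (\<Sum>(i, j)\<in>{(i, j). (i, j) \<in> {..M} \<times> {..N} \<and> i + j = k}. coeff a i * coeff b j)"
    proof (rule sum.mono_neutral_right)
      show "\<forall>x\<in>(\<lambda>i. (i, k - i)) ` {..k} - {(i, j). (i, j) \<in> {..M} \<times> {..N} \<and> i + j = k}.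
          (case x of (i, j) \<Rightarrow> coeff a i * coeff b j) = 0"
      proof
        fix x assume x: "x \<in> (\<lambda>i. (i, k - i)) ` {..k} - {(i, j). (i, j) \<in> {..M} \<times> {..N} \<and> i + j = k}"
        then obtain i where "x = (i, k - i)" "i \<le> k" "\<not> (i \<le> M \<and> k - i \<le> N)" by auto
        then show "(case x of (i, j) \<Rightarrow> coeff a i * coeff b j) = 0"
          using assms coeff_eq_0[of a i] coeff_eq_0[of b "k - i"] by auto
      qed
    qed auto
    finally show "(\<Sum>(i, j)\<in>{(i, j). (i, j) \<in> {..M} \<times> {..N} \<and> i + j = k}.
        const (coeff a i * coeff b j) * (u ^ (M + N - (i + j)) * v ^ (i + j)))
        = const (coeff (a * b) k) * (u ^ (M + N - k) * v ^ k)"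
      by (simp only: const_sum sum_distrib_right) (auto intro!: sum.cong)
  qed simp
  finally show ?thesis by (simp add: bform_def)
qed

lemma bform_one: "bform u v M 1 = u ^ M"
proof -
  have "bform u v M 1 = (\<Sum>i\<in>{0}. const (coeff 1 i) * (u ^ (M - i) * v ^ i))"
    unfolding bform_def by (intro sum.mono_neutral_right) auto
  then show ?thesis by simp
qed

lemma bform_lead:
  obtains W where "bform u v (degree c) c = const (lead_coeff c) * v ^ degree c + u * W"
    "\<And>T. graded_subalgebra T \<Longrightarrow> u \<in> T \<Longrightarrow> v \<in> T \<Longrightarrow> W \<in> T"
proof -
  let ?W = "\<Sum>i<degree c. const (coeff c i) * (u ^ (degree c - i - 1) * v ^ i)"
  have "bform u v (degree c) c = const (lead_coeff c) * v ^ degree c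
      + (\<Sum>i<degree c. const (coeff c i) * (u ^ (degree c - i) * v ^ i))"
    by (simp add: bform_def lessThan_Suc_atMost[symmetric] del: lessThan_Suc_atMost)
  also have "(\<Sum>i<degree c. const (coeff c i) * (u ^ (degree c - i) * v ^ i)) = u * ?W"
    unfolding sum_distrib_left
  proof (rule sum.cong)
    fix i assume "i \<in> {..<degree c}"
    then have "degree c - i = Suc (degree c - i - 1)" by simp
    then have "u ^ (degree c - i) = u * u ^ (degree c - i - 1)" by (metis power_Suc)
    then show "const (coeff c i) * (u ^ (degree c - i) * v ^ i)
        = u * (const (coeff c i) * (u ^ (degree c - i - 1) * v ^ i))" by (simp add: mult_ac)
  qed simp
  finally show ?thesis by (rule that) (intro subalg_sum subalg_mult subalg_const subalg_power)
qed

lemma bform_homogeneous: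
  assumes "homogeneous e u" "homogeneous e v"
  shows "homogeneous (int M * e) (bform u v M a)"
  unfolding bform_def
proof (intro homogeneous_sum homogeneous_const_mult)
  fix i assume "i \<in> {..M}"
  moreover have "homogeneous (int (M - i) * e + int i * e) (u ^ (M - i) * v ^ i)"
    by (intro homogeneous_mult homogeneous_power assms)
  ultimately show "homogeneous (int M * e) (u ^ (M - i) * v ^ i)" by (simp add: of_nat_diff flip: distrib_right)
qed

context perm_group
begin

lemma bform_mem_ideal:
  fixes p :: "nat \<Rightarrow> 'k::field mpol"
  assumes p: "hom_sop n (invariant_ring n G) p" and m: "m \<in> {1..n}"
    and uv: "u \<in> poly_ring n" "v \<in> poly_ring n" "homogeneous (int e) u" "homogeneous (int e) v"
  obtains a M where "a \<noteq> 0" "degree a \<le> M" "bform u v M a \<in> ideal_of (poly_ring n) ({1..n} - {m}) p"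
proof -
  note S = poly_ring_subalgebra[where ?'a = 'k]
  obtain C :: nat where C: "\<forall>d f. (\<forall>i\<le>C. f i \<in> poly_ring n \<and> homogeneous (int d) (f i)) \<longrightarrow>
    (\<exists>a. (\<exists>i\<le>C. a i \<noteq> 0) \<and> (\<Sum>i\<le>C. const (a i) * f i) \<in> ideal_of (poly_ring n) ({1..n} - {m}) p)"
    using dependent_mod_ideal[OF p m] by blast
  have "u ^ (C - i) * v ^ i \<in> poly_ring n \<and> homogeneous (int (C * e)) (u ^ (C - i) * v ^ i)" if "i \<le> C" for i
  proof -
    have "homogeneous (int (C - i) * int e + int i * int e) (u ^ (C - i) * v ^ i)"
      by (intro homogeneous_mult homogeneous_power uv)
    then show ?thesis
      using that uv by (auto simp: of_nat_diff simp flip: distrib_right intro!: subalg_mult[OF S] subalg_power[OF S])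
  qed
  then obtain a where a: "\<exists>i\<le>C. a i \<noteq> 0"
    "(\<Sum>i\<le>C. const (a i) * (u ^ (C - i) * v ^ i)) \<in> ideal_of (poly_ring n) ({1..n} - {m}) p"
    using C[rule_format, of "\<lambda>i. u ^ (C - i) * v ^ i" "C * e"] by blast
  define a' where "a' = (\<Sum>i\<le>C. monom (a i) i)"
  have co: "coeff a' i = (if i \<le> C then a i else 0)" for i
    by (simp add: a'_def coeff_sum if_distrib cong: if_cong)
  show ?thesis
  proof (rule that)
    show "a' \<noteq> 0" using a(1) co by (metis coeff_0)
    show "degree a' \<le> C" by (rule degree_le) (simp add: co)
    show "bform u v C a' \<in> ideal_of (poly_ring n) ({1..n} - {m}) p" using a(2) by (simp add: bform_def co)
  qed
qed

text \<open>Powers \<open>u\<close>, \<open>v\<close> of \<open>p\<^sub>m\<close>, \<open>q\<^sub>m\<close> of the same degree satisfy nontrivial homogeneous relations modulo the other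
  elements of \<open>p\<close> and modulo those of \<open>q\<close>. The product of the two relations is \<open>u\<^sup>i C\<close> with a form \<open>C\<close> of some degree
  \<open>d\<close> in which \<open>v\<^sup>d\<close> occurs. For \<open>u \<noteq> v\<close> take \<open>z = u\<^bsup>d+k\<^esup> + v\<^sup>k C\<close>, where \<open>k\<close> is 1 or 2 such that \<open>z \<noteq> 0\<close>. A radical
  ideal that contains \<open>z\<close> and \<open>u v C\<close> also contains \<open>u z - v\<^bsup>k-1\<^esup> u v C = u\<^bsup>d+k+1\<^esup>\<close>, hence \<open>u\<close>, hence a nonzero
  multiple of \<open>v\<^bsup>d+k\<^esup>\<close>, hence \<open>v\<close>; so \<open>z\<close> may replace \<open>p\<^sub>m\<close> and \<open>q\<^sub>m\<close>.\<close>

lemma common_parameter: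
  fixes p q :: "nat \<Rightarrow> 'k::field mpol"
  assumes p: "hom_sop n (invariant_ring n G) p" and q: "hom_sop n (invariant_ring n G) q" and m: "m \<in> {1..n}"
  obtains z where "hom_sop n (invariant_ring n G) (p(m := z))" "hom_sop n (invariant_ring n G) (q(m := z))"
proof -
  let ?S = "poly_ring n :: 'k mpol set" and ?R = "invariant_ring n G :: 'k mpol set"
  note R = invariant_ring_subalgebra[where ?'k = 'k]
  note S = poly_ring_subalgebra[where ?'a = 'k]
  have RS: "?R \<subseteq> ?S" by (auto simp: invariant_ring_def)
  have *: "y i \<in> ?R \<and> y i \<noteq> 0 \<and> (\<exists>d>0. homogeneous (int d) (y i))"
    if "hom_sop n ?R y" "i \<in> {1..n}" for y i using that unfolding hom_sop_def by (metis pos_int_cases)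
  obtain dp dq where d: "dp > 0" "dq > 0" "homogeneous (int dp) (p m)" "homogeneous (int dq) (q m)"
    using *[OF p m] *[OF q m] by auto
  define u v e where "u = p m ^ dq" and "v = q m ^ dp" and "e = dp * dq"
  have uv: "u \<in> ?R" "v \<in> ?R" "u \<noteq> 0" "v \<noteq> 0"
    using *[OF p m] *[OF q m] by (auto simp: u_def v_def intro!: subalg_power[OF R])
  have e: "e > 0" using d by (simp add: e_def)
  have huv: "homogeneous (int e) u" "homogeneous (int e) v"
    using homogeneous_power[OF d(3), of dq] homogeneous_power[OF d(4), of dp]
    by (simp_all add: u_def v_def e_def mult.commute)
  obtain a M where a: "a \<noteq> 0" "degree a \<le> M" "bform u v M a \<in> ideal_of ?S ({1..n} - {m}) p"
    using bform_mem_ideal[OF p m _ _ huv] uv RS by blast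
  obtain b N where b: "b \<noteq> 0" "degree b \<le> N" "bform u v N b \<in> ideal_of ?S ({1..n} - {m}) q"
    using bform_mem_ideal[OF q m _ _ huv] uv RS by blast
  have bS: "bform u v k f \<in> ?R" for k f
    unfolding bform_def by (intro subalg_sum[OF R] subalg_mult[OF R] subalg_const[OF R] subalg_power[OF R] uv)
  have ab: "bform u v (M + N) (a * b) \<in> ideal_of ?S ({1..n} - {m}) p"
    "bform u v (M + N) (a * b) \<in> ideal_of ?S ({1..n} - {m}) q"
    using ideal_of_mult[OF S a(3), of "bform u v N b"] ideal_of_mult[OF S b(3), of "bform u v M a"] bS RS
    by (auto simp: bform_mult[OF a(2) b(2)] mult.commute)
  have ab0: "a * b \<noteq> 0" "degree (a * b) \<le> M + N" using a b degree_mult_le[of a b] by auto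
  define c where "c = a * b"
  have c0: "c \<noteq> 0" and deg: "degree c \<le> M + N" using ab0 by (simp_all add: c_def)
  define C where "C = bform u v (degree c) c"
  obtain W where W: "C = const (lead_coeff c) * v ^ degree c + u * W" "W \<in> ?R"
    using bform_lead[of u v c] R uv unfolding C_def by metis
  have form: "bform u v (M + N) (a * b) = u ^ (M + N - degree c) * C"
    using bform_mult[of 1 "M + N - degree c" c "degree c" u v] deg by (simp add: bform_one C_def flip: c_def)
  have CR: "C \<in> ?R" by (simp add: C_def bS)
  have uvC: "u * v * C \<in> J"
    if J: "radical_ideal ?R J" "\<And>i. i \<in> {1..n} - {m} \<Longrightarrow> y i \<in> J"
      and y: "hom_sop n ?R y" and F: "bform u v (M + N) (a * b) \<in> ideal_of ?S ({1..n} - {m}) y" for J y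
  proof -
    let ?F = "bform u v (M + N) (a * b)"
    have "?F ^ card G \<in> ideal_of ?R ({1..n} - {m}) y" using invariant_power_in_ideal[OF bS F] *[OF y] by simp
    then have "?F \<in> rad ?R (ideal_of ?R ({1..n} - {m}) y)" using bS by (auto simp: rad_def)
    then have "?F \<in> J" using rad_minimal[OF R J(1), of "{1..n} - {m}" y] J(2) by blast
    moreover define k where "k = M + N + 1"
    have "(u * v * C) ^ k = (u ^ (k - (M + N - degree c)) * v ^ k * C ^ (k - 1)) * ?F"
    proof -
      have "M + N - degree c \<le> k" "k = (k - 1) + 1" by (auto simp: k_def)
      then have "u ^ k = u ^ (k - (M + N - degree c)) * u ^ (M + N - degree c)" "C ^ k = C ^ (k - 1) * C"
        by (metis le_add_diff_inverse2 power_add power_one_right)+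
      then show ?thesis by (simp add: form power_mult_distrib mult_ac)
    qed
    moreover have "u ^ (k - (M + N - degree c)) * v ^ k * C ^ (k - 1) \<in> ?R"
      by (intro subalg_mult[OF R] subalg_power[OF R] uv CR)
    moreover have "u * v * C \<in> ?R" by (intro subalg_mult[OF R] uv CR)
    ultimately show ?thesis using J(1) unfolding radical_ideal_def by metis
  qed
  define zz where "zz k = u ^ (degree c + k) + v ^ k * C" for k
  have "\<exists>z d. z \<in> ?R \<and> z \<noteq> 0 \<and> d > 0 \<and> homogeneous d z \<and>
      (\<forall>J. radical_ideal ?R J \<longrightarrow> z \<in> J \<longrightarrow> u * v * C \<in> J \<longrightarrow> u \<in> J \<and> v \<in> J)"
  proof (cases "u = v")
    case True
    then show ?thesis using uv huv e by (intro exI[of _ u] exI[of _ "int e"]) auto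
  next
    case False
    have "zz 1 \<noteq> 0 \<or> zz 2 \<noteq> 0"
    proof (rule ccontr)
      assume "\<not> (zz 1 \<noteq> 0 \<or> zz 2 \<noteq> 0)"
      then have z: "u ^ (degree c + 1) = - (v * C)" "u ^ (degree c + 2) = - (v ^ 2 * C)"
        by (auto simp: zz_def eq_neg_iff_add_eq_0)
      have "u * u ^ (degree c + 1) = u ^ (degree c + 2)" by (simp flip: power_Suc add: numeral_2_eq_2 One_nat_def)
      then have "v * C * (u - v) = 0" unfolding z by (simp add: algebra_simps power2_eq_square)
      then have "C = 0" using False uv by simp
      then have "u ^ (degree c + 1) = 0" using z by simp
      then show False using uv by simp
    qed
    then obtain k where k: "k \<ge> 1" "zz k \<noteq> 0" by (metis one_le_numeral order_refl)
    have "homogeneous (int (degree c + k) * int e) (zz k)"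
    proof -
      have "homogeneous (int k * int e + int (degree c) * int e) (v ^ k * C)"
        unfolding C_def by (intro homogeneous_mult homogeneous_power huv bform_homogeneous)
      moreover have "homogeneous (int (degree c + k) * int e) (u ^ (degree c + k))"
        by (intro homogeneous_power huv)
      ultimately show ?thesis unfolding zz_def by (intro homogeneous_add) (auto simp: algebra_simps)
    qed
    moreover have "int (degree c + k) * int e > 0" using k(1) e by simp
    moreover have "zz k \<in> ?R"
      unfolding zz_def by (intro subalg_add[OF R] subalg_mult[OF R] subalg_power[OF R] uv CR)
    moreover have "u \<in> J \<and> v \<in> J" if J: "radical_ideal ?R J" and z: "zz k \<in> J" and uvC: "u * v * C \<in> J" for J
    proof -
      have add: "x + y \<in> J" if "x \<in> J" "y \<in> J" for x y using J that by (auto simp: radical_ideal_def)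
      have mult: "r * x \<in> J" if "r \<in> ?R" "x \<in> J" for r x using J that by (auto simp: radical_ideal_def)
      have diff: "x - y \<in> J" if "x \<in> J" "y \<in> J" for x y
        using add[OF that(1) mult[OF subalg_uminus[OF R subalg_1[OF R]] that(2)]] by simp
      have root: "x \<in> J" if "x ^ t \<in> J" "x \<in> ?R" for x t using J that by (auto simp: radical_ideal_def)
      obtain k' where k': "k = Suc k'" using k(1) by (cases k) auto
      have "u ^ (degree c + k + 1) \<in> J"
      proof -
        have "u ^ (degree c + k + 1) = u * u ^ (degree c + k)" "v ^ k = v * v ^ k'"
          by (simp_all only: k' power_Suc Suc_eq_plus1[symmetric])
        then have "u ^ (degree c + k + 1) = u * zz k - v ^ k' * (u * v * C)" by (simp add: zz_def algebra_simps)
        then show ?thesis using uv by (auto intro!: diff mult[OF _ z] mult[OF _ uvC] subalg_power[OF R])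
      qed
      then have u: "u \<in> J" using root uv by blast
      have "v ^ k * C \<in> J"
      proof -
        have "u ^ (degree c + k) = u ^ (degree c + k') * u" by (simp only: k' add_Suc_right power_Suc2)
        then have "v ^ k * C = zz k - u ^ (degree c + k') * u" by (simp add: zz_def)
        then show ?thesis using uv by (auto intro!: diff z mult[OF _ u] subalg_power[OF R])
      qed
      then have "v ^ k * C - (v ^ k * W) * u \<in> J"
        using uv W(2) by (auto intro!: diff mult[OF _ u] subalg_power[OF R] subalg_mult[OF R])
      moreover have "v ^ k * C - (v ^ k * W) * u = const (lead_coeff c) * v ^ (degree c + k)"
        by (simp add: W(1) algebra_simps power_add)
      ultimately have "const (lead_coeff c) * v ^ (degree c + k) \<in> J" by (simp only:)
      then have "const (inverse (lead_coeff c)) * (const (lead_coeff c) * v ^ (degree c + k)) \<in> J"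
        by (rule mult[OF subalg_const[OF R]])
      moreover have "const (inverse (lead_coeff c)) * (const (lead_coeff c) * v ^ (degree c + k)) = v ^ (degree c + k)"
        using c0 by (simp flip: const_mult mult.assoc)
      ultimately have "v ^ (degree c + k) \<in> J" by simp
      then show ?thesis using u root uv by blast
    qed
    ultimately show ?thesis using k(2) by blast
  qed
  then obtain z d where z: "z \<in> ?R" "z \<noteq> 0" "d > 0" "homogeneous d z"
    "\<And>J. radical_ideal ?R J \<Longrightarrow> z \<in> J \<Longrightarrow> u * v * C \<in> J \<Longrightarrow> u \<in> J \<and> v \<in> J" by blast
  have sop: "hom_sop n ?R (y(m := z))"
    if y: "hom_sop n ?R y" and F: "bform u v (M + N) (a * b) \<in> ideal_of ?S ({1..n} - {m}) y"
      and ym: "y m ^ t = u \<or> y m ^ t = v" for y t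
  proof (rule hom_sopI[OF R])
    show "n \<ge> 1" using m by simp
    show "(y(m := z)) i \<in> ?R \<and> (y(m := z)) i \<noteq> 0 \<and> (\<exists>d>0. homogeneous d ((y(m := z)) i))" if "i \<in> {1..n}" for i
      using z(1-4) y that by (auto simp: hom_sop_def)
    define J where "J = rad ?R (ideal_of ?R {1..n} (y(m := z)))"
    have J: "radical_ideal ?R J" unfolding J_def by (rule radical_ideal_rad[OF R])
    have g: "(y(m := z)) i \<in> J" if "i \<in> {1..n}" for i
      unfolding J_def using that z(1) *[OF y that] by (intro rad_gen[OF R]) auto
    have zJ: "z \<in> J" using g[OF m] by simp
    have yJ: "y i \<in> J" if "i \<in> {1..n} - {m}" for i using g[of i] that by simp
    have "u \<in> J \<and> v \<in> J" using z(5)[OF J zJ uvC[OF J yJ y F]] .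
    then have "y m ^ t \<in> J" using ym by auto
    then have "y m \<in> J" using J *[OF y m] by (auto simp: radical_ideal_def)
    then have "rad ?R (ideal_of ?R {1..n} y) \<subseteq> J"
      using yJ by (intro rad_minimal[OF R J]) (metis DiffI singletonD)
    then show "hom_max_ideal ?R \<subseteq> rad ?R (ideal_of ?R {1..n} (y(m := z)))"
      using hom_sop_rad[OF y] by (simp add: J_def)
  qed
  show ?thesis
    using sop[OF p ab(1), of dq] sop[OF q ab(2), of dp] by (intro that[of z]) (auto simp: u_def v_def)
qed

end

section \<open>Dual systems for arbitrary systems of parameters\<close>

text \<open>As for the elementary symmetric polynomials: \<open>\<phi> t p\<close> is the value at the class of \<open>p / (y\<^sub>1 \<cdots> y\<^sub>n)\<^sup>t\<close>.\<close>

definition sop_system :: "nat \<Rightarrow> 'k::field mpol set \<Rightarrow> (nat \<Rightarrow> 'k mpol) \<Rightarrow> int \<Rightarrow> (nat \<Rightarrow> 'k mpol \<Rightarrow> 'k) \<Rightarrow> bool" where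
  "sop_system n R y d \<phi> \<longleftrightarrow> (\<forall>t\<ge>1.
     (\<forall>p\<in>R. \<forall>q\<in>R. \<phi> t (p + q) = \<phi> t p + \<phi> t q) \<and>
     (\<forall>c. \<forall>p\<in>R. \<phi> t (const c * p) = c * \<phi> t p) \<and>
     (\<forall>i\<in>{1..n}. \<forall>p\<in>R. \<phi> t (y i ^ t * p) = 0) \<and>
     (\<forall>p\<in>R. \<phi> (Suc t) ((\<Prod>i=1..n. y i) * p) = \<phi> t p) \<and>
     (\<forall>p\<in>R. \<forall>e \<delta>. homogeneous e p \<longrightarrow> homogeneous \<delta> (\<Prod>i=1..n. y i) \<longrightarrow> e \<noteq> int t * \<delta> - d \<longrightarrow> \<phi> t p = 0))"

lemma sop_systemD:
  assumes "sop_system n R y d \<phi>" "t \<ge> 1"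
  shows "p \<in> R \<Longrightarrow> q \<in> R \<Longrightarrow> \<phi> t (p + q) = \<phi> t p + \<phi> t q"
    "p \<in> R \<Longrightarrow> \<phi> t (const c * p) = c * \<phi> t p"
    "i \<in> {1..n} \<Longrightarrow> p \<in> R \<Longrightarrow> \<phi> t (y i ^ t * p) = 0"
    "p \<in> R \<Longrightarrow> \<phi> (Suc t) ((\<Prod>i=1..n. y i) * p) = \<phi> t p"
    "p \<in> R \<Longrightarrow> homogeneous e p \<Longrightarrow> homogeneous \<delta> (\<Prod>i=1..n. y i) \<Longrightarrow> e \<noteq> int t * \<delta> - d \<Longrightarrow> \<phi> t p = 0"
  using assms unfolding sop_system_def by blast+

lemma sop_system_shift:
  assumes \<phi>: "sop_system n R y d \<phi>" and R: "graded_subalgebra R" and y: "\<And>i. i \<in> {1..n} \<Longrightarrow> y i \<in> R"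
    and t: "t \<ge> 1" "p \<in> R"
  shows "\<phi> (t + k) ((\<Prod>i=1..n. y i) ^ k * p) = \<phi> t p"
proof (induction k)
  case (Suc k)
  have "(\<Prod>i=1..n. y i) ^ k * p \<in> R" by (intro subalg_mult[OF R] subalg_power[OF R] subalg_prod[OF R] y t)
  then have "\<phi> (Suc (t + k)) ((\<Prod>i=1..n. y i) * ((\<Prod>i=1..n. y i) ^ k * p)) = \<phi> (t + k) ((\<Prod>i=1..n. y i) ^ k * p)"
    using t(1) by (intro sop_systemD(4)[OF \<phi>]) simp_all
  with Suc show ?case by (simp add: mult.assoc)
qed simp

lemma sop_system_sum:
  assumes \<phi>: "sop_system n R y d \<phi>" and R: "graded_subalgebra R" and "t \<ge> 1" "\<And>i. i \<in> I \<Longrightarrow> f i \<in> R"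
  shows "\<phi> t (\<Sum>i\<in>I. f i) = (\<Sum>i\<in>I. \<phi> t (f i))"
proof -
  have zero: "\<phi> t 0 = 0" using sop_systemD(2)[OF \<phi> assms(3), of 0 0] subalg_0[OF R] by simp
  show ?thesis using assms(4)
  proof (induction I rule: infinite_finite_induct)
    case (insert x F)
    then have "\<phi> t (f x + sum f F) = \<phi> t (f x) + \<phi> t (sum f F)"
      by (intro sop_systemD(1)[OF \<phi> assms(3)] subalg_sum[OF R]) auto
    with insert show ?case by simp
  qed (simp_all add: zero)
qed

lemma hom_sopD: "hom_sop n R y \<Longrightarrow> i \<in> {1..n} \<Longrightarrow> y i \<in> R \<and> y i \<noteq> 0 \<and> (\<exists>d>0. homogeneous d (y i))"
  unfolding hom_sop_def by blast

lemma ideal_of_power_mono: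
  assumes R: "graded_subalgebra R" and "t \<le> s" and v: "\<And>j. j \<in> A \<Longrightarrow> v j \<in> R"
  shows "ideal_of R A (\<lambda>j. v j ^ s) \<subseteq> ideal_of R A (\<lambda>j. v j ^ t)"
proof
  fix x assume "x \<in> ideal_of R A (\<lambda>j. v j ^ s)"
  then obtain r where r: "\<forall>j\<in>A. r j \<in> R" "x = (\<Sum>j\<in>A. r j * v j ^ s)" unfolding ideal_of_def by blast
  have "x = (\<Sum>j\<in>A. (r j * v j ^ (s - t)) * v j ^ t)"
    unfolding r(2) using \<open>t \<le> s\<close> by (intro sum.cong refl) (simp add: mult.assoc flip: power_add)
  moreover have "\<forall>j\<in>A. r j * v j ^ (s - t) \<in> R"
    using r(1) v by (auto intro!: subalg_mult[OF R] subalg_power[OF R])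
  ultimately show "x \<in> ideal_of R A (\<lambda>j. v j ^ t)"
    unfolding ideal_of_def by (intro CollectI exI[of _ "\<lambda>j. r j * v j ^ (s - t)"]) simp
qed

text \<open>Modulo the \<open>t\<close>-th powers of the \<open>v\<^sub>j\<close> one has \<open>z\<^sup>N = \<alpha> z'\<^sup>t\<close>, so that \<open>1 / z'\<^sup>t\<close> may be replaced by
  \<open>\<alpha> / z\<^sup>N\<close> in the top local cohomology.\<close>

definition exch :: "'k::field mpol set \<Rightarrow> nat set \<Rightarrow> (nat \<Rightarrow> 'k mpol) \<Rightarrow> 'k mpol \<Rightarrow> 'k mpol \<Rightarrow> nat \<Rightarrow> nat \<Rightarrow> 'k mpol \<Rightarrow> bool" where
  "exch R A v z z' t N \<alpha> \<longleftrightarrow> t \<le> N \<and> \<alpha> \<in> R \<and> z ^ N - \<alpha> * z' ^ t \<in> ideal_of R A (\<lambda>j. v j ^ t)"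

context
  fixes n m :: nat and R :: "'k::field mpol set" and y :: "nat \<Rightarrow> 'k mpol" and A V
  assumes R: "graded_subalgebra R" and m: "m \<in> {1..n}" and y: "\<And>i. i \<in> {1..n} \<Longrightarrow> y i \<in> R"
  defines "A \<equiv> {1..n} - {m}" and "V \<equiv> \<Prod>j\<in>{1..n} - {m}. y j"
begin

lemma prod_sop: "(\<Prod>i=1..n. y i) = y m * V" using m unfolding V_def by (intro prod.remove) auto

lemma V_mem: "V \<in> R"
  unfolding V_def using y by (intro subalg_prod[OF R]) auto

lemma system_kills_ideal:
  assumes \<phi>: "sop_system n R y d \<phi>" and x: "x \<in> ideal_of R A (\<lambda>j. y j ^ t)" and t: "t \<le> N" "1 \<le> N" and a: "a \<in> R"
  shows "\<phi> N (x * (V ^ (N - t) * a)) = 0"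
proof -
  obtain r where r: "\<forall>j\<in>A. r j \<in> R" "x = (\<Sum>j\<in>A. r j * y j ^ t)" using x by (auto simp: ideal_of_def)
  have term_mem: "r j * y j ^ t * (V ^ (N - t) * a) \<in> R" if "j \<in> A" for j
    using r(1) that y a by (intro subalg_mult[OF R] subalg_power[OF R] V_mem) (auto simp: A_def)
  have "\<phi> N (r j * y j ^ t * (V ^ (N - t) * a)) = 0" if j: "j \<in> A" for j
  proof -
    define V' where "V' = (\<Prod>i\<in>A - {j}. y i)"
    have V': "V = y j * V'" unfolding V_def V'_def A_def[symmetric] using j by (intro prod.remove) (auto simp: A_def)
    have "V' \<in> R" unfolding V'_def using y by (intro subalg_prod[OF R]) (auto simp: A_def)
    then have "r j * (V' ^ (N - t) * a) \<in> R" using r(1) j a by (intro subalg_mult[OF R] subalg_power[OF R]) auto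
    then have "\<phi> N (y j ^ N * (r j * (V' ^ (N - t) * a))) = 0"
      using j t by (intro sop_systemD(3)[OF \<phi>]) (auto simp: A_def)
    moreover have "y j ^ N = y j ^ t * y j ^ (N - t)" using t by (simp flip: power_add)
    then have "y j ^ N * (r j * (V' ^ (N - t) * a)) = r j * y j ^ t * (V ^ (N - t) * a)"
      by (simp add: V' power_mult_distrib mult_ac)
    ultimately show ?thesis by simp
  qed
  then show ?thesis using sop_system_sum[OF \<phi> R t(2), of A "\<lambda>j. r j * y j ^ t * (V ^ (N - t) * a)"] term_mem
    by (simp add: r(2) sum_distrib_right)
qed

lemma ideal_closed:
  "p \<in> ideal_of R A v \<Longrightarrow> q \<in> ideal_of R A v \<Longrightarrow> p - q \<in> ideal_of R A v"
  using ideal_of_add[OF R, of p A v "(-1) * q"] ideal_of_mult[OF R, of q A v "-1"] subalg_uminus[OF R subalg_1[OF R]]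
  by simp

text \<open>On the class of a multiple of \<open>x\<close> a power of \<open>z'\<close> acts as zero, hence so does a power of \<open>y\<^sub>m\<close>; but
  multiplication by \<open>y\<^sub>m\<close> is compensated by the denominator.\<close>

lemma system_kills_torsion:
  assumes \<phi>: "sop_system n R y d \<phi>" and M: "exch R A y (y m) z' t M \<mu>"
    and x: "x \<in> R" "z' ^ t * x \<in> ideal_of R A (\<lambda>j. y j ^ t)" and t: "t \<le> N" "1 \<le> N" and a: "a \<in> R"
  shows "\<phi> N (x * (V ^ (N - t) * a)) = 0"
proof -
  have mem: "x * (V ^ (N - t) * a) \<in> R" by (intro subalg_mult[OF R] subalg_power[OF R] V_mem x a)
  have "y m ^ M * x \<in> ideal_of R A (\<lambda>j. y j ^ t)"
  proof -
    have "y m ^ M * x = x * (y m ^ M - \<mu> * z' ^ t) + \<mu> * (z' ^ t * x)" by (simp add: algebra_simps)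
    then show ?thesis using M x by (auto simp: exch_def intro!: ideal_of_add[OF R] ideal_of_mult[OF R])
  qed
  then have "\<phi> (N + M) ((y m ^ M * x) * (V ^ (N + M - t) * a)) = 0"
    using t a by (intro system_kills_ideal[OF \<phi>]) auto
  moreover have "V ^ (N + M - t) = V ^ (N - t) * V ^ M" using t by (simp flip: power_add)
  then have "(y m ^ M * x) * (V ^ (N + M - t) * a) = (\<Prod>i=1..n. y i) ^ M * (x * (V ^ (N - t) * a))"
    unfolding prod_sop by (simp add: power_mult_distrib mult_ac)
  ultimately show ?thesis using sop_system_shift[OF \<phi> R y t(2) mem, of M] by simp
qed

lemma exch_unique:
  assumes \<phi>: "sop_system n R y d \<phi>" and M: "exch R A y (y m) z' t M \<mu>" and z': "z' \<in> R"
    and N: "exch R A y (y m) z' t N \<alpha>" and N': "exch R A y (y m) z' t N' \<alpha>'" and t: "t \<ge> 1" and a: "a \<in> R"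
  shows "\<phi> N (\<alpha> * (V ^ (N - t) * a)) = \<phi> N' (\<alpha>' * (V ^ (N' - t) * a))"
proof -
  let ?z = "y m"
  have le: "t \<le> N" "t \<le> N'" "1 \<le> N" "1 \<le> N'" and aR: "\<alpha> \<in> R" "\<alpha>' \<in> R" using N N' t by (auto simp: exch_def)
  note mem = subalg_mult[OF R] subalg_power[OF R] V_mem a y[OF m] aR
  have lift: "\<phi> N (\<alpha> * (V ^ (N - t) * a)) = \<phi> (N + N') (\<alpha> * ?z ^ N' * (V ^ (N + N' - t) * a))"
    if "\<alpha> \<in> R" "t \<le> N" "1 \<le> N" for \<alpha> N N'
  proof -
    have "V ^ (N + N' - t) = V ^ (N - t) * V ^ N'" using that by (simp flip: power_add)
    then have "\<alpha> * ?z ^ N' * (V ^ (N + N' - t) * a) = (\<Prod>i=1..n. y i) ^ N' * (\<alpha> * (V ^ (N - t) * a))"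
      unfolding prod_sop by (simp add: power_mult_distrib mult_ac)
    moreover have "\<alpha> * (V ^ (N - t) * a) \<in> R" by (intro mem that)
    ultimately show ?thesis using sop_system_shift[OF \<phi> R y that(3), of "\<alpha> * (V ^ (N - t) * a)" N'] by (simp only:)
  qed
  have l: "\<phi> N (\<alpha> * (V ^ (N - t) * a)) = \<phi> (N + N') (\<alpha> * ?z ^ N' * (V ^ (N + N' - t) * a))"
    using le aR by (intro lift)
  have l': "\<phi> N' (\<alpha>' * (V ^ (N' - t) * a)) = \<phi> (N + N') (\<alpha>' * ?z ^ N * (V ^ (N + N' - t) * a))"
    using lift[of \<alpha>' N' N] le aR by (simp add: add.commute)
  define x where "x = \<alpha> * ?z ^ N' - \<alpha>' * ?z ^ N"
  have x: "x \<in> R" unfolding x_def by (intro subalg_diff[OF R] mem)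
  have "z' ^ t * x = ?z ^ N * (?z ^ N' - \<alpha>' * z' ^ t) - ?z ^ N' * (?z ^ N - \<alpha> * z' ^ t)"
    by (simp add: x_def algebra_simps)
  also have "\<dots> \<in> ideal_of R A (\<lambda>j. y j ^ t)"
  proof (rule ideal_closed)
    show "?z ^ N * (?z ^ N' - \<alpha>' * z' ^ t) \<in> ideal_of R A (\<lambda>j. y j ^ t)"
      using N' by (intro ideal_of_mult[OF R] mem) (simp add: exch_def)
    show "?z ^ N' * (?z ^ N - \<alpha> * z' ^ t) \<in> ideal_of R A (\<lambda>j. y j ^ t)"
      using N by (intro ideal_of_mult[OF R] mem) (simp add: exch_def)
  qed
  finally have "\<phi> (N + N') (x * (V ^ (N + N' - t) * a)) = 0"
    using le by (intro system_kills_torsion[OF \<phi> M x _ _ _ a]) auto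
  moreover have "\<alpha> * ?z ^ N' * (V ^ (N + N' - t) * a)
      = x * (V ^ (N + N' - t) * a) + \<alpha>' * ?z ^ N * (V ^ (N + N' - t) * a)" by (simp add: x_def algebra_simps)
  moreover have "\<phi> (N + N') (x * (V ^ (N + N' - t) * a) + \<alpha>' * ?z ^ N * (V ^ (N + N' - t) * a))
      = \<phi> (N + N') (x * (V ^ (N + N' - t) * a)) + \<phi> (N + N') (\<alpha>' * ?z ^ N * (V ^ (N + N' - t) * a))"
    using le by (intro sop_systemD(1)[OF \<phi>] mem x) simp
  ultimately show ?thesis using l l' by simp
qed

end

text \<open>The functional obtained by replacing \<open>y\<^sub>m\<close> with another parameter; by \<open>exch_unique\<close> the choice of \<open>N\<close> and \<open>\<alpha>\<close>
  is immaterial.\<close>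

definition transfer :: "nat \<Rightarrow> nat \<Rightarrow> (nat \<Rightarrow> 'k::field mpol) \<Rightarrow> (nat \<Rightarrow> nat) \<Rightarrow> (nat \<Rightarrow> 'k mpol) \<Rightarrow>
    (nat \<Rightarrow> 'k mpol \<Rightarrow> 'k) \<Rightarrow> nat \<Rightarrow> 'k mpol \<Rightarrow> 'k" where
  "transfer n m y N \<alpha> \<phi> t a = \<phi> (N t) (\<alpha> t * ((\<Prod>j\<in>{1..n} - {m}. y j) ^ (N t - t) * a))"

lemma exch_exists:
  assumes R: "graded_subalgebra R" and m: "m \<in> {1..n}" and y: "hom_sop n R y" and y': "hom_sop n R (y(m := z'))"
    and h: "homogeneous e (y m)" "homogeneous e' z'" and t: "t \<ge> 1"
  shows "\<exists>N \<alpha>. exch R ({1..n} - {m}) y (y m) z' t N \<alpha> \<and> homogeneous (int N * e - int t * e') \<alpha>"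
proof -
  let ?A = "{1..n} - {m}" and ?y' = "y(m := z')"
  define J where "J = rad R (ideal_of R {1..n} (\<lambda>i. ?y' i ^ t))"
  have J: "radical_ideal R J" unfolding J_def by (rule radical_ideal_rad[OF R])
  have y'R: "?y' i \<in> R" if "i \<in> {1..n}" for i using y' that by (auto simp: hom_sop_def)
  have yR: "y i \<in> R" if "i \<in> {1..n}" for i using y that by (auto simp: hom_sop_def)
  have "?y' i \<in> J" if i: "i \<in> {1..n}" for i
  proof -
    have "?y' i ^ t \<in> ideal_of R {1..n} (\<lambda>i. ?y' i ^ t)"
      using ideal_of_gen[OF R, of "{1..n}" i "\<lambda>i. ?y' i ^ t"] i by simp
    then show ?thesis using y'R[OF i] unfolding J_def rad_def by blast
  qed
  then have "rad R (ideal_of R {1..n} ?y') \<subseteq> J" by (rule rad_minimal[OF R J])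
  moreover have "y m \<in> rad R (ideal_of R {1..n} y)" using m yR by (intro rad_gen[OF R]) auto
  ultimately have "y m \<in> J" using hom_sop_rad[OF y] hom_sop_rad[OF y'] by auto
  then obtain s where s: "y m ^ s \<in> ideal_of R {1..n} (\<lambda>i. ?y' i ^ t)" by (auto simp: J_def rad_def)
  define N where "N = t + s"
  have "y m ^ N \<in> ideal_of R {1..n} (\<lambda>i. ?y' i ^ t)"
    unfolding N_def power_add by (intro ideal_of_mult[OF R s] subalg_power[OF R] yR m)
  then obtain r where r: "\<forall>i\<in>{1..n}. r i \<in> R" "y m ^ N = (\<Sum>i=1..n. r i * ?y' i ^ t)" by (auto simp: ideal_of_def)
  have "\<forall>i\<in>{1..n}. \<exists>d. homogeneous d (?y' i)" using y' unfolding hom_sop_def by blast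
  then obtain \<delta> where \<delta>: "\<forall>i\<in>{1..n}. homogeneous (\<delta> i) (?y' i)" by metis
  define r' where "r' i = hcomp (int N * e - int t * \<delta> i) (r i)" for i
  have "y m ^ N = hcomp (int N * e) (y m ^ N)"
    using homogeneous_power[OF h(1), of N] by (simp add: hcomp_homogeneous)
  also have "\<dots> = (\<Sum>i=1..n. hcomp (int N * e) (r i * ?y' i ^ t))" unfolding r(2) by (rule hcomp_sum)
  also have "\<dots> = (\<Sum>i=1..n. r' i * ?y' i ^ t)"
  proof (rule sum.cong)
    fix i assume "i \<in> {1..n}"
    then have "homogeneous (int t * \<delta> i) (?y' i ^ t)" using \<delta> by (intro homogeneous_power) blast
    then show "hcomp (int N * e) (r i * ?y' i ^ t) = r' i * ?y' i ^ t"
      using hcomp_mult_homogeneous[of "int t * \<delta> i" "?y' i ^ t" "int N * e - int t * \<delta> i" "r i"] by (simp add: r'_def)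
  qed simp
  also have "\<dots> = r' m * z' ^ t + (\<Sum>i\<in>?A. r' i * ?y' i ^ t)" using m by (simp add: sum.remove)
  also have "(\<Sum>i\<in>?A. r' i * ?y' i ^ t) = (\<Sum>i\<in>?A. r' i * y i ^ t)" by (rule sum.cong) auto
  finally have eq: "y m ^ N - r' m * z' ^ t = (\<Sum>i\<in>?A. r' i * y i ^ t)" by simp
  have r'R: "r' i \<in> R" if "i \<in> {1..n}" for i unfolding r'_def using r(1) that by (intro subalg_hcomp[OF R]) blast
  have "exch R ?A y (y m) z' t N (r' m)"
    unfolding exch_def eq ideal_of_def using r'R m by (auto simp: N_def)
  moreover have "\<delta> m = e'"
  proof -
    have "homogeneous (\<delta> m) z'" "z' \<noteq> 0" using \<delta>[rule_format, OF m] hom_sopD[OF y' m] by simp_all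
    then show ?thesis using h(2) homogeneous_unique by blast
  qed
  then have "homogeneous (int N * e - int t * e') (r' m)" using homogeneous_hcomp by (simp add: r'_def)
  ultimately show ?thesis by blast
qed

lemma transfer_system:
  assumes R: "graded_subalgebra R" and m: "m \<in> {1..n}" and y: "hom_sop n R y" and y': "hom_sop n R (y(m := z'))"
    and h: "homogeneous e (y m)" "homogeneous e' z'"
    and N: "\<And>t. t \<ge> 1 \<Longrightarrow> exch R ({1..n} - {m}) y (y m) z' t (N t) (\<alpha> t) \<and> homogeneous (int (N t) * e - int t * e') (\<alpha> t)"
    and \<phi>: "sop_system n R y d \<phi>"
  shows "sop_system n R (y(m := z')) d (transfer n m y N \<alpha> \<phi>)"
proof -
  let ?A = "{1..n} - {m}" and ?y' = "y(m := z')"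
  define V where "V = (\<Prod>j\<in>?A. y j)"
  have yR: "y i \<in> R" if "i \<in> {1..n}" for i using y that by (auto simp: hom_sop_def)
  have z': "z' \<in> R" using hom_sopD[OF y' m] by simp
  have V: "V \<in> R" unfolding V_def by (rule V_mem[OF R m yR])
  have Y: "(\<Prod>i=1..n. y i) = y m * V" unfolding V_def by (rule prod_sop[OF R m yR])
  have "(\<Prod>i=1..n. ?y' i) = ?y' m * (\<Prod>j\<in>?A. ?y' j)" using m by (intro prod.remove) auto
  also have "(\<Prod>j\<in>?A. ?y' j) = V" unfolding V_def by (rule prod.cong) auto
  finally have Y': "(\<Prod>i=1..n. ?y' i) = z' * V" by simp
  have "\<forall>i\<in>{1..n}. \<exists>d. homogeneous d (y i)" using y unfolding hom_sop_def by blast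
  then obtain \<delta> where \<delta>: "\<forall>i\<in>{1..n}. homogeneous (\<delta> i) (y i)" by metis
  define \<nu> where "\<nu> = (\<Sum>j\<in>?A. \<delta> j)"
  have hV: "homogeneous \<nu> V" unfolding V_def \<nu>_def using \<delta> by (intro homogeneous_prod) auto
  have V0: "V \<noteq> 0" "z' \<noteq> 0" using hom_sopD[OF y] hom_sopD[OF y' m] by (auto simp: V_def)
  show ?thesis
    unfolding sop_system_def
  proof (intro allI impI conjI ballI)
    fix t :: nat and p :: "'a mpol" assume t: "t \<ge> 1" and p: "p \<in> R"
    have ex: "exch R ?A y (y m) z' t (N t) (\<alpha> t)" and h\<alpha>: "homogeneous (int (N t) * e - int t * e') (\<alpha> t)"
      using N[OF t] by auto
    have Nt: "N t \<ge> 1" "t \<le> N t" and \<alpha>: "\<alpha> t \<in> R" using ex t by (auto simp: exch_def)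
    have mem: "\<alpha> t * (V ^ (N t - t) * q) \<in> R" if "q \<in> R" for q
      by (intro subalg_mult[OF R] subalg_power[OF R] V \<alpha> that)
    note tr = transfer_def[of n m y N \<alpha> \<phi>, folded V_def]
    show "transfer n m y N \<alpha> \<phi> t (p + q) = transfer n m y N \<alpha> \<phi> t p + transfer n m y N \<alpha> \<phi> t q" if "q \<in> R" for q
      using sop_systemD(1)[OF \<phi> Nt(1) mem[OF p] mem[OF that]] by (simp add: tr distrib_left)
    show "transfer n m y N \<alpha> \<phi> t (const c * p) = c * transfer n m y N \<alpha> \<phi> t p" for c
      using sop_systemD(2)[OF \<phi> Nt(1) mem[OF p], of c] by (simp add: tr mult.left_commute)
    show "transfer n m y N \<alpha> \<phi> t (?y' i ^ t * p) = 0" if i: "i \<in> {1..n}" for i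
    proof (cases "i = m")
      case False
      have "y i ^ t \<in> ideal_of R ?A (\<lambda>j. y j ^ t)"
        using ideal_of_gen[OF R, of ?A i "\<lambda>j. y j ^ t"] i False by simp
      then have "\<phi> (N t) ((\<alpha> t * y i ^ t) * (V ^ (N t - t) * p)) = 0"
        unfolding V_def using Nt p \<alpha> by (intro system_kills_ideal[OF R m yR \<phi>] ideal_of_mult[OF R])
      then show ?thesis using False by (simp add: tr mult_ac)
    next
      case True
      have "\<phi> (N t) ((y m ^ N t - \<alpha> t * z' ^ t) * (V ^ (N t - t) * p)) = 0"
        unfolding V_def using Nt p ex by (intro system_kills_ideal[OF R m yR \<phi>]) (auto simp: exch_def)
      moreover have "\<phi> (N t) (y m ^ N t * (V ^ (N t - t) * p)) = 0"
        by (intro sop_systemD(3)[OF \<phi> Nt(1) m] subalg_mult[OF R] subalg_power[OF R] V p)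
      moreover have "\<phi> (N t) ((y m ^ N t - \<alpha> t * z' ^ t) * (V ^ (N t - t) * p) + \<alpha> t * (V ^ (N t - t) * (z' ^ t * p)))
          = \<phi> (N t) ((y m ^ N t - \<alpha> t * z' ^ t) * (V ^ (N t - t) * p)) + \<phi> (N t) (\<alpha> t * (V ^ (N t - t) * (z' ^ t * p)))"
        by (intro sop_systemD(1)[OF \<phi> Nt(1)] subalg_mult[OF R] subalg_power[OF R] subalg_diff[OF R] V p z' \<alpha> yR m)
      moreover have "(y m ^ N t - \<alpha> t * z' ^ t) * (V ^ (N t - t) * p) + \<alpha> t * (V ^ (N t - t) * (z' ^ t * p))
          = y m ^ N t * (V ^ (N t - t) * p)" by (simp add: algebra_simps)
      ultimately show ?thesis using True by (simp add: tr)
    qed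
    show "transfer n m y N \<alpha> \<phi> (Suc t) ((\<Prod>i=1..n. ?y' i) * p) = transfer n m y N \<alpha> \<phi> t p"
    proof -
      have ex': "exch R ?A y (y m) z' (Suc t) (N (Suc t)) (\<alpha> (Suc t))" using N[of "Suc t"] by simp
      have sub: "ideal_of R ?A (\<lambda>j. y j ^ Suc t) \<subseteq> ideal_of R ?A (\<lambda>j. y j ^ t)"
        by (rule ideal_of_power_mono[OF R _ yR]) auto
      have ex'': "exch R ?A y (y m) z' t (N (Suc t)) (\<alpha> (Suc t) * z')"
        using ex' sub z' by (auto simp: exch_def mult.assoc intro: subalg_mult[OF R])
      have le: "Suc t \<le> N (Suc t)" using ex' by (simp add: exch_def)
      have "V ^ (N (Suc t) - t) = V ^ (N (Suc t) - Suc t) * V"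
        using le by (simp flip: power_Suc2 add: Suc_diff_Suc)
      then have "\<alpha> (Suc t) * (V ^ (N (Suc t) - Suc t) * (z' * V * p)) = \<alpha> (Suc t) * z' * (V ^ (N (Suc t) - t) * p)"
        by (simp add: mult_ac)
      moreover have "\<phi> (N (Suc t)) (\<alpha> (Suc t) * z' * (V ^ (N (Suc t) - t) * p)) = \<phi> (N t) (\<alpha> t * (V ^ (N t - t) * p))"
        unfolding V_def by (rule exch_unique[OF R m yR \<phi> ex z' ex'' ex t p])
      ultimately show ?thesis by (simp only: tr Y')
    qed
    show "transfer n m y N \<alpha> \<phi> t p = 0"
      if p': "homogeneous f p" "homogeneous \<epsilon> (\<Prod>i=1..n. ?y' i)" "f \<noteq> int t * \<epsilon> - d" for f \<epsilon>
    proof -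
      have "homogeneous (e' + \<nu>) (z' * V)" by (intro homogeneous_mult h hV)
      then have \<epsilon>: "\<epsilon> = e' + \<nu>" using p'(2) V0 unfolding Y' by (intro homogeneous_unique[of _ "z' * V"]) auto
      have "homogeneous ((int (N t) * e - int t * e') + (int (N t - t) * \<nu> + f)) (\<alpha> t * (V ^ (N t - t) * p))"
        by (intro homogeneous_mult homogeneous_power h\<alpha> hV p')
      moreover have "homogeneous (e + \<nu>) (\<Prod>i=1..n. y i)" unfolding Y by (intro homogeneous_mult h hV)
      moreover have "(int (N t) * e - int t * e') + (int (N t - t) * \<nu> + f) \<noteq> int (N t) * (e + \<nu>) - d"
        using p'(3) Nt(2) by (simp add: \<epsilon> of_nat_diff algebra_simps)
      ultimately show ?thesis unfolding tr by (rule sop_systemD(5)[OF \<phi> Nt(1) mem[OF p]])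
    qed
  qed
qed

lemma transfer_inverse:
  assumes R: "graded_subalgebra R" and m: "m \<in> {1..n}" and y: "hom_sop n R y" and y': "hom_sop n R (y(m := z'))"
    and N: "\<And>t. t \<ge> 1 \<Longrightarrow> exch R ({1..n} - {m}) y (y m) z' t (N t) (\<alpha> t)"
    and M: "\<And>t. t \<ge> 1 \<Longrightarrow> exch R ({1..n} - {m}) (y(m := z')) z' (y m) t (M t) (\<beta> t)"
    and \<phi>: "sop_system n R y d \<phi>" and t: "t \<ge> 1" and a: "a \<in> R"
  shows "transfer n m (y(m := z')) M \<beta> (transfer n m y N \<alpha> \<phi>) t a = \<phi> t a"
proof -
  let ?A = "{1..n} - {m}" and ?y' = "y(m := z')"
  define V where "V = (\<Prod>j\<in>?A. y j)"
  have yR: "y i \<in> R" if "i \<in> {1..n}" for i using y that by (auto simp: hom_sop_def)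
  have z': "z' \<in> R" using hom_sopD[OF y' m] by simp
  have V': "(\<Prod>j\<in>?A. ?y' j) = V" unfolding V_def by (rule prod.cong) auto
  let ?M = "M t" and ?N = "N (M t)"
  have I: "ideal_of R ?A (\<lambda>j. ?y' j ^ t) = ideal_of R ?A (\<lambda>j. y j ^ t)"
  proof -
    have "(\<Sum>j\<in>?A. r j * ?y' j ^ t) = (\<Sum>j\<in>?A. r j * y j ^ t)" for r by (rule sum.cong) auto
    then show ?thesis by (simp add: ideal_of_def)
  qed
  have M': "t \<le> ?M" "\<beta> t \<in> R" "z' ^ ?M - \<beta> t * y m ^ t \<in> ideal_of R ?A (\<lambda>j. y j ^ t)"
    using M[OF t] unfolding exch_def I by simp_all
  have N': "?M \<le> ?N" "\<alpha> ?M \<in> R" "y m ^ ?N - \<alpha> ?M * z' ^ ?M \<in> ideal_of R ?A (\<lambda>j. y j ^ ?M)"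
    using N[of ?M] t M'(1) by (simp_all add: exch_def)
  have sub: "ideal_of R ?A (\<lambda>j. y j ^ ?M) \<subseteq> ideal_of R ?A (\<lambda>j. y j ^ t)"
    by (rule ideal_of_power_mono[OF R M'(1) yR]) auto
  have "y m ^ ?N - (\<alpha> ?M * \<beta> t) * y m ^ t
      = (y m ^ ?N - \<alpha> ?M * z' ^ ?M) + \<alpha> ?M * (z' ^ ?M - \<beta> t * y m ^ t)" by (simp add: algebra_simps)
  also have "\<dots> \<in> ideal_of R ?A (\<lambda>j. y j ^ t)"
    using M' N' sub by (intro ideal_of_add[OF R] ideal_of_mult[OF R]) auto
  finally have ex: "exch R ?A y (y m) (y m) t ?N (\<alpha> ?M * \<beta> t)"
    using M' N' by (auto simp: exch_def intro: subalg_mult[OF R])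
  have ex1: "exch R ?A y (y m) (y m) t t 1" using subalg_1[OF R] ideal_of_0[OF R] by (simp add: exch_def)
  have "V ^ (?N - t) = V ^ (?N - ?M) * V ^ (?M - t)" using M'(1) N'(1) by (simp flip: power_add)
  then have "transfer n m ?y' M \<beta> (transfer n m y N \<alpha> \<phi>) t a = \<phi> ?N (\<alpha> ?M * \<beta> t * (V ^ (?N - t) * a))"
    by (simp only: transfer_def V' V_def[symmetric] mult_ac)
  also have "\<dots> = \<phi> t (1 * (V ^ (t - t) * a))"
    unfolding V_def by (rule exch_unique[OF R m yR \<phi> ex1 yR[OF m] ex ex1 t a])
  finally show ?thesis by simp
qed

section \<open>Duality for every system of parameters\<close>

context perm_group
begin

text \<open>\<open>\<Phi>\<close> identifies the module \<open>can_ideal n G\<close>, shifted by \<open>n\<close>, with the dual of the top local cohomology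
  computed with \<open>y\<close>.\<close>

definition sop_duality :: "(nat \<Rightarrow> 'k::field mpol) \<Rightarrow> ('k mpol \<Rightarrow> nat \<Rightarrow> 'k mpol \<Rightarrow> 'k) \<Rightarrow> bool" where
  "sop_duality y \<Phi> \<longleftrightarrow>
    (\<forall>d. \<forall>f\<in>can_ideal n G. homogeneous (d - int n) f \<longrightarrow> sop_system n (invariant_ring n G) y d (\<Phi> f)) \<and>
    (\<forall>f\<in>can_ideal n G. \<forall>g\<in>can_ideal n G. \<forall>t\<ge>1. \<forall>r\<in>invariant_ring n G. \<Phi> (f + g) t r = \<Phi> f t r + \<Phi> g t r) \<and>
    (\<forall>f\<in>can_ideal n G. \<forall>s\<in>invariant_ring n G. \<forall>t\<ge>1. \<forall>r\<in>invariant_ring n G. \<Phi> (s * f) t r = \<Phi> f t (s * r)) \<and>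
    (\<forall>d. \<forall>f\<in>can_ideal n G. homogeneous (d - int n) f \<longrightarrow> (\<forall>t\<ge>1. \<forall>r\<in>invariant_ring n G. \<Phi> f t r = 0) \<longrightarrow> f = 0) \<and>
    (\<forall>d \<phi>. sop_system n (invariant_ring n G) y d \<phi> \<longrightarrow>
       (\<exists>f\<in>can_ideal n G. homogeneous (d - int n) f \<and> (\<forall>t\<ge>1. \<forall>r\<in>invariant_ring n G. \<phi> t r = \<Phi> f t r)))"

lemma sop_dualityD:
  fixes y :: "nat \<Rightarrow> 'k::field mpol"
  assumes "sop_duality y \<Phi>" "f \<in> can_ideal n G"
  shows "homogeneous (d - int n) f \<Longrightarrow> sop_system n (invariant_ring n G) y d (\<Phi> f)"
    and "g \<in> can_ideal n G \<Longrightarrow> t \<ge> 1 \<Longrightarrow> r \<in> invariant_ring n G \<Longrightarrow> \<Phi> (f + g) t r = \<Phi> f t r + \<Phi> g t r"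
    and "s \<in> invariant_ring n G \<Longrightarrow> t \<ge> 1 \<Longrightarrow> r \<in> invariant_ring n G \<Longrightarrow> \<Phi> (s * f) t r = \<Phi> f t (s * r)"
    and "homogeneous (d - int n) f \<Longrightarrow> (\<And>t r. t \<ge> 1 \<Longrightarrow> r \<in> invariant_ring n G \<Longrightarrow> \<Phi> f t r = 0) \<Longrightarrow> f = 0"
  using assms unfolding sop_duality_def by blast+

lemma sop_duality_surj:
  "sop_duality y \<Phi> \<Longrightarrow> sop_system n (invariant_ring n G) y d \<phi> \<Longrightarrow>
    \<exists>f\<in>can_ideal n G. homogeneous (d - int n) f \<and> (\<forall>t\<ge>1. \<forall>r\<in>invariant_ring n G. \<phi> t r = \<Phi> f t r)"
  unfolding sop_duality_def by blast

lemma hom_sop_esym: "hom_sop n (invariant_ring n G) (esym n :: nat \<Rightarrow> 'k::field mpol)"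
  if "n \<ge> 1"
proof (rule hom_sopI[OF invariant_ring_subalgebra that])
  let ?R = "invariant_ring n G :: 'k mpol set"
  note R = invariant_ring_subalgebra[where ?'k = 'k]
  note S = poly_ring_subalgebra[where ?'a = 'k]
  show "esym n i \<in> ?R \<and> esym n i \<noteq> (0 :: 'k mpol) \<and> (\<exists>d>0. homogeneous d (esym n i :: 'k mpol))" if i: "i \<in> {1..n}" for i
  proof (intro conjI exI)
    show "esym n i \<in> ?R" by (rule esym_mem)
    show "esym n i \<noteq> (0 :: 'k mpol)"
    proof
      assume "esym n i = (0 :: 'k mpol)"
      then have "bas_map n (mon (single i i) :: 'k mpol) = 0"
        using bas_esym[of i n 1, where ?'a = 'k] i by (simp del: esym_0)
      moreover have "(mon (single i i) :: 'k mpol) \<in> poly_ring n" using i by simp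
      ultimately have "(mon (single i i) :: 'k mpol) = 0" by (rule bas_map_inj[rotated])
      then show False by (metis lookup_single_eq lookup_zero mon_def zero_neq_one)
    qed
    show "int i > 0" "homogeneous (int i) (esym n i :: 'k mpol)" using i by (auto intro: esym_homogeneous)
  qed
  show "hom_max_ideal ?R \<subseteq> rad ?R (ideal_of ?R {1..n} (esym n))"
  proof
    fix f :: "'k mpol" assume f: "f \<in> hom_max_ideal ?R"
    define J where "J = rad (poly_ring n) (ideal_of (poly_ring n) {1..n} (esym n :: nat \<Rightarrow> 'k mpol))"
    have J: "radical_ideal (poly_ring n) J" unfolding J_def by (rule radical_ideal_rad[OF S])
    have e: "esym n k \<in> J" if "k \<in> {1..n}" for k
      unfolding J_def using that by (intro rad_gen[OF S] esym_in_poly_ring) auto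
    have "f \<in> poly_ring n" "lookup f 0 = 0" "f \<in> ?R" using f by (auto simp: hom_max_ideal_def invariant_ring_def)
    have var: "var j \<in> J" if "j \<in> {1..n}" for j using var_mem_rad_esym[OF J e that] .
    have mon: "mon a \<in> J" if "a \<in> keys f" for a
    proof -
      have "a \<noteq> 0" using that \<open>lookup f 0 = 0\<close> by (auto simp: in_keys_iff)
      then obtain i where i: "i \<in> keys a" by fastforce
      have ka: "keys a \<subseteq> {1..n}" using that \<open>f \<in> poly_ring n\<close> by (auto simp: poly_ring_def)
      define b where "b = a - single i 1"
      have "a = b + single i 1"
        by (rule poly_mapping_eqI) (use i in \<open>auto simp: b_def lookup_add lookup_minus lookup_single when_def in_keys_iff\<close>)
      then have "mon a = mon b * (var i :: 'k mpol)" by (simp add: mon_add var_eq_mon)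
      moreover have "keys b \<subseteq> {1..n}" using ka by (auto simp: b_def in_keys_iff lookup_minus subset_iff)
      ultimately show ?thesis using var[of i] i ka J unfolding radical_ideal_def by auto
    qed
    have "f = (\<Sum>a\<in>keys f. const (lookup f a) * mon a)" by (rule poly_eq_sum_mon)
    also have "\<dots> \<in> J"
    proof (rule radical_ideal_sum[OF S J])
      fix a assume "a \<in> keys f"
      then show "const (lookup f a) * mon a \<in> J" using mon J subalg_const[OF S] unfolding radical_ideal_def by blast
    qed
    finally obtain t where "f ^ t \<in> ideal_of (poly_ring n) {1..n} (esym n)" by (auto simp: J_def rad_def)
    moreover have "f ^ t \<in> ?R" using \<open>f \<in> ?R\<close> by (rule subalg_power[OF R])
    ultimately have "(f ^ t) ^ card G \<in> ideal_of ?R {1..n} (esym n)"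
      using esym_mem by (intro invariant_power_in_ideal) auto
    then show "f \<in> rad ?R (ideal_of ?R {1..n} (esym n))"
      using \<open>f \<in> ?R\<close> by (auto simp: rad_def simp flip: power_mult)
  qed
qed

lemma sop_duality_esym: "sop_duality (esym n :: nat \<Rightarrow> 'k::field mpol) (theta n G)"
proof -
  have E: "homogeneous \<delta> (\<Prod>i=1..n. esym n i :: 'k mpol) \<longleftrightarrow> \<delta> = esym_deg n" for \<delta>
  proof -
    have h: "homogeneous (esym_deg n) (\<Prod>i=1..n. esym n i :: 'k mpol)"
      unfolding esym_deg_def by (intro homogeneous_prod esym_homogeneous)
    have "(\<Prod>i=1..n. esym n i :: 'k mpol) \<noteq> 0"
      using hom_sop_esym[where ?'k = 'k] by (cases "n \<ge> 1") (auto simp: hom_sop_def)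
    then show ?thesis using h homogeneous_unique by blast
  qed
  have eq: "sop_system n R (esym n) d \<phi> \<longleftrightarrow> dual_system n R d \<phi>" for R :: "'k mpol set" and d \<phi>
    unfolding sop_system_def dual_system_def E esym_prod_def by simp
  show ?thesis
    unfolding sop_duality_def eq
  proof (intro conjI allI ballI impI)
    fix f g :: "'k mpol" and t :: nat and r :: "'k mpol"
    assume f: "f \<in> can_ideal n G" and g: "g \<in> can_ideal n G" and r: "r \<in> invariant_ring n G"
    have "f * r \<in> can_ideal n G" "g * r \<in> can_ideal n G"
      using can_ideal_mult[OF f r] can_ideal_mult[OF g r] by (simp_all add: mult.commute)
    then show "theta n G (f + g) t r = theta n G f t r + theta n G g t r"
      by (simp add: theta_def distrib_right rho_add coords_add rho_in_poly_ring lookup_add)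
  next
    fix f s r :: "'k mpol" and t :: nat
    show "theta n G (s * f) t r = theta n G f t (s * r)" by (simp add: theta_def mult_ac)
  next
    fix f :: "'k mpol"
    assume "f \<in> can_ideal n G" "\<forall>t\<ge>1. \<forall>r\<in>invariant_ring n G. theta n G f t r = 0"
    then show "f = 0" by (intro theta_nondegenerate_group) auto
  next
    fix d and \<phi> :: "nat \<Rightarrow> 'k mpol \<Rightarrow> 'k" assume "dual_system n (invariant_ring n G) d \<phi>"
    then show "\<exists>f\<in>can_ideal n G. homogeneous (d - int n) f \<and> (\<forall>t\<ge>1. \<forall>r\<in>invariant_ring n G. \<phi> t r = theta n G f t r)"
      using invariant_ring_duality by metis
  qed (rule theta_dual_system)
qed

lemma sop_duality_exchange:
  fixes y :: "nat \<Rightarrow> 'k::field mpol"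
  assumes m: "m \<in> {1..n}" and y: "hom_sop n (invariant_ring n G) y" and y': "hom_sop n (invariant_ring n G) (y(m := z'))"
    and \<Phi>: "sop_duality y \<Phi>"
  shows "\<exists>\<Phi>'. sop_duality (y(m := z')) \<Phi>'"
proof -
  let ?R = "invariant_ring n G :: 'k mpol set" and ?A = "{1..n} - {m}" and ?y' = "y(m := z')"
  note R = invariant_ring_subalgebra[where ?'k = 'k]
  obtain e where e: "homogeneous e (y m)" using hom_sopD[OF y m] by blast
  obtain e' where e': "homogeneous e' z'" using hom_sopD[OF y' m] by auto
  have yy: "?y'(m := y m) = y" by simp
  obtain N \<alpha> where N: "\<And>t. t \<ge> 1 \<Longrightarrow> exch ?R ?A y (y m) z' t (N t) (\<alpha> t) \<and> homogeneous (int (N t) * e - int t * e') (\<alpha> t)"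
    using exch_exists[OF R m y y' e e'] by metis
  obtain M \<beta> where M: "\<And>t. t \<ge> 1 \<Longrightarrow> exch ?R ?A ?y' z' (y m) t (M t) (\<beta> t) \<and> homogeneous (int (M t) * e' - int t * e) (\<beta> t)"
    using exch_exists[where y = ?y' and z' = "y m" and m = m, unfolded yy fun_upd_same, OF R m y' y e' e] by metis
  let ?T = "transfer n m y N \<alpha>" and ?T' = "transfer n m ?y' M \<beta>"
  have T: "sop_system n ?R ?y' d (?T \<phi>)" if "sop_system n ?R y d \<phi>" for d \<phi>
    using transfer_system[OF R m y y' e e' N that] .
  have T': "sop_system n ?R y d (?T' \<phi>)" if "sop_system n ?R ?y' d \<phi>" for d \<phi>
    using transfer_system[where y = ?y' and z' = "y m" and m = m, unfolded yy fun_upd_same, OF R m y' y e' e M that] .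
  have TT: "?T' (?T \<phi>) t a = \<phi> t a" if "sop_system n ?R y d \<phi>" "t \<ge> 1" "a \<in> ?R" for d \<phi> t a
    using transfer_inverse[OF R m y y' _ _ that] N M by blast
  have TT': "?T (?T' \<phi>) t a = \<phi> t a" if "sop_system n ?R ?y' d \<phi>" "t \<ge> 1" "a \<in> ?R" for d \<phi> t a
    using transfer_inverse[where y = ?y' and z' = "y m" and m = m, unfolded yy fun_upd_same, OF R m y' y _ _ that] N M by blast
  have V: "(\<Prod>j\<in>?A. y j) \<in> ?R" "(\<Prod>j\<in>?A. ?y' j) \<in> ?R"
    using y y' by (auto simp: hom_sop_def intro!: subalg_prod[OF R])
  have arg: "\<alpha> t * ((\<Prod>j\<in>?A. y j) ^ (N t - t) * r) \<in> ?R \<and> N t \<ge> 1" if "t \<ge> 1" "r \<in> ?R" for t r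
    using N[OF that(1)] that V by (auto simp: exch_def intro!: subalg_mult[OF R] subalg_power[OF R])
  have arg': "\<beta> t * ((\<Prod>j\<in>?A. ?y' j) ^ (M t - t) * r) \<in> ?R \<and> M t \<ge> 1" if "t \<ge> 1" "r \<in> ?R" for t r
    using M[OF that(1)] that V by (auto simp: exch_def intro!: subalg_mult[OF R] subalg_power[OF R])
  note \<Phi>D = sop_dualityD[OF \<Phi>]
  note \<Phi>1 = \<Phi>D(1) and \<Phi>2 = \<Phi>D(2) and \<Phi>3 = \<Phi>D(3) and \<Phi>4 = \<Phi>D(4) and \<Phi>5 = sop_duality_surj[OF \<Phi>]
  have "sop_duality ?y' (\<lambda>f. ?T (\<Phi> f))"
    unfolding sop_duality_def
  proof (intro conjI allI ballI impI)
    fix d and f :: "'k mpol" assume "f \<in> can_ideal n G" "homogeneous (d - int n) f"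
    then show "sop_system n ?R ?y' d (?T (\<Phi> f))" by (intro T \<Phi>1)
  next
    fix f g :: "'k mpol" and t :: nat and r :: "'k mpol"
    assume "f \<in> can_ideal n G" "g \<in> can_ideal n G" "t \<ge> 1" "r \<in> ?R"
    then show "?T (\<Phi> (f + g)) t r = ?T (\<Phi> f) t r + ?T (\<Phi> g) t r"
      using arg[of t r] by (simp add: transfer_def \<Phi>2)
  next
    fix f s r :: "'k mpol" and t :: nat
    assume "f \<in> can_ideal n G" "s \<in> ?R" "t \<ge> 1" "r \<in> ?R"
    then show "?T (\<Phi> (s * f)) t r = ?T (\<Phi> f) t (s * r)"
      using arg[of t r] by (simp add: transfer_def \<Phi>3 mult.left_commute)
  next
    fix d and f :: "'k mpol" assume f: "f \<in> can_ideal n G" "homogeneous (d - int n) f"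
      and zero: "\<forall>t\<ge>1. \<forall>r\<in>?R. ?T (\<Phi> f) t r = 0"
    show "f = 0"
    proof (rule \<Phi>4[OF f])
      fix t :: nat and r :: "'k mpol" assume tr: "t \<ge> 1" "r \<in> ?R"
      have "\<Phi> f t r = ?T' (?T (\<Phi> f)) t r" using TT[OF \<Phi>1[OF f] tr] by simp
      also have "\<dots> = 0" using arg'[OF tr] zero unfolding transfer_def[of n m ?y'] by blast
      finally show "\<Phi> f t r = 0" .
    qed
  next
    fix d \<phi> assume \<phi>: "sop_system n ?R ?y' d \<phi>"
    obtain f where f: "f \<in> can_ideal n G" "homogeneous (d - int n) f" "\<forall>t\<ge>1. \<forall>r\<in>?R. ?T' \<phi> t r = \<Phi> f t r"
      using \<Phi>5[OF T'[OF \<phi>]] by blast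
    have "\<phi> t r = ?T (\<Phi> f) t r" if tr: "t \<ge> 1" "r \<in> ?R" for t r
    proof -
      have "\<phi> t r = ?T (?T' \<phi>) t r" using TT'[OF \<phi> tr] by simp
      also have "\<dots> = ?T (\<Phi> f) t r" using arg[OF tr] f(3) unfolding transfer_def[of n m y] by blast
      finally show ?thesis .
    qed
    then show "\<exists>f\<in>can_ideal n G. homogeneous (d - int n) f \<and> (\<forall>t\<ge>1. \<forall>r\<in>?R. \<phi> t r = ?T (\<Phi> f) t r)"
      using f(1,2) by blast
  qed
  then show ?thesis by blast
qed

lemma sop_duality_cong:
  assumes "\<And>i. i \<in> {1..n} \<Longrightarrow> y i = y' i" "sop_duality y \<Phi>"
  shows "sop_duality y' \<Phi>"
proof -
  have "(\<Prod>i=1..n. y i) = (\<Prod>i=1..n. y' i)" using assms(1) by (intro prod.cong) auto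
  then have "sop_system n R y d \<phi> \<longleftrightarrow> sop_system n R y' d \<phi>" for R d \<phi>
    using assms(1) unfolding sop_system_def by simp
  with assms(2) show ?thesis unfolding sop_duality_def by simp
qed

text \<open>Start from the elementary symmetric polynomials and make one more element agree with \<open>y\<close> at a time: pass from \<open>p\<close>
  to \<open>p(m := z)\<close>, by induction to \<open>q(m := z)\<close>, and back to \<open>q\<close>.\<close>

theorem sop_duality_exists:
  fixes y :: "nat \<Rightarrow> 'k::field mpol"
  assumes y: "hom_sop n (invariant_ring n G) y"
  shows "\<exists>\<Phi>. sop_duality y \<Phi>"
proof -
  have "\<exists>\<Phi>. sop_duality q \<Phi>"
    if "hom_sop n (invariant_ring n G) p" "hom_sop n (invariant_ring n G) q" "sop_duality p \<Phi>"
      "card {i \<in> {1..n}. p i \<noteq> q i} = k" for p q :: "nat \<Rightarrow> 'k mpol" and \<Phi> k using that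
  proof (induction k arbitrary: p q \<Phi>)
    case 0
    then have "p i = q i" if "i \<in> {1..n}" for i using that by auto
    then show ?case using sop_duality_cong 0 by blast
  next
    case (Suc k)
    then have "{i \<in> {1..n}. p i \<noteq> q i} \<noteq> {}" by (metis card.empty nat.distinct(1))
    then obtain m where m: "m \<in> {1..n}" "p m \<noteq> q m" by blast
    obtain z where z: "hom_sop n (invariant_ring n G) (p(m := z))" "hom_sop n (invariant_ring n G) (q(m := z))"
      using common_parameter[OF Suc.prems(1,2) m(1)] .
    obtain \<Phi>1 where \<Phi>1: "sop_duality (p(m := z)) \<Phi>1"
      using sop_duality_exchange[OF m(1) Suc.prems(1) z(1) Suc.prems(3)] by blast
    have "{i \<in> {1..n}. (p(m := z)) i \<noteq> (q(m := z)) i} = {i \<in> {1..n}. p i \<noteq> q i} - {m}" by auto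
    then have "card {i \<in> {1..n}. (p(m := z)) i \<noteq> (q(m := z)) i} = k" using Suc.prems(4) m by simp
    from Suc.IH[OF z \<Phi>1 this] obtain \<Phi>2 where \<Phi>2: "sop_duality (q(m := z)) \<Phi>2" by blast
    have "q = (q(m := z))(m := q m)" by simp
    then show ?case using sop_duality_exchange[OF m(1) z(2) _ \<Phi>2, of "q m"] Suc.prems(2) by simp
  qed
  moreover have "\<exists>\<Phi>. sop_duality y \<Phi>" if "n = 0"
    using sop_duality_cong[OF _ sop_duality_esym, of y] that by auto
  ultimately show ?thesis using hom_sop_esym[where ?'k = 'k] sop_duality_esym y by (metis less_one not_le)
qed

end

section \<open>From dual systems to the canonical module\<close>

lemma to_fract_power: "to_fract (x ^ t) = to_fract x ^ t" by (induction t) simp_all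

locale invariant_sop = perm_group n G for n G +
  fixes y :: "nat \<Rightarrow> 'k::field mpol"
  assumes sop: "hom_sop n (invariant_ring n G) y"
begin

abbreviation R :: "'k mpol set" where "R \<equiv> invariant_ring n G"
abbreviation B :: "'k mpol fract set" where "B \<equiv> cech_boundaries n y R"
abbreviation T :: "('k mpol, 'k mpol fract set) graded_module" where "T \<equiv> top_local_cohomology n y R"

definition Y :: "'k mpol" where "Y = (\<Prod>i=1..n. y i)"
definition frac :: "nat \<Rightarrow> 'k mpol \<Rightarrow> 'k mpol fract" where "frac t a = to_fract a / to_fract Y ^ t"
definition Ydeg :: int where "Ydeg = (SOME d. homogeneous d Y)"
definition coset :: "'k mpol fract \<Rightarrow> 'k mpol fract set" where "coset x = {x + b | b. b \<in> B}"

lemmas R = invariant_ring_subalgebra[where ?'k = 'k]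

lemma y_mem: "i \<in> {1..n} \<Longrightarrow> y i \<in> R" and y_nonzero: "i \<in> {1..n} \<Longrightarrow> y i \<noteq> 0" using hom_sopD[OF sop] by blast+

lemma Y_mem: "Y \<in> R" unfolding Y_def by (intro subalg_prod[OF R] y_mem)
lemma Y_nonzero: "Y \<noteq> 0" using y_nonzero by (auto simp: Y_def)

lemma Y_homogeneous: "homogeneous d Y \<longleftrightarrow> d = Ydeg"
proof -
  have "\<forall>i\<in>{1..n}. \<exists>d. homogeneous d (y i)" using sop unfolding hom_sop_def by blast
  then obtain \<delta> where "\<forall>i\<in>{1..n}. homogeneous (\<delta> i) (y i)" by metis
  then have "homogeneous (\<Sum>i=1..n. \<delta> i) Y" unfolding Y_def by (intro homogeneous_prod) auto
  then have "homogeneous Ydeg Y" unfolding Ydeg_def by (rule someI)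
  then show ?thesis using homogeneous_unique Y_nonzero by blast
qed

lemma frac_add: "frac t (a + b) = frac t a + frac t b" by (simp add: frac_def add_divide_distrib)
lemma frac_mult: "frac t (a * b) = to_fract a * frac t b" by (simp add: frac_def)
lemma frac_diff: "frac t (a - b) = frac t a - frac t b" by (simp add: frac_def diff_divide_distrib)
lemma frac_lift: "frac (t + k) (Y ^ k * a) = frac t a"
  using Y_nonzero by (simp add: frac_def to_fract_power power_add)
lemma frac_eq_iff: "frac t a = frac s b \<longleftrightarrow> Y ^ s * a = Y ^ t * b"
proof -
  have "frac t a = frac s b \<longleftrightarrow> to_fract (Y ^ s * a) = to_fract (Y ^ t * b)"
    using Y_nonzero by (simp add: frac_def to_fract_power frac_eq_eq mult.commute)
  then show ?thesis by (simp only: to_fract_eq_iff)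
qed

lemma localization_part_eq:
  "localization_part R Y d = {frac t a | t a. a \<in> R \<and> homogeneous (d + int t * Ydeg) a}"
  unfolding localization_part_def Y_homogeneous by (auto simp: Fract_conv_to_fract frac_def to_fract_power)

text \<open>All fractions have a common denominator \<open>(y\<^sub>1 \<cdots> y\<^sub>n)\<^sup>s\<close>, for every large \<open>s\<close>.\<close>

lemma boundary_iff:
  "x \<in> B \<longleftrightarrow> (\<exists>s0. \<forall>s\<ge>s0. \<exists>b. (\<forall>i\<in>{1..n}. b i \<in> R) \<and> x = frac s (\<Sum>i=1..n. b i * y i ^ s))"
proof
  assume "x \<in> B"
  then obtain u where u: "\<forall>i\<in>{1..n}. u i \<in> localization R (\<Prod>j\<in>{1..n} - {i}. y j)" "x = (\<Sum>i=1..n. u i)"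
    by (auto simp: cech_boundaries_def)
  have "\<forall>i\<in>{1..n}. \<exists>a t. a \<in> R \<and> u i = Fract a ((\<Prod>j\<in>{1..n} - {i}. y j) ^ t)"
    using u(1) unfolding localization_def by blast
  then obtain a t where at: "\<forall>i\<in>{1..n}. a i \<in> R \<and> u i = Fract (a i) ((\<Prod>j\<in>{1..n} - {i}. y j) ^ t i)" by metis
  show "\<exists>s0. \<forall>s\<ge>s0. \<exists>b. (\<forall>i\<in>{1..n}. b i \<in> R) \<and> x = frac s (\<Sum>i=1..n. b i * y i ^ s)"
  proof (intro exI[of _ "\<Sum>i=1..n. t i"] allI impI)
    fix s assume s: "(\<Sum>i=1..n. t i) \<le> s"
    define b where "b i = a i * (\<Prod>j\<in>{1..n} - {i}. y j) ^ (s - t i)" for i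
    have b: "b i \<in> R \<and> u i = frac s (b i * y i ^ s)" if i: "i \<in> {1..n}" for i
    proof
      define Z where "Z = (\<Prod>j\<in>{1..n} - {i}. y j)"
      have Z: "Z \<in> R" "Z \<noteq> 0" unfolding Z_def using y_mem y_nonzero by (auto intro!: subalg_prod[OF R])
      have YZ: "Y = y i * Z" unfolding Y_def Z_def using i by (intro prod.remove) auto
      show "b i \<in> R" using at i Z unfolding b_def Z_def[symmetric] by (intro subalg_mult[OF R] subalg_power[OF R]) auto
      have "t i \<le> (\<Sum>i=1..n. t i)" using i by (intro member_le_sum) auto
      then have "to_fract Z ^ s = to_fract Z ^ (s - t i) * to_fract Z ^ t i" using s by (simp flip: power_add)
      moreover have "u i = Fract (a i) (Z ^ t i)" using at i by (simp add: Z_def)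
      ultimately show "u i = frac s (b i * y i ^ s)"
        using Z(2) y_nonzero[OF i] unfolding frac_def b_def Z_def[symmetric] YZ
        by (simp add: Fract_conv_to_fract to_fract_power power_mult_distrib)
    qed
    have "x = (\<Sum>i=1..n. frac s (b i * y i ^ s))" unfolding u(2) using b by (intro sum.cong) auto
    also have "\<dots> = frac s (\<Sum>i=1..n. b i * y i ^ s)" by (simp add: frac_def sum_divide_distrib)
    finally show "\<exists>b. (\<forall>i\<in>{1..n}. b i \<in> R) \<and> x = frac s (\<Sum>i=1..n. b i * y i ^ s)" using b by blast
  qed
next
  assume "\<exists>s0. \<forall>s\<ge>s0. \<exists>b. (\<forall>i\<in>{1..n}. b i \<in> R) \<and> x = frac s (\<Sum>i=1..n. b i * y i ^ s)"
  then obtain s b where b: "\<forall>i\<in>{1..n}. b i \<in> R" "x = frac s (\<Sum>i=1..n. b i * y i ^ s)" by blast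
  have u: "frac s (b i * y i ^ s) = Fract (b i) ((\<Prod>j\<in>{1..n} - {i}. y j) ^ s)" if i: "i \<in> {1..n}" for i
  proof -
    have "Y = y i * (\<Prod>j\<in>{1..n} - {i}. y j)" unfolding Y_def using i by (intro prod.remove) auto
    then show ?thesis
      using y_nonzero[OF i] by (simp add: frac_def Fract_conv_to_fract to_fract_power power_mult_distrib)
  qed
  have "x = (\<Sum>i=1..n. frac s (b i * y i ^ s))" unfolding b(2) by (simp add: frac_def sum_divide_distrib)
  moreover have "\<forall>i\<in>{1..n}. frac s (b i * y i ^ s) \<in> localization R (\<Prod>j\<in>{1..n} - {i}. y j)"
    using u b(1) unfolding localization_def by blast
  ultimately show "x \<in> B" unfolding cech_boundaries_def by blast
qed

lemma boundary_gen:
  assumes "i \<in> {1..n}" "q \<in> R"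
  shows "frac t (y i ^ t * q) \<in> B"
  unfolding boundary_iff
proof (intro exI[of _ t] allI impI)
  fix s assume s: "t \<le> s"
  define Z where "Z = (\<Prod>j\<in>{1..n} - {i}. y j)"
  have Z: "Z \<in> R" unfolding Z_def using y_mem by (auto intro!: subalg_prod[OF R])
  have YZ: "Y = y i * Z" unfolding Y_def Z_def using assms(1) by (intro prod.remove) auto
  define b where "b j = (if j = i then Z ^ (s - t) * q else 0)" for j
  have "(\<Sum>j=1..n. b j * y j ^ s) = Z ^ (s - t) * q * y i ^ s"
    using assms(1) by (simp add: b_def if_distrib[of "\<lambda>x. x * _"] cong: if_cong)
  also have "\<dots> = Y ^ (s - t) * (y i ^ t * q)"
    using s by (simp add: YZ power_mult_distrib mult_ac flip: power_add)
  finally have "frac s (\<Sum>j=1..n. b j * y j ^ s) = frac t (y i ^ t * q)" using frac_lift[of t "s - t"] s by simp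
  moreover have "\<forall>j\<in>{1..n}. b j \<in> R"
    using assms Z by (auto simp: b_def intro!: subalg_mult[OF R] subalg_power[OF R] subalg_0[OF R])
  ultimately show "\<exists>b. (\<forall>i\<in>{1..n}. b i \<in> R) \<and> frac t (y i ^ t * q) = frac s (\<Sum>i=1..n. b i * y i ^ s)"
    by (intro exI[of _ b] conjI) simp_all
qed

lemma boundary_zero: "0 \<in> B"
  unfolding boundary_iff by (intro exI[of _ 0] allI impI exI[of _ "\<lambda>_. 0"]) (simp add: frac_def subalg_0[OF R])

lemma boundary_add: "x \<in> B \<Longrightarrow> x' \<in> B \<Longrightarrow> x + x' \<in> B"
proof -
  assume "x \<in> B" "x' \<in> B"
  then obtain s0 s1 where s: "\<forall>s\<ge>s0. \<exists>b. (\<forall>i\<in>{1..n}. b i \<in> R) \<and> x = frac s (\<Sum>i=1..n. b i * y i ^ s)"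
    "\<forall>s\<ge>s1. \<exists>b. (\<forall>i\<in>{1..n}. b i \<in> R) \<and> x' = frac s (\<Sum>i=1..n. b i * y i ^ s)" unfolding boundary_iff by blast
  show ?thesis unfolding boundary_iff
  proof (intro exI[of _ "max s0 s1"] allI impI)
    fix s assume "max s0 s1 \<le> s"
    then have "s0 \<le> s" "s1 \<le> s" by simp_all
    with s(1)[rule_format, of s] s(2)[rule_format, of s] obtain b b' where b: "\<forall>i\<in>{1..n}. b i \<in> R" "x = frac s (\<Sum>i=1..n. b i * y i ^ s)"
      "\<forall>i\<in>{1..n}. b' i \<in> R" "x' = frac s (\<Sum>i=1..n. b' i * y i ^ s)" by blast
    then have "x + x' = frac s (\<Sum>i=1..n. (b i + b' i) * y i ^ s)"
      by (simp add: distrib_right sum.distrib frac_add)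
    then show "\<exists>b. (\<forall>i\<in>{1..n}. b i \<in> R) \<and> x + x' = frac s (\<Sum>i=1..n. b i * y i ^ s)"
      using b by (intro exI[of _ "\<lambda>i. b i + b' i"]) (auto intro: subalg_add[OF R])
  qed
qed

lemma boundary_mult: "x \<in> B \<Longrightarrow> r \<in> R \<Longrightarrow> to_fract r * x \<in> B"
proof -
  assume "x \<in> B" and r: "r \<in> R"
  then obtain s0 where s: "\<forall>s\<ge>s0. \<exists>b. (\<forall>i\<in>{1..n}. b i \<in> R) \<and> x = frac s (\<Sum>i=1..n. b i * y i ^ s)"
    unfolding boundary_iff by blast
  show ?thesis unfolding boundary_iff
  proof (intro exI[of _ s0] allI impI)
    fix s assume "s0 \<le> s"
    then obtain b where b: "\<forall>i\<in>{1..n}. b i \<in> R" "x = frac s (\<Sum>i=1..n. b i * y i ^ s)" using s by blast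
    then have "to_fract r * x = frac s (\<Sum>i=1..n. (r * b i) * y i ^ s)"
      by (simp add: mult.assoc frac_mult[symmetric] flip: sum_distrib_left)
    then show "\<exists>b. (\<forall>i\<in>{1..n}. b i \<in> R) \<and> to_fract r * x = frac s (\<Sum>i=1..n. b i * y i ^ s)"
      using b r by (intro exI[of _ "\<lambda>i. r * b i"]) (auto intro: subalg_mult[OF R])
  qed
qed

lemma boundary_uminus: "x \<in> B \<Longrightarrow> - x \<in> B"
  using boundary_mult[of x "-1"] subalg_uminus[OF R subalg_1[OF R]] by simp

lemma boundary_diff: "x \<in> B \<Longrightarrow> x' \<in> B \<Longrightarrow> x - x' \<in> B" using boundary_add[of x "- x'"] boundary_uminus by simp

lemma mem_coset: "z \<in> coset x \<longleftrightarrow> z - x \<in> B"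
  unfolding coset_def by (auto intro: exI[of _ "z - x"])

lemma coset_eq_iff: "coset x = coset x' \<longleftrightarrow> x - x' \<in> B"
proof
  assume "coset x = coset x'"
  moreover have "x \<in> coset x" using boundary_zero by (simp add: mem_coset)
  ultimately show "x - x' \<in> B" by (simp add: mem_coset)
next
  assume d: "x - x' \<in> B"
  have "z - x \<in> B \<longleftrightarrow> z - x' \<in> B" for z
    using boundary_add[OF _ d, of "z - x"] boundary_diff[OF _ d, of "z - x'"] by auto
  then show "coset x = coset x'" by (auto simp: mem_coset)
qed

lemma coset_eq_B: "coset x = B \<longleftrightarrow> x \<in> B" using coset_eq_iff[of x 0] by (simp add: coset_def[of 0])

lemma T_comp: "comp T d = coset ` localization_part R Y d"
  by (simp add: top_local_cohomology_def Let_def Y_def coset_def)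

lemma T_zero: "zero_of T d = B" by (simp add: top_local_cohomology_def Let_def)

lemma T_plus: "plus_of T d (coset x) (coset x') = coset (x + x')"
proof -
  have "{u + u' | u u'. u \<in> coset x \<and> u' \<in> coset x'} = coset (x + x')"
  proof (intro Set.set_eqI iffI)
    fix z assume "z \<in> {u + u' | u u'. u \<in> coset x \<and> u' \<in> coset x'}"
    then obtain u u' where "z = u + u'" "u - x \<in> B" "u' - x' \<in> B" by (auto simp: mem_coset)
    then have "z - (x + x') = (u - x) + (u' - x')" by simp
    then show "z \<in> coset (x + x')" using \<open>u - x \<in> B\<close> \<open>u' - x' \<in> B\<close> by (simp only: mem_coset boundary_add)
  next
    fix z assume "z \<in> coset (x + x')"
    then have "z = x + (z - x)" "x \<in> coset x" "z - x \<in> coset x'"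
      using boundary_zero by (auto simp: mem_coset algebra_simps)
    then show "z \<in> {u + u' | u u'. u \<in> coset x \<and> u' \<in> coset x'}" by blast
  qed
  then show ?thesis by (simp add: top_local_cohomology_def Let_def)
qed

lemma T_act: "r \<in> R \<Longrightarrow> act T e d r (coset x) = coset (to_fract r * x)"
proof -
  assume r: "r \<in> R"
  have "{to_fract r * u + b | u b. u \<in> coset x \<and> b \<in> B} = coset (to_fract r * x)"
  proof (intro Set.set_eqI iffI)
    fix z assume "z \<in> {to_fract r * u + b | u b. u \<in> coset x \<and> b \<in> B}"
    then obtain u b where ub: "z = to_fract r * u + b" "u - x \<in> B" "b \<in> B" by (auto simp: mem_coset)
    then have "z - to_fract r * x = to_fract r * (u - x) + b" by (simp add: algebra_simps)
    then show "z \<in> coset (to_fract r * x)" using ub r by (simp only: mem_coset boundary_add boundary_mult)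
  next
    fix z assume "z \<in> coset (to_fract r * x)"
    then have "z = to_fract r * x + (z - to_fract r * x)" "x \<in> coset x" "z - to_fract r * x \<in> B"
      using boundary_zero by (auto simp: mem_coset)
    then show "z \<in> {to_fract r * u + b | u b. u \<in> coset x \<and> b \<in> B}" by blast
  qed
  then show ?thesis by (simp add: top_local_cohomology_def Let_def to_fract_def)
qed

lemma T_elem:
  assumes "X \<in> comp T d"
  shows "\<exists>t0. \<forall>t\<ge>t0. \<exists>a\<in>R. homogeneous (d + int t * Ydeg) a \<and> X = coset (frac t a)"
proof -
  obtain t a where a: "a \<in> R" "homogeneous (d + int t * Ydeg) a" "X = coset (frac t a)"
    using assms by (auto simp: T_comp localization_part_eq)
  show ?thesis
  proof (intro exI[of _ t] allI impI bexI[of _ "Y ^ (s - t) * a" for s] conjI)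
    fix s assume s: "t \<le> s"
    have "homogeneous (int (s - t) * Ydeg + (d + int t * Ydeg)) (Y ^ (s - t) * a)"
      using a Y_homogeneous by (intro homogeneous_mult homogeneous_power) auto
    then show "homogeneous (d + int s * Ydeg) (Y ^ (s - t) * a)" using s by (simp add: of_nat_diff algebra_simps)
    show "X = coset (frac s (Y ^ (s - t) * a))" using frac_lift[of t "s - t" a] s a(3) by simp
    show "Y ^ (s - t) * a \<in> R" using a by (intro subalg_mult[OF R] subalg_power[OF R] Y_mem)
  qed
qed

lemma T_elemI: "a \<in> R \<Longrightarrow> homogeneous (d + int t * Ydeg) a \<Longrightarrow> coset (frac t a) \<in> comp T d"
  unfolding T_comp localization_part_eq by blast

lemma T_elem_pos:
  assumes "X \<in> comp T d"
  obtains t a where "t \<ge> 1" "a \<in> R" "homogeneous (d + int t * Ydeg) a" "X = coset (frac t a)"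
  using T_elem[OF assms] by (metis nat_le_linear)

lemma T_elem2:
  assumes "X \<in> comp T d" "X' \<in> comp T d"
  obtains t a b where "t \<ge> 1" "a \<in> R" "homogeneous (d + int t * Ydeg) a" "X = coset (frac t a)"
    "b \<in> R" "homogeneous (d + int t * Ydeg) b" "X' = coset (frac t b)"
proof -
  obtain t0 t1 where t: "\<forall>t\<ge>t0. \<exists>a\<in>R. homogeneous (d + int t * Ydeg) a \<and> X = coset (frac t a)"
    "\<forall>t\<ge>t1. \<exists>a\<in>R. homogeneous (d + int t * Ydeg) a \<and> X' = coset (frac t a)"
    using T_elem[OF assms(1)] T_elem[OF assms(2)] by blast
  define t where "t = t0 + t1 + 1"
  have "t0 \<le> t" "t1 \<le> t" "1 \<le> t" by (auto simp: t_def)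
  then show ?thesis using t that by meson
qed

lemma zero_mem: "B \<in> comp T d"
proof -
  have "coset (frac 0 0) \<in> comp T d" by (intro T_elemI subalg_0[OF R]) (simp add: homogeneous_def)
  moreover have "coset (frac 0 0) = B" using boundary_zero by (simp add: coset_eq_B frac_def)
  ultimately show ?thesis by simp
qed

lemma system_boundary:
  assumes \<phi>: "sop_system n R y d \<phi>" and c: "c \<in> R" "frac t c \<in> B" and t: "t \<ge> 1"
  shows "\<phi> t c = 0"
proof -
  obtain s0 where s0: "\<forall>s\<ge>s0. \<exists>b. (\<forall>i\<in>{1..n}. b i \<in> R) \<and> frac t c = frac s (\<Sum>i=1..n. b i * y i ^ s)"
    using c(2) unfolding boundary_iff by blast
  define s where "s = s0 + 1"
  have s: "s0 \<le> s" "s \<ge> 1" by (simp_all add: s_def)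
  then obtain b where b: "\<forall>i\<in>{1..n}. b i \<in> R" "frac t c = frac s (\<Sum>i=1..n. b i * y i ^ s)" using s0 by blast
  define p where "p = (\<Sum>i=1..n. b i * y i ^ s)"
  have bi: "b i * y i ^ s \<in> R" if "i \<in> {1..n}" for i
    using b(1) y_mem that by (auto intro!: subalg_mult[OF R] subalg_power[OF R])
  have p: "p \<in> R" unfolding p_def by (intro subalg_sum[OF R] bi)
  have "\<phi> t c = \<phi> (t + s) (Y ^ s * c)" unfolding Y_def by (rule sop_system_shift[OF \<phi> R y_mem t c(1), symmetric])
  also have "Y ^ s * c = Y ^ t * p" using b(2) by (simp add: frac_eq_iff p_def)
  also have "\<phi> (t + s) (Y ^ t * p) = \<phi> s p"
    unfolding Y_def add.commute[of t s] by (rule sop_system_shift[OF \<phi> R y_mem s(2) p])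
  also have "\<dots> = (\<Sum>i=1..n. \<phi> s (b i * y i ^ s))" unfolding p_def by (rule sop_system_sum[OF \<phi> R s(2) bi])
  also have "\<dots> = 0" using b(1) sop_systemD(3)[OF \<phi> s(2)] by (intro sum.neutral) (metis mult.commute)
  finally show ?thesis .
qed

lemma system_coset:
  assumes \<phi>: "sop_system n R y d \<phi>" and t: "t \<ge> 1" "s \<ge> 1" and a: "a \<in> R" "b \<in> R"
    and eq: "coset (frac t a) = coset (frac s b)"
  shows "\<phi> t a = \<phi> s b"
proof -
  have m: "Y ^ s * a \<in> R" "Y ^ t * b \<in> R" using a by (auto intro!: subalg_mult[OF R] subalg_power[OF R] Y_mem)
  have ts: "t + s \<ge> 1" using t by simp
  have "frac (t + s) (Y ^ s * a - Y ^ t * b) = frac t a - frac s b"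
    using frac_lift[of t s a] frac_lift[of s t b] by (simp add: frac_diff add.commute)
  then have z: "\<phi> (t + s) (Y ^ s * a - Y ^ t * b) = 0"
    using eq subalg_diff[OF R m] ts by (intro system_boundary[OF \<phi>]) (simp_all add: coset_eq_iff)
  have "\<phi> (t + s) (Y ^ s * a) = \<phi> (t + s) ((Y ^ s * a - Y ^ t * b) + Y ^ t * b)" by simp
  also have "\<dots> = \<phi> (t + s) (Y ^ s * a - Y ^ t * b) + \<phi> (t + s) (Y ^ t * b)"
    by (rule sop_systemD(1)[OF \<phi> ts subalg_diff[OF R m] m(2)])
  finally have "\<phi> (t + s) (Y ^ s * a) = \<phi> (s + t) (Y ^ t * b)" using z by (simp add: add.commute)
  then show ?thesis
    using sop_system_shift[OF \<phi> R y_mem t(1) a(1), of s] sop_system_shift[OF \<phi> R y_mem t(2) a(2), of t]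
    unfolding Y_def by simp
qed

definition functional :: "(nat \<Rightarrow> 'k mpol \<Rightarrow> 'k) \<Rightarrow> int \<Rightarrow> 'k mpol fract set \<Rightarrow> 'k" where
  "functional \<phi> d = (\<lambda>X\<in>comp T (- d). (THE c. \<exists>t a. t \<ge> 1 \<and> a \<in> R \<and> X = coset (frac t a) \<and> c = \<phi> t a))"

lemma functional_coset:
  assumes \<phi>: "sop_system n R y d \<phi>" and t: "t \<ge> 1" and a: "a \<in> R" "homogeneous (- d + int t * Ydeg) a"
  shows "functional \<phi> d (coset (frac t a)) = \<phi> t a"
proof -
  have "(THE c. \<exists>s b. s \<ge> 1 \<and> b \<in> R \<and> coset (frac t a) = coset (frac s b) \<and> c = \<phi> s b) = \<phi> t a"
    using t a(1) system_coset[OF \<phi> _ t _ a(1)] by (intro the_equality) metis+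
  then show ?thesis using T_elemI[OF a] by (simp add: functional_def)
qed

lemma functional_mem:
  assumes \<phi>: "sop_system n R y d \<phi>"
  shows "functional \<phi> d \<in> comp (graded_dual T) d"
proof -
  have "functional \<phi> d (plus_of T (- d) X X') = functional \<phi> d X + functional \<phi> d X'"
    if X: "X \<in> comp T (- d)" "X' \<in> comp T (- d)" for X X'
  proof -
    obtain t a b where t: "t \<ge> 1" "a \<in> R" "homogeneous (- d + int t * Ydeg) a" "X = coset (frac t a)"
      "b \<in> R" "homogeneous (- d + int t * Ydeg) b" "X' = coset (frac t b)" using T_elem2[OF X] .
    then show ?thesis
      by (simp add: T_plus functional_coset[OF \<phi>] homogeneous_add subalg_add[OF R] sop_systemD(1)[OF \<phi>] flip: frac_add)
  qed
  moreover have "functional \<phi> d (act T 0 (- d) (const c) X) = c * functional \<phi> d X"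
    if X: "X \<in> comp T (- d)" for c X
  proof -
    obtain t a where t: "t \<ge> 1" "a \<in> R" "homogeneous (- d + int t * Ydeg) a" "X = coset (frac t a)" using T_elem_pos[OF X] .
    moreover have "const c * a \<in> R" "homogeneous (- d + int t * Ydeg) (const c * a)"
      using t by (auto intro: subalg_mult[OF R] subalg_const[OF R] homogeneous_const_mult)
    ultimately show ?thesis
      by (simp add: T_act subalg_const[OF R] functional_coset[OF \<phi>] sop_systemD(2)[OF \<phi>] flip: frac_mult)
  qed
  ultimately show ?thesis unfolding graded_dual_def by (auto simp: functional_def[of \<phi> d])
qed

lemma dual_zero:
  assumes "\<psi> \<in> comp (graded_dual T) d"
  shows "\<psi> B = 0"
proof -
  have "\<psi> (plus_of T (- d) B B) = \<psi> B + \<psi> B" using assms zero_mem by (simp add: graded_dual_def)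
  moreover have "plus_of T (- d) B B = B" using T_plus[of "- d" 0 0] coset_eq_B[of 0] boundary_zero by simp
  ultimately show ?thesis by (metis add_cancel_right_right)
qed

lemma dual_system_of:
  assumes \<psi>: "\<psi> \<in> comp (graded_dual T) d"
  shows "sop_system n R y d (\<lambda>t a. \<psi> (coset (frac t (hcomp (- d + int t * Ydeg) a))))"
proof -
  define h where "h t a = hcomp (- d + int t * Ydeg) a" for t and a :: "'k mpol"
  have hm: "h t a \<in> R" "coset (frac t (h t a)) \<in> comp T (- d)" if "a \<in> R" for t a
    using subalg_hcomp[OF R that] homogeneous_hcomp by (auto simp: h_def intro!: T_elemI)
  have \<psi>1: "\<psi> (plus_of T (- d) X X') = \<psi> X + \<psi> X'" if "X \<in> comp T (- d)" "X' \<in> comp T (- d)" for X X'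
    using \<psi> that by (simp add: graded_dual_def)
  have \<psi>2: "\<psi> (act T 0 (- d) (const c) X) = c * \<psi> X" if "X \<in> comp T (- d)" for c X
    using \<psi> that by (simp add: graded_dual_def)
  have \<psi>3: "\<psi> (coset x) = 0" if "x \<in> B" for x using dual_zero[OF \<psi>] that coset_eq_B by metis
  show ?thesis
    unfolding sop_system_def h_def[symmetric]
  proof (intro allI impI conjI ballI)
    fix t :: nat and p :: "'k mpol" assume t: "t \<ge> 1" and p: "p \<in> R"
    show "\<psi> (coset (frac t (h t (p + q)))) = \<psi> (coset (frac t (h t p))) + \<psi> (coset (frac t (h t q)))" if "q \<in> R" for q
      using \<psi>1[OF hm(2)[OF p, of t] hm(2)[OF that, of t]] by (simp add: T_plus h_def hcomp_add flip: frac_add)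
    show "\<psi> (coset (frac t (h t (const c * p)))) = c * \<psi> (coset (frac t (h t p)))" for c
      using \<psi>2[OF hm(2)[OF p], of c] by (simp add: T_act subalg_const[OF R] h_def hcomp_const_mult flip: frac_mult)
    show "\<psi> (coset (frac t (h t (y i ^ t * p)))) = 0" if i: "i \<in> {1..n}" for i
    proof (rule \<psi>3)
      obtain \<delta> where "homogeneous \<delta> (y i)" using hom_sopD[OF sop i] by blast
      then have "homogeneous (int t * \<delta>) (y i ^ t)" by (rule homogeneous_power)
      from hcomp_homogeneous_mult[OF this, of "- d + int t * Ydeg - int t * \<delta>" p]
      have "h t (y i ^ t * p) = y i ^ t * hcomp (- d + int t * Ydeg - int t * \<delta>) p" by (simp add: h_def)
      then show "frac t (h t (y i ^ t * p)) \<in> B" using boundary_gen[OF i subalg_hcomp[OF R p]] by simp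
    qed
    show "\<psi> (coset (frac (Suc t) (h (Suc t) ((\<Prod>i=1..n. y i) * p)))) = \<psi> (coset (frac t (h t p)))"
    proof -
      have "homogeneous Ydeg Y" using Y_homogeneous by blast
      from hcomp_homogeneous_mult[OF this, of "- d + int t * Ydeg" p]
      have "h (Suc t) (Y * p) = Y * h t p" by (simp add: h_def algebra_simps)
      then show ?thesis using frac_lift[of t 1 "h t p"] unfolding Y_def[symmetric] by (simp add: Suc_eq_plus1)
    qed
    show "\<psi> (coset (frac t (h t p))) = 0"
      if "homogeneous e p" "homogeneous \<delta> (\<Prod>i=1..n. y i)" "e \<noteq> int t * \<delta> - d" for e \<delta>
    proof (rule \<psi>3)
      have "\<delta> = Ydeg" using that(2) Y_homogeneous by (simp add: Y_def)
      then have "h t p = 0" using that(1,3) by (auto simp: h_def hcomp_homogeneous)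
      then show "frac t (h t p) \<in> B" using boundary_zero by (simp add: frac_def)
    qed
  qed
qed

end

definition is_graded_iso ::
    "'k::field mpol set \<Rightarrow> ('k mpol, 'm) graded_module \<Rightarrow> ('k mpol, 'l) graded_module \<Rightarrow> (int \<Rightarrow> 'm \<Rightarrow> 'l) \<Rightarrow> bool" where
  "is_graded_iso R M N f \<longleftrightarrow>
     (\<forall>d. bij_betw (f d) (comp M d) (comp N d)) \<and>
     (\<forall>d. \<forall>x\<in>comp M d. \<forall>y\<in>comp M d. f d (plus_of M d x y) = plus_of N d (f d x) (f d y)) \<and>
     (\<forall>e d. \<forall>r\<in>graded_part R e. \<forall>x\<in>comp M d. f (d + e) (act M e d r x) = act N e d r (f d x))"

lemma graded_iso_iff: "graded_iso R M N \<longleftrightarrow> (\<exists>f. is_graded_iso R M N f)"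
  by (simp only: graded_iso_def is_graded_iso_def)

lemma is_graded_isoD:
  assumes "is_graded_iso R M N f"
  shows "bij_betw (f d) (comp M d) (comp N d)"
    and "x \<in> comp M d \<Longrightarrow> y \<in> comp M d \<Longrightarrow> f d (plus_of M d x y) = plus_of N d (f d x) (f d y)"
    and "r \<in> graded_part R e \<Longrightarrow> x \<in> comp M d \<Longrightarrow> f (d + e) (act M e d r x) = act N e d r (f d x)"
  using assms unfolding is_graded_iso_def by blast+

definition can_module :: "nat \<Rightarrow> (nat \<Rightarrow> nat) set \<Rightarrow> ('k::field mpol, 'k mpol) graded_module" where
  "can_module n G = \<lparr>comp = (\<lambda>d. {f \<in> can_ideal n G. homogeneous (d - int n) f}), plus_of = (\<lambda>_. (+)),
     zero_of = (\<lambda>_. 0), act = (\<lambda>_ _. (*))\<rparr>"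

context invariant_sop
begin

theorem canonical_module_iso:
  "\<exists>F. is_graded_iso R (can_module n G) (canonical_module n y R) F"
proof -
  obtain \<Phi> where \<Phi>: "sop_duality y \<Phi>" using sop_duality_exists[OF sop] by blast
  note \<Phi>D = sop_dualityD[OF \<Phi>]
  note \<Phi>1 = \<Phi>D(1) and \<Phi>2 = \<Phi>D(2) and \<Phi>3 = \<Phi>D(3) and \<Phi>4 = \<Phi>D(4) and \<Phi>5 = sop_duality_surj[OF \<Phi>]
  define F where "F d f = functional (\<Phi> f) d" for d f
  have F: "F d f (coset (frac t a)) = \<Phi> f t a"
    if "f \<in> can_ideal n G" "homogeneous (d - int n) f" "t \<ge> 1" "a \<in> R" "homogeneous (- d + int t * Ydeg) a" for d f t a
    unfolding F_def by (rule functional_coset[OF \<Phi>1[OF that(1,2)] that(3-5)])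
  have ext: "F d f = \<psi>"
    if "\<psi> \<in> extensional (comp T (- d))" "\<And>X. X \<in> comp T (- d) \<Longrightarrow> F d f X = \<psi> X" for d f \<psi>
    using that by (intro extensionalityI[of _ "comp T (- d)"]) (auto simp: F_def functional_def)
  have comp: "comp (can_module n G) d = {f \<in> can_ideal n G. homogeneous (d - int n) f}" for d
    by (simp add: can_module_def)
  show ?thesis
    unfolding is_graded_iso_def
  proof (intro exI[of _ F] conjI allI ballI)
    fix d
    show "bij_betw (F d) (comp (can_module n G) d) (comp (canonical_module n y R) d)"
      unfolding bij_betw_def
    proof
      show "inj_on (F d) (comp (can_module n G) d)"
      proof (rule inj_onI)
        fix f g :: "'k mpol" assume fg: "f \<in> comp (can_module n G) d" "g \<in> comp (can_module n G) d" and eq: "F d f = F d g"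
        have f: "f \<in> can_ideal n G" "homogeneous (d - int n) f" and g: "g \<in> can_ideal n G" "homogeneous (d - int n) g"
          using fg by (auto simp: comp)
        have "const (-1) * g \<in> can_ideal n G" by (rule can_ideal_mult[OF g(1) subalg_const[OF R]])
        then have m: "f - g \<in> can_ideal n G" using can_ideal_add[OF f(1)] by (fastforce simp: const_uminus)
        have hm: "homogeneous (d - int n) (f - g)" by (rule homogeneous_diff[OF f(2) g(2)])
        have zero: "\<Phi> (f - g) t a = 0" if t: "t \<ge> 1" and a: "a \<in> R" "homogeneous (- d + int t * Ydeg) a" for t a
          using F[OF f t a] F[OF g t a] eq \<Phi>2[OF m g(1) t a(1)] by simp
        have "f - g = 0"
        proof (rule \<Phi>4[OF m hm])
          fix t :: nat and r :: "'k mpol" assume t: "t \<ge> 1" and r: "r \<in> R"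
          let ?D = "(int \<circ> mon_deg) ` keys r"
          note \<phi> = \<Phi>1[OF m hm]
          have "\<Phi> (f - g) t r = \<Phi> (f - g) t (\<Sum>e\<in>?D. hcomp e r)" by (simp only: poly_eq_sum_hcomp[of r, symmetric])
          also have "\<dots> = (\<Sum>e\<in>?D. \<Phi> (f - g) t (hcomp e r))"
            by (rule sop_system_sum[OF \<phi> R t subalg_hcomp[OF R r]])
          also have "\<dots> = 0"
          proof (rule sum.neutral, rule ballI)
            fix e
            show "\<Phi> (f - g) t (hcomp e r) = 0"
            proof (cases "e = - d + int t * Ydeg")
              case True
              then show ?thesis using zero[OF t subalg_hcomp[OF R r]] homogeneous_hcomp by blast
            next
              case False
              then show ?thesis using Y_homogeneous[of Ydeg]
                by (intro sop_systemD(5)[OF \<phi> t subalg_hcomp[OF R r] homogeneous_hcomp]) (auto simp: Y_def)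
            qed
          qed
          finally show "\<Phi> (f - g) t r = 0" .
        qed
        then show "f = g" by simp
      qed
      show "F d ` comp (can_module n G) d = comp (canonical_module n y R) d"
      proof
        show "F d ` comp (can_module n G) d \<subseteq> comp (canonical_module n y R) d"
          unfolding canonical_module_def F_def using functional_mem \<Phi>1 by (auto simp: comp)
        show "comp (canonical_module n y R) d \<subseteq> F d ` comp (can_module n G) d"
        proof
          fix \<psi> assume "\<psi> \<in> comp (canonical_module n y R) d"
          then have \<psi>: "\<psi> \<in> comp (graded_dual T) d" by (simp add: canonical_module_def)
          obtain f where f: "f \<in> can_ideal n G" "homogeneous (d - int n) f"
            "\<forall>t\<ge>1. \<forall>r\<in>R. \<psi> (coset (frac t (hcomp (- d + int t * Ydeg) r))) = \<Phi> f t r"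
            using \<Phi>5[OF dual_system_of[OF \<psi>]] by blast
          have "F d f = \<psi>"
          proof (rule ext)
            show "\<psi> \<in> extensional (comp T (- d))" using \<psi> by (simp add: graded_dual_def)
            fix X assume "X \<in> comp T (- d)"
            then obtain t a where t: "t \<ge> 1" "a \<in> R" "homogeneous (- d + int t * Ydeg) a" "X = coset (frac t a)"
              by (rule T_elem_pos)
            then show "F d f X = \<psi> X"
              using F[OF f(1,2) t(1-3)] f(3)[rule_format, OF t(1,2)] by (simp add: hcomp_homogeneous[OF t(3)])
          qed
          then show "\<psi> \<in> F d ` comp (can_module n G) d" using f(1,2) by (auto simp: comp)
        qed
      qed
    qed
  next
    fix d and f g :: "'k mpol" assume "f \<in> comp (can_module n G) d" "g \<in> comp (can_module n G) d"
    then have f: "f \<in> can_ideal n G" "homogeneous (d - int n) f" and g: "g \<in> can_ideal n G" "homogeneous (d - int n) g"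
      by (auto simp: comp)
    have fg: "f + g \<in> can_ideal n G" "homogeneous (d - int n) (f + g)"
      by (rule can_ideal_add[OF f(1) g(1)]) (rule homogeneous_add[OF f(2) g(2)])
    have "F d (f + g) = (\<lambda>X\<in>comp T (- d). F d f X + F d g X)"
    proof (rule ext)
      fix X assume X: "X \<in> comp T (- d)"
      then obtain t a where t: "t \<ge> 1" "a \<in> R" "homogeneous (- d + int t * Ydeg) a" "X = coset (frac t a)"
        by (rule T_elem_pos)
      then show "F d (f + g) X = (\<lambda>X\<in>comp T (- d). F d f X + F d g X) X"
        using X F[OF f t(1-3)] F[OF g t(1-3)] F[OF fg t(1-3)] \<Phi>2[OF f(1) g(1) t(1,2)] by simp
    qed simp
    then show "F d (plus_of (can_module n G) d f g) = plus_of (canonical_module n y R) d (F d f) (F d g)"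
      by (simp add: can_module_def canonical_module_def graded_dual_def)
  next
    fix e d and r f :: "'k mpol" assume r: "r \<in> graded_part R e" and "f \<in> comp (can_module n G) d"
    then have f: "f \<in> can_ideal n G" "homogeneous (d - int n) f" and r: "r \<in> R" "homogeneous e r"
      by (auto simp: comp graded_part_def)
    have "homogeneous (e + (d - int n)) (r * f)" by (rule homogeneous_mult[OF r(2) f(2)])
    then have rf: "r * f \<in> can_ideal n G" "homogeneous (d + e - int n) (r * f)"
      using can_ideal_mult[OF f(1) r(1)] by (simp_all add: algebra_simps)
    have "F (d + e) (r * f) = (\<lambda>X\<in>comp T (- (d + e)). F d f (act T e (- (d + e)) r X))"
    proof (rule ext)
      fix X assume X: "X \<in> comp T (- (d + e))"
      then obtain t a where t: "t \<ge> 1" "a \<in> R" "homogeneous (- (d + e) + int t * Ydeg) a" "X = coset (frac t a)"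
        by (rule T_elem_pos)
      have "homogeneous (e + (- (d + e) + int t * Ydeg)) (r * a)" by (rule homogeneous_mult[OF r(2) t(3)])
      then have ra: "r * a \<in> R" "homogeneous (- d + int t * Ydeg) (r * a)"
        using subalg_mult[OF R r(1) t(2)] by (simp_all add: algebra_simps)
      show "F (d + e) (r * f) X = (\<lambda>X\<in>comp T (- (d + e)). F d f (act T e (- (d + e)) r X)) X"
        using X F[OF rf t(1-3)] F[OF f t(1) ra] \<Phi>3[OF f(1) r(1) t(1,2)]
        by (simp add: t(4) T_act[OF r(1)] flip: frac_mult)
    qed simp
    then show "F (d + e) (act (can_module n G) e d r f) = act (canonical_module n y R) e d r (F d f)"
      by (simp add: can_module_def canonical_module_def graded_dual_def)
  qed
qed

interpretation fr: vector_space "\<lambda>c (x :: 'k mpol fract). to_fract (const c) * x"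
  by standard (simp_all add: algebra_simps const_add const_mult)

text \<open>Extend a basis of the boundaries by a representative of the class to a basis of the field of fractions over \<open>k\<close>,
  and take the coordinate belonging to the representative.\<close>

lemma dual_separates:
  assumes X: "X \<in> comp T (- d)" "X \<noteq> B"
  shows "\<exists>\<psi>\<in>comp (graded_dual T) d. \<psi> X \<noteq> 0"
proof -
  obtain t a where x: "X = coset (frac t a)" using T_elem_pos[OF X(1)] by metis
  define x where "x = frac t a"
  have xB: "x \<notin> B" using X(2) x coset_eq_B by (auto simp: x_def)
  have sub: "fr.subspace B" by (intro fr.subspaceI boundary_zero boundary_add boundary_mult subalg_const[OF R])
  obtain C where C: "C \<subseteq> B" "fr.independent C" "B \<subseteq> fr.span C" using fr.maximal_independent_subset by blast
  have spC: "fr.span C = B" using C(1,3) fr.span_minimal[OF C(1) sub] by blast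
  define E where "E = fr.extend_basis (insert x C)"
  have ind: "fr.independent (insert x C)" using C(2) xB spC by (intro fr.independent_insertI) auto
  have E: "fr.independent E" "fr.span E = UNIV" "insert x C \<subseteq> E"
    unfolding E_def by (rule fr.independent_extend_basis[OF ind] fr.span_extend_basis[OF ind] fr.extend_basis_superset[OF ind])+
  define g where "g v = fr.representation E v x" for v
  have g_add: "g (v + w) = g v + g w" for v w
    unfolding g_def using E by (subst fr.representation_add) auto
  have g_scale: "g (to_fract (const c) * v) = c * g v" for c v
    unfolding g_def using E by (subst fr.representation_scale) auto
  have gB: "g b = 0" if "b \<in> B" for b
  proof -
    have "fr.representation E b = fr.representation C b"
      using E that spC by (intro fr.representation_extend) auto
    moreover have "x \<notin> C" using C(1) xB by auto
    ultimately show ?thesis unfolding g_def using fr.representation_ne_zero[of C b x] by auto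
  qed
  have gx: "g x = 1" unfolding g_def using E fr.representation_basis[of E x] by auto
  have g_coset: "g v = g w" if "coset v = coset w" for v w
    using g_add[of "v - w" w] gB[of "v - w"] that by (simp add: coset_eq_iff)
  define \<psi> where "\<psi> = (\<lambda>Z\<in>comp T (- d). g (SOME v. Z = coset v))"
  have \<psi>: "\<psi> (coset v) = g v" if "coset v \<in> comp T (- d)" for v
  proof -
    have "coset v = coset (SOME w. coset v = coset w)" by (rule someI[of _ v]) simp
    from g_coset[OF this] show ?thesis using that by (simp add: \<psi>_def)
  qed
  have "\<psi> \<in> comp (graded_dual T) d"
    unfolding graded_dual_def
  proof (simp, intro conjI ballI allI)
    show "\<psi> \<in> extensional (comp T (- d))" by (simp add: \<psi>_def)
    fix Z assume Z: "Z \<in> comp T (- d)"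
    show "\<psi> (plus_of T (- d) Z Z') = \<psi> Z + \<psi> Z'" if Z': "Z' \<in> comp T (- d)" for Z'
    proof -
      obtain t a b where t: "t \<ge> 1" "a \<in> R" "homogeneous (- d + int t * Ydeg) a" "Z = coset (frac t a)"
        "b \<in> R" "homogeneous (- d + int t * Ydeg) b" "Z' = coset (frac t b)" using T_elem2[OF Z Z'] .
      have "coset (frac t a + frac t b) \<in> comp T (- d)"
        using T_elemI[OF subalg_add[OF R t(2,5)] homogeneous_add[OF t(3,6)]] by (simp add: frac_add)
      then show ?thesis using Z Z' by (simp add: t(4,7) T_plus \<psi> g_add)
    qed
    show "\<psi> (act T 0 (- d) (const c) Z) = c * \<psi> Z" for c
    proof -
      obtain t a where t: "t \<ge> 1" "a \<in> R" "homogeneous (- d + int t * Ydeg) a" "Z = coset (frac t a)" using T_elem_pos[OF Z] .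
      have "coset (to_fract (const c) * frac t a) \<in> comp T (- d)"
        using T_elemI[OF subalg_mult[OF R subalg_const[OF R, of c] t(2)] homogeneous_const_mult[OF t(3)]] by (simp add: frac_mult)
      then show ?thesis using Z by (simp add: t(4) T_act subalg_const[OF R] \<psi> g_scale)
    qed
  qed
  moreover have "\<psi> X \<noteq> 0" using \<psi>[of x] X(1) gx by (simp add: x x_def)
  ultimately show ?thesis by blast
qed

lemma top_cohomology_nonzero_iff:
  "comp T a \<noteq> {zero_of T a} \<longleftrightarrow> (\<exists>f\<in>can_ideal n G. f \<noteq> (0 :: 'k mpol) \<and> homogeneous (- a - int n) f)"
proof -
  obtain F where "is_graded_iso R (can_module n G) (canonical_module n y R) F" using canonical_module_iso by blast
  note F = is_graded_isoD(1)[OF this]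
  let ?C = "comp (graded_dual T) (- a)" and ?M = "comp (can_module n G :: ('k mpol, 'k mpol) graded_module) (- a)"
  have b: "bij_betw (F (- a)) ?M ?C" using F[of "- a"] by (simp add: canonical_module_def)
  have M: "?M = {f \<in> can_ideal n G. homogeneous (- a - int n) f}" by (simp add: can_module_def)
  have z: "(\<lambda>X\<in>comp T a. 0) \<in> ?C"
  proof -
    have "sop_system n R y (- a) (\<lambda>_ _. 0)" by (simp add: sop_system_def)
    note sys = this
    from functional_mem[OF this] have "functional (\<lambda>_ _. 0) (- a) \<in> ?C" .
    moreover have "functional (\<lambda>_ _. 0) (- a) = (\<lambda>X\<in>comp T a. 0)"
    proof (rule extensionalityI[of _ "comp T a"])
      fix X assume X: "X \<in> comp T a"
      then obtain t u where "t \<ge> 1" "u \<in> R" "homogeneous (a + int t * Ydeg) u" "X = coset (frac t u)"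
        by (rule T_elem_pos)
      then show "functional (\<lambda>_ _. 0) (- a) X = (\<lambda>X\<in>comp T a. 0) X"
        using X functional_coset[OF sys, of t u] by simp
    qed (simp_all add: functional_def)
    ultimately show ?thesis by simp
  qed
  have zM: "0 \<in> ?M" using can_ideal_mult[OF vand_mem_can_ideal subalg_0[OF R]] by (simp add: M homogeneous_def)
  have "comp T a \<noteq> {B} \<longleftrightarrow> (\<exists>X\<in>comp T a. X \<noteq> B)" using zero_mem[of a] by blast
  also have "\<dots> \<longleftrightarrow> (\<exists>\<psi>\<in>?C. \<psi> \<noteq> (\<lambda>X\<in>comp T a. 0))"
  proof
    assume "\<exists>X\<in>comp T a. X \<noteq> B"
    then obtain X where X: "X \<in> comp T (- (- a))" "X \<noteq> B" by auto
    obtain \<psi> where "\<psi> \<in> ?C" "\<psi> X \<noteq> 0" using dual_separates[OF X] by blast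
    then show "\<exists>\<psi>\<in>?C. \<psi> \<noteq> (\<lambda>X\<in>comp T a. 0)" using X(1) by (intro bexI[of _ \<psi>]) auto
  next
    assume "\<exists>\<psi>\<in>?C. \<psi> \<noteq> (\<lambda>X\<in>comp T a. 0)"
    then obtain \<psi> where \<psi>: "\<psi> \<in> ?C" "\<psi> \<noteq> (\<lambda>X\<in>comp T a. 0)" by blast
    have "\<psi> \<in> extensional (comp T a)" using \<psi>(1) by (simp add: graded_dual_def)
    then obtain X where X: "X \<in> comp T a" "\<psi> X \<noteq> 0" using \<psi>(2) extensionalityI[of \<psi> "comp T a" "\<lambda>X\<in>comp T a. 0"] by fastforce
    have "X \<noteq> B" using X(2) dual_zero[OF \<psi>(1)] by metis
    then show "\<exists>X\<in>comp T a. X \<noteq> B" using X(1) by blast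
  qed
  also have "\<dots> \<longleftrightarrow> (\<exists>f\<in>?M. f \<noteq> 0)"
  proof -
    have single: "(\<exists>v\<in>V. v \<noteq> w) \<longleftrightarrow> card V \<noteq> 1" if "w \<in> V" for V :: "'z set" and w
    proof -
      have "V = {w}" if "card V = 1" using card_1_singletonE[OF that] \<open>w \<in> V\<close> by (metis singletonD)
      then have "card V = 1 \<longleftrightarrow> V = {w}" by auto
      then show ?thesis using that by blast
    qed
    show ?thesis using single[OF z] single[OF zM] bij_betw_same_card[OF b] by simp
  qed
  finally show ?thesis by (auto simp: M T_zero)
qed

lemma a_invariant_eq: "a_invariant n y R = - int n - int (can_degree TYPE('k))"
  unfolding a_invariant_def
proof (rule Greatest_equality)
  show "comp T (- int n - int (can_degree TYPE('k))) \<noteq> {zero_of T (- int n - int (can_degree TYPE('k)))}"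
    using can_degree_props(1)[where ?'k = 'k] by (simp add: top_cohomology_nonzero_iff)
  fix a assume "comp T a \<noteq> {zero_of T a}"
  then obtain f :: "'k mpol" where "f \<in> can_ideal n G" "f \<noteq> 0" "homogeneous (- a - int n) f"
    unfolding top_cohomology_nonzero_iff by blast
  then have "int (can_degree TYPE('k)) \<le> - a - int n" by (rule can_degree_props(2))
  then show "a \<le> - int n - int (can_degree TYPE('k))" by simp
qed

end

section \<open>Quasi-Gorenstein rings of invariants\<close>

lemma graded_iso_trans:
  assumes "graded_iso R M N" "graded_iso R N P"
  shows "graded_iso R M P"
proof -
  obtain f g where fg: "is_graded_iso R M N f" "is_graded_iso R N P g"
    using assms unfolding graded_iso_iff by blast
  note f = is_graded_isoD[OF fg(1)] and g = is_graded_isoD[OF fg(2)]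
  have fN: "f d x \<in> comp N d" if "x \<in> comp M d" for d x using f(1) that by (rule bij_betw_apply)
  show ?thesis
    unfolding graded_iso_def by (intro exI[of _ "\<lambda>d. g d \<circ> f d"] conjI allI ballI bij_betw_trans[OF f(1) g(1)])
      (simp_all add: f g fN)
qed

lemma graded_iso_sym:
  assumes "graded_iso R M N"
    and add: "\<And>d x y. x \<in> comp M d \<Longrightarrow> y \<in> comp M d \<Longrightarrow> plus_of M d x y \<in> comp M d"
    and act: "\<And>e d r x. r \<in> graded_part R e \<Longrightarrow> x \<in> comp M d \<Longrightarrow> act M e d r x \<in> comp M (d + e)"
  shows "graded_iso R N M"
proof -
  obtain f where "is_graded_iso R M N f" using assms(1) unfolding graded_iso_iff by blast
  note f = is_graded_isoD[OF this]
  define h where "h d = the_inv_into (comp M d) (f d)" for d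
  have inj: "inj_on (f d) (comp M d)" for d using f(1) by (rule bij_betw_imp_inj_on)
  have h: "bij_betw (h d) (comp N d) (comp M d)" for d unfolding h_def by (rule bij_betw_the_inv_into[OF f(1)])
  have hM: "h d x \<in> comp M d" if "x \<in> comp N d" for d x using h that by (rule bij_betw_apply)
  have fh: "f d (h d x) = x" if "x \<in> comp N d" for d x
    unfolding h_def using inj f(1) that by (intro f_the_inv_into_f) (auto simp: bij_betw_def)
  have hf: "h d (f d x) = x" if "x \<in> comp M d" for d x unfolding h_def by (rule the_inv_into_f_f[OF inj that])
  show ?thesis
    unfolding graded_iso_def
  proof (intro exI[of _ h] conjI allI ballI h)
    fix d x y assume xy: "x \<in> comp N d" "y \<in> comp N d"
    have "h d (f d (plus_of M d (h d x) (h d y))) = plus_of M d (h d x) (h d y)" by (intro hf add hM xy)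
    then show "h d (plus_of N d x y) = plus_of M d (h d x) (h d y)" by (simp add: f(2) hM fh xy)
  next
    fix e d r x assume r: "r \<in> graded_part R e" and x: "x \<in> comp N d"
    have "h (d + e) (f (d + e) (act M e d r (h d x))) = act M e d r (h d x)" by (intro hf act hM x r)
    then show "h (d + e) (act N e d r x) = act M e d r (h d x)" by (simp add: f(3) r hM fh x)
  qed
qed

context invariant_sop
begin

lemma graded_iso_can_module: "graded_iso R (can_module n G) (canonical_module n y R)"
  unfolding graded_iso_iff by (rule canonical_module_iso)

lemma quasi_gorenstein_if:
  assumes D: "(transp_prod n G :: 'k mpol) \<in> can_ideal n G"
  shows "quasi_gorenstein n y R"
proof -
  let ?\<Delta> = "transp_prod n G :: 'k mpol"
  define c where "c = int (card (transp_pairs n G))"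
  let ?S = "shift (regular_module R) (- int n - c)"
  have \<Delta>: "?\<Delta> \<noteq> 0" "homogeneous c ?\<Delta>" using transp_prod_props by (auto simp: c_def)
  have comp: "comp ?S d = graded_part R (d - int n - c)" for d
    by (simp add: shift_def regular_module_def algebra_simps)
  have "graded_iso R ?S (can_module n G)"
    unfolding graded_iso_def
  proof (intro exI[of _ "\<lambda>d r. r * ?\<Delta>"] conjI allI ballI)
    fix d
    have "r * ?\<Delta> \<in> comp (can_module n G) d" if "r \<in> graded_part R (d - int n - c)" for r
      using that can_ideal_mult[OF D, of r] homogeneous_mult[OF _ \<Delta>(2), of "d - int n - c" r]
      by (auto simp: graded_part_def can_module_def)
    moreover have "\<exists>r\<in>graded_part R (d - int n - c). f = r * ?\<Delta>" if f: "f \<in> comp (can_module n G) d" for f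
    proof -
      have f': "f \<in> can_ideal n G" "homogeneous (d - int n) f" using f by (auto simp: can_module_def)
      obtain r where r: "r \<in> R" "f = r * ?\<Delta>" using can_ideal_generated[OF D f'(1)] by blast
      have "homogeneous (d - int n - c) r"
        using f'(2) r(2) by (intro homogeneous_quotient[OF _ \<Delta>(2,1)]) (simp add: mult.commute)
      then show ?thesis using r by (auto simp: graded_part_def)
    qed
    ultimately show "bij_betw (\<lambda>r. r * ?\<Delta>) (comp ?S d) (comp (can_module n G) d)"
      unfolding comp bij_betw_def inj_on_def using \<Delta>(1) by auto
  qed (simp_all add: shift_def regular_module_def can_module_def algebra_simps)
  from graded_iso_trans[OF this graded_iso_can_module] have iso: "graded_iso R ?S (canonical_module n y R)" .
  have "graded_iso R (canonical_module n y R) ?S"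
  proof (rule graded_iso_sym[OF iso])
    fix d x z assume "x \<in> comp ?S d" "z \<in> comp ?S d"
    then show "plus_of ?S d x z \<in> comp ?S d"
      unfolding comp by (auto simp: graded_part_def shift_def regular_module_def intro: subalg_add[OF R] homogeneous_add)
  next
    fix e d r x assume "r \<in> graded_part R e" "x \<in> comp ?S d"
    then have "r * x \<in> R" "homogeneous (e + (d - int n - c)) (r * x)"
      unfolding comp by (auto simp: graded_part_def intro: subalg_mult[OF R] homogeneous_mult)
    then show "act ?S e d r x \<in> comp ?S (d + e)"
      unfolding comp by (simp add: graded_part_def shift_def regular_module_def algebra_simps)
  qed
  then show ?thesis unfolding quasi_gorenstein_def by blast
qed

text \<open>The preimage of 1 generates the module.\<close>

lemma quasi_gorenstein_only_if:
  assumes char: "(1 :: 'k) + 1 \<noteq> 0" and qg: "quasi_gorenstein n y R"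
  shows "(transp_prod n G :: 'k mpol) \<in> can_ideal n G"
proof -
  obtain a where "graded_iso R (canonical_module n y R) (shift (regular_module R) a)"
    using qg unfolding quasi_gorenstein_def by blast
  from graded_iso_trans[OF graded_iso_can_module this]
  have "graded_iso R (can_module n G) (shift (regular_module R) a)" .
  then obtain g where "is_graded_iso R (can_module n G) (shift (regular_module R) a) g" unfolding graded_iso_iff by blast
  note g = is_graded_isoD(1,3)[OF this]
  have M: "comp (can_module n G) d = {f \<in> can_ideal n G. homogeneous (d - int n) f}"
    "act (can_module n G) e d r x = r * x" for d e r and x :: "'k mpol" by (simp_all add: can_module_def)
  have N: "comp (shift (regular_module R) a) d = graded_part R (a + d)"
    "act (shift (regular_module R) a) e d r x = r * x" for d e r x
    by (simp_all add: shift_def regular_module_def)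
  have "1 \<in> graded_part R 0" using subalg_1[OF R] homogeneous_const[of 1] by (simp add: graded_part_def)
  then have "1 \<in> g (- a) ` comp (can_module n G) (- a)"
    using bij_betw_imp_surj_on[OF g(1)[of "- a"]] by (simp add: N)
  then obtain h where h: "h \<in> comp (can_module n G) (- a)" "1 = g (- a) h" by blast
  have h': "h \<in> can_ideal n G" "homogeneous (- a - int n) h" using h(1) by (auto simp: M)
  have dvd: "h dvd f" if f: "f \<in> can_ideal n G" "homogeneous e f" for e f
  proof -
    have fM: "f \<in> comp (can_module n G) (- a + (e + int n + a))" using f by (simp add: M)
    define r where "r = g (- a + (e + int n + a)) f"
    have "r \<in> graded_part R (a + (- a + (e + int n + a)))"
      unfolding r_def using bij_betwE[OF g(1)] fM N by blast
    moreover have "a + (- a + (e + int n + a)) = e + int n + a" by simp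
    ultimately have r: "r \<in> graded_part R (e + int n + a)" by metis
    then have rR: "r \<in> R" "homogeneous (e + int n + a) r" by (auto simp: graded_part_def)
    have "g (- a + (e + int n + a)) (r * h) = r" using g(2)[OF r h(1)] h(2)[symmetric] by (simp add: M N)
    moreover have "homogeneous ((e + int n + a) + (- a - int n)) (r * h)" by (rule homogeneous_mult[OF rR(2) h'(2)])
    then have "r * h \<in> comp (can_module n G) (- a + (e + int n + a))"
      using can_ideal_mult[OF h'(1) rR(1)] by (simp add: M)
    ultimately have "r * h = f" using bij_betw_imp_inj_on[OF g(1)] fM unfolding r_def by (metis inj_onD)
    then show ?thesis by (metis dvd_triv_right)
  qed
  have h0: "h \<noteq> 0" using dvd[OF vand_mem_can_ideal vand_props(2)] vand_props(1)[of n, where ?'k = 'k] by auto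
  have "- a - int n = int (card (transp_pairs n G))" by (rule generator_degree[OF char h'(1) h0 h'(2) dvd])
  then show ?thesis using h' h0 by (intro transp_prod_mem_of_min_degree[of h]) simp_all
qed

lemma quasi_gorenstein_iff: "quasi_gorenstein n y R \<longleftrightarrow> (transp_prod n G :: 'k mpol) \<in> can_ideal n G"
  using quasi_gorenstein_if quasi_gorenstein_only_if transp_prod_mem_char_2[where ?'k = 'k] by blast

end

lemma (in perm_group) transp_prod_mem_iff_even:
  assumes char: "(1 :: 'k::field) + 1 \<noteq> 0" and none: "transp_pairs n G = {}"
  shows "(transp_prod n G :: 'k mpol) \<in> can_ideal n G \<longleftrightarrow> G \<subseteq> carrier (alt_group n)"
proof -
  have one: "transp_prod n G = (1 :: 'k mpol)" by (simp add: transp_prod_def none)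
  have p1: "perm_act \<sigma> (1 :: 'k mpol) = 1" for \<sigma> using perm_act_const[of \<sigma> 1] by simp
  have s: "(sgn_char \<sigma> :: 'k) = 1 \<longleftrightarrow> evenperm \<sigma>" for \<sigma>
    using char by (auto simp: sgn_char_def sign_def eq_neg_iff_add_eq_0 minus_equation_iff)
  have "(1 :: 'k mpol) \<in> can_ideal n G \<longleftrightarrow> semi_inv sgn_char G (1 :: 'k mpol)"
    using can_ideal_semi_inv[OF char, of 1] poly_ring_1 by (auto simp: can_ideal_def)
  also have "\<dots> \<longleftrightarrow> (\<forall>\<sigma>\<in>G. evenperm \<sigma>)"
  proof -
    have "(1 :: 'k mpol) = const (sgn_char \<sigma>) \<longleftrightarrow> evenperm \<sigma>" for \<sigma> using s[of \<sigma>] by (metis const_1 lookup_const)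
    then show ?thesis by (simp add: semi_inv_def p1)
  qed
  also have "\<dots> \<longleftrightarrow> G \<subseteq> carrier (alt_group n)" using permutes by (auto simp: alt_group_def)
  finally show ?thesis by (simp add: one)
qed

theorem corollary5p2:
  fixes n :: nat
    and G :: "(nat \<Rightarrow> nat) set"
    and R :: "'k::field mpol set"
    and y :: "nat \<Rightarrow> 'k mpol"
    and c :: nat
  assumes G: "subgroup G (sym_group n)"
    and R: "R = invariant_ring n G"
    and y: "hom_sop n R y"
    and c: "c = num_transpositions G"
  shows
    "(quasi_gorenstein n y R \<longleftrightarrow> a_invariant n y R = - (int c + int n)) \<and>
     (CHAR('k) = 2 \<longrightarrow> quasi_gorenstein n y R) \<and>
     (CHAR('k) \<noteq> 2 \<longrightarrow>
        (quasi_gorenstein n y R \<longleftrightarrow>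
           rational_degree (hilbert_series R) = - (int c + int n)) \<and>
        (c = 0 \<longrightarrow> (quasi_gorenstein n y R \<longleftrightarrow> G \<subseteq> carrier (alt_group n))))"
proof -
  interpret perm_group n G by (rule perm_group_of_subgroup[OF G])
  interpret S: invariant_sop n G y by unfold_locales (use y R in simp)
  have card: "card (transp_pairs n G) = c" by (simp add: c card_transp_pairs)
  have two: "(1 :: 'k) + 1 = 0 \<longleftrightarrow> CHAR('k) = 2"
  proof -
    have "(1 :: 'k) + 1 = of_nat 2" by simp
    also have "of_nat 2 = (0 :: 'k) \<longleftrightarrow> CHAR('k) dvd 2" by (rule of_nat_eq_0_iff_char_dvd)
    also have "\<dots> \<longleftrightarrow> CHAR('k) = 2"
      using prime_nat_iff[of 2] two_is_prime_nat CHAR_not_1[where ?'a = 'k] by (auto simp: One_nat_def)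
    finally show ?thesis .
  qed
  have qg: "quasi_gorenstein n y R \<longleftrightarrow> can_degree TYPE('k) = c"
    unfolding R using S.quasi_gorenstein_iff can_degree_eq_iff[where ?'k = 'k] card by simp
  have "quasi_gorenstein n y R" if "CHAR('k) = 2"
    using transp_prod_mem_char_2[where ?'k = 'k] that two S.quasi_gorenstein_iff R by blast
  moreover have "quasi_gorenstein n y R \<longleftrightarrow> a_invariant n y R = - (int c + int n)"
    using qg S.a_invariant_eq R by auto
  moreover have "quasi_gorenstein n y R \<longleftrightarrow> rational_degree (hilbert_series R) = - (int c + int n)" if "CHAR('k) \<noteq> 2"
    using qg can_degree_eq_sgn_degree[where ?'k = 'k] rational_degree_hilbert_series[where ?'k = 'k] that two R by auto
  moreover have "quasi_gorenstein n y R \<longleftrightarrow> G \<subseteq> carrier (alt_group n)" if "CHAR('k) \<noteq> 2" "c = 0"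
  proof -
    have "finite (transp_pairs n G)" using transp_pairs_subset by (rule finite_subset) simp
    then have "transp_pairs n G = {}" using card that(2) by simp
    then show ?thesis
      using transp_prod_mem_iff_even[where ?'k = 'k] that(1) two S.quasi_gorenstein_iff R by blast
  qed
  ultimately show ?thesis by blast
qed

end
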